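(* Let $\mathbb X=\mathbb S^2$, let $s>1$, and let $K$ be a continuous symmetric positive definite kernel on $\mathbb S^2$ with $H_K(\mathbb S^2)=H^s(\mathbb S^2)$ with equivalent norms. Then for every $\mu\in\mathcal P(\mathbb S^2)$ absolutely continuous with positive density $\rho\in H^s(\mathbb S^2)$ there is a constant $c>0$, depending on $K$ and $\rho$, such that for all $L\ge1$ $$\min_{\nu\in\mathcal P^{\mathrm{Acurve}}_L(\mathbb S^2)}\mathscr D_K(\mu,\nu)\le\min_{\nu\in\mathcal P^{\mathrm{Lcurve}}_L(\mathbb S^2)}\mathscr D_K(\mu,\nu)\le c\,L^{-s}.$$
   Context: $\mathbb S^2$ carries geodesic distance $\arccos\langle x,y\rangle$ and normalized surface measure $\sigma$. $H^s(\mathbb S^2)$ is defined via Laplace–Beltrami eigenvalues $\lambda_k$ and orthonormal eigenfunctions $\phi_k$: $\|f\|_{H^s}^2=\sum_k(1+\lambda_k)^s|\int f\overline{\phi_k}d\sigma|^2$. $H_K$: reproducing kernel Hilbert space of $K$; $\mathscr D_K(\mu,\nu)=\sup_{\|\varphi\|_{H_K}\le1}|\int\varphi\,d(\mu-\nu)|$. $\mathrm{Lip}$: Lipschitz $\gamma\colon[0,1]\to\mathbb S^2$ with $\gamma(0)=\gamma(1)$, $L(\gamma)$ optimal Lipschitz constant; $\lambda$ Lebesgue measure on $[0,1]$. $\mathcal P^{\mathrm{Acurve}}_L=\{\gamma_*(\rho'\lambda):\gamma\in\mathrm{Lip},L(\gamma)\le L,\rho'\ge0,\int_0^1\rho'=1,L(\rho')\le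 L\}$; $\mathcal P^{\mathrm{Lcurve}}_L=\{\gamma_*\lambda:\gamma\in\mathrm{Lip},L(\gamma)\le L\}$. *)

theory Defs
  imports "HOL-Analysis.Analysis"
begin

abbreviation S2 :: "(real^3) set" where
  "S2 \<equiv> sphere 0 1"

definition geodist :: "real^3 \<Rightarrow> real^3 \<Rightarrow> real" where
  "geodist x y = arccos (x \<bullet> y)"

abbreviation S2_borel :: "(real^3) measure" where
  "S2_borel \<equiv> restrict_space borel S2"

text \<open>Normalized surface measure (classical cone definition):
  sigma(A) = Lebesgue measure of the cone {t x | x in A, 0 < t <= 1} divided by the volume of
  the unit ball; written as the image of the normalized Lebesgue measure on the punctured unit
  ball under radial projection.\<close>
definition sigma_S2 :: "(real^3) measure" where
  "sigma_S2 = distr (uniform_measure (restrict_space lborel (ball 0 1 - {0})) (ball 0 1 - {0}))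
                    S2_borel (\<lambda>x. x /\<^sub>R norm x)"

definition pd :: "real^3 \<Rightarrow> (real^3 \<Rightarrow> real) \<Rightarrow> real^3 \<Rightarrow> real" where
  "pd i g x = deriv (\<lambda>t. g (x + t *\<^sub>R i)) 0"

definition partial_ok :: "real^3 \<Rightarrow> (real^3 \<Rightarrow> real) \<Rightarrow> (real^3) set \<Rightarrow> bool" where
  "partial_ok i g U \<longleftrightarrow> (\<forall>x\<in>U. (\<lambda>t. g (x + t *\<^sub>R i)) field_differentiable (at 0))
                         \<and> continuous_on U (pd i g)"

definition C2_on :: "(real^3) set \<Rightarrow> (real^3 \<Rightarrow> real) \<Rightarrow> bool" where
  "C2_on U g \<longleftrightarrow> continuous_on U g \<and>
     (\<forall>i\<in>Basis. partial_ok i g U \<and> (\<forall>j\<in>Basis. partial_ok j (pd i g) U))"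

definition laplacian :: "(real^3 \<Rightarrow> real) \<Rightarrow> real^3 \<Rightarrow> real" where
  "laplacian g x = (\<Sum>i\<in>Basis. pd i (pd i g) x)"

definition hext :: "(real^3 \<Rightarrow> real) \<Rightarrow> real^3 \<Rightarrow> real" where
  "hext f x = f (x /\<^sub>R norm x)"

definition laplace_beltrami :: "(real^3 \<Rightarrow> real) \<Rightarrow> real^3 \<Rightarrow> real" where
  "laplace_beltrami f x = laplacian (hext f) x"

definition L2_S2 :: "(real^3 \<Rightarrow> real) set" where
  "L2_S2 = {f. f \<in> borel_measurable S2_borel \<and> integrable sigma_S2 (\<lambda>x. (f x)\<^sup>2)}"

definition inner_L2 :: "(real^3 \<Rightarrow> real) \<Rightarrow> (real^3 \<Rightarrow> real) \<Rightarrow> real" where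
  "inner_L2 f g = (\<integral>x. f x * g x \<partial>sigma_S2)"

definition LB_eigenbasis :: "(nat \<Rightarrow> real^3 \<Rightarrow> real) \<Rightarrow> (nat \<Rightarrow> real) \<Rightarrow> bool" where
  "LB_eigenbasis phi lam \<longleftrightarrow>
     (\<forall>k. C2_on (- {0}) (hext (phi k)) \<and>
          (\<forall>x\<in>S2. - laplace_beltrami (phi k) x = lam k * phi k x)) \<and>
     (\<forall>k. phi k \<in> L2_S2) \<and>
     (\<forall>k l. inner_L2 (phi k) (phi l) = (if k = l then 1 else 0)) \<and>
     (\<forall>f\<in>L2_S2. (\<forall>k. inner_L2 f (phi k) = 0) \<longrightarrow> (AE x in sigma_S2. f x = 0))"

definition LB_phi :: "nat \<Rightarrow> real^3 \<Rightarrow> real" where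
  "LB_phi = fst (SOME p. LB_eigenbasis (fst p) (snd p))"

definition LB_lam :: "nat \<Rightarrow> real" where
  "LB_lam = snd (SOME p. LB_eigenbasis (fst p) (snd p))"

definition Hs_terms :: "real \<Rightarrow> (real^3 \<Rightarrow> real) \<Rightarrow> nat \<Rightarrow> real" where
  "Hs_terms s f k = (1 + LB_lam k) powr s * (inner_L2 f (LB_phi k))\<^sup>2"

definition in_Hs :: "real \<Rightarrow> (real^3 \<Rightarrow> real) \<Rightarrow> bool" where
  "in_Hs s f \<longleftrightarrow> f \<in> L2_S2 \<and> summable (Hs_terms s f)"

definition Hs_norm :: "real \<Rightarrow> (real^3 \<Rightarrow> real) \<Rightarrow> real" where
  "Hs_norm s f = sqrt (\<Sum>k. Hs_terms s f k)"

definition kernel_on_S2 :: "(real^3 \<Rightarrow> real^3 \<Rightarrow> real) \<Rightarrow> bool" where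
  "kernel_on_S2 K \<longleftrightarrow> continuous_on (S2 \<times> S2) (\<lambda>(x, y). K x y)"

definition symmetric_kernel :: "(real^3 \<Rightarrow> real^3 \<Rightarrow> real) \<Rightarrow> bool" where
  "symmetric_kernel K \<longleftrightarrow> (\<forall>x\<in>S2. \<forall>y\<in>S2. K x y = K y x)"

definition kcomb :: "(real^3 \<Rightarrow> real^3 \<Rightarrow> real) \<Rightarrow> (real \<times> (real^3)) list \<Rightarrow> real^3 \<Rightarrow> real" where
  "kcomb K xs x = (\<Sum>(a, p)\<leftarrow>xs. a * K p x)"

definition knorm2 :: "(real^3 \<Rightarrow> real^3 \<Rightarrow> real) \<Rightarrow> (real \<times> (real^3)) list \<Rightarrow> real" where
  "knorm2 K xs = (\<Sum>(a, p)\<leftarrow>xs. \<Sum>(b, q)\<leftarrow>xs. a * b * K p q)"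

definition kneg :: "(real \<times> (real^3)) list \<Rightarrow> (real \<times> (real^3)) list" where
  "kneg xs = map (\<lambda>(a, p). (- a, p)) xs"

definition pos_def_kernel :: "(real^3 \<Rightarrow> real^3 \<Rightarrow> real) \<Rightarrow> bool" where
  "pos_def_kernel K \<longleftrightarrow> (\<forall>xs. set (map snd xs) \<subseteq> S2 \<longrightarrow> knorm2 K xs \<ge> 0)"

text \<open>H_K as the completion of the span of the kernel sections: a sequence of finite
  combinations, Cauchy in the K-norm, converging pointwise on S2 to f.\<close>
definition rkhs_seq :: "(real^3 \<Rightarrow> real^3 \<Rightarrow> real) \<Rightarrow> (real^3 \<Rightarrow> real) \<Rightarrow> (nat \<Rightarrow> (real \<times> (real^3)) list) \<Rightarrow> bool" where
  "rkhs_seq K f xs \<longleftrightarrow>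
     (\<forall>n. set (map snd (xs n)) \<subseteq> S2) \<and>
     (\<forall>e>0. \<exists>N. \<forall>m\<ge>N. \<forall>n\<ge>N. knorm2 K (xs m @ kneg (xs n)) < e) \<and>
     (\<forall>x\<in>S2. (\<lambda>n. kcomb K (xs n) x) \<longlonglongrightarrow> f x)"

definition in_rkhs :: "(real^3 \<Rightarrow> real^3 \<Rightarrow> real) \<Rightarrow> (real^3 \<Rightarrow> real) \<Rightarrow> bool" where
  "in_rkhs K f \<longleftrightarrow> (\<exists>xs. rkhs_seq K f xs)"

definition rkhs_norm :: "(real^3 \<Rightarrow> real^3 \<Rightarrow> real) \<Rightarrow> (real^3 \<Rightarrow> real) \<Rightarrow> real" where
  "rkhs_norm K f = Inf {lim (\<lambda>n. sqrt (knorm2 K (xs n))) | xs. rkhs_seq K f xs}"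

definition rkhs_eq_Hs :: "(real^3 \<Rightarrow> real^3 \<Rightarrow> real) \<Rightarrow> real \<Rightarrow> bool" where
  "rkhs_eq_Hs K s \<longleftrightarrow>
     (\<exists>c1 c2. c1 > 0 \<and> c2 > 0 \<and>
        (\<forall>f. in_rkhs K f \<longrightarrow> in_Hs s f \<and>
               c1 * rkhs_norm K f \<le> Hs_norm s f \<and> Hs_norm s f \<le> c2 * rkhs_norm K f) \<and>
        (\<forall>f. in_Hs s f \<longrightarrow> (\<exists>g. in_rkhs K g \<and> (AE x in sigma_S2. g x = f x))))"

definition discrepancy :: "(real^3 \<Rightarrow> real^3 \<Rightarrow> real) \<Rightarrow> (real^3) measure \<Rightarrow> (real^3) measure \<Rightarrow> real" where
  "discrepancy K \<mu> \<nu> = Sup {\<bar>(\<integral>x. \<phi> x \<partial>\<mu>) - (\<integral>x. \<phi> x \<partial>\<nu>)\<bar> | \<phi>. in_rkhs K \<phi> \<and> rkhs_norm K \<phi> \<le> 1}"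

abbreviation unit_interval :: "real measure" where
  "unit_interval \<equiv> restrict_space lborel {0..1}"

definition lip_curve :: "real \<Rightarrow> (real \<Rightarrow> real^3) \<Rightarrow> bool" where
  "lip_curve L \<gamma> \<longleftrightarrow> (\<forall>t\<in>{0..1}. \<gamma> t \<in> S2) \<and> \<gamma> 0 = \<gamma> 1 \<and>
      (\<forall>s\<in>{0..1}. \<forall>t\<in>{0..1}. geodist (\<gamma> s) (\<gamma> t) \<le> L * \<bar>s - t\<bar>)"

definition P_Acurve :: "real \<Rightarrow> (real^3) measure set" where
  "P_Acurve L = {distr (density unit_interval (\<lambda>t. ennreal (r t))) S2_borel \<gamma> | \<gamma> r.
      lip_curve L \<gamma> \<and> (\<forall>t\<in>{0..1}. r t \<ge> 0) \<and> integral {0..1} r = 1 \<and>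
      (\<forall>s\<in>{0..1}. \<forall>t\<in>{0..1}. \<bar>r s - r t\<bar> \<le> L * \<bar>s - t\<bar>)}"

definition P_Lcurve :: "real \<Rightarrow> (real^3) measure set" where
  "P_Lcurve L = {distr unit_interval S2_borel \<gamma> | \<gamma>. lip_curve L \<gamma>}"

end

theory Submission
  imports Defs "HOL-Computational_Algebra.Polynomial" "HOL-Complex_Analysis.Great_Picard"
begin

text \<open>The rate comes from measures that integrate all polynomials of degree at most \<open>2 m\<close> exactly and
  live on a single closed curve of length of order \<open>m\<close>.  The curve is the spherical spiral with azimuth
  \<open>8 m \<theta>\<close>, and its weight is the partial sum of the Fourier series of \<open>\<bar>sin\<bar>\<close>: exactness in the
  azimuth is then a matter of frequencies, exactness in the latitude holds because a polynomial of degree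
  \<open>2 m\<close> only sees the first Fourier coefficients of the weight, and the weight stays comparable to
  \<open>1 / m + \<bar>sin \<theta>\<bar>\<close>, hence to the speed of the spiral divided by \<open>m\<close>.

  If \<open>M\<close> is such a measure, then \<open>\<integral> \<phi> \<rho> dM - \<integral> \<phi> \<rho> d\<sigma>\<close> is of order \<open>m powr (-s)\<close>, uniformly on the unit
  ball of the Sobolev space: the low frequency parts of \<open>\<phi>\<close> and \<open>\<rho>\<close> do not contribute, and the dyadic
  high frequency blocks are controlled by a Marcinkiewicz-Zygmund inequality, since exactness forces \<open>M\<close> to
  have mass of order \<open>1 / N\<^sup>2\<close> at most on caps of radius \<open>1 / N\<close> when \<open>N \<le> m\<close>.  Multiplying the weight by
  \<open>\<rho>\<close>, normalising, and reparametrising the spiral by the mass turns the weighted measure into the image of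
  Lebesgue measure under a curve whose Lipschitz constant is of order \<open>m\<close>.  Minimisers exist by the
  theorem of Arzela and Ascoli.\<close>

subsection \<open>The surface measure\<close>

text \<open>The Sobolev norm refers to an eigenbasis picked by \<open>SOME\<close>, so nothing is
  known of its members beyond what \<open>LB_eigenbasis\<close> states, and its existence has to be
  shown first. The substitute for spherical harmonics is the family \<open>zon p x ^ N\<close>, with
  \<open>zon p x\<close> the squared cosine of half the angle between \<open>p\<close> and
  \<open>x\<close>: the Laplacian sends it to a combination of the exponents \<open>N - 1\<close>
  and \<open>N\<close>. This one identity yields the integrals of the powers, the multipliers of the
  averages \<open>zavg N\<close> on arbitrary eigenfunctions, nonnegative eigenvalues, a local Weyl
  bound, completeness, and the passage from eigenfunctions to polynomials that exactness requires.

  The obstacle in the error estimate is that bounding the high frequency blocks by their supremum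
  gives only the exponent \<open>1 - s\<close>, since block \<open>j\<close> has supremum of order
  \<open>(2 powr (1 - s)) ^ j\<close>. In the mean with respect to a measure exact to degree about
  \<open>2 ^ J\<close>, \<open>J \<le> j\<close>, the same block is smaller by the factor
  \<open>1 / 2 ^ J\<close>, which is the missing power.\<close>

lemma sets_sigma_S2 [measurable_cong, simp]: "sets sigma_S2 = sets S2_borel"
  and space_sigma_S2 [simp]: "space sigma_S2 = S2"
  by (simp_all add: sigma_S2_def space_restrict_space)

lemma radial_measurable:
  "(\<lambda>x::real^3. x /\<^sub>R norm x) \<in> restrict_space lborel (ball 0 1 - {0}) \<rightarrow>\<^sub>M S2_borel"
  by (intro measurable_restrict_space2 measurable_restrict_space1)
     (auto simp: space_restrict_space)

lemma punctured_ball: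
  "emeasure (restrict_space lborel (ball 0 1 - {0})) (ball 0 1 - {0::real^3}) =
     emeasure lborel (ball 0 1 - {0::real^3})"
  "emeasure lborel (ball 0 1 - {0::real^3}) \<noteq> 0"
  "emeasure lborel (ball 0 1 - {0::real^3}) \<noteq> \<infinity>"
proof -
  show "emeasure (restrict_space lborel (ball 0 1 - {0})) (ball 0 1 - {0::real^3}) =
     emeasure lborel (ball 0 1 - {0::real^3})"
    by (subst emeasure_restrict_space) auto
  have "emeasure lborel (ball 0 1 - {0::real^3}) = emeasure lborel (ball 0 (1::real)::(real^3) set)"
    by (rule emeasure_Diff_null_set) (auto simp: null_sets_def)
  moreover have "emeasure lborel (ball 0 (1::real)::(real^3) set) = measure lborel (ball 0 (1::real)::(real^3) set)"
    by (rule emeasure_eq_ennreal_measure) (use emeasure_lborel_ball_finite[of "0::real^3" 1] in auto)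
  moreover have "measure lborel (ball 0 (1::real)::(real^3) set) > 0"
    by (rule content_ball_pos) simp
  ultimately show "emeasure lborel (ball 0 1 - {0::real^3}) \<noteq> 0"
    "emeasure lborel (ball 0 1 - {0::real^3}) \<noteq> \<infinity>" by auto
qed

lemma finite_measure_sigma_S2: "finite_measure sigma_S2"
  and emeasure_sigma_S2_space: "emeasure sigma_S2 S2 = 1"
proof -
  have m: "(\<lambda>x. x /\<^sub>R norm x) \<in> uniform_measure (restrict_space lborel (ball 0 1 - {0})) (ball 0 1 - {0}) \<rightarrow>\<^sub>M S2_borel"
    using radial_measurable by (simp add: measurable_def)
  have v: "(\<lambda>x::real^3. x /\<^sub>R norm x) -` S2 \<inter> (ball 0 1 - {0}) = ball 0 1 - {0}"
    by auto
  show "emeasure sigma_S2 S2 = 1"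
    unfolding sigma_S2_def using m punctured_ball
    by (subst emeasure_distr)
       (auto simp: space_restrict_space v sets_restrict_space intro!: emeasure_uniform_measure_1)
  then show "finite_measure sigma_S2" by (intro finite_measureI) simp
qed

interpretation sigma: finite_measure sigma_S2 by (rule finite_measure_sigma_S2)

lemma measure_sigma_S2 [simp]: "measure sigma_S2 S2 = 1"
  by (simp add: measure_def emeasure_sigma_S2_space)

lemma radial_preimage:
  assumes "A \<in> sets S2_borel"
  shows "{x \<in> ball 0 1 - {0::real^3}. x /\<^sub>R norm x \<in> A} \<in> sets borel"
proof -
  have "(\<lambda>x. x /\<^sub>R norm x) -` A \<inter> (ball 0 1 - {0::real^3}) \<in> sets (restrict_space lborel (ball 0 1 - {0::real^3}))"
    using measurable_sets[OF radial_measurable assms] by (simp add: space_restrict_space)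
  moreover have "(\<lambda>x. x /\<^sub>R norm x) -` A \<inter> (ball 0 1 - {0::real^3}) = {x \<in> ball 0 1 - {0::real^3}. x /\<^sub>R norm x \<in> A}"
    by blast
  ultimately have "{x \<in> ball 0 1 - {0::real^3}. x /\<^sub>R norm x \<in> A} \<in> sets (restrict_space lborel (ball 0 1 - {0::real^3}))"
    by simp
  then show ?thesis by (subst (asm) sets_restrict_space_iff) auto
qed

lemma emeasure_sigma_S2:
  assumes "A \<in> sets S2_borel"
  shows "emeasure sigma_S2 A =
    emeasure lborel {x \<in> ball 0 1 - {0}. x /\<^sub>R norm x \<in> A} / emeasure lborel (ball 0 1 - {0::real^3})"
proof -
  let ?M = "restrict_space lborel (ball 0 1 - {0::real^3})"
  have S: "{x \<in> ball 0 1 - {0}. x /\<^sub>R norm x \<in> A} \<in> sets ?M"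
    by (subst sets_restrict_space_iff) (use radial_preimage[OF assms] in auto)
  have m: "(\<lambda>x. x /\<^sub>R norm x) \<in> uniform_measure ?M (ball 0 1 - {0}) \<rightarrow>\<^sub>M S2_borel"
    using radial_measurable by (simp add: measurable_def)
  have "emeasure sigma_S2 A = emeasure (uniform_measure ?M (ball 0 1 - {0}))
     {x \<in> ball 0 1 - {0}. x /\<^sub>R norm x \<in> A}"
    unfolding sigma_S2_def using assms m
    by (subst emeasure_distr) (auto simp: space_restrict_space intro!: arg_cong2[of _ _ _ _ emeasure])
  also have "\<dots> = emeasure ?M ((ball 0 1 - {0}) \<inter> {x \<in> ball 0 1 - {0}. x /\<^sub>R norm x \<in> A}) /
      emeasure ?M (ball 0 1 - {0})"
    by (rule emeasure_uniform_measure) (use S in \<open>auto simp: sets_restrict_space\<close>)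
  also have "(ball 0 1 - {0}) \<inter> {x \<in> ball 0 1 - {0}. x /\<^sub>R norm x \<in> A} =
     {x \<in> ball 0 1 - {0}. x /\<^sub>R norm x \<in> A}" by auto
  also have "emeasure ?M {x \<in> ball 0 1 - {0}. x /\<^sub>R norm x \<in> A} =
      emeasure lborel {x \<in> ball 0 1 - {0}. x /\<^sub>R norm x \<in> A}"
    by (rule emeasure_restrict_space) (use S in \<open>auto simp: sets_restrict_space\<close>)
  finally show ?thesis by (simp add: punctured_ball)
qed

text \<open>The cone over a relatively open set is open in space and contains
  \<open>(1/2) *\<^sub>R x\<close>, hence is not negligible. Full support is what turns almost
  everywhere identities between continuous functions into pointwise ones.\<close>

lemma emeasure_sigma_S2_open_pos:
  assumes "open U" "x \<in> U" "x \<in> S2"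
  shows "emeasure sigma_S2 (U \<inter> S2) > 0"
proof -
  let ?V = "{y \<in> ball 0 1 - {0::real^3}. y /\<^sub>R norm y \<in> U}"
  have "continuous_on (ball 0 1 - {0::real^3}) (\<lambda>y. y /\<^sub>R norm y)"
    by (intro continuous_intros) auto
  then have "open ?V"
    using continuous_open_preimage[of "ball 0 1 - {0::real^3}" "\<lambda>y. y /\<^sub>R norm y" U] assms(1)
    by (simp add: vimage_def Int_def open_Diff conj_commute)
  moreover have "(1/2) *\<^sub>R x \<in> ?V" using assms by auto
  ultimately have nn: "\<not> negligible ?V" using open_not_negligible by blast
  have "emeasure lborel ?V \<noteq> 0"
  proof
    assume "emeasure lborel ?V = 0"
    then have "?V \<in> null_sets lborel" using \<open>open ?V\<close> by (intro null_setsI) auto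
    then show False using nn null_sets_completionI negligible_iff_null_sets by blast
  qed
  then have "emeasure lborel ?V > 0" by (simp add: zero_less_iff_neq_zero)
  moreover have "{y \<in> ball 0 1 - {0::real^3}. y /\<^sub>R norm y \<in> U \<inter> S2} = ?V" by auto
  moreover have "U \<inter> S2 \<in> sets S2_borel" using assms(1) by (auto simp: sets_restrict_space)
  ultimately show ?thesis using punctured_ball
    by (simp add: emeasure_sigma_S2 ennreal_zero_less_divide top.not_eq_extremum)
qed

lemma continuous_on_S2_bounded:
  fixes f :: "real^3 \<Rightarrow> 'b::real_normed_vector"
  assumes "continuous_on S2 f"
  obtains B where "B > 0" "\<And>x. x \<in> S2 \<Longrightarrow> norm (f x) \<le> B"
  using compact_imp_bounded[OF compact_continuous_image[OF assms compact_sphere]]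
  unfolding bounded_pos by auto

lemma continuous_on_S2_integrable:
  fixes f :: "real^3 \<Rightarrow> 'b::{banach, second_countable_topology}"
  assumes "continuous_on S2 f" "finite_measure M" "sets M = sets S2_borel"
  shows "integrable M f"
proof -
  obtain B where "\<And>x. x \<in> S2 \<Longrightarrow> norm (f x) \<le> B" using continuous_on_S2_bounded[OF assms(1)] by metis
  moreover have "space M = S2" using sets_eq_imp_space_eq[OF assms(3)] by (simp add: space_restrict_space)
  moreover have "f \<in> borel_measurable M"
    using borel_measurable_continuous_on_restrict[OF assms(1)] measurable_cong_sets[OF assms(3) refl] by blast
  ultimately show ?thesis
    using finite_measure.integrable_const_bound[OF assms(2)] by (metis (mono_tags, lifting) AE_I2)
qed

lemma sigma_integrable [intro]:
  fixes f :: "real^3 \<Rightarrow> 'b::{banach, second_countable_topology}"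
  shows "continuous_on S2 f \<Longrightarrow> integrable sigma_S2 f"
  by (rule continuous_on_S2_integrable) (auto intro: sigma.finite_measure_axioms)

lemma AE_sigma_eq_imp_eq:
  fixes f g :: "real^3 \<Rightarrow> real"
  assumes "continuous_on S2 f" "continuous_on S2 g" "AE x in sigma_S2. f x = g x" "x \<in> S2"
  shows "f x = g x"
proof (rule ccontr)
  assume ne: "f x \<noteq> g x"
  have c: "continuous_on S2 (\<lambda>x. f x - g x)" using assms by (intro continuous_intros)
  have "openin (top_of_set S2) (S2 \<inter> (\<lambda>x. f x - g x) -` (- {0}))"
    by (rule continuous_openin_preimage_gen[OF c]) auto
  then obtain U where "open U" "S2 \<inter> (\<lambda>x. f x - g x) -` (- {0}) = S2 \<inter> U"
    unfolding openin_open by blast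
  then have U: "open U" "S2 \<inter> (\<lambda>x. f x - g x) -` (- {0}) = U \<inter> S2" by blast+
  have "x \<in> S2 \<inter> (\<lambda>x. f x - g x) -` (- {0})" using ne assms(4) by simp
  then have "x \<in> U" using U(2) by blast
  then have pos: "emeasure sigma_S2 (U \<inter> S2) > 0" using emeasure_sigma_S2_open_pos U assms by blast
  obtain N where N: "{x \<in> space sigma_S2. f x \<noteq> g x} \<subseteq> N" "emeasure sigma_S2 N = 0" "N \<in> sets sigma_S2"
    using AE_E[OF assms(3)] by blast
  have "U \<inter> S2 \<subseteq> {x \<in> space sigma_S2. f x \<noteq> g x}"
    unfolding U(2)[symmetric] by auto
  then have "U \<inter> S2 \<subseteq> N" using N(1) by blast
  then have "emeasure sigma_S2 (U \<inter> S2) \<le> emeasure sigma_S2 N" using N by (intro emeasure_mono) auto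
  then show False using pos N by auto
qed

subsection \<open>Rotation invariance\<close>

lemma orthogonal_transformation_measurable_S2:
  assumes R: "orthogonal_transformation (R :: real^3 \<Rightarrow> real^3)"
  shows "R \<in> S2_borel \<rightarrow>\<^sub>M S2_borel"
proof -
  have "continuous_on UNIV R"
    using R by (simp add: linear_continuous_on linear_linear orthogonal_transformation_linear)
  then have "R \<in> borel_measurable borel" by (rule borel_measurable_continuous_onI)
  then show ?thesis
    by (intro measurable_restrict_space2 measurable_restrict_space1)
       (auto simp: space_restrict_space orthogonal_transformation_norm[OF R])
qed

text \<open>Radial projection commutes with an orthogonal map, so the cone over a preimage is mapped
  onto the cone over the set, and orthogonal maps preserve Lebesgue measure.\<close>

lemma orthogonal_transformation_sigma_S2:
  assumes R: "orthogonal_transformation (R :: real^3 \<Rightarrow> real^3)"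
  shows "distr sigma_S2 S2_borel R = sigma_S2"
proof (rule measure_eqI)
  show "sets (distr sigma_S2 S2_borel R) = sets sigma_S2" by simp
  fix A assume "A \<in> sets (distr sigma_S2 S2_borel R)"
  then have A: "A \<in> sets S2_borel" by simp
  have lin: "linear R" and no: "\<And>x. norm (R x) = norm x"
    using R by (simp_all add: orthogonal_transformation_linear orthogonal_transformation_norm)
  note mR = orthogonal_transformation_measurable_S2[OF R]
  have mR': "R \<in> sigma_S2 \<rightarrow>\<^sub>M S2_borel" using mR measurable_cong_sets[OF sets_sigma_S2 refl] by blast
  let ?P = "R -` A \<inter> S2"
  have P: "?P \<in> sets S2_borel" using measurable_sets[OF mR A] by (simp add: space_restrict_space)
  let ?V = "\<lambda>A. {x \<in> ball 0 1 - {0::real^3}. x /\<^sub>R norm x \<in> A}"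
  have Vs: "?V B \<in> lmeasurable" "?V B \<in> sets borel" if "B \<in> sets S2_borel" for B
  proof -
    show b: "?V B \<in> sets borel" by (rule radial_preimage[OF that])
    show "?V B \<in> lmeasurable" 
      by (rule bounded_set_imp_lmeasurable[OF bounded_subset[OF bounded_ball[of 0 1]]]) (blast, rule sets_completionI_sets, use b in simp)
  qed
  have em: "emeasure lborel (?V B) = measure lebesgue (?V B)" if "B \<in> sets S2_borel" for B
  proof -
    have "emeasure lborel (?V B) = emeasure lebesgue (?V B)"
      using Vs(2)[OF that] by simp
    also have "\<dots> = measure lebesgue (?V B)" by (rule emeasure_eq_measure2[OF Vs(1)[OF that]])
    finally show ?thesis .
  qed
  have "R ` ?V ?P = ?V A"
  proof
    show "R ` ?V ?P \<subseteq> ?V A"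
    proof
      fix y assume "y \<in> R ` ?V ?P"
      then obtain x where x: "y = R x" "x \<in> ball 0 1 - {0}" "R (x /\<^sub>R norm x) \<in> A" by blast
      have "R (x /\<^sub>R norm x) = y /\<^sub>R norm y" using x(1) no linear_scale[OF lin] by simp
      then have "y /\<^sub>R norm y \<in> A" using x(3) by simp
      moreover have "norm y < 1" "norm y \<noteq> 0" using x no[of x] by simp_all
      ultimately show "y \<in> ?V A" by simp
    qed
    show "?V A \<subseteq> R ` ?V ?P"
    proof
      fix y assume y: "y \<in> ?V A"
      obtain x where x: "y = R x" using orthogonal_transformation_surj[OF R] by (metis surjD)
      have "R (x /\<^sub>R norm x) = y /\<^sub>R norm y" using x no linear_scale[OF lin] by simp
      then have "R (x /\<^sub>R norm x) \<in> A" using y by simp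
      moreover have "norm x < 1" "norm x \<noteq> 0" using y x no[of x] by auto
      ultimately have "x \<in> ?V ?P" by simp
      then show "y \<in> R ` ?V ?P" using x by blast
    qed
  qed
  then have "measure lebesgue (?V A) = measure lebesgue (?V ?P)"
    using measure_orthogonal_image[OF R Vs(1)[OF P]] by simp
  then have "emeasure sigma_S2 ?P = emeasure sigma_S2 A"
    unfolding emeasure_sigma_S2[OF A] emeasure_sigma_S2[OF P] em[OF A] em[OF P] by simp
  moreover have "emeasure (distr sigma_S2 S2_borel R) A = emeasure sigma_S2 ?P"
    using emeasure_distr[OF mR' A] by simp
  ultimately show "emeasure (distr sigma_S2 S2_borel R) A = emeasure sigma_S2 A" by simp
qed

lemma integral_sigma_S2_orthogonal:
  fixes f :: "real^3 \<Rightarrow> 'b::{banach, second_countable_topology}"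
  assumes R: "orthogonal_transformation R" and f: "continuous_on S2 f"
  shows "(\<integral>x. f (R x) \<partial>sigma_S2) = (\<integral>x. f x \<partial>sigma_S2)"
proof -
  note mR = orthogonal_transformation_measurable_S2[OF R]
  have mR': "R \<in> sigma_S2 \<rightarrow>\<^sub>M S2_borel" using mR measurable_cong_sets[OF sets_sigma_S2 refl] by blast
  have "(\<integral>x. f x \<partial>sigma_S2) = (\<integral>x. f x \<partial>distr sigma_S2 S2_borel R)"
    by (simp add: orthogonal_transformation_sigma_S2[OF R])
  also have "\<dots> = (\<integral>x. f (R x) \<partial>sigma_S2)"
    by (rule integral_distr[OF mR' borel_measurable_continuous_on_restrict[OF f]])
  finally show ?thesis by simp
qed

subsection \<open>Partial derivatives and angular derivatives\<close>

definition C1_on :: "(real^3) set \<Rightarrow> (real^3 \<Rightarrow> real) \<Rightarrow> bool" where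
  "C1_on U g \<longleftrightarrow> continuous_on U g \<and> (\<forall>b\<in>Basis. partial_ok b g U)"

lemma C2_on_imp_C1_on: "C2_on U g \<Longrightarrow> C1_on U g"
  by (simp add: C2_on_def C1_on_def)

lemma C2_on_imp_C1_on_pd: "C2_on U g \<Longrightarrow> b \<in> Basis \<Longrightarrow> C1_on U (pd b g)"
  by (simp add: C2_on_def C1_on_def partial_ok_def)

lemma C1_onD:
  assumes "C1_on U g" "b \<in> Basis"
  shows "x \<in> U \<Longrightarrow> ((\<lambda>t. g (x + t *\<^sub>R b)) has_real_derivative pd b g x) (at 0)"
    and "continuous_on U (pd b g)"
  using assms DERIV_deriv_iff_field_differentiable[of "\<lambda>t. g (x + t *\<^sub>R b)" 0]
  by (auto simp: C1_on_def partial_ok_def pd_def)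

lemma pd_eqI: "((\<lambda>t. g (x + t *\<^sub>R b)) has_real_derivative d) (at 0) \<Longrightarrow> pd b g x = d"
  by (simp add: pd_def DERIV_imp_deriv)

lemma C1_onI:
  assumes "continuous_on U g"
    and "\<And>b x. b \<in> Basis \<Longrightarrow> x \<in> U \<Longrightarrow> ((\<lambda>t. g (x + t *\<^sub>R b)) has_real_derivative D b x) (at 0)"
    and "\<And>b. b \<in> Basis \<Longrightarrow> continuous_on U (D b)"
  shows "C1_on U g"
  unfolding C1_on_def partial_ok_def
proof (intro conjI ballI assms(1))
  fix b :: "real^3" assume b: "b \<in> Basis"
  show "(\<lambda>t. g (x + t *\<^sub>R b)) field_differentiable at 0" if "x \<in> U" for x
    using assms(2)[OF b that] by (auto simp: field_differentiable_def)
  show "continuous_on U (pd b g)"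
    using assms(3)[OF b] by (rule continuous_on_eq) (simp add: pd_eqI[OF assms(2)[OF b]])
qed

lemma C2_onI:
  assumes "C1_on U g" "\<And>b. b \<in> Basis \<Longrightarrow> C1_on U (pd b g)"
  shows "C2_on U g"
  using assms by (auto simp: C2_on_def C1_on_def)

lemma pd_line_deriv:
  assumes "C1_on U g" "b \<in> Basis" "p + \<tau> *\<^sub>R b \<in> U"
  shows "((\<lambda>t. g (p + t *\<^sub>R b)) has_real_derivative pd b g (p + \<tau> *\<^sub>R b)) (at \<tau>)"
proof -
  have "((\<lambda>t. g ((p + \<tau> *\<^sub>R b) + t *\<^sub>R b)) has_real_derivative pd b g (p + \<tau> *\<^sub>R b)) (at 0)"
    using C1_onD(1)[OF assms] .
  then have "((\<lambda>t. g (p + (t + \<tau>) *\<^sub>R b)) has_real_derivative pd b g (p + \<tau> *\<^sub>R b)) (at 0)"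
    by (simp add: algebra_simps)
  then show ?thesis using DERIV_shift[of "\<lambda>t. g (p + t *\<^sub>R b)" _ 0 \<tau>] by simp
qed

text \<open>\<open>C2_on\<close> provides partial derivatives, while the chain rule along rotations
  and rays needs a total derivative. The increment is split into three coordinate moves, each
  controlled by the mean value inequality.\<close>

lemma C1_on_has_derivative:
  assumes U: "open U" "x \<in> U" and g: "C1_on U g"
  shows "(g has_derivative (\<lambda>h. \<Sum>b\<in>Basis. (h \<bullet> b) * pd b g x)) (at x)"
  unfolding has_derivative_within_alt
proof (intro conjI allI impI)
  show "bounded_linear (\<lambda>h. \<Sum>b\<in>Basis. (h \<bullet> b) * pd b g x)"
    by (intro bounded_linear_sum bounded_linear_mult_left[THEN bounded_linear_compose] bounded_linear_inner_left)
  fix e :: real assume e: "e > 0"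
  \<comment> \<open>Each of the three coordinate moves gets a third of the error. Likewise
    \<open>norm h < d / 3\<close> keeps every intermediate point within \<open>d\<close> of
    \<open>x\<close>.\<close>
  define e' where "e' = e / 3"
  have e': "e' > 0" using e by (simp add: e'_def)
  have ev: "\<forall>\<^sub>F y in at x. \<forall>b\<in>Basis. \<bar>pd b g y - pd b g x\<bar> < e'"
  proof (rule eventually_ball_finite, simp, rule ballI)
    fix b :: "real^3" assume "b \<in> Basis"
    then have "isCont (pd b g) x" using C1_onD(2)[OF g] U continuous_on_eq_continuous_at by blast
    then have l: "(pd b g \<longlongrightarrow> pd b g x) (at x)" by (simp add: isCont_def)
    show "\<forall>\<^sub>F y in at x. \<bar>pd b g y - pd b g x\<bar> < e'" using tendstoD[OF l e'] by (simp add: dist_real_def)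
  qed
  have "\<forall>\<^sub>F y in at x. y \<in> U" using U by (rule eventually_at_in_open')
  then have "\<forall>\<^sub>F y in at x. y \<in> U \<and> (\<forall>b\<in>Basis. \<bar>pd b g y - pd b g x\<bar> < e')"
    using ev by (rule eventually_conj)
  then obtain d where d0: "d > 0"
    "\<And>y. y \<noteq> x \<Longrightarrow> dist y x < d \<Longrightarrow> y \<in> U \<and> (\<forall>b\<in>Basis. \<bar>pd b g y - pd b g x\<bar> < e')"
    unfolding eventually_at by auto
  have d: "d > 0" "\<And>y b. dist y x < d \<Longrightarrow> b \<in> Basis \<Longrightarrow> y \<in> U \<and> \<bar>pd b g y - pd b g x\<bar> < e'"
    using d0 U(2) e' by (metis abs_zero diff_self)+
  have main: "\<bar>g (x + h) - g x - (\<Sum>b\<in>Basis. (h \<bullet> b) * pd b g x)\<bar> \<le> e * norm h" if h: "norm h < d / 3" for h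
  proof -
    define p where "p S = x + (\<Sum>b\<in>S. (h \<bullet> b) *\<^sub>R b)" for S
    have part: "\<bar>g (p S) - g x - (\<Sum>b\<in>S. (h \<bullet> b) * pd b g x)\<bar> \<le> (\<Sum>b\<in>S. e' * \<bar>h \<bullet> b\<bar>)"
      if "S \<subseteq> Basis" "finite S" for S
      using that(2,1)
    proof (induction S rule: finite_induct)
      case empty
      then show ?case by (simp add: p_def)
    next
      case (insert b S)
      have near: "dist (p S + \<tau> *\<^sub>R b) x < d" if "\<bar>\<tau>\<bar> \<le> \<bar>h \<bullet> b\<bar>" for \<tau>
      proof -
        have "p S + \<tau> *\<^sub>R b - x = (\<Sum>b\<in>S. (h \<bullet> b) *\<^sub>R b) + \<tau> *\<^sub>R b" by (simp add: p_def)
        then have "norm (p S + \<tau> *\<^sub>R b - x) \<le> norm (\<Sum>b\<in>S. (h \<bullet> b) *\<^sub>R b) + norm (\<tau> *\<^sub>R b)"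
          by (simp only: norm_triangle_ineq)
        also have "\<dots> \<le> (\<Sum>b\<in>S. \<bar>h \<bullet> b\<bar>) + \<bar>h \<bullet> b\<bar>"
          using insert.prems that by (intro add_mono sum_norm_le) auto
        also have "\<dots> = (\<Sum>b\<in>insert b S. \<bar>h \<bullet> b\<bar>)" using insert by simp
        also have "\<dots> \<le> (\<Sum>b\<in>insert b S. norm h)"
          using insert.prems by (intro sum_mono Basis_le_norm) auto
        also have "\<dots> = card (insert b S) * norm h" by simp
        also have "\<dots> \<le> 3 * norm h"
          using card_mono[OF finite_Basis insert.prems] by (intro mult_right_mono) auto
        also have "\<dots> < d" using h by simp
        finally show ?thesis by (simp add: dist_norm)
      qed
      define \<psi> where "\<psi> \<tau> = g (p S + \<tau> *\<^sub>R b) - \<tau> * pd b g x" for \<tau>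
      have b: "b \<in> Basis" using insert by auto
      have "norm (\<psi> (h \<bullet> b) - \<psi> 0) \<le> e' * norm (h \<bullet> b - 0)"
      proof (rule field_differentiable_bound[where S="closed_segment 0 (h \<bullet> b)"])
        fix \<tau> assume "\<tau> \<in> closed_segment 0 (h \<bullet> b)"
        then have t: "\<bar>\<tau>\<bar> \<le> \<bar>h \<bullet> b\<bar>" by (auto simp: closed_segment_eq_real_ivl split: if_splits)
        have "((\<lambda>t. g (p S + t *\<^sub>R b)) has_real_derivative pd b g (p S + \<tau> *\<^sub>R b)) (at \<tau> within closed_segment 0 (h \<bullet> b))"
          using pd_line_deriv[OF g b] d(2)[OF near[OF t] b] by (blast intro: has_field_derivative_at_within)
        then show "(\<psi> has_real_derivative pd b g (p S + \<tau> *\<^sub>R b) - pd b g x) (at \<tau> within closed_segment 0 (h \<bullet> b))"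
          unfolding \<psi>_def[abs_def] by (auto intro!: derivative_eq_intros)
        show "norm (pd b g (p S + \<tau> *\<^sub>R b) - pd b g x) \<le> e'"
          using d(2)[OF near[OF t] b] by simp
      qed auto
      moreover have "p (insert b S) = p S + (h \<bullet> b) *\<^sub>R b" using insert by (simp add: p_def algebra_simps)
      ultimately have "\<bar>g (p (insert b S)) - g (p S) - (h \<bullet> b) * pd b g x\<bar> \<le> e' * \<bar>h \<bullet> b\<bar>"
        by (simp add: \<psi>_def algebra_simps)
      then show ?case using insert by (simp add: abs_le_iff)
    qed
    have "p Basis = x + h" by (simp add: p_def euclidean_representation)
    then have "\<bar>g (x + h) - g x - (\<Sum>b\<in>Basis. (h \<bullet> b) * pd b g x)\<bar> \<le> (\<Sum>b\<in>Basis. e' * \<bar>h \<bullet> b\<bar>)"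
      using part[of Basis] by simp
    also have "\<dots> \<le> (\<Sum>b\<in>(Basis::(real^3) set). e' * norm h)"
      using e' by (intro sum_mono mult_left_mono Basis_le_norm) auto
    also have "\<dots> = e * norm h" by (simp add: e'_def)
    finally show ?thesis .
  qed
  show "\<exists>d>0. \<forall>y\<in>UNIV. norm (y - x) < d \<longrightarrow> norm (g y - g x - (\<Sum>b\<in>Basis. (y - x) \<bullet> b * pd b g x)) \<le> e * norm (y - x)"
  proof (intro exI[of _ "d/3"] conjI ballI impI)
    fix y assume "norm (y - x) < d / 3"
    from main[OF this] show "norm (g y - g x - (\<Sum>b\<in>Basis. (y - x) \<bullet> b * pd b g x)) \<le> e * norm (y - x)"
      by simp
  qed (use d(1) in simp)
qed

text \<open>Rotation by the angle \<open>t\<close> in the plane of the coordinates \<open>i\<close>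
  and \<open>j\<close>, written as a perturbation of the identity so that linearity in
  \<open>x\<close> and the derivative in \<open>t\<close> can be read off.\<close>

definition rot :: "3 \<Rightarrow> 3 \<Rightarrow> real \<Rightarrow> real^3 \<Rightarrow> real^3" where
  "rot i j t x = x + (cos t - 1) *\<^sub>R (x$i *\<^sub>R axis i 1 + x$j *\<^sub>R axis j 1)
     + sin t *\<^sub>R (x$i *\<^sub>R axis j 1 - x$j *\<^sub>R axis i 1)"

lemma rot_nth:
  "i \<noteq> j \<Longrightarrow> rot i j t x $ k =
    (if k = i then cos t * x$i - sin t * x$j else if k = j then cos t * x$j + sin t * x$i else x$k)"
  by (auto simp: rot_def axis_def algebra_simps)

lemma rot_0 [simp]: "rot i j 0 x = x"
  by (simp add: rot_def)

lemma inner_rot: "i \<noteq> j \<Longrightarrow> rot i j t x \<bullet> rot i j t x = x \<bullet> x"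
proof -
  assume ij: "i \<noteq> j"
  have *: "(c * a - s * b) * (c * a - s * b) + (c * b + s * a) * (c * b + s * a) = a * a + b * b"
    if "c\<^sup>2 + s\<^sup>2 = 1" for a b c s :: real
  proof -
    have "(c * a - s * b) * (c * a - s * b) + (c * b + s * a) * (c * b + s * a) = (c\<^sup>2 + s\<^sup>2) * (a * a + b * b)"
      by (simp add: algebra_simps power2_eq_square)
    then show ?thesis using that by simp
  qed
  show ?thesis
    using exhaust_3[of i] exhaust_3[of j] ij *[of "cos t" "sin t"] *[of "cos t" "- sin t"]
    by (auto simp: inner_vec_def sum_3 rot_nth)
qed

lemma norm_rot: "i \<noteq> j \<Longrightarrow> norm (rot i j t x) = norm x"
  by (simp add: norm_eq_sqrt_inner inner_rot)

lemma orthogonal_transformation_rot: "i \<noteq> j \<Longrightarrow> orthogonal_transformation (rot i j t)"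
  unfolding orthogonal_transformation
  by (intro conjI allI linearI norm_rot) (auto simp: rot_def algebra_simps)

lemma rot_has_vector_derivative:
  assumes "i \<noteq> j"
  shows "((\<lambda>t. rot i j t x) has_vector_derivative
     (rot i j t x $ i *\<^sub>R axis j 1 - rot i j t x $ j *\<^sub>R axis i 1)) (at t)"
proof -
  have "((\<lambda>t. rot i j t x) has_vector_derivative
     ((- sin t) *\<^sub>R (x$i *\<^sub>R axis i 1 + x$j *\<^sub>R axis j 1) + cos t *\<^sub>R (x$i *\<^sub>R axis j 1 - x$j *\<^sub>R axis i 1))) (at t)"
    unfolding rot_def by (auto intro!: derivative_eq_intros)
  moreover have "(- sin t) *\<^sub>R (x$i *\<^sub>R axis i 1 + x$j *\<^sub>R axis j 1) + cos t *\<^sub>R (x$i *\<^sub>R axis j 1 - x$j *\<^sub>R axis i 1)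
     = rot i j t x $ i *\<^sub>R axis j 1 - rot i j t x $ j *\<^sub>R axis i 1"
    using assms by (simp add: rot_nth algebra_simps)
  ultimately show ?thesis by metis
qed

text \<open>Infinitesimal generator of \<open>rot i j\<close>, that is, a component of angular
  momentum up to a scalar.\<close>

definition ang :: "3 \<Rightarrow> 3 \<Rightarrow> (real^3 \<Rightarrow> real) \<Rightarrow> real^3 \<Rightarrow> real" where
  "ang i j g x = x$i * pd (axis j 1) g x - x$j * pd (axis i 1) g x"

lemma Basis3: "(Basis :: (real^3) set) = range (\<lambda>k. axis k 1)"
  by (auto simp: Basis_vec_def)

lemma axis_in_Basis [simp]: "axis k (1::real) \<in> (Basis :: (real^3) set)"
  by (simp add: Basis3)

lemma sum_Basis3: "(\<Sum>b\<in>(Basis :: (real^3) set). f b) = f (axis 1 1) + f (axis 2 1) + f (axis 3 1)"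
proof -
  have "inj (\<lambda>k::3. axis k (1::real))" by (auto simp: inj_on_def axis_eq_axis)
  then show ?thesis unfolding Basis3 by (subst sum.reindex) (auto simp: sum_3)
qed

lemma rot_deriv:
  assumes "C1_on (- {0}) g" "i \<noteq> j" "x \<noteq> 0"
  shows "((\<lambda>t. g (rot i j t x)) has_real_derivative ang i j g (rot i j t x)) (at t)"
proof -
  let ?y = "rot i j t x"
  have y: "?y \<noteq> 0" using norm_rot[OF assms(2), of t x] assms(3) by auto
  have g: "(g has_derivative (\<lambda>h. \<Sum>b\<in>Basis. (h \<bullet> b) * pd b g ?y)) (at ?y)"
    by (rule C1_on_has_derivative[OF _ _ assms(1)]) (use y in auto)
  have "((\<lambda>t. g (rot i j t x)) has_derivative
     (\<lambda>h. \<Sum>b\<in>Basis. ((h *\<^sub>R (?y $ i *\<^sub>R axis j 1 - ?y $ j *\<^sub>R axis i 1)) \<bullet> b) * pd b g ?y)) (at t)"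
    using has_derivative_compose[OF rot_has_vector_derivative[OF assms(2), of x t, unfolded has_vector_derivative_def] g] .
  moreover have "(\<Sum>b\<in>Basis. ((h *\<^sub>R (?y $ i *\<^sub>R axis j 1 - ?y $ j *\<^sub>R axis i 1)) \<bullet> b) * pd b g ?y)
      = ang i j g ?y * h" for h
    using exhaust_3[of i] exhaust_3[of j] assms(2)
    by (auto simp: sum_Basis3 inner_diff_left inner_axis_axis ang_def algebra_simps)
  ultimately show ?thesis by (simp add: has_field_derivative_def mult_commute_abs)
qed

text \<open>By rotation invariance every difference quotient has integral zero. The quotients are
  bounded by the supremum of the derivative, so the limit passes under the integral.\<close>

lemma integral_ang_eq_0:
  fixes f f' :: "real^3 \<Rightarrow> real"
  assumes ij: "i \<noteq> j" and f: "continuous_on S2 f" and f': "continuous_on S2 f'"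
    and d: "\<And>x t. x \<in> S2 \<Longrightarrow> ((\<lambda>t. f (rot i j t x)) has_real_derivative f' (rot i j t x)) (at t)"
  shows "(\<integral>x. f' x \<partial>sigma_S2) = 0"
proof -
  obtain B where B: "B > 0" "\<And>x. x \<in> S2 \<Longrightarrow> norm (f' x) \<le> B" using continuous_on_S2_bounded[OF f'] by metis
  define s where "s n x = (f (rot i j (1 / Suc n) x) - f x) * Suc n" for n x
  have rS: "rot i j t x \<in> S2" if "x \<in> S2" for t x using that norm_rot[OF ij] by simp
  have crot: "continuous_on S2 (\<lambda>x. f (rot i j t x))" for t
    by (rule continuous_on_compose2[OF f])
       (use rS in \<open>auto intro!: linear_continuous_on orthogonal_transformation_linear[THEN linear_linear[THEN iffD2]] orthogonal_transformation_rot ij\<close>)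
  have cs: "continuous_on S2 (s n)" for n unfolding s_def by (intro continuous_intros crot f)
  have "(\<lambda>n. \<integral>x. s n x \<partial>sigma_S2) \<longlonglongrightarrow> (\<integral>x. f' x \<partial>sigma_S2)"
  proof (rule integral_dominated_convergence)
    show "f' \<in> borel_measurable sigma_S2" "\<And>n. s n \<in> borel_measurable sigma_S2" "integrable sigma_S2 (\<lambda>x. B)"
      by (rule borel_measurable_integrable[OF sigma_integrable[OF f']],
          rule borel_measurable_integrable[OF sigma_integrable[OF cs]], simp)
    show "AE x in sigma_S2. (\<lambda>n. s n x) \<longlonglongrightarrow> f' x"
    proof (rule AE_I2)
      fix x assume "x \<in> space sigma_S2"
      then have x: "x \<in> S2" by simp
      have "((\<lambda>h. (f (rot i j h x) - f x) / h) \<longlongrightarrow> f' x) (at 0)"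
        using d[OF x, of 0] by (simp add: has_field_derivative_iff)
      moreover have "filterlim (\<lambda>n. 1 / real (Suc n)) (at 0) sequentially"
        by (rule filterlim_atI) (use lim_inverse_n' LIMSEQ_Suc[OF lim_1_over_n] in auto)
      ultimately have "(\<lambda>n. (f (rot i j (1 / real (Suc n)) x) - f x) / (1 / real (Suc n))) \<longlonglongrightarrow> f' x"
        by (rule filterlim_compose)
      then show "(\<lambda>n. s n x) \<longlonglongrightarrow> f' x" by (simp add: s_def)
    qed
    show "AE x in sigma_S2. norm (s n x) \<le> B" for n
    proof (rule AE_I2)
      fix x assume "x \<in> space sigma_S2"
      then have x: "x \<in> S2" by simp
      have "norm (f (rot i j (1 / Suc n) x) - f (rot i j 0 x)) \<le> B * norm (1 / Suc n - 0 :: real)"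
        by (rule field_differentiable_bound[where S=UNIV and f'="\<lambda>t. f' (rot i j t x)"])
           (use d[OF x] B rS[OF x] in auto)
      then have "norm (f (rot i j (1 / Suc n) x) - f x) * Suc n \<le> B * norm (1 / Suc n - 0 :: real) * Suc n"
        by (intro mult_right_mono) auto
      then show "norm (s n x) \<le> B" unfolding s_def by (simp add: abs_mult del: of_nat_Suc)
    qed
  qed
  moreover have "(\<integral>x. s n x \<partial>sigma_S2) = 0" for n
  proof -
    have "(\<integral>x. s n x \<partial>sigma_S2) = ((\<integral>x. f (rot i j (1 / Suc n) x) \<partial>sigma_S2) - (\<integral>x. f x \<partial>sigma_S2)) * Suc n"
      unfolding s_def using sigma_integrable[OF crot] sigma_integrable[OF f] by simp
    then show ?thesis
      using integral_sigma_S2_orthogonal[OF orthogonal_transformation_rot[OF ij] f] by simp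
  qed
  ultimately show ?thesis by (simp add: tendsto_const_iff)
qed

lemma pd_coord_mult:
  assumes "C1_on U h" "b \<in> Basis" "x \<in> U"
  shows "((\<lambda>t. (x + t *\<^sub>R b) $ i * h (x + t *\<^sub>R b)) has_real_derivative
     b $ i * h x + x $ i * pd b h x) (at 0)"
  using C1_onD(1)[OF assms] by (auto intro!: derivative_eq_intros)

lemma C1_on_coord_mult:
  assumes "C1_on U h"
  shows "C1_on U (\<lambda>x. x $ i * h x)"
  by (rule C1_onI[where D="\<lambda>b x. b $ i * h x + x $ i * pd b h x"])
     (use assms C1_onD(2)[OF assms] pd_coord_mult[OF assms] in \<open>auto simp: C1_on_def intro!: continuous_intros\<close>)

lemma C1_on_diff:
  assumes "C1_on U f" "C1_on U g"
  shows "C1_on U (\<lambda>x. f x - g x)"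
  by (rule C1_onI[where D="\<lambda>b x. pd b f x - pd b g x"])
     (use assms C1_onD[OF assms(1)] C1_onD[OF assms(2)] in \<open>auto simp: C1_on_def intro!: continuous_on_diff DERIV_diff\<close>)

lemma C1_on_ang:
  assumes "C2_on U g"
  shows "C1_on U (ang i j g)"
  unfolding ang_def[abs_def]
  by (intro C1_on_diff C1_on_coord_mult C2_on_imp_C1_on_pd[OF assms] axis_in_Basis)

lemma pd_ang:
  assumes g: "C2_on U g" and b: "b \<in> Basis" and x: "x \<in> U"
  shows "pd b (ang i j g) x = b $ i * pd (axis j 1) g x + x $ i * pd b (pd (axis j 1) g) x
     - (b $ j * pd (axis i 1) g x + x $ j * pd b (pd (axis i 1) g) x)"
  unfolding ang_def[abs_def]
  by (intro pd_eqI DERIV_diff pd_coord_mult[OF C2_on_imp_C1_on_pd[OF g axis_in_Basis] b x])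

text \<open>The chain rule along the ray through \<open>x\<close>, on which \<open>g\<close> is
  constant.\<close>

lemma euler_0_homogeneous:
  assumes g: "C1_on (- {0}) g" and hom: "\<And>c x. c > 0 \<Longrightarrow> g (c *\<^sub>R x) = g x" and x: "x \<noteq> 0"
  shows "(\<Sum>b\<in>Basis. (x \<bullet> b) * pd b g x) = 0"
proof -
  have "(g has_derivative (\<lambda>h. \<Sum>b\<in>Basis. (h \<bullet> b) * pd b g x)) (at x)"
    by (rule C1_on_has_derivative[OF _ _ g]) (use x in auto)
  then have "(g has_derivative (\<lambda>h. \<Sum>b\<in>Basis. (h \<bullet> b) * pd b g x)) (at ((1::real) *\<^sub>R x))" by simp
  moreover have "((\<lambda>t. t *\<^sub>R x) has_derivative (\<lambda>h. h *\<^sub>R x)) (at 1)"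
    by (auto intro!: derivative_eq_intros)
  ultimately have 1: "((\<lambda>t. g (t *\<^sub>R x)) has_derivative (\<lambda>h. \<Sum>b\<in>Basis. ((h *\<^sub>R x) \<bullet> b) * pd b g x)) (at 1)"
    using has_derivative_compose[of "\<lambda>t. t *\<^sub>R x" "\<lambda>h. h *\<^sub>R x" 1 UNIV g] by blast
  have "((\<lambda>t. g x) has_derivative (\<lambda>h. \<Sum>b\<in>Basis. ((h *\<^sub>R x) \<bullet> b) * pd b g x)) (at (1::real))"
    by (rule has_derivative_transform_within_open[OF 1, of "{0<..}"]) (use hom in auto)
  from has_derivative_unique[OF this has_derivative_const]
  have "(\<lambda>h::real. \<Sum>b\<in>Basis. ((h *\<^sub>R x) \<bullet> b) * pd b g x) = (\<lambda>h. 0)" .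
  from fun_cong[OF this, of 1] show ?thesis by simp
qed

text \<open>Euler's relation and its derivatives remove all radial terms from the sum of squared
  angular derivatives. The identity opens the Laplace-Beltrami operator to integration by parts,
  because the integral of an angular derivative is zero.\<close>

lemma sum_ang_ang:
  assumes g: "C2_on (- {0}) g" and hom: "\<And>c x. c > 0 \<Longrightarrow> g (c *\<^sub>R x) = g x" and x: "x \<in> S2"
  shows "ang 1 2 (ang 1 2 g) x + ang 1 3 (ang 1 3 g) x + ang 2 3 (ang 2 3 g) x = laplacian g x"
proof -
  let ?e = "\<lambda>k::3. axis k (1::real) :: real^3"
  let ?D = "\<lambda>k. pd (?e k) g x"
  let ?DD = "\<lambda>k l. pd (?e k) (pd (?e l) g) x"
  have x0: "x \<noteq> 0" "x \<in> - {0}" using x by auto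
  have n: "x$1 * x$1 + x$2 * x$2 + x$3 * x$3 = 1"
    using x by (simp add: norm_eq_1 inner_vec_def sum_3)
  have E: "(\<Sum>k\<in>UNIV. y $ k * pd (?e k) g y) = 0" if "y \<noteq> 0" for y
    using euler_0_homogeneous[OF C2_on_imp_C1_on[OF g] hom that]
    by (simp add: sum_Basis3 sum_3 inner_axis)
  have E0: "x$1 * ?D 1 + x$2 * ?D 2 + x$3 * ?D 3 = 0" using E[OF x0(1)] by (simp add: sum_3)
  \<comment> \<open>Euler's relation differentiated in direction \<open>l\<close>: a row of second
    derivatives paired with \<open>x\<close> becomes a first derivative.\<close>
  have dE: "?D l + (x$1 * ?DD l 1 + x$2 * ?DD l 2 + x$3 * ?DD l 3) = 0" for l
  proof -
    let ?S = "\<Sum>k\<in>UNIV. ?e l $ k * ?D k + x $ k * ?DD l k"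
    have d1: "((\<lambda>t. \<Sum>k\<in>UNIV. (x + t *\<^sub>R ?e l) $ k * pd (?e k) g (x + t *\<^sub>R ?e l)) has_real_derivative ?S) (at 0)"
      by (intro DERIV_sum pd_coord_mult[OF C2_on_imp_C1_on_pd[OF g axis_in_Basis] axis_in_Basis x0(2)])
    have "open ((\<lambda>t. x + t *\<^sub>R ?e l) -` (- {0}))"
      by (intro open_vimage continuous_intros open_Compl closed_singleton)
    then have op: "open {t. x + t *\<^sub>R ?e l \<noteq> 0}" by (simp add: vimage_def)
    have "((\<lambda>t. 0) has_real_derivative ?S) (at 0)"
    proof (rule has_field_derivative_transform_within_open[OF d1 op])
      show "0 \<in> {t. x + t *\<^sub>R ?e l \<noteq> 0}" using x0 by simp
      fix t assume "t \<in> {t. x + t *\<^sub>R ?e l \<noteq> 0}"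
      then have "x + t *\<^sub>R ?e l \<noteq> 0" by simp
      from E[OF this] show "(\<Sum>k\<in>UNIV. (x + t *\<^sub>R ?e l) $ k * pd (?e k) g (x + t *\<^sub>R ?e l)) = 0" .
    qed
    then have "?S = 0"
      using DERIV_unique[OF _ DERIV_const] by blast
    then show ?thesis using exhaust_3[of l] by (auto simp: sum_3 axis_def)
  qed
  have aa: "ang i j (ang i j g) x = x$i * (x$i * ?DD j j - ?D i - x$j * ?DD j i)
     - x$j * (?D j + x$i * ?DD i j - x$j * ?DD i i)" if "i \<noteq> j" for i j
  proof -
    have "axis j 1 $ i = (0::real)" "axis i 1 $ j = (0::real)" using that by (simp_all add: axis_def)
    then show ?thesis
      by (simp add: ang_def[of i j "ang i j g"] pd_ang[OF g axis_in_Basis x0(2)])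
  qed
  \<comment> \<open>The terms are grouped so that, next to the Laplacian, only
    \<open>x \<bullet> x = 1\<close> and the vanishing expressions \<open>E0\<close> and
    \<open>dE\<close> occur.\<close>
  have "ang 1 2 (ang 1 2 g) x + ang 1 3 (ang 1 3 g) x + ang 2 3 (ang 2 3 g) x =
     (x$1 * x$1 + x$2 * x$2 + x$3 * x$3) * (?DD 1 1 + ?DD 2 2 + ?DD 3 3)
      - x$1 * (?D 1 + (x$1 * ?DD 1 1 + x$2 * ?DD 1 2 + x$3 * ?DD 1 3))
      - x$2 * (?D 2 + (x$1 * ?DD 2 1 + x$2 * ?DD 2 2 + x$3 * ?DD 2 3))
      - x$3 * (?D 3 + (x$1 * ?DD 3 1 + x$2 * ?DD 3 2 + x$3 * ?DD 3 3))
      - (x$1 * ?D 1 + x$2 * ?D 2 + x$3 * ?D 3)"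
    by (simp add: aa algebra_simps)
  also have "\<dots> = ?DD 1 1 + ?DD 2 2 + ?DD 3 3" by (simp only: n dE E0) simp
  also have "\<dots> = laplacian g x" by (simp add: laplacian_def sum_Basis3)
  finally show ?thesis .
qed

lemma hext_homogeneous: "c > 0 \<Longrightarrow> hext f (c *\<^sub>R x) = hext f x"
  by (simp add: hext_def field_simps)

lemma hext_S2 [simp]: "x \<in> S2 \<Longrightarrow> hext f x = f x"
  by (simp add: hext_def)

lemma C2_hext_continuous_on_S2:
  assumes "C2_on (- {0}) (hext f)"
  shows "continuous_on S2 f"
proof -
  have "continuous_on S2 (hext f)"
    by (rule continuous_on_subset[of "- {0}"]) (use assms in \<open>auto simp: C2_on_def\<close>)
  then show ?thesis by (rule continuous_on_eq) simp
qed

lemma integral_ang_parts: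
  assumes ij: "i \<noteq> j" and u: "C1_on (- {0}) u" and v: "C1_on (- {0}) v"
  shows "(\<integral>x. ang i j u x * v x \<partial>sigma_S2) = - (\<integral>x. u x * ang i j v x \<partial>sigma_S2)"
proof -
  have c: "continuous_on S2 w" "continuous_on S2 (ang i j w)" if "C1_on (- {0}) w" for w
  proof -
    show "continuous_on S2 w"
      by (rule continuous_on_subset[of "- {0}"]) (use that in \<open>auto simp: C1_on_def\<close>)
    have "continuous_on (- {0}) (ang i j w)"
      unfolding ang_def[abs_def] by (intro continuous_intros C1_onD(2)[OF that] axis_in_Basis)
    then show "continuous_on S2 (ang i j w)" by (rule continuous_on_subset) auto
  qed
  note cu = c[OF u] and cv = c[OF v]
  have "(\<integral>x. ang i j u x * v x + u x * ang i j v x \<partial>sigma_S2) = 0"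
  proof (rule integral_ang_eq_0[OF ij, where f="\<lambda>x. u x * v x"])
    fix x :: "real^3" and t assume "x \<in> S2"
    then have "x \<noteq> 0" by auto
    then show "((\<lambda>t. u (rot i j t x) * v (rot i j t x)) has_real_derivative
      ang i j u (rot i j t x) * v (rot i j t x) + u (rot i j t x) * ang i j v (rot i j t x)) (at t)"
      using DERIV_mult[OF rot_deriv[OF u ij] rot_deriv[OF v ij]] by (simp add: algebra_simps)
  qed (intro continuous_intros cu cv)+
  moreover have "(\<integral>x. ang i j u x * v x + u x * ang i j v x \<partial>sigma_S2) =
     (\<integral>x. ang i j u x * v x \<partial>sigma_S2) + (\<integral>x. u x * ang i j v x \<partial>sigma_S2)"
    by (intro Bochner_Integration.integral_add sigma_integrable continuous_intros cu cv)
  ultimately show ?thesis by simp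
qed

text \<open>Each angular derivative is skew under the integral, so its square is symmetric, and
  \<open>sum_ang_ang\<close> turns this into Green's identity on the sphere.\<close>

lemma laplace_beltrami_symmetric:
  assumes u: "C2_on (- {0}) (hext u)" and v: "C2_on (- {0}) (hext v)"
  shows "(\<integral>x. laplace_beltrami u x * v x \<partial>sigma_S2) = (\<integral>x. u x * laplace_beltrami v x \<partial>sigma_S2)"
proof -
  have ca: "continuous_on S2 (ang i j (ang i j (hext w)))" if "C2_on (- {0}) (hext w)" for i j w
  proof -
    have "continuous_on (- {0}) (ang i j (ang i j (hext w)))"
      unfolding ang_def[of i j "ang i j (hext w)", abs_def]
      by (intro continuous_intros C1_onD(2)[OF C1_on_ang[OF that]] axis_in_Basis)
    then show ?thesis by (rule continuous_on_subset) auto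
  qed
  have I: "(\<integral>x. ang i j (ang i j (hext u)) x * hext v x \<partial>sigma_S2) =
     (\<integral>x. hext u x * ang i j (ang i j (hext v)) x \<partial>sigma_S2)" if "i \<noteq> j" for i j
    using integral_ang_parts[OF that C1_on_ang[OF u] C2_on_imp_C1_on[OF v], of i j]
      integral_ang_parts[OF that C2_on_imp_C1_on[OF u] C1_on_ang[OF v], of i j] by simp
  have LB: "laplace_beltrami w x = ang 1 2 (ang 1 2 (hext w)) x + ang 1 3 (ang 1 3 (hext w)) x
      + ang 2 3 (ang 2 3 (hext w)) x" if "C2_on (- {0}) (hext w)" "x \<in> S2" for w x
    unfolding laplace_beltrami_def using sum_ang_ang[OF that(1) hext_homogeneous that(2)] by simp
  have cc: "continuous_on S2 (hext u)" "continuous_on S2 (hext v)"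
    by (rule continuous_on_subset[of "- {0}"], use u v in \<open>auto simp: C2_on_def\<close>)+
  have int: "integrable sigma_S2 (\<lambda>x. ang i j (ang i j (hext u)) x * hext v x)"
     "integrable sigma_S2 (\<lambda>x. hext u x * ang i j (ang i j (hext v)) x)" for i j
    by (intro sigma_integrable continuous_intros ca u v cc)+
  have "(\<integral>x. laplace_beltrami u x * v x \<partial>sigma_S2) = (\<integral>x. ang 1 2 (ang 1 2 (hext u)) x * hext v x
     + ang 1 3 (ang 1 3 (hext u)) x * hext v x + ang 2 3 (ang 2 3 (hext u)) x * hext v x \<partial>sigma_S2)"
    by (intro Bochner_Integration.integral_cong) (simp_all add: LB[OF u] algebra_simps)
  also have "\<dots> = (\<integral>x. hext u x * ang 1 2 (ang 1 2 (hext v)) x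
     + hext u x * ang 1 3 (ang 1 3 (hext v)) x + hext u x * ang 2 3 (ang 2 3 (hext v)) x \<partial>sigma_S2)"
    using int by (simp add: I)
  also have "\<dots> = (\<integral>x. u x * laplace_beltrami v x \<partial>sigma_S2)"
    by (intro Bochner_Integration.integral_cong) (simp_all add: LB[OF v] algebra_simps)
  finally show ?thesis .
qed

subsection \<open>Powers of zonal functions\<close>

text \<open>Up to normalisation the powers of \<open>zon p\<close> are the de la Vallee Poussin
  kernels with pole \<open>p\<close>. The affine rescaling of the inner product makes them
  nonnegative on the sphere.\<close>

definition zon :: "real^3 \<Rightarrow> real^3 \<Rightarrow> real" where
  "zon p x = (1 + x \<bullet> p) / 2"

lemma zon_commute: "zon p x = zon x p"
  by (simp add: zon_def inner_commute)

lemma zon_dist: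
  assumes "p \<in> S2" "x \<in> S2"
  shows "zon p x = 1 - (dist p x)\<^sup>2 / 4"
proof -
  have "p \<bullet> p = 1" "x \<bullet> x = 1" using assms by (simp_all add: norm_eq_1)
  then have "(dist p x)\<^sup>2 = 2 - 2 * (x \<bullet> p)"
    by (simp add: dist_norm power2_norm_eq_inner inner_diff_left inner_diff_right inner_commute[of p x])
  then show ?thesis by (simp add: zon_def field_simps)
qed

lemma zon_le_1: "p \<in> S2 \<Longrightarrow> x \<in> S2 \<Longrightarrow> zon p x \<le> 1"
  by (simp add: zon_dist)

lemma zon_nonneg:
  assumes "p \<in> S2" "x \<in> S2"
  shows "0 \<le> zon p x"
  using Cauchy_Schwarz_ineq2[of x p] assms by (simp add: zon_def)

lemma continuous_on_zon [continuous_intros]: "continuous_on S f \<Longrightarrow> continuous_on S (\<lambda>x. zon p (f x))"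
  unfolding zon_def by (intro continuous_intros) auto

text \<open>\<open>zder\<close> and \<open>zder2\<close> are the first and second partial
  derivatives at \<open>x\<close> of \<open>x \<bullet> p / norm x\<close>, the extension of degree
  zero of the height above the equator of \<open>p\<close>.\<close>

definition zder :: "real^3 \<Rightarrow> real^3 \<Rightarrow> real^3 \<Rightarrow> real" where
  "zder p b x = (p \<bullet> b) / norm x - (x \<bullet> p) * (x \<bullet> b) / norm x ^ 3"

definition zder2 :: "real^3 \<Rightarrow> real^3 \<Rightarrow> real^3 \<Rightarrow> real^3 \<Rightarrow> real" where
  "zder2 p b c x = - (p \<bullet> b) * (x \<bullet> c) / norm x ^ 3 - (p \<bullet> c) * (x \<bullet> b) / norm x ^ 3
     - (x \<bullet> p) * (b \<bullet> c) / norm x ^ 3 + 3 * (x \<bullet> p) * (x \<bullet> b) * (x \<bullet> c) / norm x ^ 5"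

lemma norm_line_deriv:
  fixes x b :: "real^3"
  assumes "x \<noteq> 0"
  shows "((\<lambda>t. norm (x + t *\<^sub>R b)) has_real_derivative (x \<bullet> b) / norm x) (at 0)"
proof -
  define q where "q t = x \<bullet> x + t * (2 * (x \<bullet> b)) + t * (t * (b \<bullet> b))" for t
  have "(x + t *\<^sub>R b) \<bullet> (x + t *\<^sub>R b) = q t" for t
    unfolding q_def inner_add_left inner_add_right inner_scaleR_left inner_scaleR_right inner_commute[of b x]
    by (simp add: distrib_left)
  then have n: "(\<lambda>t. norm (x + t *\<^sub>R b)) = (\<lambda>t. sqrt (q t))"
    unfolding norm_eq_sqrt_inner by (simp only:)
  have dq: "(q has_real_derivative 2 * (x \<bullet> b)) (at 0)"
    unfolding q_def[abs_def]
    by (rule DERIV_cong[OF DERIV_add[OF DERIV_add[OF DERIV_const DERIV_cmult_right[OF DERIV_ident]]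
            DERIV_mult[OF DERIV_ident DERIV_cmult_right[OF DERIV_ident]]]]) simp
  have q0: "q 0 = x \<bullet> x" by (simp add: q_def)
  have "0 < x \<bullet> x" using assms by simp
  then have ds: "(sqrt has_real_derivative inverse (sqrt (x \<bullet> x)) / 2) (at (q 0))"
    unfolding q0 by (rule DERIV_real_sqrt)
  have "inverse s / 2 * (2 * k) = k / s" for s k :: real
  proof -
    have "inverse s / 2 * (2 * k) = inverse s * k" by simp
    also have "\<dots> = k / s" by (rule divide_inverse_commute[symmetric])
    finally show ?thesis .
  qed
  then have e: "inverse (sqrt (x \<bullet> x)) / 2 * (2 * (x \<bullet> b)) = (x \<bullet> b) / norm x"
    unfolding norm_eq_sqrt_inner .
  show ?thesis unfolding n
    by (rule DERIV_cong[OF DERIV_chain2[where f=sqrt and g=q, OF ds dq] e])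
qed

lemma inner_line_deriv:
  fixes x b :: "real^3"
  shows "((\<lambda>t. (x + t *\<^sub>R b) \<bullet> p) has_real_derivative b \<bullet> p) (at 0)"
  unfolding inner_add_left inner_scaleR_left by (auto intro!: derivative_eq_intros)

lemma zder_deriv:
  assumes "x \<noteq> 0"
  shows "((\<lambda>t. (x + t *\<^sub>R b) \<bullet> p / norm (x + t *\<^sub>R b)) has_real_derivative zder p b x) (at 0)"
proof (rule DERIV_cong[OF DERIV_divide[OF inner_line_deriv norm_line_deriv[OF assms]]])
  have *: "(A * r - X * (B / r)) / (r * r) = A / r - X * B / r ^ 3" if "r \<noteq> 0" for A B X r :: real
    using that by (simp add: field_simps eval_nat_numeral)
  show "(b \<bullet> p * norm (x + 0 *\<^sub>R b) - (x + 0 *\<^sub>R b) \<bullet> p * (x \<bullet> b / norm x)) /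
      (norm (x + 0 *\<^sub>R b) * norm (x + 0 *\<^sub>R b)) = zder p b x"
    using *[of "norm x" "b \<bullet> p" "x \<bullet> p" "x \<bullet> b"] assms by (simp add: zder_def inner_commute[of b p])
qed (use assms in simp)

lemma zder2_deriv:
  assumes "x \<noteq> 0"
  shows "((\<lambda>t. zder p b (x + t *\<^sub>R c)) has_real_derivative zder2 p b c x) (at 0)"
  unfolding zder_def
proof (rule DERIV_cong[OF DERIV_diff[OF DERIV_divide[OF DERIV_const norm_line_deriv[OF assms]]
        DERIV_divide[OF DERIV_mult[OF inner_line_deriv inner_line_deriv] DERIV_power[OF norm_line_deriv[OF assms]]]]])
  have *: "(0 * r - A * (C / r)) / (r * r) - ((P * B + D * X) * r ^ 3 - X * B * (real 3 * (C / r * r ^ (3 - Suc 0)))) / (r ^ 3 * r ^ 3)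
     = - A * C / r ^ 3 - P * B / r ^ 3 - X * D / r ^ 3 + 3 * X * B * C / r ^ 5"
    if r: "r \<noteq> 0" for A B C D P X r :: real
  proof -
    have 1: "(0 * r - A * (C / r)) / (r * r) = - A * C / r ^ 3" by (simp add: power3_eq_cube)
    have e: "r ^ 3 * r ^ 3 = r * r ^ 5" "C / r * r ^ (3 - Suc 0) = r * C" using r by (simp_all add: eval_nat_numeral)
    have 2: "(r * Y) / (r * r ^ 5) = Y / r ^ 5" for Y using r by simp
    have gen: "(Y * s) / (s * s) = Y / s" if "s \<noteq> 0" for Y s :: real using that by simp
    have 3: "(Y * r ^ 3) / (r ^ 3 * r ^ 3) = Y / r ^ 3" for Y by (rule gen) (use r in simp)
    let ?Z = "X * B * (real 3 * (C / r * r ^ (3 - Suc 0)))"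
    have Z: "?Z = r * (3 * X * B * C)" unfolding e by (simp add: ac_simps)
    have 4: "((P * B + D * X) * r ^ 3 - ?Z) / (r ^ 3 * r ^ 3) = P * B / r ^ 3 + X * D / r ^ 3 - ?Z / (r ^ 3 * r ^ 3)"
      by (simp only: diff_divide_distrib 3 add_divide_distrib mult.commute[of D X])
    have 5: "?Z / (r ^ 3 * r ^ 3) = 3 * X * B * C / r ^ 5" unfolding Z e(1) 2 ..
    show ?thesis unfolding 1 4 5 by simp
  qed
  show "(0 * norm (x + 0 *\<^sub>R c) - p \<bullet> b * (x \<bullet> c / norm x)) / (norm (x + 0 *\<^sub>R c) * norm (x + 0 *\<^sub>R c)) -
    ((c \<bullet> p * ((x + 0 *\<^sub>R c) \<bullet> b) + c \<bullet> b * ((x + 0 *\<^sub>R c) \<bullet> p)) * norm (x + 0 *\<^sub>R c) ^ 3 -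
     (x + 0 *\<^sub>R c) \<bullet> p * ((x + 0 *\<^sub>R c) \<bullet> b) * (real 3 * (x \<bullet> c / norm x * norm (x + 0 *\<^sub>R c) ^ (3 - Suc 0)))) /
    (norm (x + 0 *\<^sub>R c) ^ 3 * norm (x + 0 *\<^sub>R c) ^ 3) = zder2 p b c x"
    using *[of "norm x" "p \<bullet> b" "x \<bullet> c" "c \<bullet> p" "x \<bullet> b" "c \<bullet> b" "x \<bullet> p"] assms
    unfolding zder2_def inner_commute[of b c] inner_commute[of p c] by (simp only: scaleR_zero_left add_0_right) simp
qed (use assms in simp_all)

lemma continuous_on_zder: "continuous_on (- {0}) (zder p b)"
  unfolding zder_def[abs_def] by (intro continuous_intros) auto

lemma continuous_on_zder2: "continuous_on (- {0}) (zder2 p b c)"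
  unfolding zder2_def[abs_def] by (intro continuous_intros) auto

lemma hext_zon_power: "hext (\<lambda>x. zon p x ^ N) = (\<lambda>x. ((1 + x \<bullet> p / norm x) / 2) ^ N)"
  unfolding fun_eq_iff hext_def zon_def inner_scaleR_left divide_inverse_commute[symmetric] by simp

lemma zon_power_deriv:
  assumes "x \<noteq> 0"
  shows "((\<lambda>t. ((1 + (x + t *\<^sub>R b) \<bullet> p / norm (x + t *\<^sub>R b)) / 2) ^ N) has_real_derivative
      real N / 2 * ((1 + x \<bullet> p / norm x) / 2) ^ (N - 1) * zder p b x) (at 0)"
  by (rule DERIV_cong[OF DERIV_power[OF DERIV_cdivide[OF DERIV_add[OF DERIV_const zder_deriv[OF assms]]]]]) simp

lemma pd_zon_power:
  assumes "x \<noteq> 0"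
  shows "pd b (hext (\<lambda>x. zon p x ^ N)) x = real N / 2 * ((1 + x \<bullet> p / norm x) / 2) ^ (N - 1) * zder p b x"
  unfolding hext_zon_power by (rule pd_eqI[OF zon_power_deriv[OF assms]])

lemma pd_zon_power_deriv:
  assumes "x \<noteq> 0"
  shows "((\<lambda>t. pd b (hext (\<lambda>x. zon p x ^ N)) (x + t *\<^sub>R c)) has_real_derivative
     real N / 2 * (real (N - 1) / 2 * ((1 + x \<bullet> p / norm x) / 2) ^ (N - 2) * zder p c x * zder p b x
       + ((1 + x \<bullet> p / norm x) / 2) ^ (N - 1) * zder2 p b c x)) (at 0)"
proof (rule has_field_derivative_transform_within_open[where S="{t. x + t *\<^sub>R c \<noteq> 0}"])
  have "open ((\<lambda>t. x + t *\<^sub>R c) -` (- {0}))"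
    by (intro open_vimage continuous_intros open_Compl closed_singleton)
  then show "open {t. x + t *\<^sub>R c \<noteq> 0}" by (simp add: vimage_def)
  show "0 \<in> {t. x + t *\<^sub>R c \<noteq> 0}" using assms by simp
  show "((\<lambda>t. real N / 2 * (((1 + (x + t *\<^sub>R c) \<bullet> p / norm (x + t *\<^sub>R c)) / 2) ^ (N - 1) * zder p b (x + t *\<^sub>R c)))
    has_real_derivative
     real N / 2 * (real (N - 1) / 2 * ((1 + x \<bullet> p / norm x) / 2) ^ (N - 2) * zder p c x * zder p b x
       + ((1 + x \<bullet> p / norm x) / 2) ^ (N - 1) * zder2 p b c x)) (at 0)"
    using DERIV_cmult[OF DERIV_mult[OF zon_power_deriv[OF assms, of c p "N - 1"] zder2_deriv[OF assms, of p b c]], of "real N / 2"]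
    by (simp add: numeral_2_eq_2 algebra_simps)
qed (simp add: pd_zon_power)

lemma C2_on_zon_power: "C2_on (- {0}) (hext (\<lambda>x. zon p x ^ N))"
proof (rule C2_onI)
  show "C1_on (- {0}) (hext (\<lambda>x. zon p x ^ N))"
  proof (rule C1_onI[where D="\<lambda>b x. real N / 2 * ((1 + x \<bullet> p / norm x) / 2) ^ (N - 1) * zder p b x"])
    show "continuous_on (- {0}) (hext (\<lambda>x. zon p x ^ N))"
      unfolding hext_zon_power by (intro continuous_intros) auto
    fix b x :: "real^3" assume "x \<in> - {0}"
    then have "x \<noteq> 0" by simp
    from zon_power_deriv[OF this]
    show "((\<lambda>t. hext (\<lambda>x. zon p x ^ N) (x + t *\<^sub>R b)) has_real_derivative
        real N / 2 * ((1 + x \<bullet> p / norm x) / 2) ^ (N - 1) * zder p b x) (at 0)"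
      unfolding hext_zon_power .
  qed (intro continuous_intros continuous_on_zder; simp)
next
  fix b :: "real^3"
  have "continuous_on (- {0}) (\<lambda>x. real N / 2 * ((1 + x \<bullet> p / norm x) / 2) ^ (N - 1) * zder p b x)"
    by (intro continuous_intros continuous_on_zder) auto
  then have c: "continuous_on (- {0}) (pd b (hext (\<lambda>x. zon p x ^ N)))"
    by (rule continuous_on_eq) (simp add: pd_zon_power)
  show "C1_on (- {0}) (pd b (hext (\<lambda>x. zon p x ^ N)))"
  proof (rule C1_onI[OF c])
    fix d x :: "real^3" assume "x \<in> - {0}"
    then have "x \<noteq> 0" by simp
    then show "((\<lambda>t. pd b (hext (\<lambda>x. zon p x ^ N)) (x + t *\<^sub>R d)) has_real_derivative
      real N / 2 * (real (N - 1) / 2 * ((1 + x \<bullet> p / norm x) / 2) ^ (N - 2) * zder p d x * zder p b x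
       + ((1 + x \<bullet> p / norm x) / 2) ^ (N - 1) * zder2 p b d x)) (at 0)"
      by (rule pd_zon_power_deriv)
  qed (intro continuous_intros continuous_on_zder continuous_on_zder2; simp)
qed

text \<open>On functions of the height \<open>t = x \<bullet> p\<close> the operator is
  \<open>(1 - t^2) d^2/dt^2 - 2 t d/dt\<close>; its two coefficients are the sums \<open>s1\<close>
  and \<open>s2\<close>. Inserting a power of \<open>(1 + t) / 2\<close> leaves only two
  exponents.\<close>

lemma laplace_beltrami_zon_power:
  assumes p: "p \<in> S2" and x: "x \<in> S2"
  shows "laplace_beltrami (\<lambda>x. zon p x ^ N) x =
    (real N)\<^sup>2 * zon p x ^ (N - 1) - real N * (real N + 1) * zon p x ^ N"
proof -
  have x0: "x \<noteq> 0" and nx: "norm x = 1" using x by auto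
  let ?u = "zon p x" and ?t = "x \<bullet> p"
  have t: "?t = 2 * ?u - 1" by (simp add: zon_def field_simps)
  have pp: "p$1 * p$1 + p$2 * p$2 + p$3 * p$3 = 1" and xx: "x$1 * x$1 + x$2 * x$2 + x$3 * x$3 = 1"
    using p x by (simp_all add: norm_eq_1 inner_vec_def sum_3)
  have tt: "?t = x$1 * p$1 + x$2 * p$2 + x$3 * p$3" by (simp add: inner_vec_def sum_3)
  have s1: "(\<Sum>b\<in>Basis. zder p b x * zder p b x) = 1 - ?t * ?t"
  proof -
    have "(\<Sum>b\<in>Basis. zder p b x * zder p b x) = (p$1 * p$1 + p$2 * p$2 + p$3 * p$3)
       - 2 * ?t * (x$1 * p$1 + x$2 * p$2 + x$3 * p$3) + ?t * ?t * (x$1 * x$1 + x$2 * x$2 + x$3 * x$3)"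
      by (simp add: sum_Basis3 zder_def nx inner_axis algebra_simps)
    then show ?thesis by (simp only: pp xx tt[symmetric])
  qed
  have s2: "(\<Sum>b\<in>Basis. zder2 p b b x) = - 2 * ?t"
  proof -
    have "(\<Sum>b\<in>Basis. zder2 p b b x) = - 2 * (x$1 * p$1 + x$2 * p$2 + x$3 * p$3) - 3 * ?t
       + 3 * ?t * (x$1 * x$1 + x$2 * x$2 + x$3 * x$3)"
      by (simp add: sum_Basis3 zder2_def nx inner_axis inner_axis_axis algebra_simps)
    then show ?thesis by (simp only: xx tt[symmetric])
  qed
  have "laplace_beltrami (\<lambda>x. zon p x ^ N) x =
     (\<Sum>b\<in>Basis. real N / 2 * (real (N - 1) / 2 * ?u ^ (N - 2) * zder p b x * zder p b x + ?u ^ (N - 1) * zder2 p b b x))"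
    unfolding laplace_beltrami_def laplacian_def
    by (intro sum.cong refl, subst pd_eqI[OF pd_zon_power_deriv[OF x0]]) (simp add: nx zon_def)
  also have "\<dots> = real N / 2 * (real (N - 1) / 2 * ?u ^ (N - 2) * (\<Sum>b\<in>Basis. zder p b x * zder p b x)
      + ?u ^ (N - 1) * (\<Sum>b\<in>Basis. zder2 p b b x))"
    unfolding sum_Basis3 by (simp add: algebra_simps)
  also have "\<dots> = real N / 2 * (real (N - 1) / 2 * ?u ^ (N - 2) * (1 - ?t * ?t) + ?u ^ (N - 1) * (- 2 * ?t))"
    by (simp only: s1 s2)
  also have "\<dots> = (real N)\<^sup>2 * ?u ^ (N - 1) - real N * (real N + 1) * ?u ^ N"
  proof -
    consider "N = 0" | "N = 1" | m where "N = Suc (Suc m)" by (metis One_nat_def not0_implies_Suc)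
    then show ?thesis
      by cases (simp_all add: t field_simps power2_eq_square)
  qed
  finally show ?thesis .
qed

lemma continuous_on_zon_power: "continuous_on S (\<lambda>x. zon p x ^ N)"
  by (intro continuous_intros)

text \<open>Testing the symmetry of the Laplacian against the constant \<open>zon p x ^ 0\<close>
  makes a recursion for the integrals out of the two-term formula.\<close>

lemma integral_zon_power:
  assumes p: "p \<in> S2"
  shows "(\<integral>x. zon p x ^ N \<partial>sigma_S2) = 1 / (real N + 1)"
proof (induction N)
  case 0
  then show ?case by simp
next
  case (Suc N)
  have i: "integrable sigma_S2 (\<lambda>x. zon p x ^ M)" for M
    by (intro sigma_integrable continuous_on_zon_power)
  have "(\<integral>x. laplace_beltrami (\<lambda>x. zon p x ^ Suc N) x * zon p x ^ 0 \<partial>sigma_S2)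
      = (\<integral>x. zon p x ^ Suc N * laplace_beltrami (\<lambda>x. zon p x ^ 0) x \<partial>sigma_S2)"
    by (rule laplace_beltrami_symmetric) (rule C2_on_zon_power)+
  also have "\<dots> = (\<integral>x. 0 \<partial>sigma_S2)"
    by (rule Bochner_Integration.integral_cong) (simp_all only: space_sigma_S2 laplace_beltrami_zon_power[OF p], simp)
  finally have "(\<integral>x. laplace_beltrami (\<lambda>x. zon p x ^ Suc N) x \<partial>sigma_S2) = 0" by simp
  moreover have "(\<integral>x. laplace_beltrami (\<lambda>x. zon p x ^ Suc N) x \<partial>sigma_S2)
     = (\<integral>x. (real (Suc N))\<^sup>2 * zon p x ^ N - real (Suc N) * (real (Suc N) + 1) * zon p x ^ Suc N \<partial>sigma_S2)"
    by (rule Bochner_Integration.integral_cong) (simp_all only: space_sigma_S2 laplace_beltrami_zon_power[OF p], simp)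
  moreover have "\<dots> = (real (Suc N))\<^sup>2 * (\<integral>x. zon p x ^ N \<partial>sigma_S2)
      - real (Suc N) * (real (Suc N) + 1) * (\<integral>x. zon p x ^ Suc N \<partial>sigma_S2)"
    using i by (simp del: power_Suc)
  ultimately have "(real (Suc N))\<^sup>2 * (1 / (real N + 1)) = real (Suc N) * (real (Suc N) + 1) * (\<integral>x. zon p x ^ Suc N \<partial>sigma_S2)"
    using Suc by simp
  moreover have "(real (Suc N))\<^sup>2 * (1 / (real N + 1)) = real (Suc N)"
    by (simp add: power2_eq_square add.commute)
  ultimately have e: "real (Suc N) * (real (Suc N) + 1) * (\<integral>x. zon p x ^ Suc N \<partial>sigma_S2) = real (Suc N)"
    by (simp only:)
  have "(real (Suc N) + 1) * (\<integral>x. zon p x ^ Suc N \<partial>sigma_S2) = 1"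
  proof -
    have "real (Suc N) * ((real (Suc N) + 1) * (\<integral>x. zon p x ^ Suc N \<partial>sigma_S2)) = real (Suc N) * 1"
      using e by (simp only: mult.assoc mult_1_right)
    then show ?thesis by (rule mult_left_cancel[THEN iffD1, rotated]) simp
  qed
  then have "(\<integral>x. zon p x ^ Suc N \<partial>sigma_S2) = 1 / (real (Suc N) + 1)"
    by (subst eq_divide_eq) (simp only: mult.commute, simp)
  then show ?case .
qed

subsection \<open>The zonal averaging operators\<close>

text \<open>Convolution with a zonal probability density; \<open>integral_zon_power\<close> explains
  the factor \<open>real N + 1\<close>.\<close>

definition zavg :: "nat \<Rightarrow> (real^3 \<Rightarrow> real) \<Rightarrow> real^3 \<Rightarrow> real" where
  "zavg N f x = (\<integral>y. (real N + 1) * zon x y ^ N * f y \<partial>sigma_S2)"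

lemma integrable_zavg:
  "continuous_on S2 f \<Longrightarrow> integrable sigma_S2 (\<lambda>y. c * zon x y ^ N * f y)"
  by (intro sigma_integrable continuous_intros)

lemma zavg_const: "x \<in> S2 \<Longrightarrow> zavg N (\<lambda>y. c) x = c"
  using integral_zon_power[of x N] by (simp add: zavg_def)

lemma zavg_mono:
  assumes "continuous_on S2 f" "continuous_on S2 g" "x \<in> S2" "\<And>y. y \<in> S2 \<Longrightarrow> f y \<le> g y"
  shows "zavg N f x \<le> zavg N g x"
  unfolding zavg_def
  by (rule integral_mono[OF integrable_zavg[OF assms(1)] integrable_zavg[OF assms(2)]])
     (use assms zon_nonneg in \<open>auto intro!: mult_left_mono\<close>)

lemma abs_zavg_le:
  assumes "continuous_on S2 f" "x \<in> S2" "\<And>y. y \<in> S2 \<Longrightarrow> \<bar>f y\<bar> \<le> B"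
  shows "\<bar>zavg N f x\<bar> \<le> B"
proof -
  have "zavg N f x \<le> zavg N (\<lambda>y. B) x" "zavg N (\<lambda>y. - B) x \<le> zavg N f x"
    by (rule zavg_mono[OF assms(1) continuous_on_const assms(2)], use assms(3) in force)
       (rule zavg_mono[OF continuous_on_const assms(1,2)], use assms(3) in force)
  then show ?thesis using assms(2) by (simp add: zavg_const)
qed

lemma zavg_tendsto:
  assumes f: "continuous_on S2 f" and x: "x \<in> S2"
  shows "(\<lambda>N. zavg N f x) \<longlonglongrightarrow> f x"
proof (rule LIMSEQ_I)
  fix e :: real assume e: "e > 0"
  obtain B where B: "B > 0" "\<And>y. y \<in> S2 \<Longrightarrow> norm (f y) \<le> B" using continuous_on_S2_bounded[OF f] by metis
  obtain d where d: "d > 0" "\<And>y. y \<in> S2 \<Longrightarrow> dist y x < d \<Longrightarrow> dist (f y) (f x) < e / 2"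
    using f x e unfolding continuous_on_iff by (metis half_gt_zero)
  \<comment> \<open>An upper bound for \<open>zon x y\<close> at distance at least \<open>d\<close>
    from \<open>x\<close>. The maximum with \<open>0\<close> covers values of \<open>d\<close>
    beyond the diameter of the sphere.\<close>
  define q where "q = max 0 (1 - d\<^sup>2 / 4)"
  have q: "0 \<le> q" "q < 1" using d(1) by (auto simp: q_def)
  have l1: "(\<lambda>N. of_nat N * q ^ N) \<longlonglongrightarrow> 0" by (rule powser_times_n_limit_0) (use q in auto)
  have l2: "(\<lambda>N. q ^ N) \<longlonglongrightarrow> 0" by (rule LIMSEQ_realpow_zero[OF q])
  have "(\<lambda>N. 2 * B * (of_nat N * q ^ N + q ^ N)) \<longlonglongrightarrow> 2 * B * (0 + 0)"
    by (rule tendsto_mult[OF tendsto_const tendsto_add[OF l1 l2]])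
  then have "(\<lambda>N. 2 * B * ((real N + 1) * q ^ N)) \<longlonglongrightarrow> 0" by (simp add: algebra_simps)
  from LIMSEQ_D[OF this, of "e/2"] e obtain N0 where N0: "\<And>N. N \<ge> N0 \<Longrightarrow> \<bar>2 * B * ((real N + 1) * q ^ N)\<bar> < e / 2"
    by auto
  show "\<exists>N0. \<forall>N\<ge>N0. norm (zavg N f x - f x) < e"
  proof (intro exI allI impI)
    fix N assume N: "N \<ge> N0"
    have c: "continuous_on S2 (\<lambda>y. f y - f x)" by (intro continuous_intros f)
    have "zavg N f x - f x = zavg N f x - zavg N (\<lambda>y. f x) x" using x by (simp add: zavg_const)
    also have "\<dots> = (\<integral>y. (real N + 1) * zon x y ^ N * f y - (real N + 1) * zon x y ^ N * f x \<partial>sigma_S2)"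
      unfolding zavg_def
      by (rule Bochner_Integration.integral_diff[symmetric, OF integrable_zavg[OF f] integrable_zavg[OF continuous_on_const]])
    also have "\<dots> = (\<integral>y. (real N + 1) * zon x y ^ N * (f y - f x) \<partial>sigma_S2)"
      by (simp only: right_diff_distrib)
    finally have "norm (zavg N f x - f x) \<le> (\<integral>y. norm ((real N + 1) * zon x y ^ N * (f y - f x)) \<partial>sigma_S2)"
      by simp
    also have "\<dots> \<le> (\<integral>y. (real N + 1) * zon x y ^ N * (e / 2) + 2 * B * ((real N + 1) * q ^ N) \<partial>sigma_S2)"
    proof (rule integral_mono)
      show "integrable sigma_S2 (\<lambda>y. norm ((real N + 1) * zon x y ^ N * (f y - f x)))"
        using integrable_zavg[OF c] by (rule integrable_norm)
      show "integrable sigma_S2 (\<lambda>y. (real N + 1) * zon x y ^ N * (e / 2) + 2 * B * ((real N + 1) * q ^ N))"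
        by (intro sigma_integrable continuous_intros)
      fix y assume "y \<in> space sigma_S2"
      then have y: "y \<in> S2" by simp
      note z = zon_nonneg[OF x y] zon_le_1[OF x y]
      have n: "norm ((real N + 1) * zon x y ^ N * (f y - f x)) = (real N + 1) * zon x y ^ N * \<bar>f y - f x\<bar>"
        using z by (simp add: abs_mult)
      show "norm ((real N + 1) * zon x y ^ N * (f y - f x)) \<le> (real N + 1) * zon x y ^ N * (e / 2) + 2 * B * ((real N + 1) * q ^ N)"
      proof (cases "dist y x < d")
        case True
        then have "(real N + 1) * zon x y ^ N * \<bar>f y - f x\<bar> \<le> (real N + 1) * zon x y ^ N * (e / 2)"
          using d(2)[OF y] z by (intro mult_left_mono) (auto simp: dist_real_def)
        moreover have "0 \<le> 2 * B * ((real N + 1) * q ^ N)" using B q by simp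
        ultimately show ?thesis using n by linarith
      next
        case False
        then have "d\<^sup>2 \<le> (dist x y)\<^sup>2" using d(1) by (intro power_mono) (auto simp: dist_commute)
        then have "zon x y \<le> q" using zon_dist[OF x y] by (simp add: q_def)
        then have zq: "zon x y ^ N \<le> q ^ N" using z by (intro power_mono) auto
        have fb: "\<bar>f y - f x\<bar> \<le> 2 * B" using B(2)[OF x] B(2)[OF y] by simp
        have "(real N + 1) * zon x y ^ N * \<bar>f y - f x\<bar> \<le> (real N + 1) * q ^ N * (2 * B)"
          using zq fb z q by (intro mult_mono) auto
        moreover have "0 \<le> (real N + 1) * zon x y ^ N * (e / 2)" using z e by simp
        ultimately show ?thesis using n by (simp add: algebra_simps)
      qed
    qed
    also have "\<dots> = zavg N (\<lambda>y. e / 2) x + 2 * B * ((real N + 1) * q ^ N)"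
      unfolding zavg_def by (subst Bochner_Integration.integral_add) (auto intro!: sigma_integrable continuous_intros)
    also have "\<dots> < e" using N0[OF N] x by (simp add: zavg_const)
    finally show "norm (zavg N f x - f x) < e" .
  qed
qed

subsection \<open>Eigenfunctions\<close>

definition eigfun :: "(real^3 \<Rightarrow> real) \<Rightarrow> real \<Rightarrow> bool" where
  "eigfun \<phi> l \<longleftrightarrow> C2_on (- {0}) (hext \<phi>) \<and> (\<forall>x\<in>S2. - laplace_beltrami \<phi> x = l * \<phi> x)"

lemma eigfun_continuous: "eigfun \<phi> l \<Longrightarrow> continuous_on S2 \<phi>"
  by (simp add: eigfun_def C2_hext_continuous_on_S2)

lemma eigfunD: "eigfun \<phi> l \<Longrightarrow> x \<in> S2 \<Longrightarrow> laplace_beltrami \<phi> x = - l * \<phi> x"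
  unfolding eigfun_def by (metis minus_minus mult_minus_left)

lemma eigfun_orthogonal:
  assumes "eigfun \<phi> l" "eigfun \<psi> m" "l \<noteq> m"
  shows "inner_L2 \<phi> \<psi> = 0"
proof -
  have "(\<integral>x. laplace_beltrami \<phi> x * \<psi> x \<partial>sigma_S2) = (\<integral>x. \<phi> x * laplace_beltrami \<psi> x \<partial>sigma_S2)"
    using assms by (intro laplace_beltrami_symmetric) (auto simp: eigfun_def)
  moreover have "(\<integral>x. laplace_beltrami \<phi> x * \<psi> x \<partial>sigma_S2) = (\<integral>x. - l * (\<phi> x * \<psi> x) \<partial>sigma_S2)"
    by (intro Bochner_Integration.integral_cong) (simp_all add: eigfunD[OF assms(1)] eigfunD[OF assms(2)])
  moreover have "(\<integral>x. \<phi> x * laplace_beltrami \<psi> x \<partial>sigma_S2) = (\<integral>x. - m * (\<phi> x * \<psi> x) \<partial>sigma_S2)"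
    by (intro Bochner_Integration.integral_cong) (simp_all add: eigfunD[OF assms(1)] eigfunD[OF assms(2)])
  ultimately have "l * inner_L2 \<phi> \<psi> = m * inner_L2 \<phi> \<psi>" by (simp add: inner_L2_def)
  then show ?thesis using assms(3) by simp
qed

text \<open>Symmetry of the Laplacian, applied to \<open>zon x y ^ Suc N\<close> and the
  eigenfunction, relates two consecutive moments. Since \<open>zavg (N + k)\<close> tends to the
  identity as \<open>k\<close> grows, iteration shows that \<open>zavg N\<close> multiplies the
  eigenfunction by an infinite product.\<close>

lemma zavg_eigfun_step:
  assumes e: "eigfun \<phi> l" and x: "x \<in> S2"
  shows "zavg N \<phi> x = (1 - l / ((real N + 1) * (real N + 2))) * zavg (Suc N) \<phi> x"
proof -
  note c = eigfun_continuous[OF e]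
  define I where "I M = (\<integral>y. zon x y ^ M * \<phi> y \<partial>sigma_S2)" for M
  have i: "integrable sigma_S2 (\<lambda>y. zon x y ^ M * \<phi> y)" for M
    by (intro sigma_integrable continuous_intros c)
  have z: "zavg M \<phi> x = (real M + 1) * I M" for M
    unfolding zavg_def I_def by (simp add: mult.assoc)
  have "(real (Suc N))\<^sup>2 * I N - real (Suc N) * (real (Suc N) + 1) * I (Suc N) =
     (\<integral>y. (real (Suc N))\<^sup>2 * (zon x y ^ N * \<phi> y) - real (Suc N) * (real (Suc N) + 1) * (zon x y ^ Suc N * \<phi> y) \<partial>sigma_S2)"
    unfolding I_def using i by (simp del: power_Suc)
  also have "\<dots> = (\<integral>y. laplace_beltrami (\<lambda>y. zon x y ^ Suc N) y * \<phi> y \<partial>sigma_S2)"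
    by (rule Bochner_Integration.integral_cong)
       (simp_all only: space_sigma_S2 laplace_beltrami_zon_power[OF x], simp add: algebra_simps)
  also have "\<dots> = (\<integral>y. zon x y ^ Suc N * laplace_beltrami \<phi> y \<partial>sigma_S2)"
    using e by (intro laplace_beltrami_symmetric C2_on_zon_power) (simp add: eigfun_def)
  also have "\<dots> = (\<integral>y. - l * (zon x y ^ Suc N * \<phi> y) \<partial>sigma_S2)"
    by (intro Bochner_Integration.integral_cong) (simp_all add: eigfunD[OF e])
  also have "\<dots> = - l * I (Suc N)" unfolding I_def by (rule Bochner_Integration.integral_mult_right_zero)
  finally have e2: "(real N + 1)\<^sup>2 * I N = ((real N + 1) * (real N + 2) - l) * I (Suc N)"
    by (simp add: algebra_simps)
  have gen: "a * ((1 - l / (a * b)) * (b * J)) = (a * b - l) * J" if "a > 0" "b > 0" for a b J :: real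
  proof -
    have "a * b * (l / (a * b)) = l" using that by simp
    moreover have "a * ((1 - t) * (b * J)) = (a * b - a * b * t) * J" for t by (simp add: algebra_simps)
    ultimately show ?thesis by (simp only:)
  qed
  have "(real N + 1) * ((real N + 1) * I N) = (real N + 1) * ((1 - l / ((real N + 1) * (real N + 2))) * ((real N + 2) * I (Suc N)))"
    using e2 by (subst gen) (simp_all add: power2_eq_square mult.assoc)
  then have "(real N + 1) * I N = (1 - l / ((real N + 1) * (real N + 2))) * ((real N + 2) * I (Suc N))"
    by (rule mult_left_cancel[THEN iffD1, rotated]) simp
  then show ?thesis by (simp add: z add.commute)
qed

definition zprod :: "real \<Rightarrow> nat \<Rightarrow> nat \<Rightarrow> real" where
  "zprod l N k = (\<Prod>j<k. 1 - l / ((real (N + j) + 1) * (real (N + j) + 2)))"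

lemma zprod_Suc: "zprod l N (Suc k) = zprod l N k * (1 - l / ((real (N + k) + 1) * (real (N + k) + 2)))"
  by (simp add: zprod_def)

lemma zavg_eigfun_zprod:
  assumes "eigfun \<phi> l" "x \<in> S2"
  shows "zavg N \<phi> x = zprod l N k * zavg (N + k) \<phi> x"
proof (induction k)
  case 0
  then show ?case by (simp add: zprod_def)
next
  case (Suc k)
  then show ?case using zavg_eigfun_step[OF assms, of "N + k"] by (simp add: zprod_Suc)
qed

text \<open>The value of the infinite product. \<open>lim\<close> is informative only where the
  product converges, which is established for \<open>l\<close> with an eigenfunction that does not
  vanish on the sphere.\<close>

definition zmult :: "real \<Rightarrow> nat \<Rightarrow> real" where
  "zmult l N = lim (zprod l N)"

text \<open>At a point where the eigenfunction is nonzero the finite products are eventually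
  quotients of averages, and those averages converge. So the eigenfunction itself forces the product
  to converge.\<close>

lemma zprod_tendsto_zmult:
  assumes e: "eigfun \<phi> l" and x: "x \<in> S2" "\<phi> x \<noteq> 0"
  shows "zprod l N \<longlonglongrightarrow> zmult l N" and "zmult l N = zavg N \<phi> x / \<phi> x"
proof -
  have l: "(\<lambda>k. zavg (k + N) \<phi> x) \<longlonglongrightarrow> \<phi> x"
    by (rule LIMSEQ_ignore_initial_segment[OF zavg_tendsto[OF eigfun_continuous[OF e] x(1)]])
  then have "(\<lambda>k. zavg N \<phi> x / zavg (k + N) \<phi> x) \<longlonglongrightarrow> zavg N \<phi> x / \<phi> x"
    using x by (intro tendsto_intros) auto
  moreover have "\<forall>\<^sub>F k in sequentially. zavg N \<phi> x / zavg (k + N) \<phi> x = zprod l N k"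
  proof -
    have "\<forall>\<^sub>F k in sequentially. zavg (k + N) \<phi> x \<noteq> 0"
      using tendsto_imp_eventually_ne[OF l x(2)] .
    then show ?thesis
      by eventually_elim (use zavg_eigfun_zprod[OF e x(1), of N] in \<open>simp add: field_simps\<close>)
  qed
  ultimately have t: "zprod l N \<longlonglongrightarrow> zavg N \<phi> x / \<phi> x" by (rule Lim_transform_eventually)
  then show "zmult l N = zavg N \<phi> x / \<phi> x" by (simp add: zmult_def limI)
  with t show "zprod l N \<longlonglongrightarrow> zmult l N" by simp
qed

lemma zavg_eigfun:
  assumes e: "eigfun \<phi> l" and x: "x \<in> S2"
  shows "zavg N \<phi> x = zmult l N * \<phi> x"
proof (cases "\<exists>y\<in>S2. \<phi> y \<noteq> 0")
  case True
  then obtain y where y: "y \<in> S2" "\<phi> y \<noteq> 0" by auto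
  have "(\<lambda>k. zprod l N k * zavg (k + N) \<phi> x) \<longlonglongrightarrow> zmult l N * \<phi> x"
    by (intro tendsto_mult zprod_tendsto_zmult[OF e y]
        LIMSEQ_ignore_initial_segment[OF zavg_tendsto[OF eigfun_continuous[OF e] x]])
  moreover have "zprod l N k * zavg (k + N) \<phi> x = zavg N \<phi> x" for k
    using zavg_eigfun_zprod[OF e x, of N k] by (simp add: add.commute)
  ultimately show ?thesis by (simp add: tendsto_const_iff)
next
  case False
  then have "zavg N \<phi> x = (\<integral>y. 0 \<partial>sigma_S2)"
    unfolding zavg_def by (intro Bochner_Integration.integral_cong) auto
  then show ?thesis using False x by simp
qed

text \<open>For negative \<open>l\<close> all factors of the product exceed one, so
  \<open>zavg 0\<close> would enlarge the maximum of the absolute value, which an average cannot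
  do.\<close>

lemma eigfun_nonneg:
  assumes e: "eigfun \<phi> l" and x: "\<exists>x\<in>S2. \<phi> x \<noteq> 0"
  shows "l \<ge> 0"
proof (rule ccontr)
  assume "\<not> l \<ge> 0"
  then have l: "l < 0" by simp
  note c = eigfun_continuous[OF e]
  have "continuous_on S2 (\<lambda>x. \<bar>\<phi> x\<bar>)" by (intro continuous_intros c)
  then have "\<exists>y\<in>S2. \<forall>x\<in>S2. \<bar>\<phi> x\<bar> \<le> \<bar>\<phi> y\<bar>"
    by (rule continuous_attains_sup[OF compact_sphere, rotated]) (use x in blast)
  then obtain y where y: "y \<in> S2" "\<And>x. x \<in> S2 \<Longrightarrow> \<bar>\<phi> x\<bar> \<le> \<bar>\<phi> y\<bar>" by blast
  obtain z where "z \<in> S2" "\<phi> z \<noteq> 0" using x by blast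
  then have y0: "\<phi> y \<noteq> 0" using y(2)[of z] by auto
  have ge: "zprod l 0 k \<ge> 1" for k
    unfolding zprod_def by (rule prod_ge_1) (use l in \<open>simp add: divide_nonpos_pos\<close>)
  \<comment> \<open>The factor with index \<open>0\<close> equals \<open>1 - l / 2\<close> and alone
    keeps the limit above one.\<close>
  have lower: "zprod l 0 (Suc k) \<ge> 1 - l / 2" for k
  proof (induction k)
    case 0 show ?case by (simp add: zprod_def)
  next
    case (Suc k)
    have "1 - l / ((real (0 + Suc k) + 1) * (real (0 + Suc k) + 2)) \<ge> 1"
      using l by (simp add: divide_nonpos_pos)
    then have "zprod l 0 (Suc k) * 1 \<le> zprod l 0 (Suc (Suc k))"
      unfolding zprod_Suc[of l 0 "Suc k"] using ge[of "Suc k"] by (intro mult_left_mono) auto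
    then show ?case using Suc by simp
  qed
  have "zmult l 0 \<ge> 1 - l / 2"
    by (rule LIMSEQ_le_const[OF LIMSEQ_Suc[OF zprod_tendsto_zmult(1)[OF e y(1) y0]]]) (use lower in blast)
  then have "zmult l 0 > 1" using l by linarith
  moreover have "\<bar>zmult l 0 * \<phi> y\<bar> \<le> \<bar>\<phi> y\<bar>"
    using abs_zavg_le[OF c y(1) y(2), of 0] zavg_eigfun[OF e y(1), of 0] by simp
  ultimately show False using y0 by (simp add: abs_mult)
qed

text \<open>A product of factors \<open>1 - a\<close> with \<open>a\<close> in the unit interval is
  at least one minus the sum of the \<open>a\<close>, and here this sum telescopes by
  \<open>l / (m * (m + 1)) = l / m - l / (m + 1)\<close>.\<close>

lemma zprod_lower:
  assumes "0 \<le> l" "l \<le> (real N + 1) * (real N + 2)"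
  shows "0 \<le> zprod l N k \<and> zprod l N k \<le> 1 \<and> 1 - l / (real N + 1) + l / (real (N + k) + 1) \<le> zprod l N k"
proof (induction k)
  case 0 show ?case by (simp add: zprod_def)
next
  case (Suc k)
  define a where "a = l / ((real (N + k) + 1) * (real (N + k) + 2))"
  have IH: "0 \<le> zprod l N k" "zprod l N k \<le> 1"
    "1 - l / (real N + 1) + l / (real (N + k) + 1) \<le> zprod l N k" using Suc by blast+
  have "(real N + 1) * (real N + 2) \<le> (real (N + k) + 1) * (real (N + k) + 2)"
    by (intro mult_mono) auto
  then have "l \<le> (real (N + k) + 1) * (real (N + k) + 2)"
    using assms(2) by (rule order_trans[rotated])
  then have a: "0 \<le> a" "a \<le> 1" using assms(1) by (simp_all add: a_def divide_le_eq_1)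
  have tel: "l / (m * (m + 1)) = l / m - l / (m + 1)" if "m > 0" for m :: real
    using that by (simp add: divide_simps) (simp add: algebra_simps)
  have a': "a = l / (real (N + k) + 1) - l / (real (N + Suc k) + 1)"
    using tel[of "real (N + k) + 1"] by (simp add: a_def add.commute add.left_commute)
  have z: "zprod l N (Suc k) = zprod l N k * (1 - a)" by (simp add: zprod_Suc a_def)
  have "zprod l N k * a \<le> 1 * a" by (intro mult_right_mono IH a)
  then have ge: "zprod l N k - a \<le> zprod l N (Suc k)" by (simp add: z right_diff_distrib)
  have "zprod l N (Suc k) \<le> 1" unfolding z by (intro mult_le_one IH) (use a in simp_all)
  moreover have "0 \<le> zprod l N (Suc k)" unfolding z by (intro mult_nonneg_nonneg IH) (use a in simp)
  moreover have "1 - l / (real N + 1) + l / (real (N + Suc k) + 1) \<le> zprod l N (Suc k)"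
    using IH(3) ge a' by linarith
  ultimately show ?case by blast
qed

text \<open>For eigenvalues up to \<open>(N + 1) / 2\<close>, hence degrees up to order
  \<open>sqrt N\<close>, the average damps by at most a factor two. The quantitative uses of
  \<open>zavg\<close> all stay in this range.\<close>

lemma zmult_bounds:
  assumes e: "eigfun \<phi> l" and x: "x \<in> S2" "\<phi> x \<noteq> 0" and l: "2 * l \<le> real N + 1"
  shows "1 / 2 \<le> zmult l N" "zmult l N \<le> 1"
proof -
  have "\<exists>x\<in>S2. \<phi> x \<noteq> 0" using x by blast
  from eigfun_nonneg[OF e this] have l0: "0 \<le> l" .
  have gen: "l \<le> a * 1" "l / a \<le> 1 / 2" if "2 * l \<le> a" "0 < a" for a :: real
    using that l0 by (simp_all add: pos_divide_le_eq)
  have "l \<le> (real N + 1) * 1" by (rule gen(1)[OF l]) simp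
  also have "\<dots> \<le> (real N + 1) * (real N + 2)" by (rule mult_left_mono) simp_all
  finally have l1: "l \<le> (real N + 1) * (real N + 2)" .
  have l2: "l / (real N + 1) \<le> 1 / 2" by (rule gen(2)[OF l]) simp
  have half: "1 / 2 \<le> zprod l N k" for k
  proof -
    have "0 \<le> l / (real (N + k) + 1)" using l0 by simp
    then show ?thesis using zprod_lower[OF l0 l1, of k] l2 by linarith
  qed
  show "1 / 2 \<le> zmult l N"
    by (rule LIMSEQ_le_const[OF zprod_tendsto_zmult(1)[OF e x]]) (use half in blast)
  show "zmult l N \<le> 1"
    by (rule LIMSEQ_le_const2[OF zprod_tendsto_zmult(1)[OF e x]]) (simp add: zprod_lower[OF l0 l1])
qed

text \<open>A wider range with a merely qualitative conclusion: up to the eigenvalue of degree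
  \<open>N\<close> no factor vanishes, and a far tail of the product is at least one half. Exactness
  only asks that multipliers can be divided out.\<close>

lemma zmult_pos:
  assumes e: "eigfun \<phi> l" and x: "x \<in> S2" "\<phi> x \<noteq> 0" and l: "l \<le> real N * (real N + 1)"
  shows "zmult l N > 0"
proof -
  have "\<exists>x\<in>S2. \<phi> x \<noteq> 0" using x by blast
  from eigfun_nonneg[OF e this] have l0: "0 \<le> l" .
  obtain M :: nat where M: "2 * l \<le> real M" using real_arch_simple by blast
  have "zprod l N M > 0"
    unfolding zprod_def
  proof (rule prod_pos)
    fix j
    have "l \<le> real (N + j) * (real (N + j) + 1)" using l by (rule order_trans) (auto intro!: mult_mono)
    also have "\<dots> < (real (N + j) + 1) * (real (N + j) + 2)" by (simp add: algebra_simps)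
    finally show "0 < 1 - l / ((real (N + j) + 1) * (real (N + j) + 2))" by simp
  qed
  moreover have "zmult l (N + M) \<ge> 1 / 2" using zmult_bounds(1)[OF e x] M by simp
  moreover have "zmult l N = zprod l N M * zmult l (N + M)"
    using zprod_tendsto_zmult(2)[OF e x] zavg_eigfun_zprod[OF e x(1), of N M] by simp
  ultimately show ?thesis by simp
qed

subsection \<open>The inner product on continuous functions\<close>

lemma inner_L2_commute: "inner_L2 f g = inner_L2 g f"
  by (simp add: inner_L2_def mult.commute)

lemma inner_L2_cong:
  "(\<And>x. x \<in> S2 \<Longrightarrow> f x = f' x) \<Longrightarrow> (\<And>x. x \<in> S2 \<Longrightarrow> g x = g' x) \<Longrightarrow> inner_L2 f g = inner_L2 f' g'"
  unfolding inner_L2_def by (intro Bochner_Integration.integral_cong) auto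

lemma inner_L2_sum_left:
  assumes "\<And>k. k \<in> I \<Longrightarrow> integrable sigma_S2 (\<lambda>x. F k x * g x)"
  shows "inner_L2 (\<lambda>x. \<Sum>k\<in>I. a k * F k x) g = (\<Sum>k\<in>I. a k * inner_L2 (F k) g)"
proof -
  have "inner_L2 (\<lambda>x. \<Sum>k\<in>I. a k * F k x) g = (\<integral>x. (\<Sum>k\<in>I. a k * (F k x * g x)) \<partial>sigma_S2)"
    by (simp add: inner_L2_def sum_distrib_right mult.assoc)
  also have "\<dots> = (\<Sum>k\<in>I. \<integral>x. a k * (F k x * g x) \<partial>sigma_S2)"
    by (rule Bochner_Integration.integral_sum) (use assms in simp)
  also have "\<dots> = (\<Sum>k\<in>I. a k * inner_L2 (F k) g)"
    unfolding inner_L2_def by (simp only: integral_mult_right_zero)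
  finally show ?thesis .
qed

lemma inner_L2_sum_cont:
  assumes "\<And>k. k \<in> I \<Longrightarrow> continuous_on S2 (F k)" "continuous_on S2 g"
  shows "inner_L2 (\<lambda>x. \<Sum>k\<in>I. a k * F k x) g = (\<Sum>k\<in>I. a k * inner_L2 (F k) g)"
  by (rule inner_L2_sum_left) (intro sigma_integrable continuous_intros assms)

lemma inner_L2_diff_left:
  assumes "continuous_on S2 f" "continuous_on S2 f'" "continuous_on S2 g"
  shows "inner_L2 (\<lambda>x. f x - f' x) g = inner_L2 f g - inner_L2 f' g"
  unfolding inner_L2_def left_diff_distrib
  by (rule Bochner_Integration.integral_diff) (intro sigma_integrable continuous_intros assms)+

lemma inner_L2_nonneg: "0 \<le> inner_L2 f f"
  unfolding inner_L2_def by (rule Bochner_Integration.integral_nonneg) simp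

lemma inner_L2_eq_0_imp:
  assumes "continuous_on S2 f" "inner_L2 f f = 0" "x \<in> S2"
  shows "f x = 0"
proof -
  have "integrable sigma_S2 (\<lambda>x. f x * f x)" by (intro sigma_integrable continuous_intros assms)
  then have "AE x in sigma_S2. f x * f x = 0"
    using integral_nonneg_eq_0_iff_AE[of sigma_S2 "\<lambda>x. f x * f x"] assms(2) by (simp add: inner_L2_def)
  then have "AE x in sigma_S2. f x = 0" by simp
  then show ?thesis by (rule AE_sigma_eq_imp_eq[OF assms(1) continuous_on_const _ assms(3)])
qed

definition onf :: "'i set \<Rightarrow> ('i \<Rightarrow> real^3 \<Rightarrow> real) \<Rightarrow> bool" where
  "onf I F \<longleftrightarrow> finite I \<and> (\<forall>k\<in>I. continuous_on S2 (F k)) \<and>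
     (\<forall>k\<in>I. \<forall>l\<in>I. inner_L2 (F k) (F l) = (if k = l then 1 else 0))"

lemma onf_cont_sum:
  assumes "onf I F"
  shows "continuous_on S2 (\<lambda>x. \<Sum>k\<in>I. a k * F k x)"
  using assms by (intro continuous_intros) (simp add: onf_def)

lemma onf_coeff:
  assumes "onf I F" "l \<in> I"
  shows "inner_L2 (\<lambda>x. \<Sum>k\<in>I. a k * F k x) (F l) = a l"
proof -
  have "inner_L2 (\<lambda>x. \<Sum>k\<in>I. a k * F k x) (F l) = (\<Sum>k\<in>I. a k * inner_L2 (F k) (F l))"
    by (rule inner_L2_sum_cont) (use assms in \<open>simp_all add: onf_def\<close>)
  also have "\<dots> = (\<Sum>k\<in>I. if k = l then a k else 0)"
    by (rule sum.cong) (use assms in \<open>simp_all add: onf_def\<close>)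
  also have "\<dots> = a l" using assms by (simp add: onf_def)
  finally show ?thesis .
qed

lemma onf_parseval:
  assumes "onf I F"
  shows "inner_L2 (\<lambda>x. \<Sum>k\<in>I. a k * F k x) (\<lambda>x. \<Sum>k\<in>I. a k * F k x) = (\<Sum>k\<in>I. (a k)\<^sup>2)"
proof -
  have "inner_L2 (\<lambda>x. \<Sum>k\<in>I. a k * F k x) (\<lambda>x. \<Sum>k\<in>I. a k * F k x)
      = (\<Sum>k\<in>I. a k * inner_L2 (F k) (\<lambda>x. \<Sum>k\<in>I. a k * F k x))"
    by (rule inner_L2_sum_cont[OF _ onf_cont_sum[OF assms]]) (use assms in \<open>simp add: onf_def\<close>)
  also have "\<dots> = (\<Sum>k\<in>I. a k * a k)"
    by (rule sum.cong[OF refl]) (simp add: inner_L2_commute[of "F _"] onf_coeff[OF assms])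
  finally show ?thesis by (simp add: power2_eq_square)
qed

lemma onf_bessel:
  assumes "onf I F" "continuous_on S2 f"
  shows "(\<Sum>k\<in>I. (inner_L2 f (F k))\<^sup>2) \<le> inner_L2 f f"
proof -
  define a where "a k = inner_L2 f (F k)" for k
  define g where "g x = (\<Sum>k\<in>I. a k * F k x)" for x
  have g: "continuous_on S2 g" unfolding g_def[abs_def] by (rule onf_cont_sum[OF assms(1)])
  have "inner_L2 g f = (\<Sum>k\<in>I. a k * inner_L2 (F k) f)"
    unfolding g_def[abs_def] by (rule inner_L2_sum_cont) (use assms in \<open>simp_all add: onf_def\<close>)
  then have gf: "inner_L2 g f = (\<Sum>k\<in>I. (a k)\<^sup>2)"
    by (simp add: inner_L2_commute[of "F _"] a_def power2_eq_square)
  have gg: "inner_L2 g g = (\<Sum>k\<in>I. (a k)\<^sup>2)" unfolding g_def[abs_def] by (rule onf_parseval[OF assms(1)])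
  have d: "continuous_on S2 (\<lambda>x. f x - g x)" by (intro continuous_intros assms g)
  have "inner_L2 (\<lambda>x. f x - g x) (\<lambda>x. f x - g x) = inner_L2 f (\<lambda>x. f x - g x) - inner_L2 g (\<lambda>x. f x - g x)"
    by (rule inner_L2_diff_left[OF assms(2) g d])
  also have "\<dots> = (inner_L2 f f - inner_L2 g f) - (inner_L2 f g - inner_L2 g g)"
    unfolding inner_L2_commute[of f "\<lambda>x. f x - g x"] inner_L2_commute[of g "\<lambda>x. f x - g x"]
    by (simp only: inner_L2_diff_left[OF assms(2) g assms(2)] inner_L2_diff_left[OF assms(2) g g])
  also have "\<dots> = inner_L2 f f - (\<Sum>k\<in>I. (a k)\<^sup>2)"
    unfolding inner_L2_commute[of f g] gf gg by simp
  finally show ?thesis using inner_L2_nonneg[of "\<lambda>x. f x - g x"] by (simp add: a_def)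
qed

text \<open>Bessel's inequality for the zonal kernel, whose coefficients are the values of the eigenfunctions.\<close>

lemma eigen_sum_squares_le:
  assumes on: "onf I F" and e: "\<And>k. k \<in> I \<Longrightarrow> eigfun (F k) (l k)" and l: "\<And>k. k \<in> I \<Longrightarrow> 2 * l k \<le> real N + 1"
    and x: "x \<in> S2"
  shows "(\<Sum>k\<in>I. (F k x)\<^sup>2) \<le> 4 * (real N + 1)"
proof -
  define f where "f y = (real N + 1) * zon x y ^ N" for y
  have f: "continuous_on S2 f" unfolding f_def[abs_def] by (intro continuous_intros)
  have c: "inner_L2 f (F k) = zmult (l k) N * F k x" if "k \<in> I" for k
    using zavg_eigfun[OF e[OF that] x, of N] by (simp add: zavg_def inner_L2_def f_def)
  have q: "(F k x)\<^sup>2 \<le> 4 * (inner_L2 f (F k))\<^sup>2" if k: "k \<in> I" for k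
  proof (cases "F k x = 0")
    case False
    have "1 / 2 \<le> zmult (l k) N" by (rule zmult_bounds(1)[OF e[OF k] x False l[OF k]])
    then have "(1 / 2)\<^sup>2 \<le> (zmult (l k) N)\<^sup>2" by (intro power_mono) auto
    then have "(1 / 2)\<^sup>2 * (F k x)\<^sup>2 \<le> (zmult (l k) N)\<^sup>2 * (F k x)\<^sup>2" by (rule mult_right_mono) simp
    then show ?thesis unfolding c[OF k] power_mult_distrib by (simp add: power_divide)
  qed simp
  have "(\<Sum>k\<in>I. (F k x)\<^sup>2) \<le> (\<Sum>k\<in>I. 4 * (inner_L2 f (F k))\<^sup>2)" by (intro sum_mono q)
  also have "\<dots> = 4 * (\<Sum>k\<in>I. (inner_L2 f (F k))\<^sup>2)" by (simp add: sum_distrib_left)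
  also have "\<dots> \<le> 4 * inner_L2 f f" using onf_bessel[OF on f] by simp
  also have "inner_L2 f f = (real N + 1)\<^sup>2 * (\<integral>y. zon x y ^ (2 * N) \<partial>sigma_S2)"
  proof -
    have "f y * f y = (real N + 1)\<^sup>2 * zon x y ^ (2 * N)" for y
    proof -
      have "zon x y ^ (2 * N) = zon x y ^ N * zon x y ^ N" by (simp only: mult_2 power_add)
      then show ?thesis by (simp only: f_def power2_eq_square mult_ac)
    qed
    then show ?thesis unfolding inner_L2_def by (simp only: integral_mult_right_zero)
  qed
  also have "\<dots> = (real N + 1) * ((real N + 1) / (2 * real N + 1))"
    using integral_zon_power[OF x, of "2 * N"] by (simp add: power2_eq_square)
  also have "4 * \<dots> \<le> 4 * ((real N + 1) * 1)"
    by (intro mult_left_mono) simp_all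
  finally show ?thesis by simp
qed

text \<open>Each squared member has integral one, so integrating the pointwise bound counts the
  family. This is the Weyl law as an upper bound.\<close>

lemma eigen_card_le:
  assumes on: "onf I F" and e: "\<And>k. k \<in> I \<Longrightarrow> eigfun (F k) (l k)" and l: "\<And>k. k \<in> I \<Longrightarrow> 2 * l k \<le> real N + 1"
  shows "real (card I) \<le> 4 * (real N + 1)"
proof -
  have i: "integrable sigma_S2 (\<lambda>x. (F k x)\<^sup>2)" if "k \<in> I" for k
    using on that by (intro sigma_integrable continuous_intros) (simp add: onf_def)
  have "(\<integral>x. (F k x)\<^sup>2 \<partial>sigma_S2) = 1" if "k \<in> I" for k
    using on that by (auto simp: onf_def inner_L2_def power2_eq_square)
  then have "real (card I) = (\<Sum>k\<in>I. \<integral>x. (F k x)\<^sup>2 \<partial>sigma_S2)" by simp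
  also have "\<dots> = (\<integral>x. (\<Sum>k\<in>I. (F k x)\<^sup>2) \<partial>sigma_S2)"
    by (rule Bochner_Integration.integral_sum[symmetric]) (rule i)
  also have "\<dots> \<le> (\<integral>x. 4 * (real N + 1) \<partial>sigma_S2)"
    by (rule integral_mono) (use i eigen_sum_squares_le[OF on e l] in auto)
  finally show ?thesis by simp
qed

subsection \<open>Existence of an eigenbasis\<close>

lemma C1_on_transform:
  assumes "open U" "C1_on U f" "\<And>x. x \<in> U \<Longrightarrow> f x = g x"
  shows "C1_on U g" and "\<And>b x. b \<in> Basis \<Longrightarrow> x \<in> U \<Longrightarrow> pd b g x = pd b f x"
proof -
  have d: "((\<lambda>t. g (x + t *\<^sub>R b)) has_real_derivative pd b f x) (at 0)" if "b \<in> Basis" "x \<in> U" for b x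
  proof (rule has_field_derivative_transform_within_open[where S="(\<lambda>t. x + t *\<^sub>R b) -` U"])
    show "((\<lambda>t. f (x + t *\<^sub>R b)) has_real_derivative pd b f x) (at 0)" by (rule C1_onD(1)[OF assms(2) that])
    show "open ((\<lambda>t. x + t *\<^sub>R b) -` U)" by (intro open_vimage assms continuous_intros)
  qed (use that assms(3) in auto)
  have "continuous_on U g"
    by (rule continuous_on_eq[of U f]) (use assms in \<open>auto simp: C1_on_def\<close>)
  then show "C1_on U g"
    by (rule C1_onI[where D="\<lambda>b. pd b f"]) (use d C1_onD(2)[OF assms(2)] in blast)+
  show "pd b g x = pd b f x" if "b \<in> Basis" "x \<in> U" for b x
    by (rule pd_eqI[OF d[OF that]])
qed

lemma C1_on_lincomb:
  assumes "C1_on U f" "C1_on U g"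
  shows "C1_on U (\<lambda>x. a * f x + b * g x)"
    and "\<And>c x. c \<in> Basis \<Longrightarrow> x \<in> U \<Longrightarrow> pd c (\<lambda>x. a * f x + b * g x) x = a * pd c f x + b * pd c g x"
proof -
  have d: "((\<lambda>t. a * f (x + t *\<^sub>R c) + b * g (x + t *\<^sub>R c)) has_real_derivative a * pd c f x + b * pd c g x) (at 0)"
    if "c \<in> Basis" "x \<in> U" for c x
    by (intro DERIV_add DERIV_cmult C1_onD(1)[OF assms(1) that] C1_onD(1)[OF assms(2) that])
  show "C1_on U (\<lambda>x. a * f x + b * g x)"
  proof (rule C1_onI[where D="\<lambda>c x. a * pd c f x + b * pd c g x"])
    show "continuous_on U (\<lambda>x. a * f x + b * g x)"
      using assms by (intro continuous_intros) (auto simp: C1_on_def)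
    show "continuous_on U (\<lambda>x. a * pd c f x + b * pd c g x)" if "c \<in> Basis" for c
      by (intro continuous_intros C1_onD(2)[OF assms(1) that] C1_onD(2)[OF assms(2) that])
  qed (rule d)
  show "pd c (\<lambda>x. a * f x + b * g x) x = a * pd c f x + b * pd c g x" if "c \<in> Basis" "x \<in> U" for c x
    by (rule pd_eqI[OF d[OF that]])
qed

lemma C2_on_lincomb:
  assumes U: "open U" and f: "C2_on U f" and g: "C2_on U g"
  shows "C2_on U (\<lambda>x. a * f x + b * g x)"
    and "x \<in> U \<Longrightarrow> laplacian (\<lambda>x. a * f x + b * g x) x = a * laplacian f x + b * laplacian g x"
proof -
  note fg = C2_on_imp_C1_on[OF f] C2_on_imp_C1_on[OF g]
  have eq: "a * pd c f x + b * pd c g x = pd c (\<lambda>x. a * f x + b * g x) x" if "c \<in> Basis" "x \<in> U" for c x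
    using C1_on_lincomb(2)[OF fg that] by simp
  note l = C1_on_lincomb[OF C2_on_imp_C1_on_pd[OF f] C2_on_imp_C1_on_pd[OF g]]
  show "C2_on U (\<lambda>x. a * f x + b * g x)"
  proof (rule C2_onI[OF C1_on_lincomb(1)[OF fg]])
    fix c :: "real^3" assume c: "c \<in> Basis"
    show "C1_on U (pd c (\<lambda>x. a * f x + b * g x))"
      by (rule C1_on_transform(1)[OF U l(1)[OF c c] eq[OF c]])
  qed
  assume x: "x \<in> U"
  have "pd c (pd c (\<lambda>x. a * f x + b * g x)) x = a * pd c (pd c f) x + b * pd c (pd c g) x" if c: "c \<in> Basis" for c
    using C1_on_transform(2)[OF U l(1)[OF c c] eq[OF c] c x] l(2)[OF c c c x] by simp
  then show "laplacian (\<lambda>x. a * f x + b * g x) x = a * laplacian f x + b * laplacian g x"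
    by (simp add: laplacian_def sum.distrib sum_distrib_left)
qed

lemma hext_lincomb: "hext (\<lambda>x. a * f x + b * g x) = (\<lambda>x. a * hext f x + b * hext g x)"
  by (simp add: hext_def fun_eq_iff)

lemma laplace_beltrami_lincomb:
  assumes f: "C2_on (- {0}) (hext f)" and g: "C2_on (- {0}) (hext g)"
  shows "C2_on (- {0}) (hext (\<lambda>x. a * f x + b * g x))"
    and "x \<in> S2 \<Longrightarrow> laplace_beltrami (\<lambda>x. a * f x + b * g x) x = a * laplace_beltrami f x + b * laplace_beltrami g x"
proof -
  have U: "open (- {0::real^3})" by (simp add: open_Compl)
  show "C2_on (- {0}) (hext (\<lambda>x. a * f x + b * g x))"
    unfolding hext_lincomb by (rule C2_on_lincomb(1)[OF U f g])
  show "x \<in> S2 \<Longrightarrow> laplace_beltrami (\<lambda>x. a * f x + b * g x) x = a * laplace_beltrami f x + b * laplace_beltrami g x"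
    unfolding hext_lincomb laplace_beltrami_def by (rule C2_on_lincomb(2)[OF U f g]) auto
qed

lemma laplace_beltrami_sum:
  assumes "finite I" "\<And>k. k \<in> I \<Longrightarrow> C2_on (- {0}) (hext (F k))"
  shows "C2_on (- {0}) (hext (\<lambda>x. \<Sum>k\<in>I. a k * F k x)) \<and>
    (\<forall>x\<in>S2. laplace_beltrami (\<lambda>x. \<Sum>k\<in>I. a k * F k x) x = (\<Sum>k\<in>I. a k * laplace_beltrami (F k) x))"
  using assms
proof (induction I rule: finite_induct)
  case empty
  \<comment> \<open>The zero function is presented as a trivial combination of \<open>zon\<close>
    powers, from which it inherits smoothness.\<close>
  let ?z = "\<lambda>x. 0 * zon (axis 1 1) x ^ 0 + 0 * zon (axis 1 1) x ^ 0"
  have "?z = (\<lambda>x. 0)" by simp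
  then show ?case 
    using laplace_beltrami_lincomb[OF C2_on_zon_power[of "axis 1 1" 0] C2_on_zon_power[of "axis 1 1" 0], where a=0 and b=0]
    by simp
next
  case (insert k I)
  have e: "(\<lambda>x. \<Sum>k\<in>insert k I. a k * F k x) = (\<lambda>x. a k * F k x + 1 * (\<Sum>k\<in>I. a k * F k x))"
    using insert by simp
  show ?case unfolding e
    using laplace_beltrami_lincomb[where f="F k" and g="\<lambda>x. \<Sum>k\<in>I. a k * F k x" and a="a k" and b=1] insert by auto
qed

lemma eigfun_sum:
  assumes "finite I" "\<And>k. k \<in> I \<Longrightarrow> eigfun (F k) l"
  shows "eigfun (\<lambda>x. \<Sum>k\<in>I. a k * F k x) l"
  using laplace_beltrami_sum[of I F a] assms eigfunD[OF assms(2)]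
  by (auto simp: eigfun_def sum_distrib_left sum_negf[symmetric] intro!: sum.cong)

lemma eigfun_lincomb:
  assumes "eigfun f l" "eigfun g l"
  shows "eigfun (\<lambda>x. a * f x + b * g x) l"
  unfolding eigfun_def
proof (intro conjI ballI)
  have c: "C2_on (- {0}) (hext f)" "C2_on (- {0}) (hext g)" using assms by (simp_all add: eigfun_def)
  show "C2_on (- {0}) (hext (\<lambda>x. a * f x + b * g x))" by (rule laplace_beltrami_lincomb(1)[OF c])
  fix x :: "real^3" assume x: "x \<in> S2"
  show "- laplace_beltrami (\<lambda>x. a * f x + b * g x) x = l * (a * f x + b * g x)"
    unfolding laplace_beltrami_lincomb(2)[OF c x] eigfunD[OF assms(1) x] eigfunD[OF assms(2) x]
    by (simp add: distrib_left mult.left_commute)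
qed

text \<open>The eigenvalue belonging to spherical harmonics of degree \<open>n\<close>.\<close>

definition ev :: "nat \<Rightarrow> real" where "ev n = real n * (real n + 1)"

lemma ev_strict_mono: "m < n \<Longrightarrow> ev m < ev n"
  unfolding ev_def by (intro mult_strict_mono) auto

lemma ev_inj: "ev m = ev n \<longleftrightarrow> m = n"
  by (metis ev_strict_mono less_irrefl linorder_neqE_nat)

text \<open>\<open>zon p ^ M\<close> minus suitable multiples of the components of \<open>zon p ^ (M - 1)\<close> is an eigenfunction.\<close>

lemma zon_power_eigen_decomposition:
  assumes p: "p \<in> S2"
  shows "\<exists>F. (\<forall>n\<le>N. eigfun (F n) (ev n)) \<and> (\<forall>x\<in>S2. zon p x ^ N = (\<Sum>n\<le>N. F n x))"
proof (induction N)
  case 0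
  have "eigfun (\<lambda>x. zon p x ^ 0) (ev 0)"
    unfolding eigfun_def
  proof (intro conjI ballI)
    show "- laplace_beltrami (\<lambda>x. zon p x ^ 0) x = ev 0 * zon p x ^ 0" if "x \<in> S2" for x
      unfolding laplace_beltrami_zon_power[OF p that] by (simp add: ev_def)
  qed (rule C2_on_zon_power)
  then show ?case by (intro exI[of _ "\<lambda>n x. zon p x ^ 0"]) auto
next
  case (Suc N)
  then obtain F where F: "\<And>n. n \<le> N \<Longrightarrow> eigfun (F n) (ev n)" "\<And>x. x \<in> S2 \<Longrightarrow> zon p x ^ N = (\<Sum>n\<le>N. F n x)"
    by blast
  \<comment> \<open>The operator \<open>- laplace_beltrami - ev (Suc N)\<close> maps
    \<open>zon p ^ Suc N\<close> to \<open>- (real (Suc N))\<^sup>2\<close> times the sum of the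
    \<open>F n\<close>, and \<open>F n\<close> to \<open>(ev n - ev (Suc N)) * F n\<close>. With
    these coefficients it annihilates the difference \<open>G\<close>.\<close>
  define c where "c n = (real (Suc N))\<^sup>2 / (ev (Suc N) - ev n)" for n
  have c: "(ev (Suc N) - ev n) * c n = (real (Suc N))\<^sup>2" if "n \<le> N" for n
    using ev_strict_mono[of n "Suc N"] that by (simp add: c_def)
  define S where "S x = (\<Sum>n\<le>N. c n * F n x)" for x
  define G where "G x = 1 * zon p x ^ Suc N + (- 1) * S x" for x
  have S: "C2_on (- {0}) (hext S)" "\<And>x. x \<in> S2 \<Longrightarrow> laplace_beltrami S x = (\<Sum>n\<le>N. c n * laplace_beltrami (F n) x)"
    using laplace_beltrami_sum[of "{..N}" F c] F(1) unfolding S_def[abs_def] by (auto simp: eigfun_def)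
  have G: "eigfun G (ev (Suc N))"
    unfolding eigfun_def
  proof (intro conjI ballI)
    show "C2_on (- {0}) (hext G)"
      unfolding G_def[abs_def] by (rule laplace_beltrami_lincomb(1)[OF C2_on_zon_power S(1)])
    fix x :: "real^3" assume x: "x \<in> S2"
    have "laplace_beltrami G x = laplace_beltrami (\<lambda>x. zon p x ^ Suc N) x - laplace_beltrami S x"
      using laplace_beltrami_lincomb(2)[OF C2_on_zon_power S(1) x, of 1 p "Suc N" "- 1"]
      unfolding G_def[abs_def] by simp
    also have "laplace_beltrami S x = (\<Sum>n\<le>N. - (ev n * (c n * F n x)))"
      unfolding S(2)[OF x] by (rule sum.cong[OF refl]) (simp add: eigfunD[OF F(1) x])
    also have "laplace_beltrami (\<lambda>x. zon p x ^ Suc N) x = (real (Suc N))\<^sup>2 * (\<Sum>n\<le>N. F n x) - ev (Suc N) * zon p x ^ Suc N"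
      unfolding laplace_beltrami_zon_power[OF p x] F(2)[OF x, symmetric] by (simp add: ev_def)
    also have "(real (Suc N))\<^sup>2 * (\<Sum>n\<le>N. F n x) = (\<Sum>n\<le>N. (ev (Suc N) - ev n) * c n * F n x)"
      unfolding sum_distrib_left by (rule sum.cong[OF refl]) (simp add: c)
    finally have "laplace_beltrami G x = (\<Sum>n\<le>N. (ev (Suc N) - ev n) * c n * F n x) - ev (Suc N) * zon p x ^ Suc N
       - (\<Sum>n\<le>N. - (ev n * (c n * F n x)))" .
    also have "\<dots> = (\<Sum>n\<le>N. ev (Suc N) * (c n * F n x)) - ev (Suc N) * zon p x ^ Suc N"
      unfolding sum_negf by (simp add: left_diff_distrib sum_subtractf mult.assoc)
    also have "\<dots> = - (ev (Suc N) * G x)"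
      unfolding G_def S_def sum_distrib_left[symmetric] by (simp add: right_diff_distrib)
    finally show "- laplace_beltrami G x = ev (Suc N) * G x" by simp
  qed
  define H where "H n x = (if n = Suc N then G x else \<Sum>k\<in>{n}. c k * F k x)" for n x
  have "eigfun (H n) (ev n)" if "n \<le> Suc N" for n
  proof (cases "n = Suc N")
    case True
    then show ?thesis using G by (simp add: H_def[abs_def])
  next
    case False
    then have "H n = (\<lambda>x. \<Sum>k\<in>{n}. c k * F k x)" by (simp add: H_def fun_eq_iff)
    then show ?thesis using eigfun_sum[of "{n}" F "ev n" c] F(1)[of n] False that by simp
  qed
  moreover have "zon p x ^ Suc N = (\<Sum>n\<le>Suc N. H n x)" for x
    by (simp add: H_def G_def S_def del: power_Suc)
  ultimately show ?case by blast
qed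

section \<open>Completeness of the eigenfunctions in the square integrable functions\<close>

lemma L2_S2_integrable:
  assumes "f \<in> L2_S2"
  shows "integrable sigma_S2 f"
proof (rule Bochner_Integration.integrable_bound[of _ "\<lambda>x. 1 + (f x)\<^sup>2"])
  show "integrable sigma_S2 (\<lambda>x. 1 + (f x)\<^sup>2)" using assms by (simp add: L2_S2_def)
  show "f \<in> borel_measurable sigma_S2"
    using assms by (simp add: L2_S2_def measurable_cong_sets[OF sets_sigma_S2 refl])
  have "\<bar>a\<bar> \<le> 1 + a\<^sup>2" for a :: real
  proof -
    have "2 * \<bar>a\<bar> \<le> 1 + a\<^sup>2" using zero_le_power2[of "\<bar>a\<bar> - 1"] by (simp add: power2_diff)
    then show ?thesis using abs_ge_zero[of a] by linarith
  qed
  then show "AE x in sigma_S2. norm (f x) \<le> norm (1 + (f x)\<^sup>2)" by (intro AE_I2) simp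
qed

lemma continuous_in_L2_S2: "continuous_on S2 f \<Longrightarrow> f \<in> L2_S2"
  unfolding L2_S2_def
  by (auto intro!: borel_measurable_continuous_on_restrict sigma_integrable continuous_intros)

lemma integrable_mult_continuous:
  assumes f: "integrable sigma_S2 f" and g: "continuous_on S2 g"
  shows "integrable sigma_S2 (\<lambda>x. f x * g x :: real)"
proof -
  obtain B where B: "\<And>x. x \<in> S2 \<Longrightarrow> norm (g x) \<le> B" using continuous_on_S2_bounded[OF g] by metis
  show ?thesis
  proof (rule Bochner_Integration.integrable_bound[of _ "\<lambda>x. B * f x"])
    show "integrable sigma_S2 (\<lambda>x. B * f x)" using f by simp
    show "(\<lambda>x. f x * g x) \<in> borel_measurable sigma_S2"
      by (rule borel_measurable_times[OF borel_measurable_integrable[OF f] borel_measurable_integrable[OF sigma_integrable[OF g]]])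
    show "AE x in sigma_S2. norm (f x * g x) \<le> norm (B * f x)"
    proof (rule AE_I2)
      fix x assume "x \<in> space sigma_S2"
      then have "\<bar>g x\<bar> \<le> \<bar>B\<bar>" using B[of x] by simp
      then have "\<bar>f x\<bar> * \<bar>g x\<bar> \<le> \<bar>f x\<bar> * \<bar>B\<bar>" by (rule mult_left_mono) simp
      then show "norm (f x * g x) \<le> norm (B * f x)" by (simp add: abs_mult mult.commute)
    qed
  qed
qed

lemma zon_measurable_pair:
  assumes "sets M = sets S2_borel"
  shows "(\<lambda>(x, y). zon x y) \<in> borel_measurable (M \<Otimes>\<^sub>M sigma_S2)"
proof -
  have i1: "(\<lambda>x. x) \<in> M \<rightarrow>\<^sub>M borel"
    unfolding measurable_cong_sets[OF assms refl] by (rule measurable_restrict_space1) simp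
  have i2: "(\<lambda>x. x) \<in> sigma_S2 \<rightarrow>\<^sub>M borel"
    unfolding measurable_cong_sets[OF sets_sigma_S2 refl] by (rule measurable_restrict_space1) simp
  have "(\<lambda>p. fst p) \<in> M \<Otimes>\<^sub>M sigma_S2 \<rightarrow>\<^sub>M borel" "(\<lambda>p. snd p) \<in> M \<Otimes>\<^sub>M sigma_S2 \<rightarrow>\<^sub>M borel"
    using measurable_compose[OF measurable_fst i1] measurable_compose[OF measurable_snd i2] by auto
  then show ?thesis unfolding zon_def split_beta' by measurable
qed

text \<open>The kernel is symmetric in its two points. Fubini applies to a merely integrable
  \<open>f\<close> because the kernel and \<open>g\<close> are bounded.\<close>

lemma zavg_symmetric:
  assumes f: "integrable sigma_S2 f" and g: "continuous_on S2 g"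
  shows "inner_L2 f (zavg N g) = inner_L2 (zavg N f) g"
proof -
  interpret pair_sigma_finite sigma_S2 sigma_S2 ..
  define h where "h x y = f x * ((real N + 1) * zon x y ^ N * g y)" for x y
  obtain B where B: "B > 0" "\<And>x. x \<in> S2 \<Longrightarrow> norm (g x) \<le> B" using continuous_on_S2_bounded[OF g] by metis
  have meas: "case_prod h \<in> borel_measurable (sigma_S2 \<Otimes>\<^sub>M sigma_S2)"
  proof -
    have [measurable]: "f \<in> borel_measurable sigma_S2" "g \<in> borel_measurable sigma_S2"
      using f sigma_integrable[OF g] by auto
    note zon_measurable_pair[OF sets_sigma_S2, measurable]
    have "(\<lambda>p. f (fst p) * ((real N + 1) * (\<lambda>(x, y). zon x y) p ^ N * g (snd p))) \<in> borel_measurable (sigma_S2 \<Otimes>\<^sub>M sigma_S2)"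
      by measurable
    then show ?thesis by (simp add: h_def split_beta')
  qed
  have hy: "integrable sigma_S2 (\<lambda>y. h x y)" for x
    unfolding h_def by (intro sigma_integrable continuous_intros g)
  have bd: "norm (h x y) \<le> (real N + 1) * B * \<bar>f x\<bar>" if "x \<in> S2" "y \<in> S2" for x y
  proof -
    have "zon x y ^ N \<le> 1" using zon_nonneg[OF that] zon_le_1[OF that] by (rule power_le_one)
    then have "zon x y ^ N * \<bar>g y\<bar> \<le> 1 * B" using B(2)[OF that(2)] B(1) zon_nonneg[OF that] by (intro mult_mono) auto
    then have "(real N + 1) * \<bar>f x\<bar> * (zon x y ^ N * \<bar>g y\<bar>) \<le> (real N + 1) * \<bar>f x\<bar> * (1 * B)"
      by (rule mult_left_mono) simp
    then show ?thesis using zon_nonneg[OF that] by (simp add: h_def abs_mult ac_simps)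
  qed
  have int: "integrable (sigma_S2 \<Otimes>\<^sub>M sigma_S2) (case_prod h)"
  proof (rule Fubini_integrable[OF meas])
    show "AE x in sigma_S2. integrable sigma_S2 (\<lambda>y. case_prod h (x, y))" using hy by simp
    show "integrable sigma_S2 (\<lambda>x. \<integral>y. norm (case_prod h (x, y)) \<partial>sigma_S2)"
    proof (rule Bochner_Integration.integrable_bound[of _ "\<lambda>x. (real N + 1) * B * \<bar>f x\<bar>"])
      show "integrable sigma_S2 (\<lambda>x. (real N + 1) * B * \<bar>f x\<bar>)" using f by simp
      show "(\<lambda>x. \<integral>y. norm (case_prod h (x, y)) \<partial>sigma_S2) \<in> borel_measurable sigma_S2"
        using meas by (intro sigma.borel_measurable_lebesgue_integral) (simp add: split_beta')
      show "AE x in sigma_S2. norm (\<integral>y. norm (case_prod h (x, y)) \<partial>sigma_S2) \<le> norm ((real N + 1) * B * \<bar>f x\<bar>)"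
      proof (rule AE_I2)
        fix x assume "x \<in> space sigma_S2"
        then have x: "x \<in> S2" by simp
        have "(\<integral>y. norm (h x y) \<partial>sigma_S2) \<le> (\<integral>y. (real N + 1) * B * \<bar>f x\<bar> \<partial>sigma_S2)"
          by (rule integral_mono) (use hy bd[OF x] in auto)
        moreover have "0 \<le> (\<integral>y. norm (h x y) \<partial>sigma_S2)" by (rule Bochner_Integration.integral_nonneg) simp
        ultimately show "norm (\<integral>y. norm (case_prod h (x, y)) \<partial>sigma_S2) \<le> norm ((real N + 1) * B * \<bar>f x\<bar>)"
          by simp
      qed
    qed
  qed
  have "inner_L2 f (zavg N g) = (\<integral>x. (\<integral>y. h x y \<partial>sigma_S2) \<partial>sigma_S2)"
    unfolding inner_L2_def zavg_def h_def by (simp only: integral_mult_right_zero)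
  also have "\<dots> = (\<integral>y. (\<integral>x. h x y \<partial>sigma_S2) \<partial>sigma_S2)" by (rule Fubini_integral[OF int, symmetric])
  also have "\<dots> = (\<integral>y. (\<integral>x. (real N + 1) * zon y x ^ N * f x \<partial>sigma_S2) * g y \<partial>sigma_S2)"
  proof (rule Bochner_Integration.integral_cong[OF refl])
    fix y
    have "(\<lambda>x. h x y) = (\<lambda>x. ((real N + 1) * zon y x ^ N * f x) * g y)"
      by (simp add: h_def zon_commute[of y] ac_simps)
    then show "(\<integral>x. h x y \<partial>sigma_S2) = (\<integral>x. (real N + 1) * zon y x ^ N * f x \<partial>sigma_S2) * g y"
      by (simp only: integral_mult_left_zero)
  qed
  also have "\<dots> = inner_L2 (zavg N f) g" by (simp only: inner_L2_def zavg_def)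
  finally show ?thesis .
qed

lemma zavg_measurable:
  assumes g: "continuous_on S2 g" and M: "sets M = sets S2_borel"
  shows "zavg N g \<in> borel_measurable M"
  unfolding zavg_def[abs_def]
proof (rule sigma.borel_measurable_lebesgue_integral)
  have [measurable]: "g \<in> borel_measurable sigma_S2" using sigma_integrable[OF g] by auto
  note zon_measurable_pair[OF M, measurable]
  have "(\<lambda>p. (real N + 1) * (\<lambda>(x, y). zon x y) p ^ N * g (snd p)) \<in> borel_measurable (M \<Otimes>\<^sub>M sigma_S2)"
    by measurable
  then show "(\<lambda>(x, y). (real N + 1) * zon x y ^ N * g y) \<in> borel_measurable (M \<Otimes>\<^sub>M sigma_S2)"
    by (simp add: split_beta')
qed

text \<open>Closed sets generate the Borel sets and are stable under intersection, and the indicator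
  of a closed set is a bounded limit of continuous functions. So \<open>f\<close> has integral zero
  over every Borel set.\<close>

lemma orthogonal_to_continuous_imp_AE_0:
  assumes f: "integrable sigma_S2 f" and o: "\<And>g. continuous_on S2 g \<Longrightarrow> inner_L2 f g = 0"
  shows "AE x in sigma_S2. f x = 0"
proof (rule sigma.density_zero[OF f])
  fix A assume "A \<in> sets sigma_S2"
  then have "A \<in> sets S2_borel" by simp
  then obtain B where B: "B \<in> sets borel" "A = S2 \<inter> B" by (auto simp: sets_restrict_space)
  have m: "f \<in> borel_measurable sigma_S2" using f by simp
  have im: "indicat_real C \<in> borel_measurable sigma_S2" if "C \<in> sets borel" for C
  proof -
    have "indicat_real C \<in> borel_measurable borel" by (rule borel_measurable_indicator[OF that])
    then have "indicat_real C \<in> borel_measurable S2_borel" by (rule measurable_restrict_space1)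
    then show ?thesis unfolding measurable_cong_sets[OF sets_sigma_S2 refl] .
  qed
  have fm: "(\<lambda>x. f x * indicat_real C x) \<in> borel_measurable sigma_S2" if "C \<in> sets borel" for C
    by (rule borel_measurable_times[OF m im[OF that]])
  have fi: "integrable sigma_S2 (\<lambda>x. f x * indicat_real C x)" if "C \<in> sets borel" for C
    by (rule Bochner_Integration.integrable_bound[OF f fm[OF that]]) (simp add: indicator_def)
  have nf: "integrable sigma_S2 (\<lambda>x. \<bar>f x\<bar>)" using f by simp
  have "Int_stable (Collect closed)" "Collect closed \<subseteq> Pow UNIV" "B \<in> sigma_sets UNIV (Collect closed)"
    using B(1) by (auto simp: Int_stable_def borel_eq_closed)
  then have "(\<integral>x. f x * indicat_real B x \<partial>sigma_S2) = 0"
  proof (induct B rule: sigma_sets_induct_disjoint)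
    case (basic C)
    then have C: "closed C" by simp
    show ?case
    \<comment> \<open>\<open>infdist x {}\<close> is \<open>0\<close>, so for the empty set the
      functions \<open>g n\<close> below would be constantly one.\<close>
    proof (cases "C = {}")
      case False
      define g where "g n x = max 0 (1 - real n * infdist x C)" for n and x :: "real^3"
      have g: "continuous_on S2 (g n)" for n
        unfolding g_def by (intro continuous_intros)
      have "(\<lambda>n. \<integral>x. f x * g n x \<partial>sigma_S2) \<longlonglongrightarrow> (\<integral>x. f x * indicat_real C x \<partial>sigma_S2)"
      proof (rule integral_dominated_convergence[OF _ _ nf])
        show "(\<lambda>x. f x * indicat_real C x) \<in> borel_measurable sigma_S2" using C by (intro fm) simp
        show "(\<lambda>x. f x * g n x) \<in> borel_measurable sigma_S2" for n
          by (rule borel_measurable_integrable[OF integrable_mult_continuous[OF f g]])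
        show "AE x in sigma_S2. norm (f x * g n x) \<le> \<bar>f x\<bar>" for n
          unfolding g_def by (intro AE_I2) (simp add: abs_mult mult_left_le infdist_nonneg)
        show "AE x in sigma_S2. (\<lambda>n. f x * g n x) \<longlonglongrightarrow> f x * indicat_real C x"
        proof (rule AE_I2)
          fix x :: "real^3"
          show "(\<lambda>n. f x * g n x) \<longlonglongrightarrow> f x * indicat_real C x"
          proof (cases "x \<in> C")
            case True
            then show ?thesis by (simp add: g_def)
          next
            case out: False
            then have pos: "infdist x C > 0"
              using in_closed_iff_infdist_zero[OF C False] infdist_nonneg[of x C] by (metis less_eq_real_def)
            obtain n0 :: nat where n0: "1 / infdist x C < real n0" using reals_Archimedean2 by blast
            have "f x * g n x = f x * indicat_real C x" if "n \<ge> n0" for n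
            proof -
              have "1 / infdist x C \<le> real n" using n0 that by linarith
              then have "1 \<le> real n * infdist x C" using pos by (simp add: pos_divide_le_eq)
              then show ?thesis using out by (simp add: g_def)
            qed
            then have "\<forall>\<^sub>F n in sequentially. f x * g n x = f x * indicat_real C x"
              unfolding eventually_sequentially by blast
            then show ?thesis by (rule tendsto_eventually)
          qed
        qed
      qed
      moreover have "(\<integral>x. f x * g n x \<partial>sigma_S2) = 0" for n
        using o[OF g] by (simp add: inner_L2_def)
      ultimately show ?thesis by (simp add: tendsto_const_iff)
    qed simp
  next
    case empty
    then show ?case by simp
  next
    case (compl C)
    then have C: "C \<in> sets borel" by (simp add: borel_eq_closed)
    have "(\<integral>x. f x * indicat_real (UNIV - C) x \<partial>sigma_S2) = (\<integral>x. f x * 1 - f x * indicat_real C x \<partial>sigma_S2)"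
      by (rule Bochner_Integration.integral_cong) (simp_all add: indicator_def)
    also have "\<dots> = (\<integral>x. f x * 1 \<partial>sigma_S2) - (\<integral>x. f x * indicat_real C x \<partial>sigma_S2)"
      using f fi[OF C] by (intro Bochner_Integration.integral_diff) simp_all
    also have "\<dots> = 0" using compl(2) o[OF continuous_on_const, of 1] by (simp add: inner_L2_def)
    finally show ?case .
  next
    case (union C)
    then have Cb: "C i \<in> sets borel" for i by (auto simp: borel_eq_closed)
    have "(\<lambda>n. \<integral>x. (\<Sum>i<n. f x * indicat_real (C i) x) \<partial>sigma_S2) \<longlonglongrightarrow> (\<integral>x. f x * indicat_real (\<Union>i. C i) x \<partial>sigma_S2)"
    proof (rule integral_dominated_convergence[OF _ _ nf])
      show "(\<lambda>x. f x * indicat_real (\<Union>i. C i) x) \<in> borel_measurable sigma_S2" using Cb by (intro fm) auto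
      show "(\<lambda>x. \<Sum>i<n. f x * indicat_real (C i) x) \<in> borel_measurable sigma_S2" for n
        by (intro borel_measurable_sum fm Cb)
      have s: "(\<lambda>i. indicat_real (C i) x) sums indicat_real (\<Union>i. C i) x" for x
        using union(1) by (intro indicator_sums) (auto simp: disjoint_family_on_def)
      show "AE x in sigma_S2. (\<lambda>n. \<Sum>i<n. f x * indicat_real (C i) x) \<longlonglongrightarrow> f x * indicat_real (\<Union>i. C i) x"
        using sums_mult[OF s] by (intro AE_I2) (simp add: sums_def)
      show "AE x in sigma_S2. norm (\<Sum>i<n. f x * indicat_real (C i) x) \<le> \<bar>f x\<bar>" for n
      proof (rule AE_I2)
        fix x :: "real^3"
        have "(\<Sum>i<n. indicat_real (C i) x) \<le> (\<Sum>i. indicat_real (C i) x)"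
          by (rule sum_le_suminf) (use s[of x] in \<open>auto simp: sums_iff\<close>)
        also have "\<dots> \<le> 1" using s[of x] by (simp add: sums_iff indicator_def)
        finally have "\<bar>\<Sum>i<n. indicat_real (C i) x\<bar> \<le> 1" by (simp add: sum_nonneg)
        then have "\<bar>f x\<bar> * \<bar>\<Sum>i<n. indicat_real (C i) x\<bar> \<le> \<bar>f x\<bar> * 1" by (rule mult_left_mono) simp
        then show "norm (\<Sum>i<n. f x * indicat_real (C i) x) \<le> \<bar>f x\<bar>"
          by (simp add: sum_distrib_left[symmetric] abs_mult)
      qed
    qed
    moreover have "(\<integral>x. (\<Sum>i<n. f x * indicat_real (C i) x) \<partial>sigma_S2) = 0" for n
      using union(3) fi[OF Cb] by (subst Bochner_Integration.integral_sum) simp_all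
    ultimately show ?case by (simp add: tendsto_const_iff)
  qed
  moreover have "set_lebesgue_integral sigma_S2 A f = (\<integral>x. f x * indicat_real B x \<partial>sigma_S2)"
    unfolding set_lebesgue_integral_def B(2) by (rule Bochner_Integration.integral_cong) (auto simp: indicator_def)
  ultimately show "set_lebesgue_integral sigma_S2 A f = 0" by simp
qed

text \<open>Powers of \<open>zon x\<close> are sums of eigenfunctions, so all averages of
  \<open>f\<close> vanish. By symmetry \<open>f\<close> is orthogonal to every average of a
  continuous \<open>g\<close>, and these averages converge boundedly to \<open>g\<close>.\<close>

lemma orthogonal_to_eigfuns_imp_AE_0:
  assumes f: "f \<in> L2_S2" and o: "\<And>n \<phi>. eigfun \<phi> (ev n) \<Longrightarrow> inner_L2 f \<phi> = 0"
  shows "AE x in sigma_S2. f x = 0"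
proof (rule orthogonal_to_continuous_imp_AE_0)
  show fi: "integrable sigma_S2 f" by (rule L2_S2_integrable[OF f])
  have z: "zavg N f x = 0" if x: "x \<in> S2" for N x
  proof -
    obtain F where F: "\<And>n. n \<le> N \<Longrightarrow> eigfun (F n) (ev n)" "\<And>y. y \<in> S2 \<Longrightarrow> zon x y ^ N = (\<Sum>n\<le>N. F n y)"
      using zon_power_eigen_decomposition[OF x, of N] by blast
    have "zavg N f x = inner_L2 (\<lambda>y. \<Sum>n\<in>{..N}. (real N + 1) * F n y) f"
      unfolding zavg_def inner_L2_def
      by (rule Bochner_Integration.integral_cong) (simp_all add: F(2) sum_distrib_left)
    also have "\<dots> = (\<Sum>n\<in>{..N}. (real N + 1) * inner_L2 (F n) f)"
    proof (rule inner_L2_sum_left)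
      fix n assume "n \<in> {..N}"
      then have "continuous_on S2 (F n)" using eigfun_continuous[OF F(1)] by simp
      from integrable_mult_continuous[OF fi this]
      show "integrable sigma_S2 (\<lambda>y. F n y * f y)" by (simp add: mult.commute)
    qed
    also have "\<dots> = 0" using o[OF F(1)] by (simp add: inner_L2_commute[of _ f])
    finally show ?thesis .
  qed
  fix g :: "real^3 \<Rightarrow> real" assume g: "continuous_on S2 g"
  obtain B where B: "B > 0" "\<And>x. x \<in> S2 \<Longrightarrow> norm (g x) \<le> B" using continuous_on_S2_bounded[OF g] by metis
  have "(\<lambda>N. \<integral>x. f x * zavg N g x \<partial>sigma_S2) \<longlonglongrightarrow> (\<integral>x. f x * g x \<partial>sigma_S2)"
  proof (rule integral_dominated_convergence)
    show "(\<lambda>x. f x * g x) \<in> borel_measurable sigma_S2"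
      by (rule borel_measurable_integrable[OF integrable_mult_continuous[OF fi g]])
    show "(\<lambda>x. f x * zavg N g x) \<in> borel_measurable sigma_S2" for N
      by (rule borel_measurable_times[OF borel_measurable_integrable[OF fi] zavg_measurable[OF g sets_sigma_S2]])
    show "integrable sigma_S2 (\<lambda>x. \<bar>f x\<bar> * B)" using fi by simp
    show "AE x in sigma_S2. (\<lambda>N. f x * zavg N g x) \<longlonglongrightarrow> f x * g x"
      by (intro AE_I2 tendsto_mult tendsto_const zavg_tendsto[OF g]) simp
    show "AE x in sigma_S2. norm (f x * zavg N g x) \<le> \<bar>f x\<bar> * B" for N
    proof (rule AE_I2)
      fix x assume "x \<in> space sigma_S2"
      then have "\<bar>zavg N g x\<bar> \<le> B" using abs_zavg_le[OF g, of x B N] B(2) by simp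
      then show "norm (f x * zavg N g x) \<le> \<bar>f x\<bar> * B" by (simp add: abs_mult mult_left_mono)
    qed
  qed
  moreover have "(\<integral>x. f x * zavg N g x \<partial>sigma_S2) = 0" for N
  proof -
    have "inner_L2 f (zavg N g) = inner_L2 (zavg N f) g" by (rule zavg_symmetric[OF fi g])
    also have "\<dots> = inner_L2 (\<lambda>x. 0) g" by (rule inner_L2_cong) (simp_all add: z)
    finally show ?thesis by (simp add: inner_L2_def)
  qed
  ultimately show "inner_L2 f g = 0" by (simp add: inner_L2_def tendsto_const_iff)
qed

text \<open>The local Weyl bound limits the size of orthonormal sets with a given eigenvalue, so one
  of greatest size exists. A member of the eigenspace orthogonal to it has norm zero, since its
  normalisation could otherwise be added.\<close>

lemma maximal_orthonormal_eigfuns: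
  "\<exists>M. (\<forall>\<phi>\<in>M. eigfun \<phi> (ev n)) \<and> onf M (\<lambda>\<phi>. \<phi>) \<and>
     (\<forall>g. eigfun g (ev n) \<longrightarrow> (\<forall>\<phi>\<in>M. inner_L2 g \<phi> = 0) \<longrightarrow> inner_L2 g g = 0)"
proof -
  obtain N :: nat where N: "2 * ev n \<le> real N" using real_arch_simple by blast
  let ?P = "\<lambda>M. (\<forall>\<phi>\<in>M. eigfun \<phi> (ev n)) \<and> onf M (\<lambda>\<phi>. \<phi>)"
  have "?P {}" by (simp add: onf_def)
  moreover have "\<forall>M. ?P M \<longrightarrow> card M < 4 * (N + 1) + 1"
  proof (intro allI impI)
    fix M assume M: "?P M"
    have "real (card M) \<le> 4 * (real N + 1)"
      by (rule eigen_card_le[of M "\<lambda>\<phi>. \<phi>" "\<lambda>_. ev n"]) (use M in blast, use M in blast, use N in linarith)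
    then have "real (card M) \<le> real (4 * (N + 1))" by simp
    then show "card M < 4 * (N + 1) + 1" unfolding of_nat_le_iff by simp
  qed
  ultimately have "\<exists>M. ?P M \<and> (\<forall>M'. ?P M' \<longrightarrow> card M' \<le> card M)"
    by (rule ex_has_greatest_nat)
  then obtain M where M: "\<forall>\<phi>\<in>M. eigfun \<phi> (ev n)" "onf M (\<lambda>\<phi>. \<phi>)"
    and max: "\<forall>M'. ?P M' \<longrightarrow> card M' \<le> card M"
    by (elim exE conjE)
  have "inner_L2 g g = 0" if g: "eigfun g (ev n)" and o: "\<And>\<phi>. \<phi> \<in> M \<Longrightarrow> inner_L2 g \<phi> = 0" for g
  proof (rule ccontr)
    assume "inner_L2 g g \<noteq> 0"
    then have pos: "inner_L2 g g > 0" using inner_L2_nonneg[of g] by simp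
    define c where "c = 1 / sqrt (inner_L2 g g)"
    have c: "c * c * inner_L2 g g = 1" "c \<noteq> 0" using pos by (simp_all add: c_def)
    \<comment> \<open>The zero summand only fits the shape of \<open>eigfun_lincomb\<close>.\<close>
    define h where "h x = c * g x + 0 * g x" for x
    have h: "eigfun h (ev n)" unfolding h_def[abs_def] by (rule eigfun_lincomb[OF g g])
    have hh: "inner_L2 h h = 1"
    proof -
      have "inner_L2 h h = (\<integral>x. (c * c) * (g x * g x) \<partial>sigma_S2)"
        unfolding inner_L2_def h_def by (rule Bochner_Integration.integral_cong) (simp_all add: ac_simps)
      then show ?thesis using c by (simp add: inner_L2_def)
    qed
    have ho: "inner_L2 h \<phi> = 0" if "\<phi> \<in> M" for \<phi>
    proof -
      have "inner_L2 h \<phi> = (\<integral>x. c * (g x * \<phi> x) \<partial>sigma_S2)"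
        unfolding inner_L2_def h_def by (rule Bochner_Integration.integral_cong) (simp_all add: ac_simps)
      then show ?thesis using o[OF that] by (simp add: inner_L2_def)
    qed
    have nm: "h \<notin> M" using ho[of h] hh by auto
    have ho': "inner_L2 \<phi> h = 0" if "\<phi> \<in> M" for \<phi> using ho[OF that] by (simp only: inner_L2_commute[of \<phi> h])
    have fin: "finite M" and Mc: "\<forall>\<phi>\<in>M. continuous_on S2 \<phi>"
      and Mo: "\<And>\<phi> \<psi>. \<phi> \<in> M \<Longrightarrow> \<psi> \<in> M \<Longrightarrow> inner_L2 \<phi> \<psi> = (if \<phi> = \<psi> then 1 else 0)"
      using M(2) by (simp_all add: onf_def)
    have "onf (insert h M) (\<lambda>\<phi>. \<phi>)"
      unfolding onf_def
    proof (intro conjI ballI)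
      fix \<phi> \<psi> assume "\<phi> \<in> insert h M" "\<psi> \<in> insert h M"
      then consider "\<phi> = h" "\<psi> = h" | "\<phi> = h" "\<psi> \<in> M" | "\<phi> \<in> M" "\<psi> = h" | "\<phi> \<in> M" "\<psi> \<in> M" by blast
      then show "inner_L2 \<phi> \<psi> = (if \<phi> = \<psi> then 1 else 0)"
      proof cases
        case 1 then show ?thesis by (simp add: hh)
      next
        case 2 then have "h \<noteq> \<psi>" using nm by blast
        then show ?thesis using 2 ho[of \<psi>] by (simp only: if_False)
      next
        case 3 then have "\<phi> \<noteq> h" using nm by blast
        then show ?thesis using 3 ho'[of \<phi>] by (simp only: if_False)
      next
        case 4 then show ?thesis by (rule Mo)
      qed
    next
      fix \<phi> assume "\<phi> \<in> insert h M"
      then show "continuous_on S2 \<phi>" using Mc eigfun_continuous[OF h] by blast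
    qed (use fin in simp)
    then have "card (insert h M) \<le> card M" using max M(1) h by blast
    then show False using nm fin by simp
  qed
  with M show ?thesis by (intro exI[of _ M] conjI allI impI) blast+
qed

text \<open>Justifies the choice behind \<open>LB_phi\<close> and \<open>LB_lam\<close>. The bases
  of the eigenspaces are united and enumerated by the natural numbers; a bijective enumeration
  requires the union to be infinite.\<close>

lemma LB_eigenbasis_LB: "LB_eigenbasis LB_phi LB_lam"
proof -
  obtain Mx where Mx: "\<And>n \<phi>. \<phi> \<in> Mx n \<Longrightarrow> eigfun \<phi> (ev n)" "\<And>n. onf (Mx n) (\<lambda>\<phi>. \<phi>)"
    "\<And>n g. eigfun g (ev n) \<Longrightarrow> (\<forall>\<phi>\<in>Mx n. inner_L2 g \<phi> = 0) \<Longrightarrow> inner_L2 g g = 0"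
    using maximal_orthonormal_eigfuns by metis
  have cM: "continuous_on S2 \<phi>" if "\<phi> \<in> Mx n" for \<phi> n using eigfun_continuous[OF Mx(1)[OF that]] .
  have compl: "AE x in sigma_S2. f x = 0" if f: "f \<in> L2_S2" and o: "\<And>n \<phi>. \<phi> \<in> Mx n \<Longrightarrow> inner_L2 f \<phi> = 0" for f
  proof (rule orthogonal_to_eigfuns_imp_AE_0[OF f])
    fix n g assume g: "eigfun g (ev n)"
    \<comment> \<open>The remainder of \<open>g\<close> after projection to the span of
      \<open>Mx n\<close> is an eigenfunction orthogonal to \<open>Mx n\<close>, hence zero on the
      sphere by maximality.\<close>
    define S where "S x = (\<Sum>\<phi>\<in>Mx n. inner_L2 g \<phi> * \<phi> x)" for x
    define h where "h x = 1 * g x + (- 1) * S x" for x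
    have fin: "finite (Mx n)" using Mx(2) by (simp add: onf_def)
    have S: "eigfun S (ev n)" unfolding S_def[abs_def] by (rule eigfun_sum[OF fin Mx(1)])
    have h: "eigfun h (ev n)" unfolding h_def[abs_def] by (rule eigfun_lincomb[OF g S])
    have "inner_L2 h \<phi> = 0" if \<phi>: "\<phi> \<in> Mx n" for \<phi>
    proof -
      have "inner_L2 h \<phi> = inner_L2 (\<lambda>x. g x - S x) \<phi>" by (simp add: h_def[abs_def])
      also have "\<dots> = inner_L2 g \<phi> - inner_L2 S \<phi>"
        by (rule inner_L2_diff_left[OF eigfun_continuous[OF g] eigfun_continuous[OF S] cM[OF \<phi>]])
      also have "inner_L2 S \<phi> = inner_L2 g \<phi>" unfolding S_def[abs_def] by (rule onf_coeff[OF Mx(2) \<phi>])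
      finally show ?thesis by simp
    qed
    then have "inner_L2 h h = 0" using Mx(3)[OF h] by blast
    then have "g x = S x" if "x \<in> S2" for x
      using inner_L2_eq_0_imp[OF eigfun_continuous[OF h] _ that] by (simp add: h_def)
    then have "inner_L2 f g = inner_L2 S f" by (subst inner_L2_commute) (rule inner_L2_cong, simp_all)
    also have "\<dots> = (\<Sum>\<phi>\<in>Mx n. inner_L2 g \<phi> * inner_L2 \<phi> f)"
      unfolding S_def[abs_def]
    proof (rule inner_L2_sum_left)
      fix \<phi> assume "\<phi> \<in> Mx n"
      from integrable_mult_continuous[OF L2_S2_integrable[OF f] cM[OF this]]
      show "integrable sigma_S2 (\<lambda>x. \<phi> x * f x)" by (simp add: mult.commute)
    qed
    also have "\<dots> = 0" using o by (simp add: inner_L2_commute[of _ f])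
    finally show "inner_L2 f g = 0" .
  qed
  \<comment> \<open>Tagging each function with its eigenvalue lets one enumeration produce both
    sequences.\<close>
  define P where "P = (\<Union>n. (\<lambda>\<phi>. (\<phi>, ev n)) ` Mx n)"
  have PE: "eigfun (fst k) (snd k)" "continuous_on S2 (fst k)" if "k \<in> P" for k
    using that Mx(1) cM by (auto simp: P_def)
  have Pon: "inner_L2 (fst k) (fst l) = (if k = l then 1 else 0)" if kl: "k \<in> P" "l \<in> P" for k l
  proof -
    obtain \<phi> n \<psi> m where k: "k = (\<phi>, ev n)" "\<phi> \<in> Mx n" and l: "l = (\<psi>, ev m)" "\<psi> \<in> Mx m"
      using kl by (auto simp: P_def)
    show ?thesis
    proof (cases "n = m")
      case True
      then show ?thesis using Mx(2)[of m] k l by (auto simp: onf_def)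
    next
      case False
      then have "ev n \<noteq> ev m" by (simp add: ev_inj)
      then show ?thesis using eigfun_orthogonal[OF Mx(1)[OF k(2)] Mx(1)[OF l(2)]] k l by simp
    qed
  qed
  have Pc: "AE x in sigma_S2. f x = 0" if "f \<in> L2_S2" "\<And>k. k \<in> P \<Longrightarrow> inner_L2 f (fst k) = 0" for f
    by (rule compl[OF that(1)]) (use that(2) in \<open>force simp: P_def\<close>)
  have "countable P"
    unfolding P_def
  proof (rule countable_UN[OF countableI_type])
    fix n
    have "finite (Mx n)" using Mx(2) by (simp add: onf_def)
    then show "countable ((\<lambda>\<phi>. (\<phi>, ev n)) ` Mx n)" by (intro countable_finite finite_imageI)
  qed
  moreover have "infinite P"
  proof
    assume fin: "finite P"
    then have on: "onf P fst" using PE Pon by (simp add: onf_def)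
    have "finite (snd ` P)" using fin by simp
    then obtain b where b: "\<And>k. k \<in> P \<Longrightarrow> snd k \<le> b" using bdd_above_finite[of "snd ` P"] by (auto simp: bdd_above_def)
    obtain N :: nat where N: "2 * b \<le> real N" using real_arch_simple by blast
    define p :: "real^3" where "p = axis 1 1"
    have p: "p \<in> S2" by (simp add: p_def)
    \<comment> \<open>A finite basis would reproduce this function. Its value at \<open>p\<close> is
      \<open>1\<close>, its squared norm is \<open>1 / (8 * (N + 1) + 1)\<close>, and the squares of
      the basis at \<open>p\<close> sum to at most \<open>4 * (N + 1)\<close>; Cauchy-Schwarz would
      then give \<open>1 < 1 / 2\<close>.\<close>
    define f where "f x = zon p x ^ (4 * (N + 1))" for x
    have f: "continuous_on S2 f" unfolding f_def[abs_def] by (intro continuous_intros)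
    define a where "a k = inner_L2 f (fst k)" for k :: "(real^3 \<Rightarrow> real) \<times> real"
    define S where "S x = (\<Sum>k\<in>P. a k * fst k x)" for x
    have S: "continuous_on S2 S" unfolding S_def[abs_def] by (rule onf_cont_sum[OF on])
    have d: "continuous_on S2 (\<lambda>x. f x - S x)" by (intro continuous_intros f S)
    have "AE x in sigma_S2. f x - S x = 0"
    proof (rule Pc[OF continuous_in_L2_S2[OF d]])
      fix k assume k: "k \<in> P"
      have "inner_L2 S (fst k) = a k" unfolding S_def[abs_def] by (rule onf_coeff[OF on k])
      then show "inner_L2 (\<lambda>x. f x - S x) (fst k) = 0"
        by (simp add: inner_L2_diff_left[OF f S PE(2)[OF k]] a_def)
    qed
    then have "f p - S p = 0" by (rule AE_sigma_eq_imp_eq[OF d continuous_on_const _ p])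
    moreover have "f p = 1" using p by (simp add: f_def zon_def norm_eq_1)
    ultimately have "1 = (S p)\<^sup>2" by simp
    also have "\<dots> \<le> (\<Sum>k\<in>P. (a k)\<^sup>2) * (\<Sum>k\<in>P. (fst k p)\<^sup>2)"
      unfolding S_def by (rule Cauchy_Schwarz_ineq_sum)
    also have "\<dots> \<le> inner_L2 f f * (4 * (real N + 1))"
    proof (rule mult_mono)
      show "(\<Sum>k\<in>P. (a k)\<^sup>2) \<le> inner_L2 f f" unfolding a_def by (rule onf_bessel[OF on f])
      show "(\<Sum>k\<in>P. (fst k p)\<^sup>2) \<le> 4 * (real N + 1)"
      proof (rule eigen_sum_squares_le[OF on PE(1) _ p])
        fix k assume "k \<in> P"
        then show "2 * snd k \<le> real N + 1" using b[of k] N by linarith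
      qed
    qed (simp_all add: inner_L2_nonneg sum_nonneg)
    also have "inner_L2 f f = 1 / (real (2 * (4 * (N + 1))) + 1)"
      unfolding inner_L2_def f_def power_add[symmetric] mult_2[symmetric] by (rule integral_zon_power[OF p])
    finally show False by (simp add: pos_le_divide_eq)
  qed
  ultimately have bij: "bij_betw (from_nat_into P) UNIV P" by (rule bij_betw_from_nat_into)
  define e where "e = from_nat_into P"
  have e: "e k \<in> P" "e k = e l \<longleftrightarrow> k = l" for k l
    using bij unfolding e_def bij_betw_def inj_on_def by auto
  have surj: "\<exists>k. e k = q" if "q \<in> P" for q using bij that unfolding e_def bij_betw_def by (metis imageE)
  have "LB_eigenbasis (\<lambda>k. fst (e k)) (\<lambda>k. snd (e k))"
    unfolding LB_eigenbasis_def
  proof (intro conjI allI ballI impI)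
    fix k
    show "C2_on (- {0}) (hext (fst (e k)))" using PE(1)[OF e(1)] by (simp add: eigfun_def)
    show "- laplace_beltrami (fst (e k)) x = snd (e k) * fst (e k) x" if "x \<in> S2" for x
      using PE(1)[OF e(1)] that unfolding eigfun_def by blast
    show "fst (e k) \<in> L2_S2" by (rule continuous_in_L2_S2[OF PE(2)[OF e(1)]])
    show "inner_L2 (fst (e k)) (fst (e l)) = (if k = l then 1 else 0)" for l
      using Pon[OF e(1) e(1)] e(2) by simp
  next
    fix f assume "f \<in> L2_S2" "\<forall>k. inner_L2 f (fst (e k)) = 0"
    then show "AE x in sigma_S2. f x = 0" using Pc surj by metis
  qed
  then have "LB_eigenbasis (fst ((\<lambda>k. fst (e k)), (\<lambda>k. snd (e k)))) (snd ((\<lambda>k. fst (e k)), (\<lambda>k. snd (e k))))"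
    by simp
  then show ?thesis unfolding LB_phi_def LB_lam_def by (rule someI)
qed

subsection \<open>Spectral truncation\<close>

lemma eigfun_LB: "eigfun (LB_phi k) (LB_lam k)"
  using LB_eigenbasis_LB unfolding LB_eigenbasis_def eigfun_def by blast

lemma continuous_LB_phi: "continuous_on S2 (LB_phi k)"
  by (rule eigfun_continuous[OF eigfun_LB])

lemma LB_phi_orthonormal: "inner_L2 (LB_phi k) (LB_phi l) = (if k = l then 1 else 0)"
  using LB_eigenbasis_LB unfolding LB_eigenbasis_def by blast

lemma LB_phi_complete:
  "f \<in> L2_S2 \<Longrightarrow> (\<And>k. inner_L2 f (LB_phi k) = 0) \<Longrightarrow> AE x in sigma_S2. f x = 0"
  using LB_eigenbasis_LB unfolding LB_eigenbasis_def by blast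

lemma onf_LB: "finite I \<Longrightarrow> onf I LB_phi"
  by (simp add: onf_def continuous_LB_phi LB_phi_orthonormal)

lemma LB_phi_nonzero: "\<exists>x\<in>S2. LB_phi k x \<noteq> 0"
proof (rule ccontr)
  assume "\<not> (\<exists>x\<in>S2. LB_phi k x \<noteq> 0)"
  then have "inner_L2 (LB_phi k) (LB_phi k) = inner_L2 (\<lambda>x. 0) (\<lambda>x. 0)" by (intro inner_L2_cong) auto
  then show False by (simp add: LB_phi_orthonormal) (simp add: inner_L2_def)
qed

lemma LB_lam_nonneg: "0 \<le> LB_lam k"
  by (rule eigfun_nonneg[OF eigfun_LB LB_phi_nonzero])

lemma finite_LB_lam_le: "finite {k. LB_lam k \<le> b}"
proof -
  obtain N :: nat where N: "2 * b \<le> real N" using real_arch_simple by blast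
  show ?thesis
  proof (rule finite_if_finite_subsets_card_bdd[THEN conjunct1])
    fix G assume G: "G \<subseteq> {k. LB_lam k \<le> b}" "finite G"
    have "real (card G) \<le> 4 * (real N + 1)"
    proof (rule eigen_card_le[OF onf_LB[OF G(2)] eigfun_LB])
      fix k assume "k \<in> G"
      then have "LB_lam k \<le> b" using G(1) by blast
      then show "2 * LB_lam k \<le> real N + 1" using N by linarith
    qed
    then have "real (card G) \<le> real (4 * (N + 1))" by simp
    then show "card G \<le> 4 * (N + 1)" unfolding of_nat_le_iff .
  qed
qed

text \<open>\<open>4 ^ J\<close> is the square of the degree scale \<open>2 ^ J\<close>. The shift
  of the eigenvalue by one makes \<open>low 0\<close> empty, so \<open>low J\<close> is the union of
  the blocks with index below \<open>J\<close>.\<close>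

definition low :: "nat \<Rightarrow> nat set" where "low J = {k. 1 + LB_lam k < 4 ^ J}"
definition blk :: "nat \<Rightarrow> nat set" where "blk j = {k. 4 ^ j \<le> 1 + LB_lam k \<and> 1 + LB_lam k < 4 ^ Suc j}"

lemma finite_low: "finite (low J)"
  by (rule finite_subset[OF _ finite_LB_lam_le[of "4 ^ J"]]) (auto simp: low_def)

lemma finite_blk: "finite (blk j)"
  by (rule finite_subset[OF _ finite_low[of "Suc j"]]) (auto simp: low_def blk_def)

lemma low_0: "low 0 = {}"
  using LB_lam_nonneg by (auto simp: low_def not_less)

lemma low_Suc: "low (Suc J) = low J \<union> blk J" "low J \<inter> blk J = {}"
proof -
  have "(4::real) ^ J \<le> 4 ^ Suc J" by simp
  then show "low (Suc J) = low J \<union> blk J" unfolding low_def blk_def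
    by (auto simp del: power_Suc intro: less_le_trans)
  show "low J \<inter> blk J = {}" by (auto simp: low_def blk_def)
qed

lemma in_low: "\<exists>J. k \<in> low J"
proof -
  obtain J where "1 + LB_lam k < 4 ^ J" using real_arch_pow[of 4 "1 + LB_lam k"] by auto
  then show ?thesis by (auto simp: low_def)
qed

lemma low_mono: "I \<le> J \<Longrightarrow> low I \<subseteq> low J"
proof
  fix k assume "I \<le> J" "k \<in> low I"
  moreover have "(4::real) ^ I \<le> 4 ^ J" using \<open>I \<le> J\<close> by (intro power_increasing) auto
  ultimately show "k \<in> low J" unfolding low_def by (blast intro: less_le_trans)
qed

definition psum :: "(real^3 \<Rightarrow> real) \<Rightarrow> nat set \<Rightarrow> real^3 \<Rightarrow> real" where
  "psum f I x = (\<Sum>k\<in>I. inner_L2 f (LB_phi k) * LB_phi k x)"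

lemma psum_continuous: "finite I \<Longrightarrow> continuous_on S2 (psum f I)"
  unfolding psum_def[abs_def] by (rule onf_cont_sum[OF onf_LB])

lemma psum_low: "psum f (low J) x = (\<Sum>j<J. psum f (blk j) x)"
proof (induction J)
  case 0 show ?case by (simp add: low_0 psum_def)
next
  case (Suc J)
  have "psum f (low (Suc J)) x = psum f (low J) x + psum f (blk J) x"
    unfolding psum_def low_Suc(1) by (rule sum.union_disjoint) (simp_all add: finite_low finite_blk low_Suc(2))
  then show ?case using Suc by simp
qed

lemma Hs_norm_nonneg: "in_Hs s f \<Longrightarrow> 0 \<le> Hs_norm s f"
  unfolding Hs_norm_def in_Hs_def by (simp add: suminf_nonneg Hs_terms_def)

text \<open>On block \<open>j\<close> the Sobolev weight is at least \<open>(4 ^ j) powr s\<close>,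
  and the sum over the block is part of the convergent series for the norm.\<close>

lemma blk_energy:
  assumes f: "in_Hs s f" and s: "0 \<le> s"
  shows "(\<Sum>k\<in>blk j. (inner_L2 f (LB_phi k))\<^sup>2) \<le> ((2 powr - s) ^ j * Hs_norm s f)\<^sup>2"
proof -
  have sm: "summable (Hs_terms s f)" using f by (simp add: in_Hs_def)
  have nn: "0 \<le> Hs_terms s f k" for k by (simp add: Hs_terms_def)
  have pw: "((2 powr - s) ^ j)\<^sup>2 * (4 ^ j) powr s = 1"
  proof -
    have "(4::real) ^ j = 2 powr (2 * real j)"
      by (simp add: powr_realpow[symmetric] powr_powr[symmetric])
    moreover have "((2 powr - s) ^ j)\<^sup>2 = (2::real) powr (- s * (2 * real j))"
      by (simp add: powr_realpow[symmetric] powr_powr power_mult[symmetric] ac_simps)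
    ultimately show ?thesis by (simp add: powr_powr powr_add[symmetric])
  qed
  have "(\<Sum>k\<in>blk j. (inner_L2 f (LB_phi k))\<^sup>2) = ((2 powr - s) ^ j)\<^sup>2 * (\<Sum>k\<in>blk j. (4 ^ j) powr s * (inner_L2 f (LB_phi k))\<^sup>2)"
    unfolding sum_distrib_left[symmetric] using pw by (simp add: mult.assoc[symmetric])
  also have "\<dots> \<le> ((2 powr - s) ^ j)\<^sup>2 * (\<Sum>k\<in>blk j. Hs_terms s f k)"
  proof (intro mult_left_mono sum_mono)
    fix k assume "k \<in> blk j"
    then have "4 ^ j \<le> 1 + LB_lam k" by (simp add: blk_def)
    then have "(4 ^ j) powr s \<le> (1 + LB_lam k) powr s" using s by (intro powr_mono2) auto
    then show "(4 ^ j) powr s * (inner_L2 f (LB_phi k))\<^sup>2 \<le> Hs_terms s f k"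
      unfolding Hs_terms_def by (rule mult_right_mono) simp
  qed simp
  also have "\<dots> \<le> ((2 powr - s) ^ j)\<^sup>2 * (\<Sum>k. Hs_terms s f k)"
    by (intro mult_left_mono sum_le_suminf[OF sm finite_blk] nn) simp
  also have "(\<Sum>k. Hs_terms s f k) = (Hs_norm s f)\<^sup>2"
    unfolding Hs_norm_def using suminf_nonneg[OF sm nn] by simp
  finally show ?thesis by (simp add: power_mult_distrib)
qed

text \<open>Makes \<open>N = 8 * 4 ^ j\<close> large enough for \<open>zmult_bounds\<close> on the
  whole block.\<close>

lemma blk_lam_le: "k \<in> blk j \<Longrightarrow> 2 * LB_lam k \<le> real (8 * 4 ^ j) + 1"
  by (simp add: blk_def)

text \<open>Cauchy-Schwarz separates the energy of the block from the pointwise sum of squares. The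
  latter is at most \<open>4 * (8 * 4 ^ j + 1) \<le> 36 * 4 ^ j\<close>, whence the constant
  six.\<close>

lemma psum_blk_bound:
  assumes f: "in_Hs s f" and s: "0 \<le> s" and x: "x \<in> S2"
  shows "\<bar>psum f (blk j) x\<bar> \<le> 6 * Hs_norm s f * (2 powr (1 - s)) ^ j"
proof -
  have "(psum f (blk j) x)\<^sup>2 \<le> (\<Sum>k\<in>blk j. (inner_L2 f (LB_phi k))\<^sup>2) * (\<Sum>k\<in>blk j. (LB_phi k x)\<^sup>2)"
    unfolding psum_def by (rule Cauchy_Schwarz_ineq_sum)
  also have "\<dots> \<le> ((2 powr - s) ^ j * Hs_norm s f)\<^sup>2 * (4 * (real (8 * 4 ^ j) + 1))"
    by (intro mult_mono blk_energy[OF f s] eigen_sum_squares_le[OF onf_LB[OF finite_blk] eigfun_LB blk_lam_le x])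
       (simp_all add: sum_nonneg)
  also have "\<dots> \<le> ((2 powr - s) ^ j * Hs_norm s f)\<^sup>2 * (36 * 4 ^ j)"
    by (intro mult_left_mono) simp_all
  also have "\<dots> = (6 * Hs_norm s f * ((2 powr - s) ^ j * 2 ^ j))\<^sup>2"
  proof -
    have "((2::real) ^ j)\<^sup>2 = (2\<^sup>2) ^ j" by (metis power_mult mult.commute)
    then have "(4::real) ^ j = (2 ^ j)\<^sup>2" by simp
    then show ?thesis by (simp add: power_mult_distrib)
  qed
  also have "(2 powr - s) ^ j * 2 ^ j = ((2::real) powr (1 - s)) ^ j"
    unfolding power_mult_distrib[symmetric] by (simp add: powr_diff powr_minus_divide)
  finally show ?thesis
    by (rule abs_le_square_iff[THEN iffD2, THEN order_trans]) (use Hs_norm_nonneg[OF f] in simp)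
qed

text \<open>The Sobolev embedding. For \<open>s > 1\<close> the block bounds are geometric, so the
  blocks sum uniformly to a continuous function; it has the coefficients of \<open>f\<close>, and
  completeness together with continuity identifies the two at every point.\<close>

lemma psum_converges:
  assumes f: "in_Hs s f" and cf: "continuous_on S2 f" and s: "1 < s"
  defines "q \<equiv> 2 powr (1 - s)"
  shows "0 < q" "q < 1"
    and "x \<in> S2 \<Longrightarrow> (\<lambda>J. psum f (low J) x) \<longlonglongrightarrow> f x"
    and "x \<in> S2 \<Longrightarrow> \<bar>psum f (low J) x\<bar> \<le> 6 * Hs_norm s f / (1 - q)"
    and "x \<in> S2 \<Longrightarrow> \<bar>f x\<bar> \<le> 6 * Hs_norm s f / (1 - q)"
proof -
  show q: "0 < q" "q < 1" using s by (simp_all add: q_def powr_less_one)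
  have H: "0 \<le> Hs_norm s f" by (rule Hs_norm_nonneg[OF f])
  have b: "norm (psum f (blk j) x) \<le> 6 * Hs_norm s f * q ^ j" if "x \<in> S2" for j x
    using psum_blk_bound[OF f _ that, of j] s by (simp add: q_def)
  have sq: "summable (\<lambda>j. 6 * Hs_norm s f * q ^ j)"
    using q by (intro summable_mult summable_geometric) simp
  define g where "g x = (\<Sum>j. psum f (blk j) x)" for x
  have ul: "uniform_limit S2 (\<lambda>J x. \<Sum>j<J. psum f (blk j) x) g sequentially"
    unfolding g_def[abs_def] by (rule Weierstrass_m_test[OF b sq])
  then have ul: "uniform_limit S2 (\<lambda>J. psum f (low J)) g sequentially"
    by (simp only: psum_low[abs_def])
  have cg: "continuous_on S2 g"
    by (rule uniform_limit_theorem[OF _ ul]) (simp_all add: psum_continuous finite_low)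
  have pl: "(\<lambda>J. psum f (low J) x) \<longlonglongrightarrow> g x" if "x \<in> S2" for x
    by (rule tendsto_uniform_limitI[OF ul that])
  show bd: "\<bar>psum f (low J) x\<bar> \<le> 6 * Hs_norm s f / (1 - q)" if x: "x \<in> S2" for J x
  proof -
    have "\<bar>psum f (low J) x\<bar> \<le> (\<Sum>j<J. norm (psum f (blk j) x))" unfolding psum_low using norm_sum by (simp add: real_norm_def[symmetric] del: real_norm_def)
    also have "\<dots> \<le> (\<Sum>j<J. 6 * Hs_norm s f * q ^ j)" by (intro sum_mono b x)
    also have "\<dots> \<le> (\<Sum>j. 6 * Hs_norm s f * q ^ j)" using H q by (intro sum_le_suminf[OF sq]) auto
    also have "\<dots> = 6 * Hs_norm s f * (1 / (1 - q))"
      using q by (subst suminf_mult) (simp_all add: suminf_geometric summable_geometric)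
    finally show ?thesis by simp
  qed
  have eq: "f x = g x" if x: "x \<in> S2" for x
  proof -
    have d: "continuous_on S2 (\<lambda>x. f x - g x)" by (intro continuous_intros cf cg)
    have "AE x in sigma_S2. f x - g x = 0"
    proof (rule LB_phi_complete[OF continuous_in_L2_S2[OF d]])
      fix k
      obtain B where B: "\<And>x. x \<in> S2 \<Longrightarrow> norm (LB_phi k x) \<le> B"
        using continuous_on_S2_bounded[OF continuous_LB_phi] by metis
      have "(\<lambda>J. \<integral>x. psum f (low J) x * LB_phi k x \<partial>sigma_S2) \<longlonglongrightarrow> (\<integral>x. g x * LB_phi k x \<partial>sigma_S2)"
      proof (rule integral_dominated_convergence)
        show "(\<lambda>x. g x * LB_phi k x) \<in> borel_measurable sigma_S2"
          by (rule borel_measurable_integrable, intro sigma_integrable continuous_intros cg continuous_LB_phi)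
        show "(\<lambda>x. psum f (low J) x * LB_phi k x) \<in> borel_measurable sigma_S2" for J
          by (rule borel_measurable_integrable, intro sigma_integrable continuous_intros psum_continuous finite_low continuous_LB_phi)
        show "integrable sigma_S2 (\<lambda>x. 6 * Hs_norm s f / (1 - q) * B)" by simp
        show "AE x in sigma_S2. (\<lambda>J. psum f (low J) x * LB_phi k x) \<longlonglongrightarrow> g x * LB_phi k x"
          by (intro AE_I2 tendsto_mult tendsto_const pl) simp
        show "AE x in sigma_S2. norm (psum f (low J) x * LB_phi k x) \<le> 6 * Hs_norm s f / (1 - q) * B" for J
        proof (rule AE_I2)
          fix x assume "x \<in> space sigma_S2"
          then have x: "x \<in> S2" by simp
          show "norm (psum f (low J) x * LB_phi k x) \<le> 6 * Hs_norm s f / (1 - q) * B"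
            unfolding norm_mult by (intro mult_mono) (use bd[OF x] B[OF x] H q in auto)
        qed
      qed
      moreover have "\<forall>\<^sub>F J in sequentially. (\<integral>x. psum f (low J) x * LB_phi k x \<partial>sigma_S2) = inner_L2 f (LB_phi k)"
      proof -
        obtain J0 where J0: "k \<in> low J0" using in_low by blast
        have "(\<integral>x. psum f (low J) x * LB_phi k x \<partial>sigma_S2) = inner_L2 f (LB_phi k)" if "J \<ge> J0" for J
          using onf_coeff[OF onf_LB[OF finite_low], of k J "\<lambda>k. inner_L2 f (LB_phi k)"] low_mono[OF that] J0
          unfolding psum_def inner_L2_def by blast
        then show ?thesis unfolding eventually_sequentially by blast
      qed
      then have "(\<lambda>J. \<integral>x. psum f (low J) x * LB_phi k x \<partial>sigma_S2) \<longlonglongrightarrow> inner_L2 f (LB_phi k)"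
        by (rule tendsto_eventually)
      ultimately have "inner_L2 f (LB_phi k) = inner_L2 g (LB_phi k)"
        unfolding inner_L2_def[of g] by (rule LIMSEQ_unique[rotated])
      then show "inner_L2 (\<lambda>x. f x - g x) (LB_phi k) = 0"
        by (simp add: inner_L2_diff_left[OF cf cg continuous_LB_phi])
    qed
    then have "f x - g x = 0" by (rule AE_sigma_eq_imp_eq[OF d continuous_on_const _ x])
    then show ?thesis by simp
  qed
  show lf: "(\<lambda>J. psum f (low J) x) \<longlonglongrightarrow> f x" if "x \<in> S2" for x using pl[OF that] eq[OF that] by simp
  show "\<bar>f x\<bar> \<le> 6 * Hs_norm s f / (1 - q)" if x: "x \<in> S2" for x
    by (rule LIMSEQ_le_const2[OF tendsto_rabs[OF lf[OF x]]]) (use bd[OF x] in blast)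
qed

text \<open>Serves to compare the total mass of the weighted measure with one. The constant is an
  eigenfunction for eigenvalue zero, which only finitely many \<open>LB_phi k\<close> share.\<close>

lemma in_Hs_one: "in_Hs s (\<lambda>x. 1)"
  unfolding in_Hs_def
proof
  show "(\<lambda>x. 1) \<in> L2_S2" by (rule continuous_in_L2_S2) simp
  have e: "eigfun (\<lambda>x. zon (axis 1 1) x ^ 0) 0"
    using zon_power_eigen_decomposition[of "axis 1 1" 0] unfolding eigfun_def
    using C2_on_zon_power[of "axis 1 1" 0] laplace_beltrami_zon_power[of "axis 1 1" _ 0] by force
  show "summable (Hs_terms s (\<lambda>x. 1))"
  proof (rule summable_finite[OF finite_LB_lam_le[of 0]])
    fix k assume "k \<notin> {k. LB_lam k \<le> 0}"
    then have "inner_L2 (\<lambda>x. zon (axis 1 1) x ^ 0) (LB_phi k) = 0"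
      by (intro eigfun_orthogonal[OF e eigfun_LB]) auto
    then show "Hs_terms s (\<lambda>x. 1) k = 0" by (simp add: Hs_terms_def)
  qed
qed

subsection \<open>Sampling inequality and exactness\<close>

locale S2_prob =
  fixes M :: "(real^3) measure"
  assumes fin: "finite_measure M" and sets_M: "sets M = sets S2_borel" and measure_M: "measure M S2 = 1"
begin

sublocale finite_measure M by (rule fin)

lemma space_M: "space M = S2"
  using sets_eq_imp_space_eq[OF sets_M] by (simp add: space_restrict_space)

lemma integrable_cont:
  fixes f :: "real^3 \<Rightarrow> real"
  shows "continuous_on S2 f \<Longrightarrow> integrable M f"
  by (rule continuous_on_S2_integrable[OF _ fin sets_M])

text \<open>Fubini. It moves the integration over \<open>M\<close> onto the kernel alone, where
  exactness and regularity of \<open>M\<close> can act.\<close>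

lemma zavg_weighted_integral:
  assumes h: "continuous_on S2 h" and w: "continuous_on S2 w"
  shows "(\<integral>x. zavg N h x * w x \<partial>M) = (\<integral>y. h y * (\<integral>x. (real N + 1) * zon x y ^ N * w x \<partial>M) \<partial>sigma_S2)"
proof -
  interpret pair_sigma_finite M sigma_S2 ..
  define F where "F x y = ((real N + 1) * zon x y ^ N * h y) * w x" for x y
  obtain B where B: "B > 0" "\<And>x. x \<in> S2 \<Longrightarrow> norm (h x) \<le> B" using continuous_on_S2_bounded[OF h] by metis
  obtain C where C: "C > 0" "\<And>x. x \<in> S2 \<Longrightarrow> norm (w x) \<le> C" using continuous_on_S2_bounded[OF w] by metis
  have meas: "case_prod F \<in> borel_measurable (M \<Otimes>\<^sub>M sigma_S2)"
  proof -
    have [measurable]: "w \<in> borel_measurable M" "h \<in> borel_measurable sigma_S2"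
      using integrable_cont[OF w] sigma_integrable[OF h] by auto
    note zon_measurable_pair[OF sets_M, measurable]
    have "(\<lambda>p. ((real N + 1) * (\<lambda>(x, y). zon x y) p ^ N * h (snd p)) * w (fst p)) \<in> borel_measurable (M \<Otimes>\<^sub>M sigma_S2)"
      by measurable
    then show ?thesis by (simp add: F_def split_beta')
  qed
  interpret P: finite_measure "M \<Otimes>\<^sub>M sigma_S2"
    by (rule finite_measure_pair_measure) (rule finite_measure_sigma_S2, rule fin)
  have int: "integrable (M \<Otimes>\<^sub>M sigma_S2) (case_prod F)"
  proof (rule P.integrable_const_bound[where B="(real N + 1) * 1 * B * C", OF _ meas], rule AE_I2)
    fix p assume "p \<in> space (M \<Otimes>\<^sub>M sigma_S2)"
    then have p: "fst p \<in> S2" "snd p \<in> S2" by (auto simp: space_pair_measure space_M)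
    have "\<bar>zon (fst p) (snd p) ^ N\<bar> \<le> 1"
      using zon_nonneg[OF p] zon_le_1[OF p] by (simp add: power_le_one)
    then have "norm (F (fst p) (snd p)) \<le> (real N + 1) * 1 * B * C"
      unfolding F_def norm_mult using B(1) C(1) B(2)[OF p(2)] C(2)[OF p(1)]
      by (intro mult_mono) auto
    then show "norm (case_prod F p) \<le> (real N + 1) * 1 * B * C" by (simp add: split_beta')
  qed
  have "(\<integral>x. zavg N h x * w x \<partial>M) = (\<integral>x. (\<integral>y. F x y \<partial>sigma_S2) \<partial>M)"
    unfolding F_def zavg_def by (simp only: integral_mult_left_zero)
  also have "\<dots> = (\<integral>y. (\<integral>x. F x y \<partial>M) \<partial>sigma_S2)" by (rule Fubini_integral[OF int, symmetric])
  also have "\<dots> = (\<integral>y. h y * (\<integral>x. (real N + 1) * zon x y ^ N * w x \<partial>M) \<partial>sigma_S2)"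
  proof (rule Bochner_Integration.integral_cong[OF refl])
    fix y
    have "(\<lambda>x. F x y) = (\<lambda>x. h y * ((real N + 1) * zon x y ^ N * w x))"
      by (simp add: F_def ac_simps)
    then show "(\<integral>x. F x y \<partial>M) = h y * (\<integral>x. (real N + 1) * zon x y ^ N * w x \<partial>M)"
      by (simp only: integral_mult_right_zero)
  qed
  finally show ?thesis .
qed

text \<open>The truncated series is \<open>zavg N h\<close> with \<open>h\<close> of comparable norm, and \<open>zavg N\<close> is an average
  against a probability density, so Jensen's inequality applies.\<close>

lemma sampling_inequality:
  assumes I: "finite I" and l: "\<And>k. k \<in> I \<Longrightarrow> 2 * LB_lam k \<le> real N + 1"
    and A: "\<And>y. y \<in> S2 \<Longrightarrow> (\<integral>x. (real N + 1) * zon x y ^ N \<partial>M) \<le> A"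
  shows "(\<integral>x. (\<Sum>k\<in>I. a k * LB_phi k x)\<^sup>2 \<partial>M) \<le> 4 * A * (\<Sum>k\<in>I. (a k)\<^sup>2)"
proof -
  define c where "c k = zmult (LB_lam k) N" for k
  have c: "1 / 2 \<le> c k" if "k \<in> I" for k
  proof -
    obtain x where "x \<in> S2" "LB_phi k x \<noteq> 0" using LB_phi_nonzero by blast
    from zmult_bounds(1)[OF eigfun_LB this l[OF that]] show ?thesis by (simp add: c_def)
  qed
  define g where "g x = (\<Sum>k\<in>I. a k * LB_phi k x)" for x
  define h where "h x = (\<Sum>k\<in>I. (a k / c k) * LB_phi k x)" for x
  have ch: "continuous_on S2 h" unfolding h_def[abs_def] by (rule onf_cont_sum[OF onf_LB[OF I]])
  have cg: "continuous_on S2 g" unfolding g_def[abs_def] by (rule onf_cont_sum[OF onf_LB[OF I]])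
  have z: "zavg N h x = g x" if x: "x \<in> S2" for x
  proof -
    have "zavg N h x = inner_L2 h (\<lambda>y. (real N + 1) * zon x y ^ N)"
      unfolding zavg_def inner_L2_def by (simp only: mult.commute)
    also have "\<dots> = (\<Sum>k\<in>I. (a k / c k) * inner_L2 (LB_phi k) (\<lambda>y. (real N + 1) * zon x y ^ N))"
      unfolding h_def[abs_def] by (rule inner_L2_sum_cont) (intro continuous_LB_phi continuous_intros)+
    also have "\<dots> = (\<Sum>k\<in>I. a k * LB_phi k x)"
    proof (rule sum.cong[OF refl])
      fix k assume k: "k \<in> I"
      have "inner_L2 (LB_phi k) (\<lambda>y. (real N + 1) * zon x y ^ N) = zavg N (LB_phi k) x"
        unfolding zavg_def inner_L2_def by (simp only: mult.commute)
      then show "(a k / c k) * inner_L2 (LB_phi k) (\<lambda>y. (real N + 1) * zon x y ^ N) = a k * LB_phi k x"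
        using zavg_eigfun[OF eigfun_LB x, of N k] c[OF k] by (simp add: c_def)
    qed
    finally show ?thesis by (simp add: g_def)
  qed
  have jensen: "(g x)\<^sup>2 \<le> zavg N (\<lambda>y. (h y)\<^sup>2) x" if x: "x \<in> S2" for x
  \<comment> \<open>Expanding the nonnegative average of \<open>(h y - g x)\<^sup>2\<close> gives
    Jensen's inequality, since the average of \<open>h\<close> at \<open>x\<close> is
    \<open>g x\<close>.\<close>
  proof -
    have cc: "continuous_on S2 (\<lambda>y. (h y - g x)\<^sup>2)" by (intro continuous_intros ch)
    have "0 \<le> zavg N (\<lambda>y. (h y - g x)\<^sup>2) x"
      using zavg_mono[OF continuous_on_const cc x, of 0 N] zavg_const[OF x, of N 0] by simp
    also have "zavg N (\<lambda>y. (h y - g x)\<^sup>2) x =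
      (\<integral>y. (real N + 1) * zon x y ^ N * (h y)\<^sup>2 - 2 * g x * ((real N + 1) * zon x y ^ N * h y)
         + (g x)\<^sup>2 * ((real N + 1) * zon x y ^ N * 1) \<partial>sigma_S2)"
      unfolding zavg_def by (rule Bochner_Integration.integral_cong) (simp_all add: power2_eq_square algebra_simps)
    also have "\<dots> = (\<integral>y. (real N + 1) * zon x y ^ N * (h y)\<^sup>2 - 2 * g x * ((real N + 1) * zon x y ^ N * h y) \<partial>sigma_S2)
       + (\<integral>y. (g x)\<^sup>2 * ((real N + 1) * zon x y ^ N * 1) \<partial>sigma_S2)"
      by (rule Bochner_Integration.integral_add) (intro sigma_integrable continuous_intros ch)+
    also have "\<dots> = ((\<integral>y. (real N + 1) * zon x y ^ N * (h y)\<^sup>2 \<partial>sigma_S2) - (\<integral>y. 2 * g x * ((real N + 1) * zon x y ^ N * h y) \<partial>sigma_S2))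
       + (\<integral>y. (g x)\<^sup>2 * ((real N + 1) * zon x y ^ N * 1) \<partial>sigma_S2)"
      by (intro arg_cong2[where f="(+)"] Bochner_Integration.integral_diff refl) (intro sigma_integrable continuous_intros ch)+
    also have "\<dots> = zavg N (\<lambda>y. (h y)\<^sup>2) x - 2 * g x * zavg N h x + (g x)\<^sup>2 * zavg N (\<lambda>y. 1) x"
      unfolding zavg_def by (simp only: integral_mult_right_zero)
    finally show ?thesis using z[OF x] zavg_const[OF x, of N 1] by (simp add: power2_eq_square)
  qed
  have ch2: "continuous_on S2 (\<lambda>y. (h y)\<^sup>2)" by (intro continuous_intros ch)
  have "(\<integral>x. (g x)\<^sup>2 \<partial>M) \<le> (\<integral>x. zavg N (\<lambda>y. (h y)\<^sup>2) x * 1 \<partial>M)"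
  proof (rule integral_mono)
    show "integrable M (\<lambda>x. (g x)\<^sup>2)" by (intro integrable_cont continuous_intros cg)
    obtain B where B: "\<And>x. x \<in> S2 \<Longrightarrow> norm ((h x)\<^sup>2) \<le> B" using continuous_on_S2_bounded[OF ch2] by metis
    show "integrable M (\<lambda>x. zavg N (\<lambda>y. (h y)\<^sup>2) x * 1)"
    proof (rule integrable_const_bound[where B=B])
      show "AE x in M. norm (zavg N (\<lambda>y. (h y)\<^sup>2) x * 1) \<le> B"
        by (intro AE_I2) (use abs_zavg_le[OF ch2, of _ B N] B in \<open>simp add: space_M\<close>)
    qed (simp add: zavg_measurable[OF ch2 sets_M])
  qed (simp add: jensen space_M)
  also have "\<dots> = (\<integral>y. (h y)\<^sup>2 * (\<integral>x. (real N + 1) * zon x y ^ N * 1 \<partial>M) \<partial>sigma_S2)"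
    by (rule zavg_weighted_integral[OF ch2 continuous_on_const])
  also have "\<dots> \<le> (\<integral>y. (h y)\<^sup>2 * A \<partial>sigma_S2)"
  proof (rule integral_mono')
    show "integrable sigma_S2 (\<lambda>y. (h y)\<^sup>2 * A)" by (intro sigma_integrable continuous_intros ch)
    show "(h y)\<^sup>2 * (\<integral>x. (real N + 1) * zon x y ^ N * 1 \<partial>M) \<le> (h y)\<^sup>2 * A" if "y \<in> space sigma_S2" for y
      using A[of y] that by (intro mult_left_mono) simp_all
    fix y assume "y \<in> space sigma_S2"
    then have y: "y \<in> S2" by simp
    have "0 \<le> (\<integral>x. (real N + 1) * zon x y ^ N \<partial>M)"
      by (rule Bochner_Integration.integral_nonneg) (use zon_nonneg y space_M in auto)
    then show "0 \<le> (h y)\<^sup>2 * A" using A[OF y] by simp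
  qed
  also have "\<dots> = A * inner_L2 h h" by (simp add: inner_L2_def power2_eq_square mult.commute)
  also have "inner_L2 h h = (\<Sum>k\<in>I. (a k / c k)\<^sup>2)"
    unfolding h_def[abs_def] by (rule onf_parseval[OF onf_LB[OF I]])
  also have "A * \<dots> \<le> A * (\<Sum>k\<in>I. 4 * (a k)\<^sup>2)"
  proof (rule mult_left_mono[OF sum_mono])
    fix k assume "k \<in> I"
    then have k: "1 / 2 \<le> c k" by (rule c)
    then have "(1 / 2)\<^sup>2 \<le> (c k)\<^sup>2" by (intro power_mono) auto
    then have "(a k)\<^sup>2 * (1 / 2)\<^sup>2 \<le> (a k)\<^sup>2 * (c k)\<^sup>2" by (rule mult_left_mono) simp
    then have "(a k)\<^sup>2 \<le> 4 * (a k)\<^sup>2 * (c k)\<^sup>2" by (simp add: power_divide)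
    then show "(a k / c k)\<^sup>2 \<le> 4 * (a k)\<^sup>2" using k unfolding power_divide by (subst pos_divide_le_eq) auto
  next
    define y :: "real^3" where "y = axis 1 1"
    have y: "y \<in> S2" by (simp add: y_def)
    have "0 \<le> (\<integral>x. (real N + 1) * zon x y ^ N \<partial>M)"
      by (rule Bochner_Integration.integral_nonneg) (use zon_nonneg y space_M in auto)
    then show "0 \<le> A" using A[OF y] by simp
  qed
  finally show ?thesis unfolding g_def by (simp add: sum_distrib_left ac_simps)
qed

text \<open>The variance of \<open>\<bar>g\<bar>\<close> under the probability measure
  \<open>M\<close> is nonnegative.\<close>

lemma integral_abs_le:
  fixes g :: "real^3 \<Rightarrow> real"
  assumes g: "continuous_on S2 g" and t: "(\<integral>x. (g x)\<^sup>2 \<partial>M) \<le> t\<^sup>2" "0 \<le> t"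
  shows "(\<integral>x. \<bar>g x\<bar> \<partial>M) \<le> t"
proof -
  define m where "m = (\<integral>x. \<bar>g x\<bar> \<partial>M)"
  have "0 \<le> (\<integral>x. (\<bar>g x\<bar> - m)\<^sup>2 \<partial>M)" by (rule Bochner_Integration.integral_nonneg) simp
  also have "\<dots> = (\<integral>x. (g x)\<^sup>2 - 2 * m * \<bar>g x\<bar> + m\<^sup>2 \<partial>M)"
    by (rule Bochner_Integration.integral_cong) (simp_all add: power2_diff)
  also have "\<dots> = (\<integral>x. (g x)\<^sup>2 - 2 * m * \<bar>g x\<bar> \<partial>M) + (\<integral>x. m\<^sup>2 \<partial>M)"
    by (rule Bochner_Integration.integral_add) (intro integrable_cont continuous_intros g)+
  also have "(\<integral>x. (g x)\<^sup>2 - 2 * m * \<bar>g x\<bar> \<partial>M) = (\<integral>x. (g x)\<^sup>2 \<partial>M) - (\<integral>x. 2 * m * \<bar>g x\<bar> \<partial>M)"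
    by (rule Bochner_Integration.integral_diff) (intro integrable_cont continuous_intros g)+
  also have "(\<integral>x. 2 * m * \<bar>g x\<bar> \<partial>M) = 2 * m * m" unfolding m_def by (rule integral_mult_right_zero)
  also have "(\<integral>x. m\<^sup>2 \<partial>M) = m\<^sup>2" using measure_M by (simp add: space_M)
  finally have "m\<^sup>2 \<le> t\<^sup>2" using t(1) by (simp add: power2_eq_square)
  then show ?thesis unfolding m_def by (rule power2_le_imp_le) (rule t(2))
qed

text \<open>Products of at most \<open>D\<close> factors \<open>zon y\<close> span, on the sphere,
  the polynomials of degree at most \<open>D\<close>. The list form suits an induction on the number
  of factors, and a repeated entry is a power.\<close>

definition exact :: "nat \<Rightarrow> bool" where
  "exact D \<longleftrightarrow> (\<forall>ys. set ys \<subseteq> S2 \<longrightarrow> length ys \<le> D \<longrightarrow>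
     (\<integral>x. (\<Prod>y\<leftarrow>ys. zon y x) \<partial>M) = (\<integral>x. (\<Prod>y\<leftarrow>ys. zon y x) \<partial>sigma_S2))"

lemma exact_zon_powers:
  assumes "exact D" "m + n \<le> D" "y \<in> S2" "z \<in> S2"
  shows "(\<integral>x. zon x y ^ m * zon x z ^ n \<partial>M) = (\<integral>x. zon x y ^ m * zon x z ^ n \<partial>sigma_S2)"
proof -
  have "(\<Prod>w\<leftarrow>replicate m y @ replicate n z. zon w x) = zon x y ^ m * zon x z ^ n" for x
    by (simp add: prod_list_replicate map_replicate zon_commute[of _ x])
  then show ?thesis
    using assms unfolding exact_def
    by (elim allE[of _ "replicate m y @ replicate n z"]) auto
qed

end

interpretation sigma: S2_prob sigma_S2
  by unfold_locales (auto simp: finite_measure_sigma_S2)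

context S2_prob begin

text \<open>The product of two averages is a superposition of kernels
  \<open>zon x y ^ N * zon x z ^ N\<close> of degree \<open>2 * N\<close>. Fubini is applied once
  for each average, so that exactness is only used for these kernels.\<close>

lemma exact_zavg_product:
  assumes ex: "exact (2 * N)" and h: "continuous_on S2 h" and k: "continuous_on S2 k"
    and f: "continuous_on S2 f" "\<And>x. x \<in> S2 \<Longrightarrow> zavg N h x = f x"
    and g: "continuous_on S2 g" "\<And>x. x \<in> S2 \<Longrightarrow> zavg N k x = g x"
  shows "(\<integral>x. f x * g x \<partial>M) = (\<integral>x. f x * g x \<partial>sigma_S2)"
proof -
  have inner: "(\<integral>x. (real N + 1) * zon x y ^ N * ((real N + 1) * zon x z ^ N) \<partial>M)
     = (\<integral>x. (real N + 1) * zon x y ^ N * ((real N + 1) * zon x z ^ N) \<partial>sigma_S2)" if "y \<in> S2" "z \<in> S2" for y z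
  proof -
    have e: "(real N + 1) * zon x y ^ N * ((real N + 1) * zon x z ^ N) = (real N + 1)\<^sup>2 * (zon x y ^ N * zon x z ^ N)" for x
      by (simp only: power2_eq_square mult_ac)
    show ?thesis unfolding e integral_mult_right_zero
      using exact_zon_powers[OF ex _ that, of N N] by simp
  qed
  have mid: "(\<integral>x. (real N + 1) * zon x y ^ N * g x \<partial>M) = (\<integral>x. (real N + 1) * zon x y ^ N * g x \<partial>sigma_S2)"
    if y: "y \<in> S2" for y
  proof -
    have w: "continuous_on S2 (\<lambda>x. (real N + 1) * zon x y ^ N)"
      unfolding zon_commute[of _ y] by (intro continuous_intros)
    have "(\<integral>x. (real N + 1) * zon x y ^ N * g x \<partial>M) = (\<integral>x. zavg N k x * ((real N + 1) * zon x y ^ N) \<partial>M)"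
      by (rule Bochner_Integration.integral_cong) (simp_all add: space_M g(2))
    also have "\<dots> = (\<integral>z. k z * (\<integral>x. (real N + 1) * zon x z ^ N * ((real N + 1) * zon x y ^ N) \<partial>M) \<partial>sigma_S2)"
      by (rule zavg_weighted_integral[OF k w])
    also have "\<dots> = (\<integral>z. k z * (\<integral>x. (real N + 1) * zon x z ^ N * ((real N + 1) * zon x y ^ N) \<partial>sigma_S2) \<partial>sigma_S2)"
      by (rule Bochner_Integration.integral_cong) (use inner y in simp_all)
    also have "\<dots> = (\<integral>x. zavg N k x * ((real N + 1) * zon x y ^ N) \<partial>sigma_S2)"
      by (rule sigma.zavg_weighted_integral[OF k w, symmetric])
    also have "\<dots> = (\<integral>x. (real N + 1) * zon x y ^ N * g x \<partial>sigma_S2)"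
      by (rule Bochner_Integration.integral_cong) (simp_all add: g(2))
    finally show ?thesis .
  qed
  have "(\<integral>x. f x * g x \<partial>M) = (\<integral>x. zavg N h x * g x \<partial>M)"
    by (rule Bochner_Integration.integral_cong) (simp_all add: space_M f(2))
  also have "\<dots> = (\<integral>y. h y * (\<integral>x. (real N + 1) * zon x y ^ N * g x \<partial>M) \<partial>sigma_S2)"
    by (rule zavg_weighted_integral[OF h g(1)])
  also have "\<dots> = (\<integral>y. h y * (\<integral>x. (real N + 1) * zon x y ^ N * g x \<partial>sigma_S2) \<partial>sigma_S2)"
    by (rule Bochner_Integration.integral_cong) (simp_all add: mid)
  also have "\<dots> = (\<integral>x. zavg N h x * g x \<partial>sigma_S2)"
    by (rule sigma.zavg_weighted_integral[OF h g(1), symmetric])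
  also have "\<dots> = (\<integral>x. f x * g x \<partial>sigma_S2)"
    by (rule Bochner_Integration.integral_cong) (simp_all add: f(2))
  finally show ?thesis .
qed

text \<open>Dividing the coefficients by positive multipliers presents a truncated series as an
  average of order \<open>N = 2 ^ J\<close>; the eigenvalues in \<open>low J\<close> are below
  \<open>4 ^ J = N * N\<close> and thus in the range of \<open>zmult_pos\<close>.\<close>

lemma exact_psum_product:
  assumes ex: "exact (2 * 2 ^ J)"
  shows "(\<integral>x. psum f (low J) x * psum g (low J) x \<partial>M) = (\<integral>x. psum f (low J) x * psum g (low J) x \<partial>sigma_S2)"
proof -
  define N :: nat where "N = 2 ^ J"
  define c where "c k = zmult (LB_lam k) N" for k
  have c: "c k > 0" if "k \<in> low J" for k
  proof -
    obtain x where x: "x \<in> S2" "LB_phi k x \<noteq> 0" using LB_phi_nonzero by blast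
    have "LB_lam k \<le> 4 ^ J" using that by (simp add: low_def)
    also have "\<dots> = real N * real N" by (simp add: N_def power_mult_distrib[symmetric])
    also have "\<dots> \<le> real N * (real N + 1)" by (intro mult_left_mono) auto
    finally show ?thesis unfolding c_def by (rule zmult_pos[OF eigfun_LB x])
  qed
  define h where "h f x = (\<Sum>k\<in>low J. (inner_L2 f (LB_phi k) / c k) * LB_phi k x)" for f x
  have ch: "continuous_on S2 (h f)" for f unfolding h_def[abs_def] by (rule onf_cont_sum[OF onf_LB[OF finite_low]])
  have z: "zavg N (h f) x = psum f (low J) x" if x: "x \<in> S2" for f x
  proof -
    have "zavg N (h f) x = inner_L2 (h f) (\<lambda>y. (real N + 1) * zon x y ^ N)"
      unfolding zavg_def inner_L2_def by (simp only: mult.commute)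
    also have "\<dots> = (\<Sum>k\<in>low J. (inner_L2 f (LB_phi k) / c k) * inner_L2 (LB_phi k) (\<lambda>y. (real N + 1) * zon x y ^ N))"
      unfolding h_def[abs_def] by (rule inner_L2_sum_cont) (intro continuous_LB_phi continuous_intros)+
    also have "\<dots> = (\<Sum>k\<in>low J. inner_L2 f (LB_phi k) * LB_phi k x)"
    proof (rule sum.cong[OF refl])
      fix k assume k: "k \<in> low J"
      have "inner_L2 (LB_phi k) (\<lambda>y. (real N + 1) * zon x y ^ N) = zavg N (LB_phi k) x"
        unfolding zavg_def inner_L2_def by (simp only: mult.commute)
      then show "(inner_L2 f (LB_phi k) / c k) * inner_L2 (LB_phi k) (\<lambda>y. (real N + 1) * zon x y ^ N) = inner_L2 f (LB_phi k) * LB_phi k x"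
        using zavg_eigfun[OF eigfun_LB x, of N k] c[OF k] by (simp add: c_def)
    qed
    finally show ?thesis by (simp add: psum_def)
  qed
  have "exact (2 * N)" using ex by (simp add: N_def)
  from exact_zavg_product[OF this ch ch psum_continuous[OF finite_low] z psum_continuous[OF finite_low] z]
  show ?thesis .
qed

end

subsection \<open>Regularity of exact measures\<close>

text \<open>With \<open>t = sin\<^sup>2 (\<theta>/2)\<close>, \<open>sp j\<close> is \<open>sin\<^sup>2 (2\<^sup>j \<theta>/2)\<close> and \<open>fp j\<close> is the Fejer type
  kernel \<open>sin\<^sup>2 (2\<^sup>j \<theta>/2) / (4\<^sup>j sin\<^sup>2 (\<theta>/2))\<close>.\<close>

primrec sp :: "nat \<Rightarrow> real poly" where
  "sp 0 = [:0, 1:]"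
| "sp (Suc j) = smult 4 (sp j * (1 - sp j))"

primrec fp :: "nat \<Rightarrow> real poly" where
  "fp 0 = 1"
| "fp (Suc j) = fp j * (1 - sp j)"

lemma sp_eq: "poly (sp j) t = 4 ^ j * t * poly (fp j) t"
  by (induction j) (simp_all add: algebra_simps)

lemma sp_range:
  assumes "0 \<le> t" "t \<le> 1"
  shows "0 \<le> poly (sp j) t \<and> poly (sp j) t \<le> 1"
proof (induction j)
  case 0 then show ?case using assms by simp
next
  case (Suc j)
  have "4 * (a * (1 - a)) \<le> 1" for a :: real
    using zero_le_power2[of "2 * a - 1"] by (simp add: power2_eq_square algebra_simps)
  then show ?case using Suc by simp
qed

lemma fp_range:
  assumes "0 \<le> t" "t \<le> 1"
  shows "0 \<le> poly (fp j) t \<and> poly (fp j) t \<le> 1"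
proof (induction j)
  case (Suc j)
  then show ?case using sp_range[OF assms, of j] by (auto intro!: mult_le_one)
qed simp

text \<open>The step from \<open>j\<close> to \<open>Suc j\<close> loses
  \<open>fp j * sp j \<le> 4 ^ j * t\<close>, and the losses form a geometric sum.\<close>

lemma fp_lower:
  assumes t: "0 \<le> t" "t \<le> 1"
  shows "1 - t * (4 ^ j - 1) / 3 \<le> poly (fp j) t"
proof (induction j)
  case (Suc j)
  have "poly (fp j) t * poly (sp j) t \<le> 1 * poly (sp j) t"
    using fp_range[OF t, of j] sp_range[OF t, of j] by (intro mult_right_mono) auto
  moreover have "poly (sp j) t \<le> 4 ^ j * t"
    unfolding sp_eq using fp_range[OF t, of j] t by (intro mult_left_le) auto
  ultimately have "poly (fp j) t - 4 ^ j * t \<le> poly (fp (Suc j)) t" by (simp add: algebra_simps)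
  moreover have "1 - t * (4 ^ Suc j - 1) / 3 = (1 - t * (4 ^ j - 1) / 3) - 4 ^ j * t" by (simp add: field_simps)
  ultimately show ?case using Suc by linarith
qed simp

lemma fp_ge:
  assumes t: "0 \<le> t" "t \<le> 1" and j: "t * 4 ^ j \<le> 1"
  shows "4 / 9 \<le> (poly (fp j) t)\<^sup>2"
proof -
  have "t * (4 ^ j - 1) \<le> 1" using j t by (simp add: algebra_simps)
  then have "2 / 3 \<le> poly (fp j) t" using fp_lower[OF t, of j] by linarith
  then have "(2 / 3)\<^sup>2 \<le> (poly (fp j) t)\<^sup>2" by (intro power_mono) auto
  then show ?thesis by (simp add: power_divide)
qed

text \<open>Both \<open>fp j\<close> and \<open>4 ^ j * t * fp j = sp j\<close> are at most one;
  adding the two bounds gives \<open>(1 + 4 ^ j * t) * fp j \<le> 2\<close>.\<close>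

lemma fp_upper:
  assumes t: "0 \<le> t" "t \<le> 1"
  shows "(poly (fp j) t)\<^sup>2 \<le> 4 / (1 + 4 ^ j * t)\<^sup>2"
proof -
  define a where "a = 4 ^ j * t"
  have a: "0 \<le> a" using t by (simp add: a_def)
  note f = fp_range[OF t, of j]
  have af: "a * poly (fp j) t \<le> 1" using sp_range[OF t, of j] by (simp add: sp_eq a_def)
  have "(1 + a) * poly (fp j) t \<le> 2" using f af by (simp add: distrib_right)
  then have "((1 + a) * poly (fp j) t)\<^sup>2 \<le> 2\<^sup>2" using a f by (intro power_mono) auto
  then have "(poly (fp j) t)\<^sup>2 * (1 + a)\<^sup>2 \<le> 4" by (simp add: power_mult_distrib mult.commute)
  then show ?thesis using a by (subst pos_le_divide_eq) (auto simp: a_def)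
qed

lemma degree_sp: "degree (sp j) \<le> 2 ^ j"
proof (induction j)
  case (Suc j)
  have "degree (1 - sp j) \<le> 2 ^ j" by (rule degree_diff_le) (use Suc in auto)
  then have "degree (sp j * (1 - sp j)) \<le> 2 ^ j + 2 ^ j" using Suc by (intro order_trans[OF degree_mult_le]) auto
  then show ?case by simp
qed simp

lemma degree_fp: "degree (fp j) + 1 \<le> 2 ^ j"
proof (induction j)
  case (Suc j)
  have "degree (1 - sp j) \<le> 2 ^ j" by (rule degree_diff_le) (use degree_sp[of j] in auto)
  then have "degree (fp j * (1 - sp j)) + 1 \<le> 2 ^ j + 2 ^ j" using Suc degree_mult_le[of "fp j" "1 - sp j"] by linarith
  then show ?case by simp
qed simp

lemma has_integral_poly_01:
  "((\<lambda>t. poly p t) has_integral (\<Sum>i\<le>degree p. coeff p i / (real i + 1))) {0..1::real}"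
proof -
  have "((\<lambda>t. coeff p i * t ^ i) has_integral (coeff p i / (real i + 1))) {0..1}" for i
  proof -
    let ?a = "coeff p i / (real i + 1)"
    have "((\<lambda>t. coeff p i * t ^ i) has_integral (?a * 1 ^ Suc i - ?a * 0 ^ Suc i)) {0..1}"
    proof (rule fundamental_theorem_of_calculus)
      fix t :: real
      have "((\<lambda>t. ?a * t ^ Suc i) has_real_derivative ?a * (real (Suc i) * t ^ (Suc i - Suc 0))) (at t within {0..1})"
        by (rule DERIV_cmult[OF DERIV_pow])
      moreover have "?a * (real (Suc i) * t ^ (Suc i - Suc 0)) = coeff p i * t ^ i" by (simp add: add.commute)
      ultimately show "((\<lambda>t. ?a * t ^ Suc i) has_vector_derivative coeff p i * t ^ i) (at t within {0..1})"
        by (simp only: has_real_derivative_iff_has_vector_derivative)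
    qed simp
    then show ?thesis by simp
  qed
  then show ?thesis unfolding poly_altdef by (intro has_integral_sum) auto
qed

text \<open>The left side is the integral of the square of \<open>fp j\<close> over the unit
  interval, in the form in which \<open>integral_poly_zon\<close> delivers it.\<close>

lemma fp_integral: "(\<Sum>i\<le>degree (fp j * fp j). coeff (fp j * fp j) i / (real i + 1)) \<le> 4 / 4 ^ j"
proof -
  define c :: real where "c = 4 ^ j"
  have c: "c > 0" by (simp add: c_def)
  have "((\<lambda>t. 4 / (1 + c * t)\<^sup>2) has_integral (- 4 / (c * (1 + c * 1)) - - 4 / (c * (1 + c * 0)))) {0..1}"
  proof (rule fundamental_theorem_of_calculus)
    fix t :: real assume t: "t \<in> {0..1}"
    then have pos: "1 + c * t > 0" using c by (simp add: add_pos_nonneg)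
    have "((\<lambda>t. - 4 / (c * (1 + c * t))) has_real_derivative (0 * (c * (1 + c * t)) - - 4 * (c * c)) / ((c * (1 + c * t)) * (c * (1 + c * t)))) (at t)"
      using pos c by (intro DERIV_divide DERIV_const) (auto intro!: derivative_eq_intros)
    moreover have "(0 * (c * (1 + c * t)) - - 4 * (c * c)) / ((c * (1 + c * t)) * (c * (1 + c * t))) = 4 / (1 + c * t)\<^sup>2"
      using pos c by (simp add: power2_eq_square)
    ultimately show "((\<lambda>t. - 4 / (c * (1 + c * t))) has_vector_derivative 4 / (1 + c * t)\<^sup>2) (at t within {0..1})"
      by (simp add: has_real_derivative_iff_has_vector_derivative[symmetric] has_field_derivative_at_within)
  qed simp
  from has_integral_le[OF has_integral_poly_01 this, of "fp j * fp j"]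
  have "(\<Sum>i\<le>degree (fp j * fp j). coeff (fp j * fp j) i / (real i + 1)) \<le> - 4 / (c * (1 + c * 1)) - - 4 / (c * (1 + c * 0))"
    using fp_upper[of _ j] by (auto simp: power2_eq_square c_def)
  also have "\<dots> \<le> 4 / c" using c by simp
  finally show ?thesis by (simp add: c_def)
qed

lemma uminus_S2: "y \<in> S2 \<Longrightarrow> - y \<in> S2" by simp

lemma zon_uminus: "zon (- y) x = 1 - zon y x"
  by (simp add: zon_def field_simps)

text \<open>A power of high degree is dominated by squares of kernels whose degree an exact measure
  can handle. Moving \<open>i\<close> scales away, the power has decayed to order
  \<open>(1 / 16) ^ i\<close>, so the weight \<open>(1 / 8) ^ i\<close> suffices, while the
  integrals of the squared kernels grow like \<open>4 ^ i\<close>, so the weighted sum stays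
  bounded.\<close>

lemma one_minus_power_le:
  assumes t: "0 \<le> t" "t \<le> 1" and N: "4 ^ J \<le> N"
  shows "(1 - t) ^ N \<le> 72 * (\<Sum>i\<le>J. (1 / 8) ^ i * (poly (fp (J - i)) t)\<^sup>2)"
proof -
  have term_le: "(1 / 8) ^ i * (poly (fp (J - i)) t)\<^sup>2 \<le> (\<Sum>i\<le>J. (1 / 8) ^ i * (poly (fp (J - i)) t)\<^sup>2)" if "i \<le> J" for i
    by (rule member_le_sum) (use that in auto)
  show ?thesis
  proof (cases "t * 4 ^ J \<le> 1")
    case True
    have "(1 - t) ^ N \<le> 1" using t by (intro power_le_one) auto
    moreover have "4 / 9 \<le> (\<Sum>i\<le>J. (1 / 8) ^ i * (poly (fp (J - i)) t)\<^sup>2)"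
      using term_le[of 0] fp_ge[OF t True] by simp
    ultimately show ?thesis by linarith
  next
    case False
    \<comment> \<open>\<open>j\<close> is a scale with
      \<open>t * 4 ^ j \<le> 1 < t * 4 ^ Suc j\<close>: the first inequality bounds
      \<open>fp j\<close> below by \<open>2 / 3\<close>, the second makes the power small.\<close>
    then have "t * 4 ^ J > 1" "\<not> t * 4 ^ 0 > 1" using t by auto
    from ex_least_nat_less[of "\<lambda>n. t * 4 ^ n > 1", OF this]
    obtain j where j: "j < J" "t * 4 ^ j \<le> 1" "t * 4 ^ Suc j > 1" by (auto simp: not_less simp del: power_Suc)
    define i where "i = J - j"
    have i: "i \<le> J" "J - i = j" "J = j + i" using j(1) by (auto simp: i_def)
    define y :: real where "y = 4 ^ i / 4"
    have y: "y > 0" by (simp add: y_def)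
    have "y * 1 \<le> y * (t * 4 ^ Suc j)" using j(3) y by (intro mult_left_mono) auto
    also have "\<dots> = t * 4 ^ J" by (simp add: y_def i(3) power_add)
    also have "\<dots> \<le> t * real N" using N t by (intro mult_left_mono) (metis of_nat_le_iff of_nat_numeral of_nat_power)+
    finally have ty: "y \<le> t * real N" by simp
    have "1 - t \<le> exp (- t)" using exp_ge_add_one_self[of "- t"] by simp
    then have "(1 - t) ^ N \<le> exp (- t) ^ N" using t by (intro power_mono) auto
    also have "\<dots> = exp (- (t * real N))" by (simp add: exp_of_nat_mult[symmetric] mult.commute)
    also have "\<dots> \<le> exp (- y)" using ty by simp
    also have "exp (- y) \<le> 2 / y\<^sup>2"
    proof -
      have "y\<^sup>2 / 2 \<le> exp y" using exp_lower_Taylor_quadratic[of y] y by simp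
      then show ?thesis using y by (simp add: exp_minus field_simps)
    qed
    also have "2 / y\<^sup>2 = 32 * (1 / 16) ^ i"
    proof -
      have "(4::real) ^ i * 4 ^ i = 16 ^ i" by (simp add: power_mult_distrib[symmetric])
      then show ?thesis by (simp add: y_def power2_eq_square power_one_over)
    qed
    also have "\<dots> \<le> 32 * (1 / 8) ^ i" by (intro mult_left_mono power_mono) auto
    \<comment> \<open>The constant comes from \<open>72 * (4 / 9) = 32\<close>.\<close>
    also have "\<dots> \<le> 72 * ((1 / 8) ^ i * (poly (fp (J - i)) t)\<^sup>2)"
    proof -
      have "(1 / 8 :: real) ^ i * (4 / 9) \<le> (1 / 8) ^ i * (poly (fp (J - i)) t)\<^sup>2"
        unfolding i(2) by (intro mult_left_mono fp_ge[OF t j(2)]) simp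
      then show ?thesis by linarith
    qed
    also have "\<dots> \<le> 72 * (\<Sum>i\<le>J. (1 / 8) ^ i * (poly (fp (J - i)) t)\<^sup>2)"
      by (intro mult_left_mono term_le i) simp
    finally show ?thesis .
  qed
qed

context S2_prob begin

text \<open>Up to the degree of exactness \<open>zon y\<close> has the moments of the uniform
  distribution on \<open>[0, 1]\<close>, as it has under the surface measure.\<close>

lemma integral_poly_zon:
  assumes ex: "exact D" and p: "degree p \<le> D" and y: "y \<in> S2"
  shows "(\<integral>x. poly p (zon y x) \<partial>M) = (\<Sum>i\<le>degree p. coeff p i / (real i + 1))"
proof -
  have i: "integrable M (\<lambda>x. coeff p i * zon y x ^ i)" for i by (intro integrable_cont continuous_intros)
  have "(\<integral>x. poly p (zon y x) \<partial>M) = (\<Sum>i\<le>degree p. \<integral>x. coeff p i * zon y x ^ i \<partial>M)"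
    unfolding poly_altdef by (rule Bochner_Integration.integral_sum) (rule i)
  also have "\<dots> = (\<Sum>i\<le>degree p. coeff p i / (real i + 1))"
  proof (rule sum.cong[OF refl])
    fix i assume "i \<in> {..degree p}"
    then have "i + 0 \<le> D" using p by simp
    then have "(\<integral>x. zon y x ^ i \<partial>M) = 1 / (real i + 1)"
      using exact_zon_powers[OF ex _ y y, of i 0] integral_zon_power[OF y, of i] by (simp add: zon_commute[of _ y])
    then show "(\<integral>x. coeff p i * zon y x ^ i \<partial>M) = coeff p i / (real i + 1)" by simp
  qed
  finally show ?thesis .
qed

text \<open>For the surface measure the left side is one; beyond the resolution of an exact measure
  it grows at most like \<open>N / 4 ^ J\<close>. The antipode of \<open>y\<close> enters because
  \<open>1 - zon y x = zon (- y) x\<close> is the variable of the kernels, and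
  \<open>576 = 72 * 4 * 2\<close>.\<close>

lemma exact_regular:
  assumes ex: "exact (2 * 2 ^ J)" and N: "4 ^ J \<le> N" and y: "y \<in> S2"
  shows "(\<integral>x. (real N + 1) * zon x y ^ N \<partial>M) \<le> 576 * (real N + 1) / 4 ^ J"
proof -
  note y' = uminus_S2[OF y]
  define t where "t x = zon (- y) x" for x
  have ct: "continuous_on S2 t" unfolding t_def[abs_def] by (intro continuous_intros)
  have t: "0 \<le> t x" "t x \<le> 1" if "x \<in> S2" for x
    using zon_nonneg[OF y' that] zon_le_1[OF y' that] by (simp_all add: t_def)
  have cp: "continuous_on S2 (\<lambda>x. (poly p (t x))\<^sup>2)" for p by (intro continuous_intros ct)
  have "(\<integral>x. zon x y ^ N \<partial>M) \<le> (\<integral>x. 72 * (\<Sum>i\<le>J. (1 / 8) ^ i * (poly (fp (J - i)) (t x))\<^sup>2) \<partial>M)"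
  proof (rule integral_mono)
    show "integrable M (\<lambda>x. zon x y ^ N)" unfolding zon_commute[of _ y] by (intro integrable_cont continuous_intros)
    show "integrable M (\<lambda>x. 72 * (\<Sum>i\<le>J. (1 / 8) ^ i * (poly (fp (J - i)) (t x))\<^sup>2))"
      by (intro integrable_cont continuous_intros ct)
    fix x assume "x \<in> space M"
    then have x: "x \<in> S2" by (simp add: space_M)
    have "zon x y = 1 - t x" by (simp add: t_def zon_uminus zon_commute[of x])
    then show "zon x y ^ N \<le> 72 * (\<Sum>i\<le>J. (1 / 8) ^ i * (poly (fp (J - i)) (t x))\<^sup>2)"
      using one_minus_power_le[OF t[OF x] N] by simp
  qed
  also have "\<dots> = 72 * (\<integral>x. (\<Sum>i\<le>J. (1 / 8) ^ i * (poly (fp (J - i)) (t x))\<^sup>2) \<partial>M)"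
    by (rule integral_mult_right_zero)
  also have "(\<integral>x. (\<Sum>i\<le>J. (1 / 8) ^ i * (poly (fp (J - i)) (t x))\<^sup>2) \<partial>M)
      = (\<Sum>i\<le>J. \<integral>x. (1 / 8) ^ i * (poly (fp (J - i)) (t x))\<^sup>2 \<partial>M)"
    by (rule Bochner_Integration.integral_sum) (intro integrable_cont continuous_intros ct)
  also have "\<dots> = (\<Sum>i\<le>J. (1 / 8) ^ i * (\<integral>x. (poly (fp (J - i)) (t x))\<^sup>2 \<partial>M))"
    by (simp only: integral_mult_right_zero)
  also have "\<dots> \<le> (\<Sum>i\<le>J. (1 / 8) ^ i * (4 / 4 ^ (J - i)))"
  proof (intro sum_mono mult_left_mono)
    fix i assume "i \<in> {..J}"
    let ?p = "fp (J - i) * fp (J - i)"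
    have "degree ?p \<le> 2 ^ (J - i) + 2 ^ (J - i)"
      using degree_mult_le[of "fp (J - i)" "fp (J - i)"] degree_fp[of "J - i"] by linarith
    also have "\<dots> \<le> 2 * 2 ^ J"
    proof -
      have "(2::nat) ^ (J - i) \<le> 2 ^ J" by (rule power_increasing) auto
      then show ?thesis by linarith
    qed
    finally have d: "degree ?p \<le> 2 * 2 ^ J" .
    have "(\<integral>x. (poly (fp (J - i)) (t x))\<^sup>2 \<partial>M) = (\<integral>x. poly ?p (zon (- y) x) \<partial>M)"
      by (simp only: t_def power2_eq_square poly_mult)
    also have "\<dots> = (\<Sum>k\<le>degree ?p. coeff ?p k / (real k + 1))" by (rule integral_poly_zon[OF ex d y'])
    also have "\<dots> \<le> 4 / 4 ^ (J - i)" by (rule fp_integral)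
    finally show "(\<integral>x. (poly (fp (J - i)) (t x))\<^sup>2 \<partial>M) \<le> 4 / 4 ^ (J - i)" .
  qed simp
  also have "\<dots> = (\<Sum>i\<le>J. 4 / 4 ^ J * (1 / 2) ^ i)"
  proof (rule sum.cong[OF refl])
    fix i assume "i \<in> {..J}"
    then have "(4::real) ^ J = 4 ^ (J - i) * 4 ^ i" by (simp add: power_add[symmetric])
    moreover have "(8::real) ^ i = 4 ^ i * 2 ^ i" by (simp add: power_mult_distrib[symmetric])
    ultimately show "(1 / 8) ^ i * (4 / 4 ^ (J - i)) = 4 / 4 ^ J * (1 / 2 :: real) ^ i"
      by (simp add: power_one_over)
  qed
  also have "\<dots> = 4 / 4 ^ J * (\<Sum>i\<le>J. (1 / 2) ^ i)" by (simp only: sum_distrib_left)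
  finally have le: "(\<integral>x. zon x y ^ N \<partial>M) \<le> 72 * (4 / 4 ^ J * (\<Sum>i\<le>J. (1 / 2) ^ i))" by simp
  have "(\<Sum>i\<le>J. (1 / 2 :: real) ^ i) \<le> 2"
  proof -
    have "(\<Sum>i\<le>J. (1 / 2 :: real) ^ i) \<le> (\<Sum>i. (1 / 2) ^ i)"
      by (rule sum_le_suminf) (auto intro!: summable_geometric)
    also have "\<dots> = 2" by (subst suminf_geometric) auto
    finally show ?thesis .
  qed
  then have "72 * (4 / 4 ^ J * (\<Sum>i\<le>J. (1 / 2 :: real) ^ i)) \<le> 72 * (4 / 4 ^ J * 2)"
    by (intro mult_left_mono) simp_all
  with le have "(\<integral>x. zon x y ^ N \<partial>M) \<le> 72 * (4 / 4 ^ J * 2)" by (rule order_trans)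
  then have "(real N + 1) * (\<integral>x. zon x y ^ N \<partial>M) \<le> (real N + 1) * (72 * (4 / 4 ^ J * 2))"
    by (rule mult_left_mono) simp
  then show ?thesis by (simp add: mult.commute)
qed

subsection \<open>The approximation error of exact measures\<close>

text \<open>The sampling inequality, with the regularity bound for \<open>N = 8 * 4 ^ j\<close>,
  estimates the mean square on the block by its energy times a multiple of
  \<open>4 ^ j / 4 ^ J\<close>; here \<open>4 * 576 * 9 = 144 * 144\<close>.\<close>

lemma blk_integral_le:
  assumes ex: "exact (2 * 2 ^ J)" and f: "in_Hs s f" and s: "0 \<le> s" and j: "J \<le> j"
  shows "(\<integral>x. \<bar>psum f (blk j) x\<bar> \<partial>M) \<le> 144 * Hs_norm s f * (2 powr (1 - s)) ^ j / 2 ^ J"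
proof (rule integral_abs_le[OF psum_continuous[OF finite_blk]])
  define N :: nat where "N = 8 * 4 ^ j"
  have "(4::nat) ^ J \<le> 4 ^ j" using j by (intro power_increasing) auto
  then have NJ: "4 ^ J \<le> N" unfolding N_def by (rule order_trans) simp
  have "(\<integral>x. (psum f (blk j) x)\<^sup>2 \<partial>M) \<le> 4 * (576 * (real N + 1) / 4 ^ J) * (\<Sum>k\<in>blk j. (inner_L2 f (LB_phi k))\<^sup>2)"
    unfolding psum_def
  proof (rule sampling_inequality[OF finite_blk])
    show "2 * LB_lam k \<le> real N + 1" if "k \<in> blk j" for k using blk_lam_le[OF that] by (simp add: N_def)
    show "(\<integral>x. (real N + 1) * zon x y ^ N \<partial>M) \<le> 576 * (real N + 1) / 4 ^ J" if "y \<in> S2" for y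
      by (rule exact_regular[OF ex NJ that])
  qed
  also have "\<dots> \<le> 4 * (576 * (9 * 4 ^ j) / 4 ^ J) * ((2 powr - s) ^ j * Hs_norm s f)\<^sup>2"
    by (intro mult_mono blk_energy[OF f s] mult_left_mono divide_right_mono) (simp_all add: N_def sum_nonneg)
  also have "\<dots> = (144 * Hs_norm s f * ((2 powr - s) ^ j * 2 ^ j) / 2 ^ J)\<^sup>2"
  proof -
    have "(4::real) ^ n = (2 ^ n)\<^sup>2" for n
    proof -
      have "((2::real) ^ n)\<^sup>2 = (2\<^sup>2) ^ n" by (metis power_mult mult.commute)
      then show ?thesis by simp
    qed
    then show ?thesis by (simp add: power_mult_distrib power_divide)
  qed
  also have "(2 powr - s) ^ j * 2 ^ j = ((2::real) powr (1 - s)) ^ j"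
    unfolding power_mult_distrib[symmetric] by (simp add: powr_diff powr_minus_divide)
  finally show "(\<integral>x. (psum f (blk j) x)\<^sup>2 \<partial>M) \<le> (144 * Hs_norm s f * (2 powr (1 - s)) ^ j / 2 ^ J)\<^sup>2" .
  show "0 \<le> 144 * Hs_norm s f * (2 powr (1 - s)) ^ j / 2 ^ J" using Hs_norm_nonneg[OF f] by simp
qed

lemma geometric_tail_le:
  fixes q :: real
  assumes "0 \<le> q" "q < 1" "J \<le> P"
  shows "(\<Sum>j\<in>{J..<P}. q ^ j) \<le> q ^ J / (1 - q)"
proof -
  have "(1 - q) * (\<Sum>j\<in>{J..<P}. q ^ j) = q ^ J - q ^ P"
    using assms(3)
  proof (induction rule: dec_induct)
    case (step n)
    have "(\<Sum>j\<in>{J..<Suc n}. q ^ j) = (\<Sum>j\<in>{J..<n}. q ^ j) + q ^ n" using step by simp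
    then have "(1 - q) * (\<Sum>j\<in>{J..<Suc n}. q ^ j) = (1 - q) * (\<Sum>j\<in>{J..<n}. q ^ j) + (1 - q) * q ^ n"
      by (simp only: distrib_left)
    then show ?case using step.IH by (simp add: left_diff_distrib)
  qed simp
  also have "\<dots> \<le> q ^ J" using assms by simp
  finally show ?thesis using assms by (simp add: pos_le_divide_eq mult.commute)
qed

lemma psum_low_split: "J \<le> P \<Longrightarrow> psum f (low P) x = psum f (low J) x + (\<Sum>j\<in>{J..<P}. psum f (blk j) x)"
  unfolding psum_low lessThan_atLeast0 by (simp add: sum.atLeastLessThan_concat)

text \<open>The difference of products is split so that one factor is a sum of high blocks, measured
  in the mean, and the other a partial sum, bounded uniformly. With
  \<open>q = 2 powr (1 - s)\<close> the blocks sum to order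
  \<open>q ^ J / 2 ^ J = (2 powr - s) ^ J\<close>, and \<open>1728 = 2 * 6 * 144\<close>.\<close>

lemma truncation_error:
  assumes ex: "exact (2 * 2 ^ J)" and f: "in_Hs s f" "continuous_on S2 f" and r: "in_Hs s r" "continuous_on S2 r"
    and s: "1 < s" and P: "J \<le> P"
  shows "\<bar>(\<integral>x. psum f (low P) x * psum r (low P) x \<partial>M) - (\<integral>x. psum f (low J) x * psum r (low J) x \<partial>M)\<bar>
     \<le> 1728 / (1 - 2 powr (1 - s))\<^sup>2 * Hs_norm s f * Hs_norm s r * (2 powr - s) ^ J"
proof -
  define q where "q = 2 powr (1 - s)"
  note qq = psum_converges(1,2)[OF f s, folded q_def]
  define F where "F = 6 * Hs_norm s f / (1 - q)"
  define R where "R = 6 * Hs_norm s r / (1 - q)"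
  have nn: "0 \<le> Hs_norm s f" "0 \<le> Hs_norm s r" using Hs_norm_nonneg f r by auto
  have FR: "0 \<le> F" "0 \<le> R" using nn qq by (simp_all add: F_def R_def)
  note c = psum_continuous[OF finite_low] psum_continuous[OF finite_blk]
  have pt: "\<bar>psum f (low P) x * psum r (low P) x - psum f (low J) x * psum r (low J) x\<bar>
      \<le> (\<Sum>j\<in>{J..<P}. R * \<bar>psum f (blk j) x\<bar> + F * \<bar>psum r (blk j) x\<bar>)" if x: "x \<in> S2" for x
  proof -
    have "psum f (low P) x * psum r (low P) x - psum f (low J) x * psum r (low J) x
       = (\<Sum>j\<in>{J..<P}. psum f (blk j) x) * psum r (low P) x + psum f (low J) x * (\<Sum>j\<in>{J..<P}. psum r (blk j) x)"
      unfolding psum_low_split[OF P, of f] psum_low_split[OF P, of r] by (simp add: algebra_simps)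
    also have "\<bar>\<dots>\<bar> \<le> \<bar>\<Sum>j\<in>{J..<P}. psum f (blk j) x\<bar> * \<bar>psum r (low P) x\<bar> + \<bar>psum f (low J) x\<bar> * \<bar>\<Sum>j\<in>{J..<P}. psum r (blk j) x\<bar>"
      by (rule order_trans[OF abs_triangle_ineq]) (simp add: abs_mult)
    also have "\<dots> \<le> (\<Sum>j\<in>{J..<P}. \<bar>psum f (blk j) x\<bar>) * R + F * (\<Sum>j\<in>{J..<P}. \<bar>psum r (blk j) x\<bar>)"
      using psum_converges(4)[OF f s x, of J] psum_converges(4)[OF r s x, of P] FR
      by (intro add_mono mult_mono sum_abs) (auto simp: F_def R_def q_def sum_nonneg)
    finally show ?thesis by (simp add: sum_distrib_left sum.distrib mult.commute)
  qed
  have "\<bar>(\<integral>x. psum f (low P) x * psum r (low P) x \<partial>M) - (\<integral>x. psum f (low J) x * psum r (low J) x \<partial>M)\<bar>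
     = \<bar>\<integral>x. psum f (low P) x * psum r (low P) x - psum f (low J) x * psum r (low J) x \<partial>M\<bar>"
    by (subst Bochner_Integration.integral_diff) (auto intro!: integrable_cont continuous_intros c)
  also have "\<dots> \<le> (\<integral>x. \<bar>psum f (low P) x * psum r (low P) x - psum f (low J) x * psum r (low J) x\<bar> \<partial>M)"
    by (rule integral_abs_bound)
  also have "\<dots> \<le> (\<integral>x. (\<Sum>j\<in>{J..<P}. R * \<bar>psum f (blk j) x\<bar> + F * \<bar>psum r (blk j) x\<bar>) \<partial>M)"
  proof (rule integral_mono)
    show "integrable M (\<lambda>x. \<bar>psum f (low P) x * psum r (low P) x - psum f (low J) x * psum r (low J) x\<bar>)"
      by (intro integrable_cont continuous_intros c)
    show "integrable M (\<lambda>x. \<Sum>j\<in>{J..<P}. R * \<bar>psum f (blk j) x\<bar> + F * \<bar>psum r (blk j) x\<bar>)"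
      by (intro integrable_cont continuous_intros c)
  qed (simp add: space_M pt)
  also have "\<dots> = (\<Sum>j\<in>{J..<P}. \<integral>x. R * \<bar>psum f (blk j) x\<bar> + F * \<bar>psum r (blk j) x\<bar> \<partial>M)"
    by (rule Bochner_Integration.integral_sum) (intro integrable_cont continuous_intros c)
  also have "\<dots> = (\<Sum>j\<in>{J..<P}. R * (\<integral>x. \<bar>psum f (blk j) x\<bar> \<partial>M) + F * (\<integral>x. \<bar>psum r (blk j) x\<bar> \<partial>M))"
  proof (rule sum.cong[OF refl])
    fix j
    have "(\<integral>x. R * \<bar>psum f (blk j) x\<bar> + F * \<bar>psum r (blk j) x\<bar> \<partial>M) =
      (\<integral>x. R * \<bar>psum f (blk j) x\<bar> \<partial>M) + (\<integral>x. F * \<bar>psum r (blk j) x\<bar> \<partial>M)"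
      by (rule Bochner_Integration.integral_add) (intro integrable_cont continuous_intros c)+
    then show "(\<integral>x. R * \<bar>psum f (blk j) x\<bar> + F * \<bar>psum r (blk j) x\<bar> \<partial>M) =
      R * (\<integral>x. \<bar>psum f (blk j) x\<bar> \<partial>M) + F * (\<integral>x. \<bar>psum r (blk j) x\<bar> \<partial>M)"
      by (simp only: integral_mult_right_zero)
  qed
  also have "\<dots> \<le> (\<Sum>j\<in>{J..<P}. R * (144 * Hs_norm s f * q ^ j / 2 ^ J) + F * (144 * Hs_norm s r * q ^ j / 2 ^ J))"
    using blk_integral_le[OF ex f(1)] blk_integral_le[OF ex r(1)] s FR
    by (intro sum_mono add_mono mult_left_mono) (auto simp: q_def)
  also have "\<dots> = 1728 / (1 - q) * Hs_norm s f * Hs_norm s r / 2 ^ J * (\<Sum>j\<in>{J..<P}. q ^ j)"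
    unfolding sum_distrib_left by (rule sum.cong[OF refl]) (simp add: F_def R_def)
  also have "\<dots> \<le> 1728 / (1 - q) * Hs_norm s f * Hs_norm s r / 2 ^ J * (q ^ J / (1 - q))"
    using qq nn by (intro mult_left_mono geometric_tail_le P) auto
  also have "\<dots> = 1728 / (1 - q)\<^sup>2 * Hs_norm s f * Hs_norm s r * (q ^ J / 2 ^ J)"
    by (simp add: power2_eq_square)
  also have "q ^ J / 2 ^ J = (2 powr - s) ^ J"
    unfolding power_divide[symmetric] q_def by (simp add: powr_diff powr_minus_divide)
  finally show ?thesis unfolding q_def .
qed

lemma psum_integral_tendsto:
  assumes f: "in_Hs s f" "continuous_on S2 f" and r: "in_Hs s r" "continuous_on S2 r" and s: "1 < s"
  shows "(\<lambda>P. \<integral>x. psum f (low P) x * psum r (low P) x \<partial>M) \<longlonglongrightarrow> (\<integral>x. f x * r x \<partial>M)"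
proof (rule integral_dominated_convergence)
  let ?F = "6 * Hs_norm s f / (1 - 2 powr (1 - s))" and ?R = "6 * Hs_norm s r / (1 - 2 powr (1 - s))"
  show "(\<lambda>x. f x * r x) \<in> borel_measurable M"
    by (rule borel_measurable_integrable, intro integrable_cont continuous_intros f r)
  show "(\<lambda>x. psum f (low P) x * psum r (low P) x) \<in> borel_measurable M" for P
    by (rule borel_measurable_integrable, intro integrable_cont continuous_intros psum_continuous finite_low)
  show "integrable M (\<lambda>x. ?F * ?R)" by simp
  show "AE x in M. (\<lambda>P. psum f (low P) x * psum r (low P) x) \<longlonglongrightarrow> f x * r x"
    by (intro AE_I2 tendsto_mult psum_converges(3)[OF f s] psum_converges(3)[OF r s]) (simp_all add: space_M)
  show "AE x in M. norm (psum f (low P) x * psum r (low P) x) \<le> ?F * ?R" for P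
  proof (rule AE_I2)
    fix x assume "x \<in> space M"
    then have x: "x \<in> S2" by (simp add: space_M)
    have "0 \<le> ?F" using psum_converges(5)[OF f s x] abs_ge_zero order_trans by blast
    then show "norm (psum f (low P) x * psum r (low P) x) \<le> ?F * ?R"
      unfolding real_norm_def abs_mult
      by (intro mult_mono psum_converges(4)[OF f s x] psum_converges(4)[OF r s x]) simp_all
  qed
qed

end

lemma sigma_exact: "sigma.exact D"
  by (simp add: sigma.exact_def)

text \<open>Low frequency products have the same integral under both measures. The surface measure
  is itself exact of every degree, so both truncation errors obey the same bound, which doubles the
  constant.\<close>

lemma (in S2_prob) exact_error:
  assumes ex: "exact (2 * 2 ^ J)" and f: "in_Hs s f" "continuous_on S2 f" and r: "in_Hs s r" "continuous_on S2 r"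
    and s: "1 < s"
  shows "\<bar>(\<integral>x. f x * r x \<partial>M) - (\<integral>x. f x * r x \<partial>sigma_S2)\<bar>
     \<le> 3456 / (1 - 2 powr (1 - s))\<^sup>2 * Hs_norm s f * Hs_norm s r * (2 powr - s) ^ J"
proof -
  let ?E = "1728 / (1 - 2 powr (1 - s))\<^sup>2 * Hs_norm s f * Hs_norm s r * (2 powr - s) ^ J"
  let ?I = "\<lambda>P. \<integral>x. psum f (low P) x * psum r (low P) x \<partial>M"
  let ?S = "\<lambda>P. \<integral>x. psum f (low P) x * psum r (low P) x \<partial>sigma_S2"
  have "\<bar>?I P - ?S P\<bar> \<le> 2 * ?E" if P: "P \<ge> J" for P
    using truncation_error[OF ex f r s P] sigma.truncation_error[OF sigma_exact f r s P]
      exact_psum_product[OF ex, of f r] by linarith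
  moreover have "(\<lambda>P. \<bar>?I P - ?S P\<bar>) \<longlonglongrightarrow> \<bar>(\<integral>x. f x * r x \<partial>M) - (\<integral>x. f x * r x \<partial>sigma_S2)\<bar>"
    by (intro tendsto_rabs tendsto_diff psum_integral_tendsto[OF f r s] sigma.psum_integral_tendsto[OF f r s])
  ultimately have "\<bar>(\<integral>x. f x * r x \<partial>M) - (\<integral>x. f x * r x \<partial>sigma_S2)\<bar> \<le> 2 * ?E"
    by (intro LIMSEQ_le_const2) blast+
  then show ?thesis by simp
qed

subsection \<open>The weight of the spiral\<close>

text \<open>Truncated Fourier series of \<open>pi / 2 * \<bar>sin (2 * pi * t)\<bar>\<close>. That
  function is the density of the surface measure in the polar angle when \<open>t\<close> in
  \<open>[0, 1]\<close> runs once around a full meridian circle.\<close>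

definition wt :: "nat \<Rightarrow> real \<Rightarrow> real" where
  "wt m t = 1 - 2 * (\<Sum>k\<in>{1..m}. cos (2 * (real k * (2 * pi * t))) / (4 * (real k)\<^sup>2 - 1))"

lemma continuous_wt [continuous_intros]: "continuous_on S (wt m)"
  unfolding wt_def[abs_def] divide_inverse by (intro continuous_intros)

lemma four_sq_pos: "k \<in> {1..m} \<Longrightarrow> 0 < 4 * (real k)\<^sup>2 - 1"
proof -
  assume "k \<in> {1..m}"
  then have "1\<^sup>2 \<le> (real k)\<^sup>2" by (intro power_mono) auto
  then show ?thesis by simp
qed

lemma telescoping_sum: "2 * (\<Sum>k\<in>{1..m}. 1 / (4 * (real k)\<^sup>2 - 1)) = 1 - 1 / (2 * real m + 1)"
proof (induction m)
  case (Suc m)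
  have "2 * (1 / (4 * (real (Suc m))\<^sup>2 - 1)) = 1 / (2 * real m + 1) - 1 / (2 * real (Suc m) + 1)"
  proof -
    have e: "4 * (real (Suc m))\<^sup>2 - 1 = (2 * real m + 1) * (2 * real (Suc m) + 1)"
      by (simp add: power2_eq_square algebra_simps)
    have gen: "2 * (1 / (a * b)) = 1 / a - 1 / b" if "a > 0" "b > 0" "b - a = 2" for a b :: real
      using that by (simp add: diff_frac_eq)
    show ?thesis unfolding e by (rule gen) auto
  qed
  then show ?case using Suc by (simp add: distrib_left)
qed simp

text \<open>Replacing \<open>cos (2 * x)\<close> by \<open>1 - 2 * (sin x)\<^sup>2\<close> and
  telescoping the coefficients exhibits the weight as a positive constant of order
  \<open>1 / m\<close> plus nonnegative terms.\<close>

lemma wt_eq: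
  "wt m t = 1 / (2 * real m + 1) + 4 * (\<Sum>k\<in>{1..m}. (sin (real k * (2 * pi * t)))\<^sup>2 / (4 * (real k)\<^sup>2 - 1))"
proof -
  have "(\<Sum>k\<in>{1..m}. cos (2 * (real k * (2 * pi * t))) / (4 * (real k)\<^sup>2 - 1))
    = (\<Sum>k\<in>{1..m}. 1 / (4 * (real k)\<^sup>2 - 1) - 2 * ((sin (real k * (2 * pi * t)))\<^sup>2 / (4 * (real k)\<^sup>2 - 1)))"
    by (rule sum.cong[OF refl]) (simp only: cos_double_sin diff_divide_distrib times_divide_eq_right)
  also have "\<dots> = (\<Sum>k\<in>{1..m}. 1 / (4 * (real k)\<^sup>2 - 1)) - 2 * (\<Sum>k\<in>{1..m}. (sin (real k * (2 * pi * t)))\<^sup>2 / (4 * (real k)\<^sup>2 - 1))"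
    by (simp only: sum_subtractf sum_distrib_left)
  finally show ?thesis using telescoping_sum[of m] unfolding wt_def by linarith
qed

lemma sin_mult_le: "(sin (real k * x))\<^sup>2 \<le> (real k)\<^sup>2 * (sin x)\<^sup>2"
proof -
  have "\<bar>sin (real k * x)\<bar> \<le> real k * \<bar>sin x\<bar>"
  proof (induction k)
    case (Suc k)
    have "\<bar>sin (real (Suc k) * x)\<bar> = \<bar>sin (real k * x) * cos x + cos (real k * x) * sin x\<bar>"
    proof -
      have "real (Suc k) * x = real k * x + x" by (simp add: distrib_right)
      then show ?thesis by (simp only: sin_add)
    qed
    also have "\<dots> \<le> \<bar>sin (real k * x)\<bar> * \<bar>cos x\<bar> + \<bar>cos (real k * x)\<bar> * \<bar>sin x\<bar>"
      by (rule order_trans[OF abs_triangle_ineq]) (simp add: abs_mult)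
    also have "\<dots> \<le> \<bar>sin (real k * x)\<bar> * 1 + 1 * \<bar>sin x\<bar>"
      by (intro add_mono mult_left_mono mult_right_mono abs_cos_le_one) auto
    finally show ?case using Suc by (simp add: distrib_right)
  qed simp
  then have "\<bar>sin (real k * x)\<bar>\<^sup>2 \<le> (real k * \<bar>sin x\<bar>)\<^sup>2" by (intro power_mono) auto
  then show ?thesis by (simp add: power_mult_distrib)
qed

text \<open>The second difference in \<open>k\<close> of \<open>k\<^sup>2 sin\<^sup>2 x - sin\<^sup>2 (k x)\<close> is \<open>4 sin\<^sup>2 x sin\<^sup>2 (k x)\<close>.\<close>

lemma sin_mult_ge: "(real k)\<^sup>2 * (sin x)\<^sup>2 - (sin (real k * x))\<^sup>2 \<le> real k ^ 4 * ((sin x)\<^sup>2)\<^sup>2 / 3"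
proof -
  define X where "X = (sin x)\<^sup>2"
  define c where "c k = (real k)\<^sup>2 * X - (sin (real k * x))\<^sup>2" for k
  have X: "0 \<le> X" by (simp add: X_def)
  have rec: "c (Suc (Suc k)) - c (Suc k) = c (Suc k) - c k + 4 * X * (sin (real (Suc k) * x))\<^sup>2" for k
  proof -
    let ?y = "real (Suc k) * x"
    have s2: "(sin y)\<^sup>2 = (1 - cos (2 * y)) / 2" for y :: real by (simp add: cos_double_sin)
    have "cos (2 * (real (Suc (Suc k)) * x)) + cos (2 * (real k * x)) = 2 * cos (2 * ?y) * cos (2 * x)"
    proof -
      have "2 * (real (Suc (Suc k)) * x) = 2 * ?y + 2 * x" "2 * (real k * x) = 2 * ?y - 2 * x"
        by (simp_all add: algebra_simps)
      then show ?thesis by (simp add: cos_add cos_diff)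
    qed
    then have "(sin (real (Suc (Suc k)) * x))\<^sup>2 + (sin (real k * x))\<^sup>2 = 1 - cos (2 * ?y) * cos (2 * x)"
      unfolding s2 by (simp add: field_simps)
    also have "\<dots> = 2 * (sin ?y)\<^sup>2 + 2 * X - 4 * X * (sin ?y)\<^sup>2"
      unfolding cos_double_sin X_def by (simp add: algebra_simps)
    finally have "(sin (real (Suc (Suc k)) * x))\<^sup>2 + (sin (real k * x))\<^sup>2 = 2 * (sin ?y)\<^sup>2 + 2 * X - 4 * X * (sin ?y)\<^sup>2" .
    moreover have "(real (Suc (Suc k)))\<^sup>2 * X + (real k)\<^sup>2 * X = 2 * ((real (Suc k))\<^sup>2 * X) + 2 * X"
      by (simp add: power2_eq_square algebra_simps)
    ultimately show ?thesis unfolding c_def by linarith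
  qed
  have "c k \<le> real k ^ 4 * X\<^sup>2 / 3 \<and> c (Suc k) - c k \<le> (real (Suc k) ^ 4 - real k ^ 4) * X\<^sup>2 / 3"
  proof (induction k)
    case 0
    then show ?case by (simp add: c_def X_def)
  next
    case (Suc k)
    have "c (Suc k) \<le> real (Suc k) ^ 4 * X\<^sup>2 / 3" using Suc by (simp add: left_diff_distrib diff_divide_distrib)
    moreover have "c (Suc (Suc k)) - c (Suc k) \<le> (real (Suc (Suc k)) ^ 4 - real (Suc k) ^ 4) * X\<^sup>2 / 3"
    proof -
      have "4 * X * (sin (real (Suc k) * x))\<^sup>2 \<le> 4 * X * ((real (Suc k))\<^sup>2 * X)"
        using sin_mult_le[of "Suc k" x] X unfolding X_def by (intro mult_left_mono) auto
      then have "c (Suc (Suc k)) - c (Suc k) \<le> (real (Suc k) ^ 4 - real k ^ 4) * X\<^sup>2 / 3 + 4 * (real (Suc k))\<^sup>2 * X\<^sup>2"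
        using rec[of k] Suc by (simp add: power2_eq_square mult_ac)
      also have "\<dots> \<le> (real (Suc (Suc k)) ^ 4 - real (Suc k) ^ 4) * X\<^sup>2 / 3"
      proof -
        have "(real (Suc k) ^ 4 - real k ^ 4) + 12 * (real (Suc k))\<^sup>2 \<le> real (Suc (Suc k)) ^ 4 - real (Suc k) ^ 4"
          by (simp add: power4_eq_xxxx power2_eq_square algebra_simps)
        then have "((real (Suc k) ^ 4 - real k ^ 4) + 12 * (real (Suc k))\<^sup>2) * X\<^sup>2 \<le> (real (Suc (Suc k)) ^ 4 - real (Suc k) ^ 4) * X\<^sup>2"
          by (rule mult_right_mono) simp
        then show ?thesis by (simp add: distrib_right)
      qed
      finally show ?thesis .
    qed
    ultimately show ?case ..
  qed
  then show ?thesis by (simp add: c_def X_def)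
qed

text \<open>The constant in \<open>wt_eq\<close> accounts for \<open>1 / m\<close>. With
  \<open>s = \<bar>sin\<bar>\<close>, each of the roughly \<open>1 / s\<close> frequencies
  \<open>k\<close> with \<open>k * s \<le> 1\<close> contributes at least
  \<open>s\<^sup>2 / 6\<close> by \<open>sin_mult_ge\<close>, and together they account for
  \<open>s\<close>.\<close>

lemma wt_lower:
  assumes m: "m \<ge> 1"
  shows "\<bar>sin (2 * pi * t)\<bar> + 1 / real m \<le> 10 * wt m t"
proof -
  define s where "s = \<bar>sin (2 * pi * t)\<bar>"
  have s: "0 \<le> s" "s \<le> 1" by (simp_all add: s_def)
  have pos: "0 \<le> (sin (real k * (2 * pi * t)))\<^sup>2 / (4 * (real k)\<^sup>2 - 1)" if "k \<in> {1..m}" for k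
    using four_sq_pos[OF that] by simp
  have "0 \<le> (\<Sum>k\<in>{1..m}. (sin (real k * (2 * pi * t)))\<^sup>2 / (4 * (real k)\<^sup>2 - 1))"
    by (rule sum_nonneg) (rule pos)
  then have w1: "1 / (2 * real m + 1) \<le> wt m t" unfolding wt_eq by linarith
  have "1 / real m \<le> 3 * (1 / (2 * real m + 1))" using m by (simp add: field_simps)
  then have w1: "1 / real m \<le> 3 * wt m t" using w1 by linarith
  show ?thesis
  proof (cases "s \<le> 1 / real m")
    case True
    then show ?thesis using w1 unfolding s_def by linarith
  next
    case False
    have m0: "0 < real m" using m by simp
    have s0: "s > 0" using False m0 by (smt (verit) divide_pos_pos)
    \<comment> \<open>The number of frequencies \<open>k\<close> with \<open>k * s \<le> 1\<close>;
      it is at most \<open>m\<close> because \<open>s > 1 / m\<close> in this case.\<close>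
    define K where "K = nat \<lfloor>1 / s\<rfloor>"
    have i1: "1 \<le> 1 / s" using s s0 by simp
    have K1: "1 / s - 1 < real K" "real K \<le> 1 / s" using i1 unfolding K_def by linarith+
    have K2: "1 / s \<le> 2 * real K"
    proof -
      have "1 \<le> \<lfloor>1 / s\<rfloor>" using i1 by simp
      then have "1 \<le> real K" unfolding K_def by linarith
      then show ?thesis using K1 by linarith
    qed
    have "1 / s < real m" using False s0 m0 by (simp add: field_simps)
    then have Km: "K \<le> m" using K1 by linarith
    have "s\<^sup>2 / 6 \<le> (sin (real k * (2 * pi * t)))\<^sup>2 / (4 * (real k)\<^sup>2 - 1)" if k: "k \<in> {1..K}" for k
    proof -
      have km: "k \<in> {1..m}" using k Km by auto
      have "real k * s \<le> 1"
      proof -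
        have "real k \<le> 1 / s" using k K1 by auto
        then show ?thesis using s0 by (simp add: pos_le_divide_eq)
      qed
      then have "(real k * s)\<^sup>2 \<le> 1" using s by (simp add: power_le_one)
      then have "(real k * s)\<^sup>2 * (real k * s)\<^sup>2 \<le> (real k * s)\<^sup>2 * 1" by (rule mult_left_mono) simp
      moreover have "(real k)\<^sup>2 * s\<^sup>2 - (sin (real k * (2 * pi * t)))\<^sup>2 \<le> (real k * s)\<^sup>2 * (real k * s)\<^sup>2 / 3"
        using sin_mult_ge[of k "2 * pi * t"] by (simp add: s_def power_mult_distrib power2_eq_square power4_eq_xxxx mult_ac)
      ultimately have a: "2 / 3 * ((real k)\<^sup>2 * s\<^sup>2) \<le> (sin (real k * (2 * pi * t)))\<^sup>2"
        by (simp add: power_mult_distrib)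
      have "s\<^sup>2 / 6 * (4 * (real k)\<^sup>2 - 1) \<le> s\<^sup>2 / 6 * (4 * (real k)\<^sup>2)" by (rule mult_left_mono) auto
      also have "\<dots> = 2 / 3 * ((real k)\<^sup>2 * s\<^sup>2)" by simp
      also note a
      finally show ?thesis using four_sq_pos[OF km] by (simp add: pos_le_divide_eq)
    qed
    then have "(\<Sum>k\<in>{1..K}. s\<^sup>2 / 6) \<le> (\<Sum>k\<in>{1..K}. (sin (real k * (2 * pi * t)))\<^sup>2 / (4 * (real k)\<^sup>2 - 1))"
      by (rule sum_mono)
    also have "\<dots> \<le> (\<Sum>k\<in>{1..m}. (sin (real k * (2 * pi * t)))\<^sup>2 / (4 * (real k)\<^sup>2 - 1))"
      by (rule sum_mono2) (use Km pos in auto)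
    finally have "real K * (s\<^sup>2 / 6) \<le> (\<Sum>k\<in>{1..m}. (sin (real k * (2 * pi * t)))\<^sup>2 / (4 * (real k)\<^sup>2 - 1))" by simp
    then have "4 * (real K * (s\<^sup>2 / 6)) \<le> wt m t" unfolding wt_eq using m by (simp add: add_increasing)
    moreover have "s \<le> 2 * real K * s\<^sup>2"
    proof -
      have "1 / s * s\<^sup>2 \<le> 2 * real K * s\<^sup>2" using K2 by (rule mult_right_mono) simp
      then show ?thesis using s0 by (simp add: power2_eq_square)
    qed
    ultimately have "s \<le> 3 * wt m t" by simp
    then show ?thesis using w1 s0 unfolding s_def by linarith
  qed
qed

lemma wt_pos: "m \<ge> 1 \<Longrightarrow> 0 < wt m t"
proof -
  assume m: "m \<ge> 1"
  then have "0 < 1 / real m" by simp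
  then show ?thesis using wt_lower[OF m, of t] abs_ge_zero[of "sin (2 * pi * t)"] by linarith
qed

subsection \<open>Trigonometric integrals\<close>

definition en :: "int \<Rightarrow> real \<Rightarrow> complex" where
  "en q t = cis (real_of_int q * (2 * pi * t))"

lemma continuous_en [continuous_intros]: "continuous_on S (en q)"
  unfolding en_def[abs_def] by (intro continuous_intros)

lemma en_add: "en p t * en q t = en (p + q) t"
  by (simp add: en_def cis_mult distrib_right)

lemma en_0 [simp]: "en 0 t = 1"
  by (simp add: en_def)

lemma en_power: "en q t ^ k = en (int k * q) t"
  by (simp only: en_def Complex.DeMoivre of_int_mult of_int_of_nat_eq mult.assoc)

lemma en_integral: "(en q has_integral (if q = 0 then 1 else 0)) {0..1}"
proof (cases "q = 0")
  case True
  then have "en q = (\<lambda>t. 1)" by (simp add: fun_eq_iff)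
  then show ?thesis using True has_integral_const_real[of "1::complex" 0 1] by simp
next
  case False
  let ?c = "real_of_int q * (2 * pi)"
  have c: "?c \<noteq> 0" using False by simp
  have "(en q has_integral (en q 1 / (\<i> * of_real ?c) - en q 0 / (\<i> * of_real ?c))) {0..1}"
  proof (rule fundamental_theorem_of_calculus)
    fix t :: real
    have "((\<lambda>t. exp (t *\<^sub>R (\<i> * of_real ?c))) has_vector_derivative exp (t *\<^sub>R (\<i> * of_real ?c)) * (\<i> * of_real ?c)) (at t within {0..1})"
      by (rule exp_scaleR_has_vector_derivative_right)
    moreover have ee: "exp (t *\<^sub>R (\<i> * of_real ?c)) = en q t" for t
      by (simp add: en_def cis_conv_exp scaleR_conv_of_real mult_ac)
    ultimately have "(en q has_vector_derivative en q t * (\<i> * of_real ?c)) (at t within {0..1})" by simp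
    from has_vector_derivative_divide[OF this, of "\<i> * of_real ?c"]
    show "((\<lambda>t. en q t / (\<i> * of_real ?c)) has_vector_derivative en q t) (at t within {0..1})" using c by simp
  qed simp
  moreover have "en q 1 = 1"
    using cis_multiple_2pi[of "real_of_int q"] by (simp add: en_def mult_ac)
  moreover have "en q 0 = 1" by (simp add: en_def)
  ultimately show ?thesis using False by simp
qed

lemma cos_en: "complex_of_real (cos (real_of_int q * (2 * pi * t))) = (en q t + en (- q) t) / 2"
  by (simp add: en_def complex_eq_iff)

lemma cs_en: "complex_of_real (cos (2 * pi * t)) = (en 1 t + en (- 1) t) / 2"
  using cos_en[of 1 t] by simp

lemma sn_en: "complex_of_real (sin (2 * pi * t)) = (en 1 t - en (- 1) t) / (2 * \<i>)"
  by (simp add: en_def complex_eq_iff)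

lemma wt_en: "complex_of_real (wt m t) =
   1 - (\<Sum>k\<in>{1..m}. (en (2 * int k) t + en (- (2 * int k)) t) / of_real (4 * (real k)\<^sup>2 - 1))"
proof -
  have "complex_of_real (2 * (cos (2 * (real k * (2 * pi * t))) / (4 * (real k)\<^sup>2 - 1))) =
    (en (2 * int k) t + en (- (2 * int k)) t) / of_real (4 * (real k)\<^sup>2 - 1)" for k
  proof -
    have gen: "complex_of_real (2 * (c / d)) = (complex_of_real c * 2) / of_real d" for c d by simp
    have e: "real_of_int (2 * int k) * (2 * pi * t) = 2 * (real k * (2 * pi * t))" by simp
    have gen2: "(a / 2 * 2) / d = a / d" for a d :: complex by simp
    show ?thesis unfolding gen cos_en[of "2 * int k" t, unfolded e] gen2 ..
  qed
  then show ?thesis unfolding wt_def sum_distrib_left by (simp only: of_real_diff of_real_1 of_real_sum)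
qed

definition Lam :: "nat \<Rightarrow> (real \<Rightarrow> complex) \<Rightarrow> complex" where
  "Lam m g = integral {0..1} (\<lambda>t. of_real (wt m t) * g t)"

lemma Lam_lin:
  assumes "continuous_on {0..1} g" "continuous_on {0..1} h"
  shows "Lam m (\<lambda>t. a * g t + b * h t) = a * Lam m g + b * Lam m h"
proof -
  have "Lam m (\<lambda>t. a * g t + b * h t) = integral {0..1} (\<lambda>t. a * (of_real (wt m t) * g t) + b * (of_real (wt m t) * h t))"
    unfolding Lam_def by (simp only: distrib_left mult.left_commute)
  also have "\<dots> = integral {0..1} (\<lambda>t. a * (of_real (wt m t) * g t)) + integral {0..1} (\<lambda>t. b * (of_real (wt m t) * h t))"
    by (rule Henstock_Kurzweil_Integration.integral_add) (intro integrable_continuous_interval continuous_intros assms)+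
  also have "\<dots> = a * Lam m g + b * Lam m h" unfolding Lam_def by simp
  finally show ?thesis .
qed

lemma Lam_en: "Lam m (en q) = (if q = 0 then 1 else 0)
   - (\<Sum>k\<in>{1..m}. ((if q = - (2 * int k) then 1 else 0) + (if q = 2 * int k then 1 else 0)) / of_real (4 * (real k)\<^sup>2 - 1))"
proof -
  have "(\<lambda>t. of_real (wt m t) * en q t) =
     (\<lambda>t. en q t - (\<Sum>k\<in>{1..m}. (en (q + 2 * int k) t + en (q - 2 * int k) t) / of_real (4 * (real k)\<^sup>2 - 1)))"
    unfolding wt_en left_diff_distrib sum_distrib_right
    by (simp add: fun_eq_iff distrib_right en_add add.commute)
  moreover have "((\<lambda>t. en q t - (\<Sum>k\<in>{1..m}. (en (q + 2 * int k) t + en (q - 2 * int k) t) / of_real (4 * (real k)\<^sup>2 - 1)))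
    has_integral ((if q = 0 then 1 else 0) - (\<Sum>k\<in>{1..m}. ((if q + 2 * int k = 0 then 1 else 0) + (if q - 2 * int k = 0 then 1 else 0)) / of_real (4 * (real k)\<^sup>2 - 1)))) {0..1}"
    by (intro has_integral_diff has_integral_sum has_integral_divide has_integral_add en_integral) simp
  moreover have "q + 2 * int k = 0 \<longleftrightarrow> q = - (2 * int k)" "q - 2 * int k = 0 \<longleftrightarrow> q = 2 * int k" for k by auto
  ultimately show ?thesis unfolding Lam_def by (simp add: integral_unique)
qed

lemma Lam_en_vanish: "\<bar>q\<bar> > 2 * int m \<Longrightarrow> Lam m (en q) = 0"
  unfolding Lam_en by (auto intro!: sum.neutral)

lemma cs_en_mult: "complex_of_real (cos (2 * pi * t)) * en q t = (en (q + 1) t + en (q + - 1) t) / 2"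
  unfolding cs_en by (simp add: distrib_right en_add add.commute)

lemma sn_en_mult: "complex_of_real (sin (2 * pi * t)) * en q t = (en (q + 1) t - en (q + - 1) t) / (2 * \<i>)"
  unfolding sn_en times_divide_eq_left left_diff_distrib en_add by (simp add: add.commute)

text \<open>Every sine or cosine factor moves the frequency by one and the weight contains
  frequencies up to \<open>2 * m\<close> only, so no constant term can arise.\<close>

lemma Lam_sin_cos_vanish:
  "\<bar>q\<bar> > int (A + C + 2 * m) \<Longrightarrow> Lam m (\<lambda>t. of_real (sin (2 * pi * t)) ^ A * of_real (cos (2 * pi * t)) ^ C * en q t) = 0"
proof (induction A arbitrary: q)
  case 0
  then show ?case
  proof (induction C arbitrary: q)
    case 0
    then show ?case using Lam_en_vanish[of m q] by simp
  next
    case (Suc C)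
    let ?g = "\<lambda>q t. of_real (sin (2 * pi * t)) ^ 0 * of_real (cos (2 * pi * t)) ^ C * en q t"
    have "Lam m (\<lambda>t. of_real (sin (2 * pi * t)) ^ 0 * of_real (cos (2 * pi * t)) ^ Suc C * en q t)
        = Lam m (\<lambda>t. 1 / 2 * ?g (q + 1) t + 1 / 2 * ?g (q + - 1) t)"
    proof (rule arg_cong[of _ _ "Lam m"], rule ext)
      fix t
      have "of_real (sin (2 * pi * t)) ^ 0 * of_real (cos (2 * pi * t)) ^ Suc C * en q t =
        of_real (cos (2 * pi * t)) ^ C * (complex_of_real (cos (2 * pi * t)) * en q t)"
        by (simp only: power_Suc power_0 mult_1_left mult_ac)
      also have "\<dots> = 1 / 2 * ?g (q + 1) t + 1 / 2 * ?g (q + - 1) t"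
        unfolding cs_en_mult by (simp add: distrib_left add_divide_distrib)
      finally show "of_real (sin (2 * pi * t)) ^ 0 * of_real (cos (2 * pi * t)) ^ Suc C * en q t
        = 1 / 2 * ?g (q + 1) t + 1 / 2 * ?g (q + - 1) t" .
    qed
    also have "\<dots> = 1 / 2 * Lam m (?g (q + 1)) + 1 / 2 * Lam m (?g (q + - 1))"
      by (rule Lam_lin) (intro continuous_intros)+
    also have "\<dots> = 0" using Suc.IH[of "q + 1"] Suc.IH[of "q + - 1"] Suc.prems by simp
    finally show ?case .
  qed
next
  case (Suc A)
  let ?g = "\<lambda>q t. of_real (sin (2 * pi * t)) ^ A * of_real (cos (2 * pi * t)) ^ C * en q t"
  have "Lam m (\<lambda>t. of_real (sin (2 * pi * t)) ^ Suc A * of_real (cos (2 * pi * t)) ^ C * en q t)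
      = Lam m (\<lambda>t. 1 / (2 * \<i>) * ?g (q + 1) t + - 1 / (2 * \<i>) * ?g (q + - 1) t)"
  proof (rule arg_cong[of _ _ "Lam m"], rule ext)
    fix t
    have gen: "X * ((a - b) / (2 * \<i>)) = 1 / (2 * \<i>) * (X * a) + - 1 / (2 * \<i>) * (X * b)" for X a b :: complex
      by (simp add: right_diff_distrib diff_divide_distrib mult_ac)
    have "of_real (sin (2 * pi * t)) ^ Suc A * of_real (cos (2 * pi * t)) ^ C * en q t =
      (of_real (sin (2 * pi * t)) ^ A * of_real (cos (2 * pi * t)) ^ C) * (complex_of_real (sin (2 * pi * t)) * en q t)"
      by (simp only: power_Suc mult_ac)
    then show "of_real (sin (2 * pi * t)) ^ Suc A * of_real (cos (2 * pi * t)) ^ C * en q t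
      = 1 / (2 * \<i>) * ?g (q + 1) t + - 1 / (2 * \<i>) * ?g (q + - 1) t"
      unfolding sn_en_mult gen .
  qed
  also have "\<dots> = 1 / (2 * \<i>) * Lam m (?g (q + 1)) + - 1 / (2 * \<i>) * Lam m (?g (q + - 1))"
    by (rule Lam_lin) (intro continuous_intros)+
  also have "\<dots> = 0" using Suc.IH[of "q + 1"] Suc.IH[of "q + - 1"] Suc.prems by simp
  finally show ?case .
qed

text \<open>With polar angle \<open>2 * pi * t\<close>, half a period leads from pole to pole, and
  this is the surface integral of a function of the latitude alone.\<close>

definition Half :: "(real \<Rightarrow> real) \<Rightarrow> real" where
  "Half g = integral {0..1/2} (\<lambda>t. pi * sin (2 * pi * t) * g t)"

lemma sin_half_integral:
  "((\<lambda>t. sin (real_of_int p * (2 * pi * t))) has_integral (if even p then 0 else 1 / (pi * real_of_int p))) {0..1/2}"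
proof (cases "p = 0")
  case False
  let ?c = "real_of_int p * (2 * pi)"
  have c: "?c \<noteq> 0" using False by simp
  have "((\<lambda>t. sin (real_of_int p * (2 * pi * t))) has_integral (- cos (?c * (1/2)) / ?c - - cos (?c * 0) / ?c)) {0..1/2}"
  proof (rule fundamental_theorem_of_calculus)
    fix t :: real
    have "((\<lambda>t. - cos (?c * t) / ?c) has_real_derivative - (- sin (?c * t) * ?c) / ?c) (at t within {0..1/2})"
      using c by (intro DERIV_cdivide DERIV_minus) (auto intro!: derivative_eq_intros)
    moreover have "- (- sin (?c * t) * ?c) / ?c = sin (real_of_int p * (2 * pi * t))" using c by (simp add: mult.assoc)
    ultimately show "((\<lambda>t. - cos (?c * t) / ?c) has_vector_derivative sin (real_of_int p * (2 * pi * t))) (at t within {0..1/2})"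
      by (simp only: has_real_derivative_iff_has_vector_derivative)
  qed simp
  moreover have "cos (?c * (1/2)) = (if even p then 1 else - 1)"
    using cos_int_times_real[of p pi] cos_npi_int[of p] by (simp add: mult.commute)
  ultimately show ?thesis using c by (auto simp: field_simps)
qed simp

lemma Half_lin:
  assumes "continuous_on {0..1/2} g" "continuous_on {0..1/2} h"
  shows "Half (\<lambda>t. a * g t + b * h t) = a * Half g + b * Half h"
proof -
  have "Half (\<lambda>t. a * g t + b * h t) = integral {0..1/2} (\<lambda>t. a * (pi * sin (2 * pi * t) * g t) + b * (pi * sin (2 * pi * t) * h t))"
    unfolding Half_def by (simp only: distrib_left mult.left_commute)
  also have "\<dots> = integral {0..1/2} (\<lambda>t. a * (pi * sin (2 * pi * t) * g t)) + integral {0..1/2} (\<lambda>t. b * (pi * sin (2 * pi * t) * h t))"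
    by (rule Henstock_Kurzweil_Integration.integral_add) (intro integrable_continuous_interval continuous_intros assms)+
  also have "\<dots> = a * Half g + b * Half h" unfolding Half_def by simp
  finally show ?thesis .
qed

lemma Half_cos: "Half (\<lambda>t. cos (real_of_int q * (2 * pi * t))) = (if even q then - 1 / ((real_of_int q)\<^sup>2 - 1) else 0)"
proof -
  have e: "(\<lambda>t. pi * sin (2 * pi * t) * cos (real_of_int q * (2 * pi * t))) =
    (\<lambda>t. pi / 2 * (sin (real_of_int (q + 1) * (2 * pi * t)) - sin (real_of_int (q - 1) * (2 * pi * t))))"
    by (simp add: fun_eq_iff distrib_right left_diff_distrib sin_add sin_diff)
  have "((\<lambda>t. pi / 2 * (sin (real_of_int (q + 1) * (2 * pi * t)) - sin (real_of_int (q - 1) * (2 * pi * t)))) has_integral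
    pi / 2 * ((if even (q + 1) then 0 else 1 / (pi * real_of_int (q + 1))) - (if even (q - 1) then 0 else 1 / (pi * real_of_int (q - 1))))) {0..1/2}"
    by (intro has_integral_mult_right has_integral_diff sin_half_integral)
  then have "Half (\<lambda>t. cos (real_of_int q * (2 * pi * t))) =
    pi / 2 * ((if even (q + 1) then 0 else 1 / (pi * real_of_int (q + 1))) - (if even (q - 1) then 0 else 1 / (pi * real_of_int (q - 1))))"
    unfolding Half_def e by (rule integral_unique)
  also have "\<dots> = (if even q then - 1 / ((real_of_int q)\<^sup>2 - 1) else 0)"
  proof (cases "even q")
    case True
    then have "q \<noteq> 1" "q \<noteq> - 1" by auto
    then have nz: "real_of_int q + 1 \<noteq> 0" "real_of_int q - 1 \<noteq> 0" by linarith+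
    have gen: "pi / 2 * (1 / (pi * (x + 1)) - 1 / (pi * (x - 1))) = - 1 / (x\<^sup>2 - 1)" if "x + 1 \<noteq> 0" "x - 1 \<noteq> 0" for x :: real
    proof -
      have x2: "x\<^sup>2 - 1 = (x + 1) * (x - 1)" by (simp add: power2_eq_square algebra_simps)
      have "1 / (x + 1) - 1 / (x - 1) = - 2 / ((x + 1) * (x - 1))" using that by (simp add: diff_frac_eq)
      moreover have "pi / 2 * (1 / (pi * a) - 1 / (pi * b)) = 1 / 2 * (1 / a - 1 / b)" for a b :: real
        by (simp add: right_diff_distrib)
      ultimately show ?thesis unfolding x2 by simp
    qed
    have o: "even (q + 1) = False" "even (q - 1) = False" using True by auto
    show ?thesis unfolding o if_False using gen[OF nz] True
      by (simp only: of_int_add of_int_diff of_int_1 if_True)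
  qed simp
  finally show ?thesis .
qed

definition Lamr :: "nat \<Rightarrow> (real \<Rightarrow> real) \<Rightarrow> real" where
  "Lamr m g = integral {0..1} (\<lambda>t. wt m t * g t)"

lemma Lamr_lin:
  assumes "continuous_on {0..1} g" "continuous_on {0..1} h"
  shows "Lamr m (\<lambda>t. a * g t + b * h t) = a * Lamr m g + b * Lamr m h"
proof -
  have "Lamr m (\<lambda>t. a * g t + b * h t) = integral {0..1} (\<lambda>t. a * (wt m t * g t) + b * (wt m t * h t))"
    unfolding Lamr_def by (simp only: distrib_left mult.left_commute)
  also have "\<dots> = integral {0..1} (\<lambda>t. a * (wt m t * g t)) + integral {0..1} (\<lambda>t. b * (wt m t * h t))"
    by (rule Henstock_Kurzweil_Integration.integral_add) (intro integrable_continuous_interval continuous_intros assms)+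
  also have "\<dots> = a * Lamr m g + b * Lamr m h" unfolding Lamr_def by simp
  finally show ?thesis .
qed

lemma Lam_of_real:
  assumes "continuous_on {0..1} g"
  shows "Lam m (\<lambda>t. of_real (g t)) = of_real (Lamr m g)"
proof -
  have "((\<lambda>t. wt m t * g t) has_integral Lamr m g) {0..1}"
    unfolding Lamr_def by (intro integrable_integral integrable_continuous_interval continuous_intros assms)
  from has_integral_linear[OF this bounded_linear_of_real]
  show ?thesis unfolding Lam_def by (intro integral_unique) (simp add: o_def)
qed

text \<open>The right side is that of \<open>Half_cos\<close>. Up to frequency \<open>2 * m\<close>
  the weight retains the coefficients of the full series, and at \<open>2 * m + 1\<close> both sides
  vanish by parity.\<close>

lemma Lamr_cos:
  assumes q: "\<bar>q\<bar> \<le> 2 * int m + 1"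
  shows "Lamr m (\<lambda>t. cos (real_of_int q * (2 * pi * t))) = (if even q then - 1 / ((real_of_int q)\<^sup>2 - 1) else 0)"
proof -
  have c: "complex_of_real (Lamr m (\<lambda>t. cos (real_of_int q * (2 * pi * t)))) = 1 / 2 * Lam m (en q) + 1 / 2 * Lam m (en (- q))"
  proof -
    have "complex_of_real (Lamr m (\<lambda>t. cos (real_of_int q * (2 * pi * t)))) = Lam m (\<lambda>t. of_real (cos (real_of_int q * (2 * pi * t))))"
      by (rule Lam_of_real[symmetric]) (intro continuous_intros)
    also have "\<dots> = Lam m (\<lambda>t. 1 / 2 * en q t + 1 / 2 * en (- q) t)"
      by (rule arg_cong[of _ _ "Lam m"]) (simp add: fun_eq_iff cos_en add_divide_distrib)
    also have "\<dots> = 1 / 2 * Lam m (en q) + 1 / 2 * Lam m (en (- q))"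
      by (rule Lam_lin) (intro continuous_intros)+
    finally show ?thesis .
  qed
  have L: "Lam m (en p) = of_real (if even p then - 1 / ((real_of_int p)\<^sup>2 - 1) else 0)" if p: "\<bar>p\<bar> \<le> 2 * int m + 1" for p
  proof (cases "odd p")
    case True
    then have "p \<noteq> 0" "\<And>k. p \<noteq> 2 * int k" "\<And>k. p \<noteq> - (2 * int k)" by auto
    then show ?thesis using True unfolding Lam_en by simp
  next
    case ev: False
    then obtain r where r: "p = 2 * r" by (auto elim: evenE)
    show ?thesis
    proof (cases "r = 0")
      case True
      then show ?thesis using r unfolding Lam_en by simp
    next
      case False
      define i where "i = nat \<bar>r\<bar>"
      have i: "i \<in> {1..m}" "int i = \<bar>r\<bar>" using p False r by (auto simp: i_def)
      have "(\<Sum>k\<in>{1..m}. ((if p = - (2 * int k) then 1 else 0) + (if p = 2 * int k then 1 else 0)) / complex_of_real (4 * (real k)\<^sup>2 - 1))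
        = (\<Sum>k\<in>{1..m}. if k = i then 1 / complex_of_real (4 * (real k)\<^sup>2 - 1) else 0)"
      proof (rule sum.cong[OF refl])
        fix k assume k: "k \<in> {1..m}"
        have "p = - (2 * int k) \<longleftrightarrow> k = i \<and> r < 0" "p = 2 * int k \<longleftrightarrow> k = i \<and> 0 < r"
          using r i(2) False k by auto
        then show "((if p = - (2 * int k) then 1 else 0) + (if p = 2 * int k then 1 else 0)) / complex_of_real (4 * (real k)\<^sup>2 - 1)
          = (if k = i then 1 / complex_of_real (4 * (real k)\<^sup>2 - 1) else 0)"
          using False by auto
      qed
      also have "\<dots> = 1 / complex_of_real (4 * (real i)\<^sup>2 - 1)" using i(1) by simp
      also have "4 * (real i)\<^sup>2 = (real_of_int p)\<^sup>2"
      proof -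
        have "real i = \<bar>real_of_int r\<bar>" using i(2) by linarith
        then show ?thesis by (simp add: r power_mult_distrib)
      qed
      finally show ?thesis using ev False r unfolding Lam_en by simp
    qed
  qed
  have "complex_of_real (Lamr m (\<lambda>t. cos (real_of_int q * (2 * pi * t)))) = of_real (if even q then - 1 / ((real_of_int q)\<^sup>2 - 1) else 0)"
  proof -
    have "Lam m (en (- q)) = of_real (if even q then - 1 / ((real_of_int q)\<^sup>2 - 1) else 0)"
      using L[of "- q"] q by simp
    moreover have "1 / 2 * v + 1 / 2 * v = v" for v :: complex by simp
    ultimately show ?thesis unfolding c L[OF q] by (simp only:)
  qed
  then show ?thesis by (simp only: of_real_eq_iff)
qed

text \<open>The product-to-sum formula trades a power of the cosine for neighbouring frequencies, so
  that only frequencies up to \<open>\<bar>q\<bar> + C\<close> occur, on which the two functionals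
  agree.\<close>

lemma Lamr_cos_power:
  "\<bar>q\<bar> + int C \<le> 2 * int m + 1 \<Longrightarrow>
    Lamr m (\<lambda>t. cos (2 * pi * t) ^ C * cos (real_of_int q * (2 * pi * t))) =
    Half (\<lambda>t. cos (2 * pi * t) ^ C * cos (real_of_int q * (2 * pi * t)))"
proof (induction C arbitrary: q)
  case 0
  then show ?case by (simp add: Lamr_cos Half_cos)
next
  case (Suc C)
  let ?g = "\<lambda>q t. cos (2 * pi * t) ^ C * cos (real_of_int q * (2 * pi * t))"
  have e: "(\<lambda>t. cos (2 * pi * t) ^ Suc C * cos (real_of_int q * (2 * pi * t))) =
     (\<lambda>t. 1 / 2 * ?g (q + 1) t + 1 / 2 * ?g (q - 1) t)"
  proof
    fix t
    let ?P = "2 * pi * t" and ?Q = "real_of_int q * (2 * pi * t)"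
    have a: "real_of_int (q + 1) * (2 * pi * t) = ?Q + ?P" "real_of_int (q - 1) * (2 * pi * t) = ?Q - ?P"
      by (simp_all add: distrib_right left_diff_distrib)
    have K: "cos ?P * cos ?Q = 1 / 2 * cos (?Q + ?P) + 1 / 2 * cos (?Q - ?P)"
      unfolding cos_add cos_diff by (simp only: distrib_left right_diff_distrib) simp
    have "cos ?P ^ Suc C * cos ?Q = cos ?P ^ C * (cos ?P * cos ?Q)" by (simp only: power_Suc mult_ac)
    also have "\<dots> = 1 / 2 * (cos ?P ^ C * cos (?Q + ?P)) + 1 / 2 * (cos ?P ^ C * cos (?Q - ?P))"
      unfolding K by (simp only: distrib_left mult.left_commute)
    finally show "cos ?P ^ Suc C * cos ?Q = 1 / 2 * ?g (q + 1) t + 1 / 2 * ?g (q - 1) t" unfolding a .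
  qed
  have "Lamr m (\<lambda>t. 1 / 2 * ?g (q + 1) t + 1 / 2 * ?g (q - 1) t) = 1 / 2 * Lamr m (?g (q + 1)) + 1 / 2 * Lamr m (?g (q - 1))"
    by (rule Lamr_lin) (intro continuous_intros)+
  moreover have "Half (\<lambda>t. 1 / 2 * ?g (q + 1) t + 1 / 2 * ?g (q - 1) t) = 1 / 2 * Half (?g (q + 1)) + 1 / 2 * Half (?g (q - 1))"
    by (rule Half_lin) (intro continuous_intros)+
  ultimately show ?case unfolding e using Suc.IH[of "q + 1"] Suc.IH[of "q - 1"] Suc.prems by simp
qed

text \<open>The value is half the integral of \<open>x ^ C\<close> over \<open>[-1, 1]\<close>:
  after passing to \<open>Half\<close> the integrand is an exact derivative.\<close>

lemma Lamr_cos_moment: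
  assumes "C \<le> 2 * m + 1"
  shows "Lamr m (\<lambda>t. cos (2 * pi * t) ^ C) = (1 - (- 1) ^ Suc C) / (2 * (real C + 1))"
proof -
  let ?a = "1 / (2 * (real C + 1))"
  have "((\<lambda>t. pi * sin (2 * pi * t) * cos (2 * pi * t) ^ C) has_integral
     (- ?a * cos (2 * pi * (1/2)) ^ Suc C - - ?a * cos (2 * pi * 0) ^ Suc C)) {0..1/2}"
  proof (rule fundamental_theorem_of_calculus)
    fix t :: real
    have "((\<lambda>t. cos (2 * pi * t)) has_real_derivative - sin (2 * pi * t) * (2 * pi)) (at t within {0..1/2})"
      by (auto intro!: derivative_eq_intros)
    from DERIV_cmult[OF DERIV_power[OF this, of "Suc C"], of "- ?a"]
    have "((\<lambda>t. - ?a * cos (2 * pi * t) ^ Suc C) has_real_derivative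
      - ?a * (real (Suc C) * (- sin (2 * pi * t) * (2 * pi) * cos (2 * pi * t) ^ (Suc C - Suc 0)))) (at t within {0..1/2})" .
    moreover have "- ?a * (real (Suc C) * (- sin (2 * pi * t) * (2 * pi) * cos (2 * pi * t) ^ (Suc C - Suc 0)))
       = pi * sin (2 * pi * t) * cos (2 * pi * t) ^ C"
    proof -
      have "?a * (real (Suc C) * (2 * x)) = x" for x :: real
      proof -
        have "1 / (2 * d) * (d * (2 * x)) = x" if "d \<noteq> 0" for d :: real using that by simp
        from this[of "real C + 1"] show ?thesis by (simp only: of_nat_Suc add.commute)
      qed
      from this[of "pi * sin (2 * pi * t) * cos (2 * pi * t) ^ C"] show ?thesis by (simp add: mult_ac)
    qed
    ultimately show "((\<lambda>t. - ?a * cos (2 * pi * t) ^ Suc C) has_vector_derivative pi * sin (2 * pi * t) * cos (2 * pi * t) ^ C) (at t within {0..1/2})"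
      by (simp only: has_real_derivative_iff_has_vector_derivative)
  qed simp
  then have "Half (\<lambda>t. cos (2 * pi * t) ^ C) = - ?a * cos (2 * pi * (1/2)) ^ Suc C - - ?a * cos (2 * pi * 0) ^ Suc C"
    unfolding Half_def by (rule integral_unique)
  also have "\<dots> = (1 - (- 1) ^ Suc C) / (2 * (real C + 1))" by (simp add: diff_divide_distrib add_divide_distrib)
  finally show ?thesis using Lamr_cos_power[of 0 C m] assms by simp
qed


subsection \<open>The spiral measure\<close>

text \<open>Polar angle \<open>2 * pi * t\<close> and azimuth \<open>n\<close> times as large.
  Letting the polar angle run through a full circle leads back from the south pole to the north
  pole, so the curve is closed.\<close>

definition spi :: "nat \<Rightarrow> real \<Rightarrow> real^3" where
  "spi n t = (\<chi> k. if k = 1 then sin (2 * pi * t) * cos (real n * (2 * pi * t))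
     else if k = 2 then sin (2 * pi * t) * sin (real n * (2 * pi * t)) else cos (2 * pi * t))"

lemma spi_nth [simp]:
  "spi n t $ 1 = sin (2 * pi * t) * cos (real n * (2 * pi * t))"
  "spi n t $ 2 = sin (2 * pi * t) * sin (real n * (2 * pi * t))"
  "spi n t $ 3 = cos (2 * pi * t)"
  by (simp_all add: spi_def)

lemma spi_S2: "spi n t \<in> S2"
proof -
  have "spi n t \<bullet> spi n t = (sin (2 * pi * t))\<^sup>2 * ((cos (real n * (2 * pi * t)))\<^sup>2 + (sin (real n * (2 * pi * t)))\<^sup>2) + (cos (2 * pi * t))\<^sup>2"
  proof -
    have "(s * a) * (s * a) + (s * b) * (s * b) + c * c = s\<^sup>2 * (a\<^sup>2 + b\<^sup>2) + c\<^sup>2" for a b c s :: real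
      by (simp add: power2_eq_square algebra_simps)
    then show ?thesis by (simp only: inner_vec_def sum_3 spi_nth inner_real_def)
  qed
  also have "\<dots> = 1" by (simp only: sin_cos_squared_add2 mult_1_right sin_cos_squared_add)
  finally show ?thesis by (simp add: norm_eq_1)
qed

lemma continuous_spi: "continuous_on S (spi n)"
  unfolding spi_def[abs_def]
proof (rule continuous_on_vec_lambda)
  fix k :: 3
  show "continuous_on S (\<lambda>t. if k = 1 then sin (2 * pi * t) * cos (real n * (2 * pi * t))
     else if k = 2 then sin (2 * pi * t) * sin (real n * (2 * pi * t)) else cos (2 * pi * t))"
    by (cases "k = 1"; cases "k = 2") (auto intro!: continuous_intros)
qed

lemma spi_closed: "spi n 0 = spi n 1"
proof -
  have "spi n 0 $ k = spi n 1 $ k" for k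
    using exhaust_3[of k] by auto
  then show ?thesis by (simp add: vec_eq_iff)
qed

text \<open>The factor \<open>8\<close> separates frequencies: a nonzero azimuthal mode turns into a
  frequency of at least \<open>8 * m\<close> along the curve, whereas the remaining factors of a
  polynomial of degree \<open>2 * m\<close> and the weight reach at most \<open>4 * m\<close>
  together.\<close>

definition spm :: "nat \<Rightarrow> (real^3) measure" where
  "spm m = distr (density unit_interval (\<lambda>t. ennreal (wt m t))) S2_borel (spi (8 * m))"

lemma unit_interval_facts:
  "space unit_interval = {0..1}" "finite_measure unit_interval"
  by (auto simp: space_restrict_space emeasure_restrict_space intro!: finite_measureI)

lemma continuous_measurable_unit_interval:
  fixes g :: "real \<Rightarrow> 'a::topological_space"
  assumes "continuous_on {0..1} g"
  shows "g \<in> borel_measurable unit_interval"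
proof -
  have "g \<in> borel_measurable (restrict_space borel {0..1})"
    by (rule borel_measurable_continuous_on_restrict[OF assms])
  then show ?thesis
    using measurable_cong_sets[of unit_interval "restrict_space borel {0..1}" borel borel]
    by (simp add: sets_restrict_space)
qed

lemma curve_measurable:
  assumes "continuous_on {0..1} c" "\<And>t. t \<in> {0..1} \<Longrightarrow> c t \<in> S2"
  shows "c \<in> unit_interval \<rightarrow>\<^sub>M S2_borel"
  by (rule measurable_restrict_space2)
     (use assms(2) continuous_measurable_unit_interval[OF assms(1)] unit_interval_facts in auto)

lemma integral_unit_interval:
  fixes g :: "real \<Rightarrow> 'b::euclidean_space"
  assumes "continuous_on {0..1} g"
  shows "(\<integral>t. g t \<partial>unit_interval) = integral {0..1} g"
proof -
  have "set_integrable lborel {0..1} g" by (rule borel_integrable_atLeastAtMost') (rule assms)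
  then have "(LINT t : {0..1} | lborel. g t) = integral {0..1} g" by (rule set_borel_integral_eq_integral)
  moreover have "(\<integral>t. g t \<partial>unit_interval) = (LINT t : {0..1} | lborel. g t)"
    unfolding set_lebesgue_integral_def by (rule integral_restrict_space) simp
  ultimately show ?thesis by simp
qed

lemma integral_curve_measure:
  fixes f :: "real^3 \<Rightarrow> 'b::euclidean_space"
  assumes f: "continuous_on S2 f" and c: "continuous_on {0..1} c" "\<And>t. t \<in> {0..1} \<Longrightarrow> c t \<in> S2"
    and w: "continuous_on {0..1} w" "\<And>t. t \<in> {0..1} \<Longrightarrow> 0 \<le> w t"
  shows "(\<integral>x. f x \<partial>distr (density unit_interval (\<lambda>t. ennreal (w t))) S2_borel c) = integral {0..1} (\<lambda>t. w t *\<^sub>R f (c t))"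
proof -
  have fc: "continuous_on {0..1} (\<lambda>t. f (c t))"
    by (rule continuous_on_compose2[OF f c(1)]) (use c(2) in blast)
  have cm: "c \<in> density unit_interval (\<lambda>t. ennreal (w t)) \<rightarrow>\<^sub>M S2_borel"
    using curve_measurable[OF c] measurable_cong_sets[OF sets_density refl] by blast
  have "(\<integral>x. f x \<partial>distr (density unit_interval (\<lambda>t. ennreal (w t))) S2_borel c)
     = (\<integral>t. f (c t) \<partial>density unit_interval (\<lambda>t. ennreal (w t)))"
    by (rule integral_distr[OF cm borel_measurable_continuous_on_restrict[OF f]])
  also have "\<dots> = (\<integral>t. w t *\<^sub>R f (c t) \<partial>unit_interval)"
    by (rule integral_density[OF continuous_measurable_unit_interval[OF fc] continuous_measurable_unit_interval[OF w(1)]])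
       (intro AE_I2, use w(2) unit_interval_facts in simp)
  also have "\<dots> = integral {0..1} (\<lambda>t. w t *\<^sub>R f (c t))"
    by (rule integral_unit_interval) (intro continuous_intros w fc)
  finally show ?thesis .
qed

lemma emeasure_curve_measure:
  assumes c: "continuous_on {0..1} c" "\<And>t. t \<in> {0..1} \<Longrightarrow> c t \<in> S2"
    and w: "continuous_on {0..1} w" "\<And>t. t \<in> {0..1} \<Longrightarrow> 0 \<le> w t"
  shows "emeasure (distr (density unit_interval (\<lambda>t. ennreal (w t))) S2_borel c) S2 = ennreal (integral {0..1} w)"
proof -
  have cm: "c \<in> density unit_interval (\<lambda>t. ennreal (w t)) \<rightarrow>\<^sub>M S2_borel"
    using curve_measurable[OF c] measurable_cong_sets[OF sets_density refl] by blast
  have sp: "S2 \<in> sets S2_borel" by (metis sets.top space_restrict_space2 borel_closed closed_sphere sets_borel)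
  have pre: "c -` S2 \<inter> space (density unit_interval (\<lambda>t. ennreal (w t))) = {0..1}"
    using c(2) by (auto simp: unit_interval_facts)
  have s01: "{0..1} \<in> sets unit_interval" using sets.top[of unit_interval] by (simp add: unit_interval_facts)
  have wm: "w \<in> borel_measurable unit_interval" by (rule continuous_measurable_unit_interval[OF w(1)])
  have "emeasure (distr (density unit_interval (\<lambda>t. ennreal (w t))) S2_borel c) S2 = emeasure (density unit_interval (\<lambda>t. ennreal (w t))) {0..1}"
    unfolding emeasure_distr[OF cm sp] pre ..
  also have "\<dots> = (\<integral>\<^sup>+ t. ennreal (w t) * indicator {0..1} t \<partial>unit_interval)"
    by (rule emeasure_density[OF _ s01]) (use wm in measurable)
  also have "\<dots> = (\<integral>\<^sup>+ t. ennreal (w t) \<partial>unit_interval)"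
    by (rule nn_integral_cong) (simp add: unit_interval_facts)
  also have "\<dots> = ennreal (\<integral>t. w t \<partial>unit_interval)"
  proof (rule nn_integral_eq_integral)
    obtain B where B0: "\<forall>y\<in>w ` {0..1}. norm y \<le> B"
      using compact_imp_bounded[OF compact_continuous_image[OF w(1) compact_Icc]] unfolding bounded_iff by blast
    then have B: "norm (w t) \<le> B" if "t \<in> {0..1}" for t using that by blast
    show "integrable unit_interval w"
      by (rule finite_measure.integrable_const_bound[OF unit_interval_facts(2), where B=B])
         (intro AE_I2, use B unit_interval_facts in simp, rule wm)
    show "AE t in unit_interval. 0 \<le> w t" by (intro AE_I2) (use w(2) unit_interval_facts in simp)
  qed
  also have "(\<integral>t. w t \<partial>unit_interval) = integral {0..1} w" by (rule integral_unit_interval[OF w(1)])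
  finally show ?thesis .
qed

lemma S2_prob_spm:
  assumes m: "m \<ge> 1"
  shows "S2_prob (spm m)"
  unfolding S2_prob_def
proof (intro conjI)
  have "Lamr m (\<lambda>t. cos (2 * pi * t) ^ 0) = 1" using Lamr_cos_moment[of 0 m] by simp
  then have "integral {0..1} (wt m) = 1" by (simp add: Lamr_def)
  moreover have "emeasure (spm m) S2 = ennreal (integral {0..1} (wt m))"
    unfolding spm_def
    by (rule emeasure_curve_measure[OF continuous_spi spi_S2 continuous_wt]) (use wt_pos[OF m] in \<open>simp add: less_imp_le\<close>)
  ultimately have e: "emeasure (spm m) S2 = 1" by simp
  show "sets (spm m) = sets S2_borel" by (simp add: spm_def)
  then have "space (spm m) = S2" using sets_eq_imp_space_eq[of "spm m" S2_borel] by (simp add: space_restrict_space)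
  then show "finite_measure (spm m)" using e by (intro finite_measureI) simp
  show "measure (spm m) S2 = 1" using e by (simp add: measure_def)
qed

lemma integral_spm:
  fixes f :: "real^3 \<Rightarrow> 'b::euclidean_space"
  assumes "m \<ge> 1" "continuous_on S2 f"
  shows "(\<integral>x. f x \<partial>spm m) = integral {0..1} (\<lambda>t. wt m t *\<^sub>R f (spi (8 * m) t))"
  unfolding spm_def
  by (rule integral_curve_measure[OF assms(2) continuous_spi spi_S2 continuous_wt]) (use wt_pos[OF assms(1)] in \<open>simp add: less_imp_le\<close>)

subsection \<open>Exactness of the spiral measure\<close>

definition zt :: "real^3 \<Rightarrow> complex" where "zt x = Complex (x$1) (x$2)"

lemma zt_alt: "zt x = of_real (x$1) + \<i> * of_real (x$2)"
  by (simp add: zt_def complex_eq_iff)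

lemma continuous_zt [continuous_intros]: "continuous_on S zt"
  unfolding zt_alt[abs_def] by (intro continuous_intros)

text \<open>Monomials adapted to rotations about the third axis; \<open>a - b\<close> is the
  azimuthal frequency.\<close>

definition mon :: "nat \<Rightarrow> nat \<Rightarrow> nat \<Rightarrow> real^3 \<Rightarrow> complex" where
  "mon a b c x = zt x ^ a * cnj (zt x) ^ b * of_real (x$3) ^ c"

lemma continuous_mon [continuous_intros]: "continuous_on S (mon a b c)"
  unfolding mon_def[abs_def] by (intro continuous_intros continuous_on_cnj)

lemma zt_spi: "zt (spi n t) = of_real (sin (2 * pi * t)) * en (int n) t"
  by (simp add: zt_def en_def complex_eq_iff)

lemma mon_spi: "mon a b c (spi n t) =
  of_real (sin (2 * pi * t)) ^ (a + b) * of_real (cos (2 * pi * t)) ^ c * en (int a * int n - int b * int n) t"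
proof -
  have cj: "cnj (en (int n) t) = en (- int n) t" by (simp add: en_def cis_cnj)
  have "en (int n) t ^ a * en (- int n) t ^ b = en (int a * int n - int b * int n) t"
    unfolding en_power en_add by simp
  then show ?thesis unfolding mon_def zt_spi complex_cnj_mult cj
    by (simp add: power_mult_distrib power_add mult_ac)
qed

text \<open>Rotating about the axis by \<open>pi / (a - b)\<close> changes the sign of the monomial.\<close>

lemma integral_mon_sigma_eq_0:
  assumes "a \<noteq> b"
  shows "(\<integral>x. mon a b c x \<partial>sigma_S2) = 0"
proof -
  define t where "t = pi / (real a - real b)"
  have n12: "(1::3) \<noteq> 2" by simp
  have z: "zt (rot 1 2 t x) = cis t * zt x" for x
    by (simp add: zt_def rot_nth complex_eq_iff)
  have c: "cis t ^ a * cnj (cis t) ^ b = - 1"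
  proof -
    have "cis t ^ a * cnj (cis t) ^ b = cis (real a * t + real b * (- t))"
      by (simp only: cis_cnj Complex.DeMoivre cis_mult)
    also have "real a * t + real b * (- t) = (real a - real b) * t" by (simp add: left_diff_distrib)
    also have "\<dots> = pi" using assms by (simp add: t_def)
    finally show ?thesis by simp
  qed
  have m: "mon a b c (rot 1 2 t x) = - 1 * mon a b c x" for x
  proof -
    have "mon a b c (rot 1 2 t x) = (cis t ^ a * cnj (cis t) ^ b) * mon a b c x"
      unfolding mon_def z by (simp add: rot_nth power_mult_distrib mult_ac)
    then show ?thesis unfolding c .
  qed
  have "(\<integral>x. mon a b c x \<partial>sigma_S2) = (\<integral>x. mon a b c (rot 1 2 t x) \<partial>sigma_S2)"
    by (rule integral_sigma_S2_orthogonal[OF orthogonal_transformation_rot[OF n12] continuous_mon, symmetric])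
  also have "\<dots> = - 1 * (\<integral>x. mon a b c x \<partial>sigma_S2)" unfolding m by (rule integral_mult_right_zero)
  finally show ?thesis by simp
qed

text \<open>Archimedes: a coordinate is uniformly distributed on \<open>[-1, 1]\<close>. It equals
  \<open>2 * zon - 1\<close> for the pole on its axis, and the moments of \<open>zon\<close> are
  known.\<close>

lemma integral_coord_power_sigma:
  "(\<integral>x. (x$3) ^ c \<partial>sigma_S2) = (1 - (- 1) ^ Suc c) / (2 * (real c + 1))"
proof -
  let ?y = "axis 3 1 :: real^3"
  have y: "?y \<in> S2" by simp
  let ?p = "[:- 1, 2:] ^ c :: real poly"
  have "(x$3) ^ c = poly ?p (zon ?y x)" for x :: "real^3"
  proof -
    have "2 * zon ?y x - 1 = x$3" by (simp add: zon_def inner_axis field_simps)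
    moreover have "poly ?p u = (2 * u - 1) ^ c" for u by (simp add: poly_power mult.commute)
    ultimately show ?thesis by (simp only:)
  qed
  then have "(\<integral>x. (x$3) ^ c \<partial>sigma_S2) = (\<integral>x. poly ?p (zon ?y x) \<partial>sigma_S2)" by simp
  also have "\<dots> = (\<Sum>i\<le>degree ?p. coeff ?p i / (real i + 1))"
    by (rule sigma.integral_poly_zon[OF sigma_exact le_refl y])
  also have "\<dots> = integral {0..1} (poly ?p)"
    by (rule integral_unique[OF has_integral_poly_01, symmetric])
  also have "\<dots> = 1 / (2 * (real c + 1)) * (2 * 1 - 1) ^ Suc c - 1 / (2 * (real c + 1)) * (2 * 0 - 1) ^ Suc c"
  proof (rule integral_unique, rule fundamental_theorem_of_calculus)
    fix u :: real
    let ?a = "1 / (2 * (real c + 1))"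
    have "((\<lambda>u. 2 * u - 1) has_real_derivative 2) (at u within {0..1})" by (auto intro!: derivative_eq_intros)
    from DERIV_cmult[OF DERIV_power[OF this, of "Suc c"], of ?a]
    have "((\<lambda>u. ?a * (2 * u - 1) ^ Suc c) has_real_derivative ?a * (real (Suc c) * (2 * (2 * u - 1) ^ (Suc c - Suc 0)))) (at u within {0..1})" .
    moreover have "?a * (real (Suc c) * (2 * (2 * u - 1) ^ (Suc c - Suc 0))) = poly ?p u"
    proof -
      have "1 / (2 * d) * (d * (2 * x)) = x" if "d \<noteq> 0" for d x :: real using that by simp
      from this[of "real c + 1" "(2 * u - 1) ^ c"] have "?a * (real (Suc c) * (2 * (2 * u - 1) ^ c)) = (2 * u - 1) ^ c"
        by (simp only: of_nat_Suc add.commute)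
      then show ?thesis by (simp add: poly_power mult.commute)
    qed
    ultimately show "((\<lambda>u. ?a * (2 * u - 1) ^ Suc c) has_vector_derivative poly ?p u) (at u within {0..1})"
      by (simp only: has_real_derivative_iff_has_vector_derivative)
  qed simp
  also have "\<dots> = (1 - (- 1) ^ Suc c) / (2 * (real c + 1))" by (simp add: diff_divide_distrib add_divide_distrib)
  finally show ?thesis .
qed

context
  fixes m :: nat
  assumes m: "m \<ge> 1"
begin

interpretation spm: S2_prob "spm m" by (rule S2_prob_spm[OF m])

text \<open>Continuity is included because it supplies the integrability that linear combinations
  require.\<close>

definition agree :: "(real^3 \<Rightarrow> complex) \<Rightarrow> bool" where
  "agree f \<longleftrightarrow> continuous_on S2 f \<and> (\<integral>x. f x \<partial>spm m) = (\<integral>x. f x \<partial>sigma_S2)"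

lemma agree_lincomb:
  assumes "agree f" "agree g"
  shows "agree (\<lambda>x. a * f x + b * g x)"
proof -
  have c: "continuous_on S2 f" "continuous_on S2 g" using assms by (simp_all add: agree_def)
  have i: "integrable M f" "integrable M g" if "finite_measure M" "sets M = sets S2_borel" for M
    using that by (auto intro: continuous_on_S2_integrable c)
  note i1 = i[OF spm.fin spm.sets_M] and i2 = i[OF finite_measure_sigma_S2 sets_sigma_S2]
  have "(\<integral>x. a * f x + b * g x \<partial>spm m) = (\<integral>x. a * f x + b * g x \<partial>sigma_S2)"
    using assms i1 i2 by (simp add: agree_def)
  then show ?thesis using c by (auto simp: agree_def intro!: continuous_intros)
qed

lemma agree_cong: "agree f \<Longrightarrow> (\<And>x. x \<in> S2 \<Longrightarrow> f x = g x) \<Longrightarrow> agree g"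
proof -
  assume f: "agree f" and e: "\<And>x. x \<in> S2 \<Longrightarrow> f x = g x"
  have "(\<integral>x. g x \<partial>spm m) = (\<integral>x. f x \<partial>spm m)" "(\<integral>x. g x \<partial>sigma_S2) = (\<integral>x. f x \<partial>sigma_S2)"
    by (rule Bochner_Integration.integral_cong, simp, simp add: spm.space_M e)+
  moreover have "continuous_on S2 g" by (rule continuous_on_eq[of _ f]) (use f e in \<open>auto simp: agree_def\<close>)
  ultimately show "agree g" using f by (simp add: agree_def)
qed

lemma integral_mon_spm:
  "(\<integral>x. mon a b c x \<partial>spm m) = Lam m (\<lambda>t. of_real (sin (2 * pi * t)) ^ (a + b) * of_real (cos (2 * pi * t)) ^ c
      * en (int a * int (8 * m) - int b * int (8 * m)) t)"
  unfolding integral_spm[OF m continuous_mon] Lam_def mon_spi by (simp only: scaleR_conv_of_real)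

lemma agree_mon_asym:
  assumes "a \<noteq> b" "a + b + c \<le> 2 * m"
  shows "agree (mon a b c)"
proof -
  have "1 \<le> \<bar>int a - int b\<bar>" using assms(1) by auto
  then have "1 * int (8 * m) \<le> \<bar>int a - int b\<bar> * int (8 * m)" by (intro mult_right_mono) auto
  also have "\<dots> = \<bar>int a * int (8 * m) - int b * int (8 * m)\<bar>" by (simp add: abs_mult left_diff_distrib[symmetric])
  finally have "\<bar>int a * int (8 * m) - int b * int (8 * m)\<bar> > int ((a + b) + c + 2 * m)" using assms(2) m by linarith
  from Lam_sin_cos_vanish[OF this] have "(\<integral>x. mon a b c x \<partial>spm m) = 0" unfolding integral_mon_spm .
  then show ?thesis using integral_mon_sigma_eq_0[OF assms(1), of c] by (simp add: agree_def continuous_mon)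
qed

lemma agree_mon_axial:
  assumes "c \<le> 2 * m"
  shows "agree (mon 0 0 c)"
proof -
  have "(\<integral>x. mon 0 0 c x \<partial>spm m) = Lam m (\<lambda>t. of_real (cos (2 * pi * t) ^ c))"
    unfolding integral_mon_spm by simp
  also have "\<dots> = of_real (Lamr m (\<lambda>t. cos (2 * pi * t) ^ c))"
    by (rule Lam_of_real) (intro continuous_intros)
  also have "Lamr m (\<lambda>t. cos (2 * pi * t) ^ c) = (\<integral>x. (x$3) ^ c \<partial>sigma_S2)"
    using Lamr_cos_moment[of c m] assms by (simp add: integral_coord_power_sigma)
  also have "complex_of_real \<dots> = (\<integral>x. mon 0 0 c x \<partial>sigma_S2)"
    unfolding mon_def by (simp flip: integral_complex_of_real)
  finally show ?thesis by (simp add: agree_def continuous_mon)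
qed

text \<open>On the sphere \<open>zt x * cnj (zt x) = 1 - (x $ 3)\<^sup>2\<close>, which lowers
  \<open>a\<close> and \<open>b\<close> together without raising the total degree. The recursion
  ends at a monomial with nonzero azimuthal frequency or at a power of the third coordinate.\<close>

lemma agree_mon: "a + b + c \<le> 2 * m \<Longrightarrow> agree (mon a b c)"
proof (induction a arbitrary: b c)
  case 0
  then show ?case using agree_mon_asym[of 0 b c] agree_mon_axial[of c] by (cases "b = 0") auto
next
  case (Suc a)
  show ?case
  proof (cases b)
    case 0
    then show ?thesis using agree_mon_asym[of "Suc a" b c] Suc.prems by simp
  next
    case (Suc b')
    have "agree (\<lambda>x. 1 * mon a b' c x + - 1 * mon a b' (Suc (Suc c)) x)"
      using Suc Suc.prems \<open>Suc a + b + c \<le> 2 * m\<close> by (intro agree_lincomb Suc.IH Suc.prems) auto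
    then show ?thesis
    proof (rule agree_cong)
      fix x :: "real^3" assume "x \<in> S2"
      then have "x$1 * x$1 + x$2 * x$2 + x$3 * x$3 = 1" by (simp add: norm_eq_1 inner_vec_def sum_3)
      then have e: "zt x * cnj (zt x) = 1 - of_real (x$3) * of_real (x$3)"
        by (simp add: zt_def complex_eq_iff algebra_simps)
      have "mon (Suc a) b c x = (zt x * cnj (zt x)) * mon a b' c x"
        unfolding mon_def Suc by (simp only: power_Suc mult_ac)
      then show "1 * mon a b' c x + - 1 * mon a b' (Suc (Suc c)) x = mon (Suc a) b c x"
        unfolding e by (simp add: mon_def algebra_simps)
    qed
  qed
qed

text \<open>A factor \<open>zon y\<close> is an affine combination of \<open>zt\<close>, its
  conjugate and the third coordinate, so it can be absorbed into the monomial at the cost of one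
  degree.\<close>

lemma agree_zon_product:
  "a + b + c + length ys \<le> 2 * m \<Longrightarrow> agree (\<lambda>x. mon a b c x * of_real (\<Prod>y\<leftarrow>ys. zon y x))"
proof (induction ys arbitrary: a b c)
  case Nil
  then show ?case using agree_mon[of a b c] by simp
next
  case (Cons y ys)
  let ?F = "\<lambda>a b c x. mon a b c x * complex_of_real (\<Prod>y\<leftarrow>ys. zon y x)"
  \<comment> \<open>Twice the real part of \<open>k * zt x\<close> is the share of the first two
    coordinates in \<open>zon y x\<close>.\<close>
  define k where "k = Complex (y$1 / 4) (- y$2 / 4)"
  have "agree (\<lambda>x. 1 * (1 / 2 * ?F a b c x + k * ?F (Suc a) b c x) + 1 * (cnj k * ?F a (Suc b) c x + of_real (y$3) / 2 * ?F a b (Suc c) x))"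
    using Cons.prems by (intro agree_lincomb Cons.IH) simp_all
  then show ?case
  proof (rule agree_cong)
    fix x :: "real^3"
    have "complex_of_real (zon y x) = 1 / 2 + k * zt x + cnj k * cnj (zt x) + of_real (y$3) / 2 * of_real (x$3)"
      by (simp add: zon_def k_def zt_def complex_eq_iff inner_vec_def sum_3 field_simps)
    then have "mon a b c x * of_real (\<Prod>y\<leftarrow>y # ys. zon y x) =
       mon a b c x * ((1 / 2 + k * zt x + cnj k * cnj (zt x) + of_real (y$3) / 2 * of_real (x$3)) * of_real (\<Prod>y\<leftarrow>ys. zon y x))"
      by simp
    also have "\<dots> = 1 * (1 / 2 * ?F a b c x + k * ?F (Suc a) b c x) + 1 * (cnj k * ?F a (Suc b) c x + of_real (y$3) / 2 * ?F a b (Suc c) x)"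
      unfolding mon_def by (simp add: algebra_simps)
    finally show "1 * (1 / 2 * ?F a b c x + k * ?F (Suc a) b c x) + 1 * (cnj k * ?F a (Suc b) c x + of_real (y$3) / 2 * ?F a b (Suc c) x)
      = mon a b c x * of_real (\<Prod>y\<leftarrow>y # ys. zon y x)" ..
  qed
qed

lemma exact_spm: "S2_prob.exact (spm m) (2 * m)"
  unfolding spm.exact_def
proof (intro allI impI)
  fix ys :: "(real^3) list" assume "length ys \<le> 2 * m"
  then have "agree (\<lambda>x. mon 0 0 0 x * of_real (\<Prod>y\<leftarrow>ys. zon y x))" by (intro agree_zon_product) simp
  then have "(\<integral>x. complex_of_real (\<Prod>y\<leftarrow>ys. zon y x) \<partial>spm m) = (\<integral>x. complex_of_real (\<Prod>y\<leftarrow>ys. zon y x) \<partial>sigma_S2)"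
    by (simp add: agree_def mon_def)
  then show "(\<integral>x. (\<Prod>y\<leftarrow>ys. zon y x) \<partial>spm m) = (\<integral>x. (\<Prod>y\<leftarrow>ys. zon y x) \<partial>sigma_S2)"
    unfolding integral_complex_of_real of_real_eq_iff .
qed

end

subsection \<open>The speed of the spiral\<close>

text \<open>Up to the factor \<open>2 * pi\<close> the velocity is a unit vector along the meridian
  plus \<open>n * sin\<close> times the horizontal unit vector \<open>d2\<close>.\<close>

lemma spi_speed:
  obtains d where "\<And>t. (spi n has_vector_derivative d t) (at t)"
    "\<And>t. norm (d t) \<le> 2 * pi * (1 + real n * \<bar>sin (2 * pi * t)\<bar>)"
proof -
  let ?P = "\<lambda>t. 2 * pi * t" and ?Q = "\<lambda>t. real n * (2 * pi * t)"
  define d1 where "d1 t = cos (?Q t) *\<^sub>R axis 1 1 + sin (?Q t) *\<^sub>R (axis 2 1 :: real^3)" for t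
  define d2 where "d2 t = (- sin (?Q t)) *\<^sub>R axis 1 1 + cos (?Q t) *\<^sub>R (axis 2 1 :: real^3)" for t
  define d where "d t = (2 * pi) *\<^sub>R ((cos (?P t) *\<^sub>R d1 t - sin (?P t) *\<^sub>R axis 3 1) + (sin (?P t) * real n) *\<^sub>R d2 t)" for t
  have e: "spi n = (\<lambda>t. (sin (?P t) * cos (?Q t)) *\<^sub>R axis 1 1 + (sin (?P t) * sin (?Q t)) *\<^sub>R axis 2 1 + cos (?P t) *\<^sub>R axis 3 1)"
  proof
    fix t
    have "spi n t $ k = ((sin (?P t) * cos (?Q t)) *\<^sub>R axis 1 1 + (sin (?P t) * sin (?Q t)) *\<^sub>R axis 2 1 + cos (?P t) *\<^sub>R axis 3 1) $ k" for k
      using exhaust_3[of k] by (auto simp: axis_def)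
    then show "spi n t = (sin (?P t) * cos (?Q t)) *\<^sub>R axis 1 1 + (sin (?P t) * sin (?Q t)) *\<^sub>R axis 2 1 + cos (?P t) *\<^sub>R axis 3 1"
      by (simp add: vec_eq_iff)
  qed
  have der: "(spi n has_vector_derivative d t) (at t)" for t
    unfolding e
    by (rule derivative_eq_intros refl | simp add: d_def d1_def d2_def algebra_simps)+
  have nd: "norm (c *\<^sub>R axis 1 1 + s *\<^sub>R (axis 2 1 :: real^3)) = 1" if "c\<^sup>2 + s\<^sup>2 = 1" for c s :: real
    using that by (simp add: norm_eq_1 inner_add_left inner_add_right inner_axis_axis power2_eq_square)
  have n1: "norm (d1 t) = 1" and n2: "norm (d2 t) = 1" for t
    unfolding d1_def d2_def by (rule nd, simp)+
  have o: "d1 t \<bullet> axis 3 1 = 0" for t by (simp add: d1_def inner_add_left inner_axis_axis)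
  have n3: "norm (cos p *\<^sub>R d1 t - sin p *\<^sub>R axis 3 1) = 1" for p t
  proof -
    have "d1 t \<bullet> d1 t = 1" using n1[of t] by (simp add: norm_eq_1)
    then show ?thesis
      using o[of t] by (simp add: norm_eq_1 inner_diff_left inner_diff_right inner_axis_axis inner_commute[of "axis 3 1" "d1 t"] power2_eq_square[symmetric])
  qed
  have "norm (d t) \<le> 2 * pi * (1 + real n * \<bar>sin (?P t)\<bar>)" for t
  proof -
    have "norm (d t) = 2 * pi * norm ((cos (?P t) *\<^sub>R d1 t - sin (?P t) *\<^sub>R axis 3 1) + (sin (?P t) * real n) *\<^sub>R d2 t)"
      by (simp add: d_def)
    also have "\<dots> \<le> 2 * pi * (norm (cos (?P t) *\<^sub>R d1 t - sin (?P t) *\<^sub>R axis 3 1) + norm ((sin (?P t) * real n) *\<^sub>R d2 t))"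
      by (intro mult_left_mono norm_triangle_ineq) simp
    also have "\<dots> = 2 * pi * (1 + real n * \<bar>sin (?P t)\<bar>)" by (simp add: n2 n3 abs_mult)
    finally show ?thesis .
  qed
  with der show ?thesis by (rule that)
qed

text \<open>The additive constant in the speed is the \<open>1 / m\<close> of
  \<open>wt_lower\<close> multiplied by \<open>8 * m\<close>, and \<open>160 = 2 * 8 * 10\<close>. A
  bound proportional to the weight is what a parametrisation by mass can use.\<close>

lemma spi_speed_wt:
  assumes m: "m \<ge> 1"
  obtains d where "\<And>t. (spi (8 * m) has_vector_derivative d t) (at t)"
    "\<And>t. norm (d t) \<le> 160 * pi * real m * wt m t"
proof -
  obtain d where d: "\<And>t. (spi (8 * m) has_vector_derivative d t) (at t)"
    "\<And>t. norm (d t) \<le> 2 * pi * (1 + real (8 * m) * \<bar>sin (2 * pi * t)\<bar>)"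
    using spi_speed[of "8 * m"] by metis
  have "norm (d t) \<le> 160 * pi * real m * wt m t" for t
  proof -
    have "1 + real (8 * m) * \<bar>sin (2 * pi * t)\<bar> \<le> 8 * real m * (\<bar>sin (2 * pi * t)\<bar> + 1 / real m)"
      using m by (simp add: distrib_left)
    also have "\<dots> \<le> 8 * real m * (10 * wt m t)" by (intro mult_left_mono wt_lower[OF m]) simp
    finally have "2 * pi * (1 + real (8 * m) * \<bar>sin (2 * pi * t)\<bar>) \<le> 2 * pi * (8 * real m * (10 * wt m t))"
      by (intro mult_left_mono) simp_all
    also have "2 * pi * (8 * real m * (10 * wt m t)) = 160 * pi * real m * wt m t" by simp
    finally show ?thesis by (rule order_trans[OF d(2)])
  qed
  with d(1) show ?thesis by (rule that)
qed

subsection \<open>Continuity of the functions in the reproducing kernel space\<close>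

lemma kcomb_append: "kcomb K (xs @ ys) x = kcomb K xs x + kcomb K ys x"
  by (simp add: kcomb_def)

lemma kcomb_kneg: "kcomb K (kneg xs) x = - kcomb K xs x"
  by (induction xs) (auto simp: kcomb_def kneg_def)

lemma knorm2_snoc:
  assumes K: "symmetric_kernel K" and xs: "set (map snd xs) \<subseteq> S2" and x: "x \<in> S2"
  shows "knorm2 K (xs @ [(t, x)]) = knorm2 K xs + 2 * t * kcomb K xs x + t * t * K x x"
proof -
  have "(\<Sum>(a, p)\<leftarrow>xs. \<Sum>(b, q)\<leftarrow>xs @ [(t, x)]. a * b * K p q) = (\<Sum>(a, p)\<leftarrow>xs. \<Sum>(b, q)\<leftarrow>xs. a * b * K p q) + t * kcomb K xs x"
    for xs :: "(real \<times> (real^3)) list"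
  proof -
    have "(\<Sum>(a, p)\<leftarrow>zs. (\<Sum>(b, q)\<leftarrow>xs. a * b * K p q) + a * t * K p x) = (\<Sum>(a, p)\<leftarrow>zs. \<Sum>(b, q)\<leftarrow>xs. a * b * K p q) + t * kcomb K zs x"
      for zs by (induction zs) (auto simp: kcomb_def algebra_simps)
    then show ?thesis by simp
  qed
  moreover have "(\<Sum>(b, q)\<leftarrow>xs. t * b * K x q) = t * kcomb K xs x"
    using xs
  proof (induction xs)
    case (Cons z xs)
    then have "K x (snd z) = K (snd z) x" using K x by (auto simp: symmetric_kernel_def)
    then show ?case using Cons by (auto simp: kcomb_def split_beta' algebra_simps)
  qed (simp add: kcomb_def)
  ultimately show ?thesis by (simp add: knorm2_def algebra_simps)
qed

lemma quadratic_discriminant_le: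
  fixes A B C :: real
  assumes "\<And>t. 0 \<le> A + 2 * t * B + t * t * C" "0 \<le> C"
  shows "B\<^sup>2 \<le> A * C"
proof (cases "C = 0")
  case True
  have "B = 0"
  proof (rule ccontr)
    assume "B \<noteq> 0"
    then have "2 * (- (A + 1) / (2 * B)) * B = - (A + 1)" by simp
    then show False using assms(1)[of "- (A + 1) / (2 * B)"] True by simp
  qed
  then show ?thesis using True by simp
next
  case False
  then have C: "C > 0" using assms(2) by simp
  have "2 * (- B / C) * B + (- B / C) * (- B / C) * C = - (B * B / C)" using C by simp
  then have "B * B / C \<le> A" using assms(1)[of "- B / C"] by linarith
  then show ?thesis using C by (simp add: pos_divide_le_eq power2_eq_square)
qed

text \<open>Cauchy-Schwarz in the kernel space: adding \<open>t\<close> times the kernel section at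
  \<open>x\<close> keeps the squared norm nonnegative for all \<open>t\<close>, which bounds the
  discriminant.\<close>

lemma kcomb_le:
  assumes K: "symmetric_kernel K" "pos_def_kernel K" and xs: "set (map snd xs) \<subseteq> S2" and x: "x \<in> S2"
  shows "(kcomb K xs x)\<^sup>2 \<le> knorm2 K xs * K x x"
proof (rule quadratic_discriminant_le)
  fix t
  have "0 \<le> knorm2 K (xs @ [(t, x)])" using K(2) xs x unfolding pos_def_kernel_def by simp
  then show "0 \<le> knorm2 K xs + 2 * t * kcomb K xs x + t * t * K x x"
    unfolding knorm2_snoc[OF K(1) xs x] .
next
  have "set (map snd [(1, x)]) \<subseteq> S2" using x by simp
  then have "0 \<le> knorm2 K [(1, x)]" using K(2) unfolding pos_def_kernel_def by blast
  then show "0 \<le> K x x" by (simp add: knorm2_def)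
qed

text \<open>The Sobolev norm sees functions only up to null sets, while integrals along curves see
  point values; continuity bridges this gap. By \<open>kcomb_le\<close> and the boundedness of the
  diagonal of \<open>K\<close>, a Cauchy sequence in the kernel norm converges uniformly.\<close>

lemma in_rkhs_continuous:
  assumes K: "kernel_on_S2 K" "symmetric_kernel K" "pos_def_kernel K" and f: "in_rkhs K f"
  shows "continuous_on S2 f"
proof -
  obtain xs where sub: "\<And>n. set (map snd (xs n)) \<subseteq> S2"
    and Cau: "\<And>e. e > 0 \<Longrightarrow> \<exists>N. \<forall>m\<ge>N. \<forall>n\<ge>N. knorm2 K (xs m @ kneg (xs n)) < e"
    and lim: "\<And>x. x \<in> S2 \<Longrightarrow> (\<lambda>n. kcomb K (xs n) x) \<longlonglongrightarrow> f x"
    using f unfolding in_rkhs_def rkhs_seq_def by blast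
  have cK: "continuous_on (S2 \<times> S2) (\<lambda>z. K (fst z) (snd z))"
    using K(1) unfolding kernel_on_S2_def by (simp add: split_beta')
  have cd: "continuous_on S2 (\<lambda>x. K x x)"
  proof -
    have "continuous_on S2 (\<lambda>x. (\<lambda>z. K (fst z) (snd z)) (x, x))"
      by (rule continuous_on_compose2[OF cK]) (auto intro!: continuous_on_Pair continuous_on_id continuous_on_const)
    then show ?thesis by simp
  qed
  obtain C where C: "C > 0" "\<And>x. x \<in> S2 \<Longrightarrow> norm (K x x) \<le> C" using continuous_on_S2_bounded[OF cd] by metis
  have ck: "continuous_on S2 (kcomb K ys)" if "set (map snd ys) \<subseteq> S2" for ys
    using that
  proof (induction ys)
    case (Cons z ys)
    have "continuous_on S2 (\<lambda>x. K (snd z) x)"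
    proof -
      have "continuous_on S2 (\<lambda>x. (\<lambda>z. K (fst z) (snd z)) (snd z, x))"
        by (rule continuous_on_compose2[OF cK])
          (use Cons.prems in \<open>auto intro!: continuous_on_Pair continuous_on_id continuous_on_const\<close>)
      then show ?thesis by simp
    qed
    then have "continuous_on S2 (\<lambda>x. fst z * K (snd z) x + kcomb K ys x)"
      using Cons by (intro continuous_intros) auto
    moreover have "kcomb K (z # ys) = (\<lambda>x. fst z * K (snd z) x + kcomb K ys x)"
      by (simp add: kcomb_def fun_eq_iff split_beta')
    ultimately show ?case by simp
  qed (simp add: kcomb_def[abs_def])
  have "uniform_limit S2 (\<lambda>n. kcomb K (xs n)) f sequentially"
  proof (rule uniform_limitI)
    fix e :: real assume e: "e > 0"
    define d where "d = (e / 2)\<^sup>2 / C"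
    have d: "d > 0" using e C by (simp add: d_def)
    obtain N where N: "\<And>m n. m \<ge> N \<Longrightarrow> n \<ge> N \<Longrightarrow> knorm2 K (xs m @ kneg (xs n)) < d" using Cau[OF d] by blast
    have b: "\<bar>kcomb K (xs m) x - kcomb K (xs n) x\<bar> \<le> e / 2" if mn: "m \<ge> N" "n \<ge> N" and x: "x \<in> S2" for m n x
    proof -
      have s: "set (map snd (xs m @ kneg (xs n))) \<subseteq> S2"
        using sub[of m] sub[of n] by (auto simp: kneg_def)
      have k0: "0 \<le> knorm2 K (xs m @ kneg (xs n))" using K(3) s unfolding pos_def_kernel_def by blast
      have "(kcomb K (xs m) x - kcomb K (xs n) x)\<^sup>2 \<le> knorm2 K (xs m @ kneg (xs n)) * K x x"
        using kcomb_le[OF K(2,3) s x] by (simp add: kcomb_append kcomb_kneg)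
      also have "\<dots> \<le> knorm2 K (xs m @ kneg (xs n)) * C" using C(2)[OF x] k0 by (intro mult_left_mono) auto
      also have "\<dots> \<le> d * C" using N[OF mn] C(1) by (intro mult_right_mono) auto
      also have "\<dots> = (e / 2)\<^sup>2" using C(1) by (simp add: d_def)
      finally have "\<bar>kcomb K (xs m) x - kcomb K (xs n) x\<bar>\<^sup>2 \<le> (e / 2)\<^sup>2" by simp
      then show ?thesis by (rule power2_le_imp_le) (use e in simp)
    qed
    have "dist (kcomb K (xs n) x) (f x) < e" if n: "n \<ge> N" and x: "x \<in> S2" for n x
    proof -
      have "(\<lambda>m. \<bar>kcomb K (xs m) x - kcomb K (xs n) x\<bar>) \<longlonglongrightarrow> \<bar>f x - kcomb K (xs n) x\<bar>"
        by (intro tendsto_intros lim x)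
      then have "\<bar>f x - kcomb K (xs n) x\<bar> \<le> e / 2"
        by (rule LIMSEQ_le_const2) (use b[OF _ n x] in blast)
      then show ?thesis using e by (simp add: dist_real_def abs_minus_commute)
    qed
    then show "\<forall>\<^sub>F n in sequentially. \<forall>x\<in>S2. dist (kcomb K (xs n) x) (f x) < e"
      unfolding eventually_sequentially by blast
  qed
  then show ?thesis by (rule uniform_limit_theorem[rotated]) (simp_all add: ck[OF sub])
qed

subsection \<open>Geodesic and Euclidean distance\<close>

lemma sin_ge_half: "0 \<le> x \<Longrightarrow> x \<le> pi / 2 \<Longrightarrow> x / 2 \<le> sin x"
proof -
  assume x: "0 \<le> x" "x \<le> pi / 2"
  have "\<bar>sin x - (\<Sum>m<3. sin_coeff m * x ^ m)\<bar> \<le> inverse (fact 3) * \<bar>x\<bar> ^ 3" by (rule Maclaurin_sin_bound)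
  moreover have "(\<Sum>m<3. sin_coeff m * x ^ m) = x" by (simp add: numeral_3_eq_3 sin_coeff_def)
  moreover have "inverse (fact 3) * \<bar>x\<bar> ^ 3 = x * x\<^sup>2 / 6" using x by (simp add: fact_numeral power3_eq_cube power2_eq_square)
  ultimately have "x - x * x\<^sup>2 / 6 \<le> sin x" by linarith
  moreover have "x * x\<^sup>2 \<le> x * 3"
  proof -
    have "x \<le> 1.7" using x pi_less_4 pi_approx by simp
    then have "x\<^sup>2 \<le> 1.7\<^sup>2" using x by (intro power_mono) auto
    then show ?thesis using x by (intro mult_left_mono) (auto simp: power2_eq_square)
  qed
  ultimately show ?thesis by linarith
qed

text \<open>Chord and arc are related by
  \<open>dist x y = 2 * sin (geodist x y / 2)\<close>.\<close>

lemma geodist_bounds: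
  assumes x: "x \<in> S2" and y: "y \<in> S2"
  shows "dist x y \<le> geodist x y" "geodist x y \<le> 2 * dist x y"
proof -
  define b where "b = geodist x y / 2"
  have n: "norm x = 1" "norm y = 1" using x y by simp_all
  then have n1: "x \<bullet> x = 1" "y \<bullet> y = 1" by (simp_all only: norm_eq_1)
  have r: "-1 \<le> x \<bullet> y" "x \<bullet> y \<le> 1"
    using Cauchy_Schwarz_ineq2[of x y] unfolding n by linarith+
  have b: "0 \<le> b" "b \<le> pi / 2" using arccos_lbound[OF r] arccos_ubound[OF r] by (simp_all add: b_def geodist_def)
  have "(dist x y)\<^sup>2 = 2 - 2 * (x \<bullet> y)"
    by (simp only: dist_norm power2_norm_eq_inner inner_diff_left inner_diff_right inner_commute[of y x] n1)
  also have "x \<bullet> y = cos (2 * b)" using cos_arccos[OF r] by (simp only: b_def geodist_def) simp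
  also have "2 - 2 * cos (2 * b) = (2 * sin b)\<^sup>2" unfolding cos_double_sin power_mult_distrib by simp
  finally have "(dist x y)\<^sup>2 = (2 * sin b)\<^sup>2" .
  then have d: "dist x y = 2 * sin b"
    by (rule power2_eq_imp_eq) (use b in \<open>auto intro!: sin_ge_zero\<close>)
  have "sin b \<le> b" by (rule sin_x_le_x[OF b(1)])
  then show "dist x y \<le> geodist x y" by (simp add: d b_def)
  show "geodist x y \<le> 2 * dist x y" using sin_ge_half[OF b] by (simp add: d b_def)
qed

lemma tendsto_geodist:
  assumes "\<And>n. f n \<in> S2" "\<And>n. g n \<in> S2" "f \<longlonglongrightarrow> x" "g \<longlonglongrightarrow> y" "x \<in> S2" "y \<in> S2"
  shows "(\<lambda>n. geodist (f n) (g n)) \<longlonglongrightarrow> geodist x y"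
  unfolding geodist_def
proof (rule continuous_on_tendsto_compose[OF continuous_on_arccos'])
  have r: "u \<bullet> v \<in> {-1..1}" if "u \<in> S2" "v \<in> S2" for u v :: "real^3"
    using Cauchy_Schwarz_ineq2[of u v] that by auto
  show "(\<lambda>n. f n \<bullet> g n) \<longlonglongrightarrow> x \<bullet> y" by (intro tendsto_inner assms)
  show "x \<bullet> y \<in> {-1..1}" by (rule r[OF assms(5,6)])
  show "\<forall>\<^sub>F n in sequentially. f n \<bullet> g n \<in> {-1..1}" using r[OF assms(1,2)] by simp
qed

lemma lip_curveD:
  assumes "lip_curve L c"
  shows "t \<in> {0..1} \<Longrightarrow> c t \<in> S2"
    and "s \<in> {0..1} \<Longrightarrow> t \<in> {0..1} \<Longrightarrow> dist (c s) (c t) \<le> L * \<bar>s - t\<bar>"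
    and "continuous_on {0..1} c"
proof -
  show S: "t \<in> {0..1} \<Longrightarrow> c t \<in> S2" for t using assms unfolding lip_curve_def by blast
  show d: "dist (c s) (c t) \<le> L * \<bar>s - t\<bar>" if "s \<in> {0..1}" "t \<in> {0..1}" for s t
  proof -
    have "geodist (c s) (c t) \<le> L * \<bar>s - t\<bar>" using assms that unfolding lip_curve_def by blast
    then show ?thesis using geodist_bounds(1)[OF S[OF that(1)] S[OF that(2)]] by linarith
  qed
  have "dist (c 0) (c 1) \<le> L" using d[of 0 1] by simp
  then have L: "0 \<le> L" using zero_le_dist order_trans by blast
  show "continuous_on {0..1} c"
    by (rule lipschitz_on_continuous_on[of L]) (rule lipschitz_onI, use d L in \<open>auto simp: dist_real_def\<close>)
qed

subsection \<open>Discrepancies of curve measures\<close>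

abbreviation cmeas :: "(real \<Rightarrow> real^3) \<Rightarrow> (real \<Rightarrow> real) \<Rightarrow> (real^3) measure" where
  "cmeas c r \<equiv> distr (density unit_interval (\<lambda>t. ennreal (r t))) S2_borel c"

definition admissible :: "real \<Rightarrow> (real \<Rightarrow> real) \<Rightarrow> bool" where
  "admissible L r \<longleftrightarrow> (\<forall>t\<in>{0..1}. r t \<ge> 0) \<and> integral {0..1} r = 1 \<and>
      (\<forall>s\<in>{0..1}. \<forall>t\<in>{0..1}. \<bar>r s - r t\<bar> \<le> L * \<bar>s - t\<bar>)"

lemma P_Acurve_eq: "P_Acurve L = {cmeas c r | c r. lip_curve L c \<and> admissible L r}"
  unfolding P_Acurve_def admissible_def by simp

text \<open>With the density \<open>1\<close> written out, both classes of curve measures have the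
  same shape and can share one minimisation argument.\<close>

lemma P_Lcurve_eq: "P_Lcurve L = {cmeas c r | c r. lip_curve L c \<and> r = (\<lambda>t. 1)}"
  unfolding P_Lcurve_def by (simp add: density_1)

lemma P_LcurveI: "lip_curve L c \<Longrightarrow> cmeas c (\<lambda>t. 1) \<in> P_Lcurve L"
  unfolding P_Lcurve_eq by auto

lemma P_AcurveI: "lip_curve L c \<Longrightarrow> admissible L r \<Longrightarrow> cmeas c r \<in> P_Acurve L"
  unfolding P_Acurve_eq by auto

lemma admissible_1: "0 \<le> L \<Longrightarrow> admissible L (\<lambda>t. 1)"
  by (simp add: admissible_def)

lemma admissible_continuous:
  assumes "admissible L r" "0 \<le> L"
  shows "continuous_on {0..1} r"
  by (rule lipschitz_on_continuous_on[of L])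
     (rule lipschitz_onI, use assms in \<open>auto simp: admissible_def dist_real_def\<close>)

text \<open>A density above \<open>1 + L\<close> at one point of the unit interval would exceed one
  throughout. The bound supplies compactness for the densities.\<close>

lemma admissible_le:
  assumes r: "admissible L r" and L: "0 \<le> L" and t: "t \<in> {0..1}"
  shows "r t \<le> 1 + L"
proof (rule ccontr)
  assume "\<not> r t \<le> 1 + L"
  then have k: "1 < r t - L" by simp
  have "integral {0..1} (\<lambda>s::real. r t - L) \<le> integral {0..1} r"
  proof (rule Henstock_Kurzweil_Integration.integral_le)
    show "r integrable_on {0..1}" by (rule integrable_continuous_interval[OF admissible_continuous[OF r L]])
    fix s :: real assume s: "s \<in> {0..1}"
    have "\<bar>r s - r t\<bar> \<le> L * \<bar>s - t\<bar>" using r s t unfolding admissible_def by blast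
    also have "\<dots> \<le> L * 1" using s t L by (intro mult_left_mono) auto
    finally show "r t - L \<le> r s" by simp
  qed (rule integrable_const_ivl)
  then show False using k r by (simp add: admissible_def)
qed

locale curve_problem =
  fixes s :: real and K :: "real^3 \<Rightarrow> real^3 \<Rightarrow> real" and \<rho> :: "real^3 \<Rightarrow> real" and c2 :: real
  assumes s: "s > 1"
    and K: "kernel_on_S2 K" "symmetric_kernel K" "pos_def_kernel K"
    and c2: "c2 > 0" "\<And>f. in_rkhs K f \<Longrightarrow> in_Hs s f" "\<And>f. in_rkhs K f \<Longrightarrow> Hs_norm s f \<le> c2 * rkhs_norm K f"
    and zero: "rkhs_norm K (\<lambda>x. 0) \<le> 0"
    and rho: "continuous_on S2 \<rho>" "\<And>x. x \<in> S2 \<Longrightarrow> \<rho> x > 0" "(\<integral>x. \<rho> x \<partial>sigma_S2) = 1" "in_Hs s \<rho>"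
begin

definition U :: "(real^3 \<Rightarrow> real) set" where "U = {\<phi>. in_rkhs K \<phi> \<and> rkhs_norm K \<phi> \<le> 1}"
text \<open>A common bound on the sphere for all members of \<open>U\<close>, read off from
  \<open>psum_converges\<close>.\<close>

definition F :: real where "F = 6 * c2 / (1 - 2 powr (1 - s))"
definition \<mu> :: "(real^3) measure" where "\<mu> = density sigma_S2 \<rho>"

lemma q_less_1: "2 powr (1 - s) < 1"
  using s by (simp add: powr_less_one)

lemma F_pos: "F > 0"
  using q_less_1 c2(1) by (simp add: F_def)

lemma zero_U: "(\<lambda>x. 0) \<in> U"
proof -
  have "rkhs_seq K (\<lambda>x. 0) (\<lambda>n. [])" unfolding rkhs_seq_def by (simp add: knorm2_def kcomb_def kneg_def)
  then show ?thesis using zero by (auto simp: U_def in_rkhs_def)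
qed

lemma U_facts:
  assumes "\<phi> \<in> U"
  shows "continuous_on S2 \<phi>" "in_Hs s \<phi>" "Hs_norm s \<phi> \<le> c2" "\<And>x. x \<in> S2 \<Longrightarrow> \<bar>\<phi> x\<bar> \<le> F"
proof -
  have r: "in_rkhs K \<phi>" "rkhs_norm K \<phi> \<le> 1" using assms by (simp_all add: U_def)
  show c: "continuous_on S2 \<phi>" by (rule in_rkhs_continuous[OF K r(1)])
  show h: "in_Hs s \<phi>" by (rule c2(2)[OF r(1)])
  have "c2 * rkhs_norm K \<phi> \<le> c2 * 1" using c2(1) r(2) by (intro mult_left_mono) auto
  then show n: "Hs_norm s \<phi> \<le> c2" using c2(3)[OF r(1)] by simp
  show "\<bar>\<phi> x\<bar> \<le> F" if x: "x \<in> S2" for x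
  proof -
    have "6 * Hs_norm s \<phi> / (1 - 2 powr (1 - s)) \<le> F"
      unfolding F_def using n q_less_1 by (intro divide_right_mono) auto
    then show ?thesis using psum_converges(5)[OF h c s x] by linarith
  qed
qed

lemma integral_\<mu>:
  assumes "continuous_on S2 f"
  shows "(\<integral>x. f x \<partial>\<mu>) = (\<integral>x. f x * \<rho> x \<partial>sigma_S2)"
proof -
  have "(\<integral>x. f x \<partial>\<mu>) = (\<integral>x. \<rho> x *\<^sub>R f x \<partial>sigma_S2)"
    unfolding \<mu>_def
    by (rule integral_density[OF borel_measurable_integrable[OF sigma_integrable[OF assms]]
          borel_measurable_integrable[OF sigma_integrable[OF rho(1)]]])
       (intro AE_I2, use rho(2) in \<open>simp add: less_imp_le\<close>)
  then show ?thesis by (simp add: mult.commute)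
qed

lemma integral_\<mu>_le:
  assumes "\<phi> \<in> U"
  shows "\<bar>\<integral>x. \<phi> x \<partial>\<mu>\<bar> \<le> F"
proof -
  note u = U_facts[OF assms]
  have "\<bar>\<integral>x. \<phi> x \<partial>\<mu>\<bar> \<le> (\<integral>x. \<bar>\<phi> x * \<rho> x\<bar> \<partial>sigma_S2)" unfolding integral_\<mu>[OF u(1)] by (rule integral_abs_bound)
  also have "\<dots> \<le> (\<integral>x. F * \<rho> x \<partial>sigma_S2)"
  proof (rule integral_mono)
    show "\<bar>\<phi> x * \<rho> x\<bar> \<le> F * \<rho> x" if "x \<in> space sigma_S2" for x
      unfolding abs_mult using that u(4)[of x] rho(2)[of x] by (intro mult_mono) auto
  qed (intro sigma_integrable continuous_intros u rho)+
  also have "\<dots> = F" using rho(3) by simp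
  finally show ?thesis .
qed

lemma curve_integral:
  assumes "lip_curve L c" "admissible L r" "0 \<le> L" "continuous_on S2 f"
  shows "(\<integral>x. f x \<partial>cmeas c r) = integral {0..1} (\<lambda>t. r t * f (c t))"
proof -
  have "(\<integral>x. f x \<partial>cmeas c r) = integral {0..1} (\<lambda>t. r t *\<^sub>R f (c t))"
    by (rule integral_curve_measure[OF assms(4) lip_curveD(3,1)[OF assms(1)] admissible_continuous[OF assms(2,3)]])
       (use assms(2) in \<open>auto simp: admissible_def\<close>)
  then show ?thesis by simp
qed

lemma curve_integral_le:
  assumes c: "lip_curve L c" and r: "admissible L r" and L: "0 \<le> L" and p: "\<phi> \<in> U"
  shows "\<bar>\<integral>x. \<phi> x \<partial>cmeas c r\<bar> \<le> F"
proof -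
  note u = U_facts[OF p]
  note cr = admissible_continuous[OF r L]
  have fc: "continuous_on {0..1} (\<lambda>t. \<phi> (c t))"
    by (rule continuous_on_compose2[OF u(1) lip_curveD(3)[OF c]]) (use lip_curveD(1)[OF c] in blast)
  have "norm (integral {0..1} (\<lambda>t. r t * \<phi> (c t))) \<le> integral {0..1} (\<lambda>t. F * r t)"
  proof (rule integral_norm_bound_integral)
    fix t :: real assume t: "t \<in> {0..1}"
    have "0 \<le> r t" using r t by (simp add: admissible_def)
    then show "norm (r t * \<phi> (c t)) \<le> F * r t"
      using u(4)[OF lip_curveD(1)[OF c t]] by (simp add: abs_mult mult.commute mult_left_mono)
  qed (intro integrable_continuous_interval continuous_intros cr fc)+
  also have "\<dots> = F" using r by (simp add: admissible_def)
  finally show ?thesis unfolding curve_integral[OF c r L u(1)] by simp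
qed

text \<open>\<open>discrepancy\<close> is a supremum in the reals and can be compared with its
  members only once the set is known to be bounded.\<close>

lemma disc_bdd:
  assumes "\<And>\<phi>. \<phi> \<in> U \<Longrightarrow> \<bar>\<integral>x. \<phi> x \<partial>\<nu>\<bar> \<le> F"
  shows "bdd_above {\<bar>(\<integral>x. \<phi> x \<partial>\<mu>) - (\<integral>x. \<phi> x \<partial>\<nu>)\<bar> | \<phi>. in_rkhs K \<phi> \<and> rkhs_norm K \<phi> \<le> 1}"
proof (rule bdd_aboveI)
  fix v assume "v \<in> {\<bar>(\<integral>x. \<phi> x \<partial>\<mu>) - (\<integral>x. \<phi> x \<partial>\<nu>)\<bar> | \<phi>. in_rkhs K \<phi> \<and> rkhs_norm K \<phi> \<le> 1}"
  then obtain \<phi> where p: "\<phi> \<in> U" "v = \<bar>(\<integral>x. \<phi> x \<partial>\<mu>) - (\<integral>x. \<phi> x \<partial>\<nu>)\<bar>" by (auto simp: U_def)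
  then show "v \<le> 2 * F" using assms[OF p(1)] integral_\<mu>_le[OF p(1)] by linarith
qed

lemma disc_ge:
  assumes "\<And>\<phi>. \<phi> \<in> U \<Longrightarrow> \<bar>\<integral>x. \<phi> x \<partial>\<nu>\<bar> \<le> F" "\<phi> \<in> U"
  shows "\<bar>(\<integral>x. \<phi> x \<partial>\<mu>) - (\<integral>x. \<phi> x \<partial>\<nu>)\<bar> \<le> discrepancy K \<mu> \<nu>"
  unfolding discrepancy_def by (rule cSup_upper[OF _ disc_bdd[OF assms(1)]]) (use assms(2) in \<open>auto simp: U_def\<close>)

lemma disc_le:
  assumes "\<And>\<phi>. \<phi> \<in> U \<Longrightarrow> \<bar>(\<integral>x. \<phi> x \<partial>\<mu>) - (\<integral>x. \<phi> x \<partial>\<nu>)\<bar> \<le> b"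
  shows "discrepancy K \<mu> \<nu> \<le> b"
  unfolding discrepancy_def
proof (rule cSup_least)
  show "{\<bar>(\<integral>x. \<phi> x \<partial>\<mu>) - (\<integral>x. \<phi> x \<partial>\<nu>)\<bar> | \<phi>. in_rkhs K \<phi> \<and> rkhs_norm K \<phi> \<le> 1} \<noteq> {}"
    using zero_U by (auto simp: U_def)
qed (use assms in \<open>auto simp: U_def\<close>)

subsection \<open>Existence of minimisers\<close>

text \<open>The direct method. Curve and density form one map into a product space, so a joint
  subsequence is extracted at once; the discrepancy, a supremum of functionals continuous along it,
  is lower semicontinuous. The predicate \<open>Q\<close> covers both classes of densities, and
  \<open>cl\<close> asks only for agreement on \<open>[0, 1]\<close>, since the limit says nothing
  about other arguments.\<close>

lemma exists_minimiser:
  assumes L: "0 \<le> L" and adm: "\<And>r. Q r \<Longrightarrow> admissible L r"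
    and cl: "\<And>rn r. (\<And>n. Q (rn n)) \<Longrightarrow> uniform_limit {0..1} rn r sequentially \<Longrightarrow> continuous_on {0..1} r \<Longrightarrow>
       \<exists>r'. Q r' \<and> (\<forall>t\<in>{0..1}. r' t = r t)"
    and ne: "lip_curve L c0" "Q r0"
  shows "\<exists>c r. lip_curve L c \<and> Q r \<and>
    (\<forall>c' r'. lip_curve L c' \<longrightarrow> Q r' \<longrightarrow> discrepancy K \<mu> (cmeas c r) \<le> discrepancy K \<mu> (cmeas c' r'))"
proof -
  define D where "D c r = discrepancy K \<mu> (cmeas c r)" for c r
  define V where "V = {D c r | c r. lip_curve L c \<and> Q r}"
  have Vne: "V \<noteq> {}" using ne by (auto simp: V_def)
  have D0: "0 \<le> D c r" if "lip_curve L c" "Q r" for c r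
    using disc_ge[OF curve_integral_le[OF that(1) adm[OF that(2)] L] zero_U] unfolding D_def by simp
  have Vb: "bdd_below V" by (rule bdd_belowI[of _ 0]) (auto simp: V_def D0)
  define m where "m = Inf V"
  have m_le: "m \<le> D c r" if "lip_curve L c" "Q r" for c r
    unfolding m_def by (rule cInf_lower[OF _ Vb]) (use that in \<open>auto simp: V_def\<close>)
  have "\<exists>c r. lip_curve L c \<and> Q r \<and> D c r < m + 1 / real (Suc n)" for n
  proof -
    have "Inf V < m + 1 / real (Suc n)" by (simp add: m_def)
    then obtain v where "v \<in> V" "v < m + 1 / real (Suc n)" using cInf_lessD[OF Vne] by blast
    then show ?thesis by (auto simp: V_def)
  qed
  then obtain cn rn where cn: "\<And>n. lip_curve L (cn n)" and rn: "\<And>n. Q (rn n)" and Dn: "\<And>n. D (cn n) (rn n) < m + 1 / real (Suc n)"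
    by metis
  note an = adm[OF rn]
  define Z where "Z n t = (cn n t, rn n t)" for n t
  have lipZ: "norm (Z n s - Z n t) \<le> 2 * L * \<bar>s - t\<bar>" if st: "s \<in> {0..1}" "t \<in> {0..1}" for n s t
  proof -
    have "norm (Z n s - Z n t) \<le> norm (cn n s - cn n t) + norm (rn n s - rn n t)"
      using norm_Pair_le[of "cn n s - cn n t" "rn n s - rn n t"] by (simp add: Z_def)
    moreover have "norm (cn n s - cn n t) \<le> L * \<bar>s - t\<bar>" using lip_curveD(2)[OF cn st, of n] by (simp add: dist_norm)
    moreover have "norm (rn n s - rn n t) \<le> L * \<bar>s - t\<bar>" using an[of n] st by (simp add: admissible_def)
    ultimately show ?thesis by linarith
  qed
  obtain g :: "real \<Rightarrow> (real^3) \<times> real" and k :: "nat \<Rightarrow> nat" where g: "continuous_on {0..1} g" "strict_mono k"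
    "\<And>e. 0 < e \<Longrightarrow> \<exists>N. \<forall>n x. n \<ge> N \<and> x \<in> {0..1} \<longrightarrow> norm (Z (k n) x - g x) < e"
  proof (rule Arzela_Ascoli[of "{0..1::real}" Z "1 + (1 + L)"])
    show "compact {0..1::real}" by simp
    show "norm (Z n t) \<le> 1 + (1 + L)" if t: "t \<in> {0..1}" for n t
    proof -
      have "norm (Z n t) \<le> norm (cn n t) + norm (rn n t)" using norm_Pair_le[of "cn n t" "rn n t"] by (simp add: Z_def)
      moreover have "norm (cn n t) = 1" using lip_curveD(1)[OF cn t, of n] by simp
      moreover have "0 \<le> rn n t" using an[of n] t by (simp add: admissible_def)
      ultimately show ?thesis using admissible_le[OF an L t, of n] unfolding real_norm_def by linarith
    qed
    show "\<exists>d. 0 < d \<and> (\<forall>n y. y \<in> {0..1} \<and> norm (x - y) < d \<longrightarrow> norm (Z n x - Z n y) < e)" if "x \<in> {0..1}" "0 < e" for x e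
    proof (intro exI[of _ "e / (2 * L + 1)"] conjI allI impI)
      show "0 < e / (2 * L + 1)" using that L by simp
      fix n y assume y: "y \<in> {0..1} \<and> norm (x - y) < e / (2 * L + 1)"
      have "norm (Z n x - Z n y) \<le> 2 * L * \<bar>x - y\<bar>" using lipZ that(1) y by blast
      also have "\<dots> \<le> (2 * L + 1) * \<bar>x - y\<bar>" by (rule mult_right_mono) simp_all
      also have "\<dots> < e" using y L by (simp add: pos_less_divide_eq mult.commute)
      finally show "norm (Z n x - Z n y) < e" .
    qed
  qed (rule that)
  define c where "c t = fst (g t)" for t
  define r where "r t = snd (g t)" for t
  have ul: "uniform_limit {0..1} (\<lambda>n. Z (k n)) g sequentially"
  proof (rule uniform_limitI)
    fix e :: real assume "e > 0"
    then obtain N where "\<forall>n x. n \<ge> N \<and> x \<in> {0..1} \<longrightarrow> norm (Z (k n) x - g x) < e" using g(3) by metis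
    then show "\<forall>\<^sub>F n in sequentially. \<forall>x\<in>{0..1}. dist (Z (k n) x) (g x) < e"
      unfolding dist_norm eventually_sequentially by blast
  qed
  have pt: "(\<lambda>n. Z (k n) t) \<longlonglongrightarrow> g t" if "t \<in> {0..1}" for t by (rule tendsto_uniform_limitI[OF ul that])
  have ct: "(\<lambda>n. cn (k n) t) \<longlonglongrightarrow> c t" if "t \<in> {0..1}" for t
    using tendsto_fst[OF pt[OF that]] by (simp add: Z_def c_def)
  have rt: "(\<lambda>n. rn (k n) t) \<longlonglongrightarrow> r t" if "t \<in> {0..1}" for t
    using tendsto_snd[OF pt[OF that]] by (simp add: Z_def r_def)
  have cS: "c t \<in> S2" if t: "t \<in> {0..1}" for t
  proof -
    have "(\<lambda>n. norm (cn (k n) t)) \<longlonglongrightarrow> norm (c t)" by (intro tendsto_norm ct t)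
    moreover have "norm (cn (k n) t) = 1" for n using lip_curveD(1)[OF cn t, of "k n"] by simp
    ultimately show ?thesis by (simp add: tendsto_const_iff)
  qed
  have lc: "lip_curve L c"
    unfolding lip_curve_def
  proof (intro conjI ballI)
    show "c t \<in> S2" if "t \<in> {0..1}" for t by (rule cS[OF that])
    have "(\<lambda>n. cn (k n) 1) \<longlonglongrightarrow> c 0" using ct[of 0] cn by (simp add: lip_curve_def)
    then show "c 0 = c 1" using ct[of 1] by (intro LIMSEQ_unique) auto
    fix u t :: real assume ut: "u \<in> {0..1}" "t \<in> {0..1}"
    have "(\<lambda>n. geodist (cn (k n) u) (cn (k n) t)) \<longlonglongrightarrow> geodist (c u) (c t)"
      by (intro tendsto_geodist lip_curveD(1)[OF cn] ct cS ut)
    then show "geodist (c u) (c t) \<le> L * \<bar>u - t\<bar>"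
      by (rule LIMSEQ_le_const2) (use cn ut in \<open>auto simp: lip_curve_def\<close>)
  qed
  have ulr: "uniform_limit {0..1} (\<lambda>n. rn (k n)) r sequentially"
  proof (rule uniform_limitI)
    fix e :: real assume "e > 0"
    from uniform_limitD[OF ul this] show "\<forall>\<^sub>F n in sequentially. \<forall>t\<in>{0..1}. dist (rn (k n) t) (r t) < e"
    proof eventually_elim
      case (elim n)
      show ?case
      proof
        fix t :: real assume "t \<in> {0..1}"
        then have "dist (Z (k n) t) (g t) < e" using elim by blast
        moreover have "dist (rn (k n) t) (r t) \<le> dist (Z (k n) t) (g t)"
          using dist_snd_le[of "Z (k n) t" "g t"] by (simp add: Z_def r_def)
        ultimately show "dist (rn (k n) t) (r t) < e" by linarith
      qed
    qed
  qed
  have cr: "continuous_on {0..1} r" unfolding r_def[abs_def] by (intro continuous_intros g)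
  obtain r' where r': "Q r'" "\<And>t. t \<in> {0..1} \<Longrightarrow> r' t = r t"
    using cl[of "\<lambda>n. rn (k n)" r, OF rn ulr cr] by blast
  have "D c r' \<le> m"
    unfolding D_def
  proof (rule disc_le)
    fix \<phi> assume p: "\<phi> \<in> U"
    note u = U_facts[OF p]
    let ?J = "\<lambda>n. \<integral>x. \<phi> x \<partial>cmeas (cn (k n)) (rn (k n))"
    have fc: "continuous_on {0..1} (\<lambda>t. \<phi> (\<gamma> t))" if "lip_curve L \<gamma>" for \<gamma>
      by (rule continuous_on_compose2[OF u(1) lip_curveD(3)[OF that]]) (use lip_curveD(1)[OF that] in blast)
    have "(\<lambda>n. \<integral>t. rn (k n) t * \<phi> (cn (k n) t) \<partial>unit_interval) \<longlonglongrightarrow> (\<integral>t. r t * \<phi> (c t) \<partial>unit_interval)"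
    proof (rule integral_dominated_convergence)
      show "(\<lambda>t. r t * \<phi> (c t)) \<in> borel_measurable unit_interval"
        by (intro continuous_measurable_unit_interval continuous_intros cr fc lc)
      show "(\<lambda>t. rn (k n) t * \<phi> (cn (k n) t)) \<in> borel_measurable unit_interval" for n
        by (intro continuous_measurable_unit_interval continuous_intros admissible_continuous[OF an L] fc cn)
      show "integrable unit_interval (\<lambda>t. (1 + L) * F)"
        by (rule finite_measure.integrable_const[OF unit_interval_facts(2)])
      show "AE t in unit_interval. (\<lambda>n. rn (k n) t * \<phi> (cn (k n) t)) \<longlonglongrightarrow> r t * \<phi> (c t)"
      proof (rule AE_I2)
        fix t assume "t \<in> space unit_interval"
        then have t: "t \<in> {0..1}" by (simp add: unit_interval_facts)
        have "(\<lambda>n. \<phi> (cn (k n) t)) \<longlonglongrightarrow> \<phi> (c t)"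
          by (rule continuous_on_tendsto_compose[OF u(1) ct[OF t] cS[OF t]]) (use lip_curveD(1)[OF cn t] in simp)
        then show "(\<lambda>n. rn (k n) t * \<phi> (cn (k n) t)) \<longlonglongrightarrow> r t * \<phi> (c t)" by (intro tendsto_mult rt t)
      qed
      show "AE t in unit_interval. norm (rn (k n) t * \<phi> (cn (k n) t)) \<le> (1 + L) * F" for n
      proof (rule AE_I2)
        fix t assume "t \<in> space unit_interval"
        then have t: "t \<in> {0..1}" by (simp add: unit_interval_facts)
        have "0 \<le> rn (k n) t" using an[of "k n"] t by (simp add: admissible_def)
        then show "norm (rn (k n) t * \<phi> (cn (k n) t)) \<le> (1 + L) * F"
          unfolding real_norm_def abs_mult
          using admissible_le[OF an L t, of "k n"] u(4)[OF lip_curveD(1)[OF cn t]] L by (intro mult_mono) auto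
      qed
    qed
    moreover have "(\<integral>t. rn (k n) t * \<phi> (cn (k n) t) \<partial>unit_interval) = ?J n" for n
      unfolding curve_integral[OF cn an L u(1)]
      by (rule integral_unit_interval) (intro continuous_intros admissible_continuous[OF an L] fc cn)
    moreover have "(\<integral>t. r t * \<phi> (c t) \<partial>unit_interval) = (\<integral>x. \<phi> x \<partial>cmeas c r')"
    proof -
      have "(\<integral>t. r t * \<phi> (c t) \<partial>unit_interval) = integral {0..1} (\<lambda>t. r t * \<phi> (c t))"
        by (rule integral_unit_interval) (intro continuous_intros cr fc lc)
      also have "\<dots> = integral {0..1} (\<lambda>t. r' t * \<phi> (c t))"
        by (rule Henstock_Kurzweil_Integration.integral_cong) (simp add: r'(2))
      finally show ?thesis unfolding curve_integral[OF lc adm[OF r'(1)] L u(1)] .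
    qed
    ultimately have J: "?J \<longlonglongrightarrow> (\<integral>x. \<phi> x \<partial>cmeas c r')" by simp
    have lim1: "(\<lambda>n. \<bar>(\<integral>x. \<phi> x \<partial>\<mu>) - ?J n\<bar>) \<longlonglongrightarrow> \<bar>(\<integral>x. \<phi> x \<partial>\<mu>) - (\<integral>x. \<phi> x \<partial>cmeas c r')\<bar>"
      by (intro tendsto_intros J)
    have lim2: "(\<lambda>n. m + 1 / real (Suc (k n))) \<longlonglongrightarrow> m + 0"
    proof (intro tendsto_add tendsto_const)
      have "(\<lambda>n. 1 / real (Suc n)) \<longlonglongrightarrow> 0" by (rule LIMSEQ_Suc[OF lim_1_over_n])
      from LIMSEQ_subseq_LIMSEQ[OF this g(2)] show "(\<lambda>n. 1 / real (Suc (k n))) \<longlonglongrightarrow> 0" by (simp add: o_def)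
    qed
    have le: "\<bar>(\<integral>x. \<phi> x \<partial>\<mu>) - ?J n\<bar> \<le> m + 1 / real (Suc (k n))" for n
    proof -
      have "\<bar>(\<integral>x. \<phi> x \<partial>\<mu>) - ?J n\<bar> \<le> discrepancy K \<mu> (cmeas (cn (k n)) (rn (k n)))"
        by (rule disc_ge[OF curve_integral_le[OF cn an L] p])
      then show ?thesis using Dn[of "k n"] unfolding D_def by linarith
    qed
    have "\<bar>(\<integral>x. \<phi> x \<partial>\<mu>) - (\<integral>x. \<phi> x \<partial>cmeas c r')\<bar> \<le> m + 0"
      by (rule LIMSEQ_le[OF lim1 lim2]) (use le in blast)
    then show "\<bar>(\<integral>x. \<phi> x \<partial>\<mu>) - (\<integral>x. \<phi> x \<partial>cmeas c r')\<bar> \<le> m" by simp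
  qed
  then have "D c r' \<le> D c1 r1" if "lip_curve L c1" "Q r1" for c1 r1
    using m_le[OF that] by (rule order_trans)
  then show ?thesis using lc r'(1) unfolding D_def by blast
qed

lemma lip_curve_const: "0 \<le> L \<Longrightarrow> lip_curve L (\<lambda>t. axis 1 1)"
  by (simp add: lip_curve_def geodist_def inner_axis_axis)

lemma exists_minimiser_Acurve:
  assumes L: "0 \<le> L"
  shows "\<exists>\<nu>\<in>P_Acurve L. \<forall>\<nu>'\<in>P_Acurve L. discrepancy K \<mu> \<nu> \<le> discrepancy K \<mu> \<nu>'"
proof -
  have "\<exists>c r. lip_curve L c \<and> admissible L r \<and>
    (\<forall>c' r'. lip_curve L c' \<longrightarrow> admissible L r' \<longrightarrow> discrepancy K \<mu> (cmeas c r) \<le> discrepancy K \<mu> (cmeas c' r'))"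
  proof (rule exists_minimiser[where Q="admissible L", OF L _ _ lip_curve_const[OF L] admissible_1[OF L]])
    fix rn and r :: "real \<Rightarrow> real" assume an: "\<And>n. admissible L (rn n)" and ul: "uniform_limit {0..1} rn r sequentially"
      and cr: "continuous_on {0..1} r"
    have rt: "(\<lambda>n. rn n t) \<longlonglongrightarrow> r t" if "t \<in> {0..1}" for t by (rule tendsto_uniform_limitI[OF ul that])
    have "(\<lambda>n. \<integral>t. rn n t \<partial>unit_interval) \<longlonglongrightarrow> (\<integral>t. r t \<partial>unit_interval)"
    proof (rule integral_dominated_convergence)
      show "r \<in> borel_measurable unit_interval" "rn n \<in> borel_measurable unit_interval" for n
        by (intro continuous_measurable_unit_interval cr admissible_continuous[OF an L])+
      show "integrable unit_interval (\<lambda>t. 1 + L)"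
        by (rule finite_measure.integrable_const[OF unit_interval_facts(2)])
      show "AE t in unit_interval. (\<lambda>n. rn n t) \<longlonglongrightarrow> r t"
        by (intro AE_I2 rt) (simp add: unit_interval_facts)
      show "AE t in unit_interval. norm (rn n t) \<le> 1 + L" for n
        by (intro AE_I2) (use an admissible_le[OF an L] in \<open>auto simp: unit_interval_facts admissible_def\<close>)
    qed
    moreover have "(\<integral>t. rn n t \<partial>unit_interval) = 1" for n
      using an[of n] integral_unit_interval[OF admissible_continuous[OF an L], of n] by (simp add: admissible_def)
    ultimately have "integral {0..1} r = 1" using integral_unit_interval[OF cr] by (simp add: tendsto_const_iff)
    moreover have "0 \<le> r t" if t: "t \<in> {0..1}" for t
      by (rule LIMSEQ_le_const[OF rt[OF t]]) (use an t in \<open>auto simp: admissible_def\<close>)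
    moreover have "\<bar>r u - r t\<bar> \<le> L * \<bar>u - t\<bar>" if "u \<in> {0..1}" "t \<in> {0..1}" for u t
      by (rule LIMSEQ_le_const2[OF tendsto_rabs[OF tendsto_diff[OF rt[OF that(1)] rt[OF that(2)]]]])
         (use an that in \<open>auto simp: admissible_def\<close>)
    ultimately show "\<exists>r'. admissible L r' \<and> (\<forall>t\<in>{0..1}. r' t = r t)"
      by (intro exI[of _ r]) (auto simp: admissible_def)
  qed
  then show ?thesis unfolding P_Acurve_eq by blast
qed

lemma exists_minimiser_Lcurve:
  assumes L: "0 \<le> L"
  shows "\<exists>\<nu>\<in>P_Lcurve L. \<forall>\<nu>'\<in>P_Lcurve L. discrepancy K \<mu> \<nu> \<le> discrepancy K \<mu> \<nu>'"
proof -
  have "\<exists>c r. lip_curve L c \<and> r = (\<lambda>t. 1) \<and>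
    (\<forall>c' r'. lip_curve L c' \<longrightarrow> r' = (\<lambda>t. 1) \<longrightarrow> discrepancy K \<mu> (cmeas c r) \<le> discrepancy K \<mu> (cmeas c' r'))"
  proof (rule exists_minimiser[where Q="\<lambda>r. r = (\<lambda>t. 1)", OF L _ _ lip_curve_const[OF L] refl])
    show "admissible L r" if "r = (\<lambda>t. 1)" for r using admissible_1[OF L] that by simp
    fix rn and r :: "real \<Rightarrow> real" assume rn: "\<And>n. rn n = (\<lambda>t. 1)" and ul: "uniform_limit {0..1} rn r sequentially"
    have "r t = 1" if "t \<in> {0..1}" for t
      using tendsto_uniform_limitI[OF ul that] by (simp add: rn tendsto_const_iff)
    then show "\<exists>r'. r' = (\<lambda>t. 1) \<and> (\<forall>t\<in>{0..1}. r' t = r t)" by simp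
  qed
  then obtain c where "lip_curve L c"
    "\<And>c'. lip_curve L c' \<Longrightarrow> discrepancy K \<mu> (cmeas c (\<lambda>t. 1)) \<le> discrepancy K \<mu> (cmeas c' (\<lambda>t. 1))"
    by auto
  then show ?thesis unfolding P_Lcurve_eq by (intro bexI[of _ "cmeas c (\<lambda>t. 1)"]) auto
qed

end

subsection \<open>Reparametrised spirals\<close>

lemma lip_curve_mono: "lip_curve L c \<Longrightarrow> L \<le> L' \<Longrightarrow> lip_curve L' c"
  unfolding lip_curve_def by (blast intro: order_trans mult_right_mono[OF _ abs_ge_zero])

text \<open>\<open>G\<close> is the distribution function of a positive density; its inverse
  \<open>H\<close> is the reparametrisation by mass.\<close>

lemma increasing_integral_inverse:
  fixes g :: "real \<Rightarrow> real"
  assumes cg: "continuous_on {0..1} g" and g: "\<And>t. t \<in> {0..1} \<Longrightarrow> 0 < g t" and g1: "integral {0..1} g = 1"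
  obtains G H where "\<And>t. t \<in> {0..1} \<Longrightarrow> (G has_real_derivative g t) (at t within {0..1})"
    "continuous_on {0..1} G" "G 0 = 0" "G 1 = 1"
    "\<And>t. t \<in> {0..1} \<Longrightarrow> G t \<in> {0..1} \<and> H (G t) = t" "\<And>u. u \<in> {0..1} \<Longrightarrow> H u \<in> {0..1} \<and> G (H u) = u"
proof -
  define G where "G t = integral {0..t} g" for t
  have der: "(G has_real_derivative g t) (at t within {0..1})" if "t \<in> {0..1}" for t
    unfolding G_def[abs_def] by (rule integral_has_real_derivative[OF cg that])
  have cG: "continuous_on {0..1} G" by (rule DERIV_continuous_on[OF der])
  have G01: "G 0 = 0" "G 1 = 1" using g1 by (simp_all add: G_def)
  have mono: "G x < G y" if "0 \<le> x" "x < y" "y \<le> 1" for x y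
  proof (rule DERIV_pos_imp_increasing_open[OF that(2)])
    show "\<exists>d. DERIV G z :> d \<and> d > 0" if "x < z" "z < y" for z
    proof -
      have z: "0 < z" "z < 1" using that \<open>0 \<le> x\<close> \<open>y \<le> 1\<close> by auto
      then have "(G has_real_derivative g z) (at z)" using der[of z] by (simp add: at_within_Icc_at)
      then show ?thesis using g[of z] z by auto
    qed
    show "continuous_on {x..y} G" by (rule continuous_on_subset[OF cG]) (use that in auto)
  qed
  have range: "G t \<in> {0..1}" if "t \<in> {0..1}" for t
  proof -
    have "0 \<le> G t" using mono[of 0 t] G01 that by (cases "t = 0") auto
    moreover have "G t \<le> 1" using mono[of t 1] G01 that by (cases "t = 1") auto
    ultimately show ?thesis by simp
  qed
  have "\<exists>t\<in>{0..1}. G t = u" if "u \<in> {0..1}" for u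
    using IVT'[of G 0 u 1] cG G01 that by auto
  then obtain H where H: "\<And>u. u \<in> {0..1} \<Longrightarrow> H u \<in> {0..1} \<and> G (H u) = u" by metis
  have "H (G t) = t" if t: "t \<in> {0..1}" for t
  proof -
    have "H (G t) \<in> {0..1}" "G (H (G t)) = G t" using H[OF range[OF t]] by auto
    then show ?thesis using mono[of t "H (G t)"] mono[of "H (G t)" t] t by (cases t "H (G t)" rule: linorder_cases) auto
  qed
  then show ?thesis using that[OF der cG G01 _ H] range by blast
qed

text \<open>In the mass parameter the weighted measure becomes Lebesgue measure, and the speed of
  the curve becomes the speed of the spiral divided by the density. \<open>spi_speed_wt\<close>
  bounds this ratio, the factor \<open>M / a\<close> comes from the normalised \<open>r\<close>, and
  \<open>320 = 2 * 160\<close> passes from chords to arcs.\<close>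

lemma spiral_curve:
  assumes m: "m \<ge> 1" and r: "continuous_on S2 r" and a: "0 < a" "\<And>x. x \<in> S2 \<Longrightarrow> a \<le> r x"
  defines "M \<equiv> (\<integral>x. r x \<partial>spm m)"
  shows "0 < M"
    and "\<exists>c. lip_curve (320 * pi * real m * (M / a)) c \<and>
      (\<forall>f. continuous_on S2 f \<longrightarrow> integral {0..1} (\<lambda>t. f (c t)) = (\<integral>x. f x * r x \<partial>spm m) / M)"
proof -
  interpret S2_prob "spm m" by (rule S2_prob_spm[OF m])
  define p where "p = spi (8 * m)"
  have cp: "continuous_on A p" for A unfolding p_def by (rule continuous_spi)
  have pS: "p t \<in> S2" for t unfolding p_def by (rule spi_S2)
  have cfp: "continuous_on A (\<lambda>t. f (p t))" if "continuous_on S2 f" for A and f :: "real^3 \<Rightarrow> real"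
    by (rule continuous_on_compose2[OF that cp]) (use pS in blast)
  have int: "(\<integral>x. f x \<partial>spm m) = integral {0..1} (\<lambda>t. wt m t * f (p t))" if "continuous_on S2 f" for f :: "real^3 \<Rightarrow> real"
    using integral_spm[OF m that] by (simp add: p_def)
  have "(\<integral>x. a \<partial>spm m) \<le> M"
    unfolding M_def by (rule integral_mono) (use a(2) in \<open>auto intro!: integrable_cont r simp: space_M\<close>)
  then have "a \<le> M" using measure_M by (simp add: space_M)
  then show M: "0 < M" using a(1) by linarith
  define g where "g t = wt m t * r (p t) / M" for t
  have rp: "0 < r (p t)" "a \<le> r (p t)" for t using a(2)[OF pS[of t]] a(1) by linarith+
  have g: "0 < g t" for t unfolding g_def by (intro divide_pos_pos mult_pos_pos wt_pos[OF m] rp M)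
  have cg: "continuous_on A g" for A unfolding g_def[abs_def] using M by (intro continuous_intros cfp[OF r]) simp
  have g1: "integral {0..1} g = 1" unfolding g_def[abs_def] using int[OF r] M by (simp add: M_def)
  obtain G H where der: "\<And>t. t \<in> {0..1} \<Longrightarrow> (G has_real_derivative g t) (at t within {0..1})"
    and cG: "continuous_on {0..1} G" and G01: "G 0 = 0" "G 1 = 1"
    and HG: "\<And>t. t \<in> {0..1} \<Longrightarrow> G t \<in> {0..1} \<and> H (G t) = t" and GH: "\<And>u. u \<in> {0..1} \<Longrightarrow> H u \<in> {0..1} \<and> G (H u) = u"
    by (rule increasing_integral_inverse[OF cg g g1]) (rule that)
  define k where "k = 160 * pi * real m * (M / a)"
  have k: "0 \<le> k" unfolding k_def using M a(1) by simp
  obtain d where d': "\<And>t. (spi (8 * m) has_vector_derivative d t) (at t)"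
    and d2: "\<And>t. norm (d t) \<le> 160 * pi * real m * wt m t" by (rule spi_speed_wt[OF m]) (rule that)
  note d = d'[folded p_def] d2
  have dg: "norm (d t) \<le> k * g t" for t
  proof -
    have "wt m t * 1 \<le> wt m t * (r (p t) / a)"
      using rp[of t] a(1) wt_pos[OF m, of t] by (intro mult_left_mono) (auto simp: pos_le_divide_eq)
    then have "160 * pi * real m * wt m t \<le> 160 * pi * real m * (wt m t * (r (p t) / a))"
      by (intro mult_left_mono) auto
    also have "\<dots> = k * g t" using M a(1) by (simp add: k_def g_def)
    finally show ?thesis using d(2)[of t] by linarith
  qed
  \<comment> \<open>The increments of the spiral are compared with those of \<open>k * G\<close>, so
    that inserting \<open>H\<close> directly yields a Lipschitz bound in the mass parameter.\<close>
  have lt: "norm (p y - p x) \<le> k * G y - k * G x" if "x \<in> {0..1}" "y \<in> {0..1}" "x < y" for x y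
  proof (rule differentiable_bound_general[OF that(3) cp, where \<phi>' = "\<lambda>t. k * g t"])
    show "continuous_on {x..y} (\<lambda>t. k * G t)"
      by (intro continuous_intros continuous_on_subset[OF cG]) (use that in auto)
    fix z assume "x < z" "z < y"
    then have z: "0 < z" "z < 1" using that by auto
    show "(p has_vector_derivative d z) (at z)" by (rule d)
    show "norm (d z) \<le> k * g z" by (rule dg)
    have "(G has_real_derivative g z) (at z)" using der[of z] z by (simp add: at_within_Icc_at)
    then show "((\<lambda>t. k * G t) has_vector_derivative k * g z) (at z)"
      unfolding has_real_derivative_iff_has_vector_derivative[symmetric] by (rule DERIV_cmult)
  qed
  have lip: "dist (p x) (p y) \<le> k * \<bar>G x - G y\<bar>" if xy: "x \<in> {0..1}" "y \<in> {0..1}" for x y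
  proof -
    have *: "dist (p x) (p y) \<le> k * \<bar>G x - G y\<bar>" if "x \<in> {0..1}" "y \<in> {0..1}" "x < y" for x y
    proof -
      have "norm (p y - p x) \<le> k * (G y - G x)" using lt[OF that] by (simp add: right_diff_distrib)
      also have "\<dots> \<le> k * \<bar>G x - G y\<bar>" using k by (intro mult_left_mono) auto
      finally show ?thesis by (simp add: dist_norm norm_minus_commute)
    qed
    show ?thesis
      using *[OF xy] *[OF xy(2,1)] by (cases x y rule: linorder_cases) (auto simp: dist_commute abs_minus_commute)
  qed
  define c where "c = (\<lambda>u. p (H u))"
  have H01: "H 0 = 0" "H 1 = 1" using HG[of 0] HG[of 1] G01 by auto
  have lc: "lip_curve (320 * pi * real m * (M / a)) c"
    unfolding lip_curve_def
  proof (intro conjI ballI)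
    show "c t \<in> S2" for t by (simp only: c_def pS)
    show "c 0 = c 1" by (simp add: c_def H01 p_def spi_closed)
    fix u v :: real assume uv: "u \<in> {0..1}" "v \<in> {0..1}"
    have "dist (c u) (c v) \<le> k * \<bar>u - v\<bar>" using lip[of "H u" "H v"] GH[OF uv(1)] GH[OF uv(2)] by (simp add: c_def)
    then have "geodist (c u) (c v) \<le> 2 * (k * \<bar>u - v\<bar>)"
      using geodist_bounds(2)[OF pS pS, of "H u" "H v"] unfolding c_def by linarith
    also have "\<dots> = 320 * pi * real m * (M / a) * \<bar>u - v\<bar>" by (simp add: k_def)
    finally show "geodist (c u) (c v) \<le> 320 * pi * real m * (M / a) * \<bar>u - v\<bar>" .
  qed
  have "integral {0..1} (\<lambda>t. f (c t)) = (\<integral>x. f x * r x \<partial>spm m) / M" if f: "continuous_on S2 f" for f :: "real^3 \<Rightarrow> real"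
  proof -
    have cfc: "continuous_on {0..1} (\<lambda>u. f (c u))"
      by (rule continuous_on_compose2[OF f lip_curveD(3)[OF lc]]) (use lip_curveD(1)[OF lc] in blast)
    have "((\<lambda>t. g t *\<^sub>R f (c (G t))) has_integral integral {G 0..G 1} (\<lambda>u. f (c u))) {0..1}"
      by (rule has_integral_substitution[OF _ _ _ cfc der]) (use G01 HG in auto)
    then have "integral {0..1} (\<lambda>u. f (c u)) = integral {0..1} (\<lambda>t. g t *\<^sub>R f (c (G t)))"
      by (simp only: G01 integral_unique)
    also have "\<dots> = integral {0..1} (\<lambda>t. (wt m t * (f (p t) * r (p t))) / M)"
      by (rule Henstock_Kurzweil_Integration.integral_cong) (use HG in \<open>simp add: c_def g_def\<close>)
    also have "\<dots> = (\<integral>x. f x * r x \<partial>spm m) / M"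
      using int[of "\<lambda>x. f x * r x"] f r by (simp add: continuous_on_mult)
    finally show ?thesis .
  qed
  then show "\<exists>c. lip_curve (320 * pi * real m * (M / a)) c \<and>
      (\<forall>f. continuous_on S2 f \<longrightarrow> integral {0..1} (\<lambda>t. f (c t)) = (\<integral>x. f x * r x \<partial>spm m) / M)"
    using lc by blast
qed

context curve_problem
begin

subsection \<open>The rate of convergence\<close>

lemma rho_bounds:
  obtains a b where "0 < a" "\<And>x. x \<in> S2 \<Longrightarrow> a \<le> \<rho> x \<and> \<rho> x \<le> b"
proof -
  have S: "compact S2" "S2 \<noteq> ({} :: (real^3) set)" by auto
  obtain x0 where x0: "x0 \<in> S2" "\<And>x. x \<in> S2 \<Longrightarrow> \<rho> x0 \<le> \<rho> x"
    using continuous_attains_inf[OF S rho(1)] by blast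
  obtain x1 where x1: "x1 \<in> S2" "\<And>x. x \<in> S2 \<Longrightarrow> \<rho> x \<le> \<rho> x1"
    using continuous_attains_sup[OF S rho(1)] by blast
  show ?thesis by (rule that[OF rho(2)[OF x0(1)]]) (use x0 x1 in blast)
qed

text \<open>Two errors add up: that of integrating \<open>\<phi> * \<rho>\<close>, and that of
  normalising, because the mass \<open>M\<close> equals one only up to the error for the constant
  function. The second is \<open>(M - 1) * (I / M)\<close>, where \<open>I / M\<close> is an
  integral over a probability measure and hence bounded by \<open>F\<close>.\<close>

lemma dyadic_rate:
  obtains k C where "0 < k" "0 \<le> C"
    "\<And>J. \<exists>c. lip_curve (k * 2 ^ J) c \<and> discrepancy K \<mu> (cmeas c (\<lambda>t. 1)) \<le> C * (2 powr - s) ^ J"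
proof -
  obtain a b where ab: "0 < a" "\<And>x. x \<in> S2 \<Longrightarrow> a \<le> \<rho> x \<and> \<rho> x \<le> b" by (rule rho_bounds) blast
  have "axis 1 1 \<in> (S2 :: (real^3) set)" by (simp add: norm_axis_1)
  then have b: "0 < b" using ab(1) ab(2)[of "axis 1 1"] by linarith
  define E where "E = 3456 / (1 - 2 powr (1 - s))\<^sup>2"
  have E: "0 \<le> E" by (simp add: E_def)
  define R where "R = Hs_norm s \<rho>"
  define N1 where "N1 = Hs_norm s (\<lambda>x. 1)"
  have nn: "0 \<le> R" "0 \<le> N1" by (simp_all add: R_def N1_def Hs_norm_nonneg rho in_Hs_one)
  define C where "C = E * c2 * R + F * (E * N1 * R)"
  define k where "k = 320 * pi * (b / a)"
  have k: "0 < k" using ab b by (simp add: k_def)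
  have C: "0 \<le> C" using E nn F_pos c2(1) by (simp add: C_def)
  have "\<exists>c. lip_curve (k * 2 ^ J) c \<and> discrepancy K \<mu> (cmeas c (\<lambda>t. 1)) \<le> C * (2 powr - s) ^ J" for J :: nat
  proof -
    define m :: nat where "m = 2 ^ J"
    have m: "m \<ge> 1" by (simp add: m_def)
    interpret S2_prob "spm m" by (rule S2_prob_spm[OF m])
    have ex: "exact (2 * 2 ^ J)" using exact_spm[OF m] by (simp add: m_def)
    define M where "M = (\<integral>x. \<rho> x \<partial>spm m)"
    define q where "q = (2 powr - s) ^ J"
    have q: "0 \<le> q" by (simp add: q_def)
    have err: "\<bar>(\<integral>x. f x * \<rho> x \<partial>spm m) - (\<integral>x. f x * \<rho> x \<partial>sigma_S2)\<bar> \<le> E * Hs_norm s f * R * q"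
      if "in_Hs s f" "continuous_on S2 f" for f
      using exact_error[OF ex that rho(4,1) s] by (simp only: E_def R_def q_def)
    have a': "\<And>x. x \<in> S2 \<Longrightarrow> a \<le> \<rho> x" using ab(2) by blast
    have M0: "0 < M" unfolding M_def by (rule spiral_curve(1)[OF m rho(1) ab(1) a'])
    obtain c where lc: "lip_curve (320 * pi * real m * (M / a)) c"
      and ic: "\<And>f. continuous_on S2 f \<Longrightarrow> integral {0..1} (\<lambda>t. f (c t)) = (\<integral>x. f x * \<rho> x \<partial>spm m) / M"
      using spiral_curve(2)[OF m rho(1) ab(1) a'] unfolding M_def by blast
    have "M \<le> (\<integral>x. b \<partial>spm m)"
      unfolding M_def by (rule integral_mono) (use ab(2) in \<open>auto intro!: integrable_cont rho simp: space_M\<close>)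
    then have Mb: "M \<le> b" using measure_M by (simp add: space_M)
    have kl: "320 * pi * real m * (M / a) \<le> k * 2 ^ J"
    proof -
      have "M / a \<le> b / a" using Mb ab(1) by (intro divide_right_mono) auto
      then have "320 * pi * real m * (M / a) \<le> 320 * pi * real m * (b / a)" by (intro mult_left_mono) auto
      then show ?thesis by (simp add: k_def m_def mult_ac)
    qed
    have L: "lip_curve (k * 2 ^ J) c" by (rule lip_curve_mono[OF lc kl])
    have L0: "0 \<le> k * 2 ^ J" using k by simp
    have M1: "\<bar>M - 1\<bar> \<le> E * N1 * R * q"
      using err[OF in_Hs_one] by (simp add: M_def N1_def rho(3))
    have "discrepancy K \<mu> (cmeas c (\<lambda>t. 1)) \<le> C * q"
    proof (rule disc_le)
      fix \<phi> assume p: "\<phi> \<in> U"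
      note u = U_facts[OF p]
      define I where "I = (\<integral>x. \<phi> x * \<rho> x \<partial>spm m)"
      have c1: "(\<integral>x. \<phi> x \<partial>cmeas c (\<lambda>t. 1)) = I / M"
        using curve_integral[OF L admissible_1[OF L0] L0 u(1)] ic[OF u(1)] by (simp add: I_def)
      have "\<bar>I / M\<bar> \<le> F" using curve_integral_le[OF L admissible_1[OF L0] L0 p] by (simp only: c1)
      moreover have "I - I / M = (M - 1) * (I / M)" using M0 by (simp add: field_simps)
      ultimately have e2: "\<bar>I - I / M\<bar> \<le> E * N1 * R * q * F"
        using M1 by (simp only: abs_mult) (intro mult_mono order_trans[OF abs_ge_zero M1], auto)
      have "\<bar>I - (\<integral>x. \<phi> x \<partial>\<mu>)\<bar> \<le> E * Hs_norm s \<phi> * R * q"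
        unfolding integral_\<mu>[OF u(1)] I_def by (rule err[OF u(2,1)])
      also have "\<dots> \<le> E * c2 * R * q" using u(3) E nn q by (intro mult_right_mono mult_left_mono) auto
      finally have "\<bar>I - (\<integral>x. \<phi> x \<partial>\<mu>)\<bar> \<le> E * c2 * R * q" .
      then have "\<bar>(\<integral>x. \<phi> x \<partial>\<mu>) - I / M\<bar> \<le> E * c2 * R * q + E * N1 * R * q * F" using e2 by linarith
      also have "\<dots> = C * q" by (simp add: C_def algebra_simps)
      finally show "\<bar>(\<integral>x. \<phi> x \<partial>\<mu>) - (\<integral>x. \<phi> x \<partial>cmeas c (\<lambda>t. 1))\<bar> \<le> C * q" unfolding c1 .
    qed
    then show ?thesis using L unfolding q_def by blast
  qed
  then show ?thesis using that[OF k C] by blast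
qed

text \<open>For \<open>L \<ge> k\<close> the largest dyadic length \<open>k * 2 ^ n\<close> not
  above \<open>L\<close> is more than half of \<open>L\<close>, which costs a factor
  \<open>2 powr s\<close>. For smaller \<open>L\<close> a constant curve has discrepancy at most
  \<open>2 * F\<close>, and \<open>(k / L) powr s \<ge> 1\<close> absorbs this into the
  constant.\<close>

lemma Lcurve_rate:
  obtains c where "c > 0" "\<And>L. L \<ge> 1 \<Longrightarrow> \<exists>\<nu>\<in>P_Lcurve L. discrepancy K \<mu> \<nu> \<le> c * L powr - s"
proof -
  obtain k C where k: "0 < k" and C: "0 \<le> C"
    and J: "\<And>J. \<exists>c. lip_curve (k * 2 ^ J) c \<and> discrepancy K \<mu> (cmeas c (\<lambda>t. 1)) \<le> C * (2 powr - s) ^ J"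
    by (rule dyadic_rate) blast
  define c where "c = C * (2 * k) powr s + 2 * F * k powr s"
  have c: "c > 0" unfolding c_def using C k F_pos by (intro add_nonneg_pos) auto
  have "\<exists>\<nu>\<in>P_Lcurve L. discrepancy K \<mu> \<nu> \<le> c * L powr - s" if L: "L \<ge> 1" for L
  proof (cases "k \<le> L")
    case True
    have "\<exists>n. L < k * 2 ^ n"
    proof -
      obtain n where "L / k < 2 ^ n" using real_arch_pow[of 2 "L / k"] by auto
      then show ?thesis using k by (intro exI[of _ n]) (simp add: pos_divide_less_eq mult.commute)
    qed
    moreover have "\<not> L < k * 2 ^ 0" using True by simp
    ultimately obtain n where n: "\<not> L < k * 2 ^ n" "L < k * 2 ^ Suc n"
      using ex_least_nat_less[of "\<lambda>n. L < k * 2 ^ n"] by blast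
    obtain \<gamma> where g: "lip_curve (k * 2 ^ n) \<gamma>" "discrepancy K \<mu> (cmeas \<gamma> (\<lambda>t. 1)) \<le> C * (2 powr - s) ^ n" using J by blast
    have "lip_curve L \<gamma>" by (rule lip_curve_mono[OF g(1)]) (use n in simp)
    then have "cmeas \<gamma> (\<lambda>t. 1) \<in> P_Lcurve L" by (rule P_LcurveI)
    moreover have "discrepancy K \<mu> (cmeas \<gamma> (\<lambda>t. 1)) \<le> c * L powr - s"
    proof -
      have pw: "(2 powr - s) ^ n = (2 ^ n) powr - s"
        by (simp add: powr_realpow[symmetric] powr_powr mult.commute)
      have "L / (2 * k) \<le> 2 ^ n" using n(2) k by (simp add: pos_divide_le_eq mult_ac)
      then have "(2 ^ n) powr - s \<le> (L / (2 * k)) powr - s" using s L k by (intro powr_mono2') auto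
      also have "\<dots> = (2 * k) powr s * L powr - s" using k L by (simp add: powr_divide powr_minus field_simps)
      finally have "C * (2 powr - s) ^ n \<le> C * ((2 * k) powr s * L powr - s)" unfolding pw using C by (rule mult_left_mono)
      also have "\<dots> \<le> c * L powr - s"
      proof -
        have "0 \<le> 2 * F * k powr s * L powr - s" using F_pos by simp
        then show ?thesis by (simp add: c_def algebra_simps)
      qed
      finally show ?thesis using g(2) by linarith
    qed
    ultimately show ?thesis by blast
  next
    case False
    have L0: "0 \<le> L" using L by simp
    let ?c = "\<lambda>t::real. axis 1 1 :: real^3"
    note lc = lip_curve_const[OF L0]
    have "cmeas ?c (\<lambda>t. 1) \<in> P_Lcurve L" by (rule P_LcurveI[OF lc])
    moreover have "discrepancy K \<mu> (cmeas ?c (\<lambda>t. 1)) \<le> c * L powr - s"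
    proof -
      have "discrepancy K \<mu> (cmeas ?c (\<lambda>t. 1)) \<le> 2 * F"
      proof (rule disc_le)
        fix \<phi> assume p: "\<phi> \<in> U"
        show "\<bar>(\<integral>x. \<phi> x \<partial>\<mu>) - (\<integral>x. \<phi> x \<partial>cmeas ?c (\<lambda>t. 1))\<bar> \<le> 2 * F"
          using integral_\<mu>_le[OF p] curve_integral_le[OF lc admissible_1[OF L0] L0 p] by linarith
      qed
      also have "\<dots> * 1 \<le> 2 * F * (k powr s * L powr - s)"
      proof (rule mult_left_mono)
        have "1 powr s \<le> (k / L) powr s" using False L s by (intro powr_mono2) auto
        then show "1 \<le> k powr s * L powr - s" using k L by (simp add: powr_divide powr_minus field_simps)
      qed (use F_pos in simp)
      also have "\<dots> \<le> c * L powr - s"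
      proof -
        have "0 \<le> C * (2 * k) powr s * L powr - s" using C by simp
        then show ?thesis by (simp add: c_def algebra_simps)
      qed
      finally show ?thesis by simp
    qed
    ultimately show ?thesis by blast
  qed
  then show ?thesis by (rule that[OF c])
qed

end

theorem theorem9:
  fixes s :: real and K :: "real^3 \<Rightarrow> real^3 \<Rightarrow> real" and \<rho> :: "real^3 \<Rightarrow> real"
  assumes "s > 1"
    and "kernel_on_S2 K" and "symmetric_kernel K" and "pos_def_kernel K"
    and "rkhs_eq_Hs K s"
    and "continuous_on S2 \<rho>" and "\<forall>x\<in>S2. \<rho> x > 0"
    and "(\<integral>x. \<rho> x \<partial>sigma_S2) = 1"
    and "in_Hs s \<rho>"
  shows "\<exists>c>0. \<forall>L\<ge>1.
           (\<exists>\<nu>A\<in>P_Acurve L. \<exists>\<nu>L\<in>P_Lcurve L.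
              (\<forall>\<nu>\<in>P_Acurve L. discrepancy K (density sigma_S2 \<rho>) \<nu>A \<le> discrepancy K (density sigma_S2 \<rho>) \<nu>) \<and>
              (\<forall>\<nu>\<in>P_Lcurve L. discrepancy K (density sigma_S2 \<rho>) \<nu>L \<le> discrepancy K (density sigma_S2 \<rho>) \<nu>) \<and>
              discrepancy K (density sigma_S2 \<rho>) \<nu>A \<le> discrepancy K (density sigma_S2 \<rho>) \<nu>L \<and>
              discrepancy K (density sigma_S2 \<rho>) \<nu>L \<le> c * L powr (- s))"
proof -
  obtain c1 c2 where c1: "c1 > 0" and c2: "c2 > 0"
    and emb: "\<And>f. in_rkhs K f \<Longrightarrow> in_Hs s f \<and> c1 * rkhs_norm K f \<le> Hs_norm s f \<and> Hs_norm s f \<le> c2 * rkhs_norm K f"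
    using assms(5) unfolding rkhs_eq_Hs_def by blast
  \<comment> \<open>\<open>rkhs_norm\<close> is an infimum of limits, and its value at the zero
    function is controlled through the lower half of the norm equivalence. It places the zero
    function in the unit ball, so the supremum is over a nonempty set.\<close>
  have "rkhs_seq K (\<lambda>x. 0) (\<lambda>n. [])" unfolding rkhs_seq_def by (simp add: knorm2_def kcomb_def kneg_def)
  then have "c1 * rkhs_norm K (\<lambda>x. 0) \<le> Hs_norm s (\<lambda>x. 0)" using emb unfolding in_rkhs_def by blast
  also have "Hs_norm s (\<lambda>x. 0) = 0" by (simp add: Hs_norm_def Hs_terms_def inner_L2_def)
  finally have zero: "rkhs_norm K (\<lambda>x. 0) \<le> 0" using c1 by (simp add: mult_le_0_iff)
  interpret curve_problem s K \<rho> c2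
    by unfold_locales (use assms c2 emb zero in blast)+
  obtain c where c: "c > 0" and rate: "\<And>L. L \<ge> 1 \<Longrightarrow> \<exists>\<nu>\<in>P_Lcurve L. discrepancy K \<mu> \<nu> \<le> c * L powr - s"
    by (rule Lcurve_rate) blast
  have "\<exists>\<nu>A\<in>P_Acurve L. \<exists>\<nu>L\<in>P_Lcurve L.
      (\<forall>\<nu>\<in>P_Acurve L. discrepancy K \<mu> \<nu>A \<le> discrepancy K \<mu> \<nu>) \<and>
      (\<forall>\<nu>\<in>P_Lcurve L. discrepancy K \<mu> \<nu>L \<le> discrepancy K \<mu> \<nu>) \<and>
      discrepancy K \<mu> \<nu>A \<le> discrepancy K \<mu> \<nu>L \<and> discrepancy K \<mu> \<nu>L \<le> c * L powr (- s)"
    if L: "L \<ge> 1" for L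
  proof -
    have L0: "0 \<le> L" using L by simp
    obtain \<nu>A where A: "\<nu>A \<in> P_Acurve L" "\<And>\<nu>. \<nu> \<in> P_Acurve L \<Longrightarrow> discrepancy K \<mu> \<nu>A \<le> discrepancy K \<mu> \<nu>"
      using exists_minimiser_Acurve[OF L0] by blast
    obtain \<nu>L where B: "\<nu>L \<in> P_Lcurve L" "\<And>\<nu>. \<nu> \<in> P_Lcurve L \<Longrightarrow> discrepancy K \<mu> \<nu>L \<le> discrepancy K \<mu> \<nu>"
      using exists_minimiser_Lcurve[OF L0] by blast
    \<comment> \<open>A Lebesgue image has density \<open>1\<close>, which is admissible for every
      \<open>L\<close>; so the minimum over the larger class is no greater.\<close>
    have "\<nu>L \<in> P_Acurve L" using B(1) P_AcurveI[OF _ admissible_1[OF L0]] unfolding P_Lcurve_eq by auto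
    moreover have "discrepancy K \<mu> \<nu>L \<le> c * L powr - s" using rate[OF L] B(2) order_trans by blast
    ultimately show ?thesis using A B by blast
  qed
  then show ?thesis using c unfolding \<mu>_def by blast
qed

end
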